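(* In dimension $d=2$: 1. There exists a stationary point process $\mathbf X$ in $\mathbb R^2$ such that $\mathsf{Wass}_2(\mathbf X,\mathrm{Leb})<+\infty$ but which has infinite regularized Coulomb energy (i.e. $\mathsf{Coul}_\eta(\mathbf X)=+\infty$ for all $\eta\in(0,1]$). 2. There exists a stationary point process $\mathbf X$ in $\mathbb R^2$ of intensity $1$ which is hyperuniform and such that $\mathsf{Wass}_1(\mathbf X,\mathrm{Leb})=+\infty$; in particular $\mathsf{Wass}_2(\mathbf X,\mathrm{Leb})=+\infty$.
   Context: Point configurations are locally finite collections of points of $\mathbb R^2$ (counted with multiplicity), identified with the Radon measures $\sum_{x}\delta_x$. A point process is a random point configuration; it is stationary if its law is invariant under translations. $\mathrm{Leb}$ is Lebesgue measure, $\mathrm B_r$ the closed disk of radius $r$ centered at $0$, $|\mathbf X\cap \mathrm B_r|$ the number of points in $\mathrm B_r$, $\Lambda_n:=[-\frac n2,\frac n2]^2$. Convention: $\inf\emptyset=+\infty$. Hyperuniformity: $\sigma(r):=\mathrm{Var}[|\mathbf X\cap \mathrm B_r|]/|\mathrm B_r|\to0$ as $r\to\infty$. Wasserstein distance. For Radon measures $M_0,M_1$ on $\mathbb R^2$ let $\mathsf{cpl}(M_0,M_1)$ be the set of Radon measures on $\mathbb R^2\times\mathbb R^2$ with marginals $M_0,M_1$, and for $p\ge1$ $$\mathsf w_p(M_0,M_1):=\Big(\inf_{q\in\mathsf{cpl}(M_0,M_1)}\limsup_{n\to\infty}\frac1{n^2}\int_{\Lambda_n\times\mathbb R^2}|x-y|^p\,dq(x,y)\Big)^{1/p}.$$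 For a stationary point process, $\mathsf{Wass}_p(\mathbf X,\mathrm{Leb}):=\mathbb E\left[\mathsf w_p^p(\mathbf X,\mathrm{Leb})\right]^{1/p}$. Electric fields. An electric field is a vector field $\mathrm E\in\bigcap_{1\le p<2}L^p_{loc}(\mathbb R^2,\mathbb R^2)$; it is compatible with a point configuration $\mathbf X$ if $-\mathrm{div}(\mathrm E)=2\pi(\mathbf X-\mathrm{Leb})$ in the sense of distributions. A random electric field $\mathrm E$ is compatible with a point process $\mathbf X$ if $-\frac1{2\pi}\mathrm{div}(\mathrm E)+\mathrm{Leb}$ has the same law as $\mathbf X$; it is stationary if its law is invariant under translations. Truncation. Fix once and for all a smooth radial function $\chi\ge0$ supported in the unit disk with $\int\chi=1$. For $\eta>0$ let $\chi_\eta:=\eta^{-2}\chi(\cdot/\eta)$, let $\delta^{(\eta)}_x$ be the measure with density $\chi_\eta(\cdot-x)$, and let $\mathsf f_\eta$ be the solution of $-\Delta\mathsf f_\eta=2\pi(\delta_0^{(\eta)}-\delta_0)$, $\mathsf f_\eta\equiv0$ outside $\mathrm B_\eta$. If $\mathrm E$ is compatible with $\mathbf X$, set $\mathrm E_\eta(y):=\mathrm E(y)+\sum_{x\in\mathbf X}\nabla\mathsf f_\eta(y-x)$. Regularized Coulomb energy. $\mathsf{Coul}_\eta(\mathbf X):=\inf\mathbb E[|\mathrm E_\eta(0)|^2]$, the infimum being over stationary random electric fields $\mathrm E$ compatible with $\mathbf X$ ($\mathrm E_\eta$ is computed with the point configuration $-\frac1{2\pi}\mathrm{div}(\mathrm E)+\mathrm{Leb}$).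 $\mathbf X$ has finite regularized Coulomb energy if $\mathsf{Coul}_\eta(\mathbf X)<\infty$ for some $\eta\in(0,1]$. *)

theory Defs
  imports "HOL-Probability.Probability"
begin

type_synonym plane = "real^2"

section \<open>Point processes\<close>

text \<open>
  A locally finite collection of points with multiplicity is given by its multiplicity function
  \<open>m\<close>, and is identified with the Borel measure that puts mass \<open>m x\<close> at \<open>x\<close>.
\<close>

definition config_measure :: "(plane \<Rightarrow> nat) \<Rightarrow> plane measure" where
  "config_measure m = distr (density (count_space UNIV) (\<lambda>x. of_nat (m x))) borel (\<lambda>x. x)"

definition locally_finite :: "(plane \<Rightarrow> nat) \<Rightarrow> bool" where
  "locally_finite m \<longleftrightarrow> (\<forall>K. compact K \<longrightarrow> finite {x\<in>K. m x \<noteq> 0})"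

definition configs :: "plane measure set" where
  "configs = {config_measure m | m. locally_finite m}"

definition config_algebra :: "plane measure measure" where
  "config_algebra = (SUP A\<in>sets borel. vimage_algebra configs (\<lambda>X. emeasure X A) borel)"

text \<open>
  A point process enters only through its law, so it is represented by its law.
\<close>

definition point_process :: "plane measure measure \<Rightarrow> bool" where
  "point_process P \<longleftrightarrow> prob_space P \<and> sets P = sets config_algebra"

definition translate_config :: "plane \<Rightarrow> plane measure \<Rightarrow> plane measure" where
  "translate_config t X = distr X borel (\<lambda>x. x + t)"

definition stationary_process :: "plane measure measure \<Rightarrow> bool" where
  "stationary_process P \<longleftrightarrow> point_process P \<and> (\<forall>t. distr P config_algebra (translate_config t) = P)"

definition has_intensity :: "plane measure measure \<Rightarrow> real \<Rightarrow> bool" where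
  "has_intensity P c \<longleftrightarrow>
     (\<forall>A\<in>sets borel. (\<integral>\<^sup>+X. emeasure X A \<partial>P) = ennreal c * emeasure lborel A)"

definition num_points :: "real \<Rightarrow> plane measure \<Rightarrow> real" where
  "num_points r X = measure X (cball 0 r)"

text \<open>
  The integrability condition says that the variances are finite; without it the Bochner integrals
  defining the variance would silently be 0.
\<close>

definition hyperuniform :: "plane measure measure \<Rightarrow> bool" where
  "hyperuniform P \<longleftrightarrow>
     (\<forall>r>0. integrable P (\<lambda>X. (num_points r X)\<^sup>2)) \<and>
     ((\<lambda>r. prob_space.variance P (num_points r) / measure lborel (cball (0::plane) r)) \<longlongrightarrow> 0) at_top"


section \<open>Wasserstein distance\<close>

definition radon_measure :: "'a::topological_space measure \<Rightarrow> bool" where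
  "radon_measure M \<longleftrightarrow> sets M = sets borel \<and> (\<forall>K. compact K \<longrightarrow> emeasure M K < \<infinity>)"

definition cpl :: "plane measure \<Rightarrow> plane measure \<Rightarrow> (plane \<times> plane) measure set" where
  "cpl M0 M1 = {q. radon_measure q \<and> distr q borel fst = M0 \<and> distr q borel snd = M1}"

definition Lambda :: "nat \<Rightarrow> plane set" where
  "Lambda n = {x. \<forall>i. \<bar>x $ i\<bar> \<le> real n / 2}"

text \<open>Real powers on \<open>[0, \<infinity>]\<close>; only used with positive exponents.\<close>

definition ennpowr :: "ennreal \<Rightarrow> real \<Rightarrow> ennreal" where
  "ennpowr x a = (if x = \<infinity> then \<infinity> else ennreal (enn2real x powr a))"

definition transport_cost :: "real \<Rightarrow> (plane \<times> plane) measure \<Rightarrow> ennreal" where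
  "transport_cost p q = limsup (\<lambda>n.
     (\<integral>\<^sup>+z\<in>Lambda n \<times> UNIV. ennreal (dist (fst z) (snd z) powr p) \<partial>q) / ennreal (real n ^ 2))"

definition wasserstein :: "real \<Rightarrow> plane measure \<Rightarrow> plane measure \<Rightarrow> ennreal" where
  "wasserstein p M0 M1 = ennpowr (INF q\<in>cpl M0 M1. transport_cost p q) (1 / p)"

text \<open>
  The integrand is universally measurable, being an infimum over couplings, so that the expectation
  is the integral with respect to the completion of \<open>P\<close>, and this is the value of
  the library's integral with respect to \<open>P\<close> (fact \<open>nn_integral_completion\<close>).
\<close>

definition Wass :: "real \<Rightarrow> plane measure measure \<Rightarrow> ennreal" where
  "Wass p P = ennpowr (\<integral>\<^sup>+X. ennpowr (wasserstein p X lborel) p \<partial>P) (1 / p)"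


section \<open>Smooth functions\<close>

definition gradient :: "(plane \<Rightarrow> real) \<Rightarrow> plane \<Rightarrow> plane" where
  "gradient f x = (THE D. GDERIV f x :> D)"

definition laplacian :: "(plane \<Rightarrow> real) \<Rightarrow> plane \<Rightarrow> real" where
  "laplacian f x = (\<Sum>i\<in>UNIV. gradient (\<lambda>y. gradient f y $ i) x $ i)"

primrec Ck :: "nat \<Rightarrow> (plane \<Rightarrow> real) \<Rightarrow> bool" where
  "Ck 0 f \<longleftrightarrow> continuous_on UNIV f"
| "Ck (Suc k) f \<longleftrightarrow> (\<exists>g. (\<forall>x. GDERIV f x :> g x) \<and> (\<forall>i. Ck k (\<lambda>x. g x $ i)))"

definition smooth :: "(plane \<Rightarrow> real) \<Rightarrow> bool" where
  "smooth f \<longleftrightarrow> (\<forall>k. Ck k f)"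

definition test_function :: "(plane \<Rightarrow> real) \<Rightarrow> bool" where
  "test_function \<phi> \<longleftrightarrow> smooth \<phi> \<and> bounded {x. \<phi> x \<noteq> 0}"


section \<open>Electric fields\<close>

definition Lp_loc :: "real \<Rightarrow> (plane \<Rightarrow> 'b::euclidean_space) \<Rightarrow> bool" where
  "Lp_loc p f \<longleftrightarrow> f \<in> borel_measurable borel \<and>
     (\<forall>K. compact K \<longrightarrow> (\<integral>\<^sup>+x\<in>K. ennreal (norm (f x) powr p) \<partial>lborel) < \<infinity>)"

definition electric_fields :: "(plane \<Rightarrow> plane) set" where
  "electric_fields = {E. \<forall>p. 1 \<le> p \<and> p < 2 \<longrightarrow> Lp_loc p E}"

text \<open>\<open>- div E = 2 \<pi> (X - Leb)\<close> in the sense of distributions.\<close>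

definition compatible :: "(plane \<Rightarrow> plane) \<Rightarrow> plane measure \<Rightarrow> bool" where
  "compatible E X \<longleftrightarrow> (\<forall>\<phi>. test_function \<phi> \<longrightarrow>
     (\<integral>y. E y \<bullet> gradient \<phi> y \<partial>lborel) = 2 * pi * ((\<integral>x. \<phi> x \<partial>X) - (\<integral>x. \<phi> x \<partial>lborel)))"

text \<open>
  The point configuration \<open>- div E / (2 \<pi>) + Leb\<close>; the default value (the empty configuration)
  is irrelevant below.
\<close>

definition field_config :: "(plane \<Rightarrow> plane) \<Rightarrow> plane measure" where
  "field_config E =
     (if \<exists>X\<in>configs. compatible E X then THE X. X \<in> configs \<and> compatible E X else null_measure borel)"

text \<open>
  Electric fields are classes of functions modulo Lebesgue-null sets. The sigma-algebra below lives
  on representatives, but it is generated by the pairings with continuous compactly supported fields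
  and hence does not distinguish functions that agree almost everywhere: it is the pullback of the
  Borel sigma-algebra of the space of classes, and its probability measures are exactly the laws of
  random electric fields.
\<close>

definition field_algebra :: "(plane \<Rightarrow> plane) measure" where
  "field_algebra =
     (SUP \<psi>\<in>{\<psi> :: plane \<Rightarrow> plane. continuous_on UNIV \<psi> \<and> bounded {x. \<psi> x \<noteq> 0}}.
        vimage_algebra electric_fields (\<lambda>E. \<integral>y. E y \<bullet> \<psi> y \<partial>lborel) borel)"

definition random_field :: "(plane \<Rightarrow> plane) measure \<Rightarrow> bool" where
  "random_field Q \<longleftrightarrow> prob_space Q \<and> sets Q = sets field_algebra"

definition stationary_field :: "(plane \<Rightarrow> plane) measure \<Rightarrow> bool" where
  "stationary_field Q \<longleftrightarrow> random_field Q \<and> (\<forall>t. distr Q field_algebra (\<lambda>E y. E (y - t)) = Q)"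

definition compatible_process :: "(plane \<Rightarrow> plane) measure \<Rightarrow> plane measure measure \<Rightarrow> bool" where
  "compatible_process Q P \<longleftrightarrow>
     (AE E in Q. \<exists>X\<in>configs. compatible E X) \<and> distr Q config_algebra field_config = P"


section \<open>Truncation and regularized Coulomb energy\<close>

text \<open>The profile is called \<open>\<rho>\<close> because the letter chi is the library's binder for vectors.\<close>

definition mollifier :: "(plane \<Rightarrow> real) \<Rightarrow> bool" where
  "mollifier \<rho> \<longleftrightarrow> smooth \<rho> \<and> (\<forall>x y. norm x = norm y \<longrightarrow> \<rho> x = \<rho> y) \<and> (\<forall>x. 0 \<le> \<rho> x) \<and>
     (\<forall>x. 1 < norm x \<longrightarrow> \<rho> x = 0) \<and> (\<integral>x. \<rho> x \<partial>lborel) = 1"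

definition smeared :: "(plane \<Rightarrow> real) \<Rightarrow> real \<Rightarrow> plane \<Rightarrow> plane measure" where
  "smeared \<rho> \<eta> x = density lborel (\<lambda>y. ennreal (\<rho> ((y - x) /\<^sub>R \<eta>) / \<eta>\<^sup>2))"

text \<open>
  The equation \<open>- \<Delta> f = 2 \<pi> (\<delta>\<^sub>0\<^bsup>(\<eta>)\<^esup> - \<delta>\<^sub>0)\<close> is again in the sense of distributions. Continuity
  off the origin selects the regular version of the solution; only the (irrelevant) value at the
  origin, where the solution has a logarithmic singularity, remains undetermined.
\<close>

definition truncation_potential :: "(plane \<Rightarrow> real) \<Rightarrow> real \<Rightarrow> (plane \<Rightarrow> real) \<Rightarrow> bool" where
  "truncation_potential \<rho> \<eta> f \<longleftrightarrow>
     Lp_loc 1 f \<and> continuous_on (- {0}) f \<and> (\<forall>x. x \<notin> cball 0 \<eta> \<longrightarrow> f x = 0) \<and>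
     (\<forall>\<phi>. test_function \<phi> \<longrightarrow>
        - (\<integral>x. f x * laplacian \<phi> x \<partial>lborel) =
          2 * pi * ((\<integral>x. \<phi> x \<partial>smeared \<rho> \<eta> 0) - (\<integral>x. \<phi> x \<partial>return borel 0)))"

definition f_trunc :: "(plane \<Rightarrow> real) \<Rightarrow> real \<Rightarrow> plane \<Rightarrow> real" where
  "f_trunc \<rho> \<eta> = (SOME f. truncation_potential \<rho> \<eta> f)"

definition truncated_field :: "(plane \<Rightarrow> real) \<Rightarrow> real \<Rightarrow> (plane \<Rightarrow> plane) \<Rightarrow> plane \<Rightarrow> plane" where
  "truncated_field \<rho> \<eta> E y = E y + (\<integral>x. gradient (f_trunc \<rho> \<eta>) (y - x) \<partial>field_config E)"

text \<open>
  The value at a point of a class of locally integrable fields is its Lebesgue value, the limit of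
  the averages over small disks. For a stationary random field a given point almost surely is a
  Lebesgue point, so this limit exists almost surely.
\<close>

definition value_at :: "(plane \<Rightarrow> plane) \<Rightarrow> plane \<Rightarrow> plane" where
  "value_at F y =
     Lim (at_right 0) (\<lambda>r. (LINT z:cball y r|lborel. F z) /\<^sub>R measure lborel (cball y r))"

definition Coul :: "(plane \<Rightarrow> real) \<Rightarrow> real \<Rightarrow> plane measure measure \<Rightarrow> ennreal" where
  "Coul \<rho> \<eta> P = (INF Q\<in>{Q. stationary_field Q \<and> compatible_process Q P}.
     \<integral>\<^sup>+E. ennreal ((norm (value_at (truncated_field \<rho> \<eta> E) 0))\<^sup>2) \<partial>Q)"

end

theory Submission
  imports Defs
begin

text \<open>
  Both processes are mixtures, over a random scale index, of randomly shifted lattices.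

  For the first process the lattice at scale \<open>k\<close> has spacing \<open>16 \<cdot> 4^k\<close> and carries \<open>M = (16 \<cdot> 4^k)\<^sup>2\<close>
  coinciding points at each site. Sending the points of a site uniformly to its cell costs about \<open>M\<close>
  per unit area. A compatible field has flux at least of order \<open>M\<close> through each of the \<open>k\<close> dyadic
  annuli around a site, so by the Cauchy-Schwarz inequality its energy per unit area is at least of
  order \<open>k M\<close>; truncation does not change the field on these annuli, as they contain no point of the
  process. With weights proportional to \<open>1 / (M (k + 1)\<^sup>2)\<close> the mean of \<open>M\<close> is finite and that of
  \<open>k M\<close> is not. To pass from energies per unit area to the Lebesgue value of the field at the
  origin, one uses stationarity, Fubini's theorem and Lebesgue differentiation.

  The second process superposes, at scale \<open>j\<close>, two lattices whose sites are independently and uniformly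
  perturbed in their cells: one of intensity slightly below \<open>1\<close>, and one of spacing \<open>16 \<cdot> 4^j\<close> each of
  whose sites carries \<open>a 4^j\<close> points, spread along a segment of length \<open>4^j\<close>, where \<open>a\<close> is about
  \<open>sqrt (j + 1)\<close>. The scale has weights proportional to \<open>(j + 1) powr (-3/2)\<close>. The points on the segments
  can only be accommodated at distances of order \<open>4^j\<close>, which costs about \<open>a\<close> per unit area, and \<open>a\<close> has
  infinite mean. Since the segments are one-dimensional, scale \<open>j\<close> contributes to the normalised
  variance at radius \<open>r\<close> only about \<open>a\<^sup>2 min (r / 4^j) (4^j / r)\<close>, and the weights times \<open>a\<^sup>2\<close> tend to \<open>0\<close>.
\<close>

section \<open>Point configurations\<close>

text \<open>The averaging over scales must not create variance. In the second process both lattices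
  together have intensity exactly 1 at every scale, and displacements uniform over a full cell make
  the expected number of points in a disk equal to its area, even given the global shifts. Given a
  shift the sites of a lattice are independent, and no term of order \<open>r ^ 4\<close> appears.
  The other obstacle is measurability. The optimal cost is not shown to be measurable, so it is
  bounded below by the measurable functional \<open>wlow\<close>, a supremum over countably many
  Kantorovich potentials, and above through the measurable events \<open>GG k\<close>. The same
  events recover the scale from the configuration of a field, which is what is known about an
  arbitrary competitor in the infimum of \<open>Coul\<close>; the energy at the origin is replaced
  by the measurable minorant \<open>h0\<close>. Even the measurability of
  \<open>field_config\<close> has to be extracted from an equation between laws
  (\<open>measurable_of_distr_prob\<close>).\<close>

definition loc_fin :: "'i set \<Rightarrow> ('i \<Rightarrow> plane) \<Rightarrow> bool" where
  "loc_fin I x \<longleftrightarrow> (\<forall>r. finite {i\<in>I. norm (x i) \<le> r})"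

text \<open>Multiplicities arise from indices with the same value, so clusters and unions of
  lattices need no multiplicity functions, and relabelling the points is a change of variables of
  counting measures.\<close>

definition conf :: "'i set \<Rightarrow> ('i \<Rightarrow> plane) \<Rightarrow> plane measure" where
  "conf I x = distr (count_space I) borel x"

lemma sets_conf [simp]: "sets (conf I x) = sets borel"
  and space_conf [simp]: "space (conf I x) = UNIV"
  by (simp_all add: conf_def)

lemma nn_integral_conf:
  assumes "f \<in> borel_measurable borel"
  shows "(\<integral>\<^sup>+y. f y \<partial>conf I x) = (\<integral>\<^sup>+i. f (x i) \<partial>count_space I)"
  unfolding conf_def using assms by (subst nn_integral_distr) auto

lemma emeasure_conf:
  assumes "A \<in> sets borel"
  shows "emeasure (conf I x) A = (\<integral>\<^sup>+i. indicator A (x i) \<partial>count_space I)"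
  using nn_integral_conf[of "indicator A" I x] assms by simp

lemma conf_reindex:
  assumes "bij_betw g J I"
  shows "conf I x = conf J (\<lambda>j. x (g j))"
proof -
  have "conf I x = distr (distr (count_space J) (count_space I) g) borel x"
    using distr_bij_count_space[OF assms] by (simp add: conf_def)
  also have "\<dots> = conf J (\<lambda>j. x (g j))"
    using assms unfolding conf_def by (subst distr_distr) (auto simp: comp_def bij_betw_def)
  finally show ?thesis .
qed

lemma translate_conf: "translate_config t (conf I x) = conf I (\<lambda>i. x i + t)"
  unfolding translate_config_def conf_def by (subst distr_distr) (auto simp: comp_def)

lemma conf_cong: "(\<And>i. i \<in> I \<Longrightarrow> x i = y i) \<Longrightarrow> conf I x = conf I y"
  unfolding conf_def by (intro distr_cong) auto

lemma loc_fin_countable: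
  assumes "loc_fin I x" shows "countable I"
proof -
  have "I = (\<Union>n::nat. {i\<in>I. norm (x i) \<le> n})"
    using real_arch_simple by auto
  moreover have "countable {i\<in>I. norm (x i) \<le> real n}" for n
    using assms unfolding loc_fin_def by (blast intro: countable_finite)
  then have "countable (\<Union>n::nat. {i\<in>I. norm (x i) \<le> n})" by blast
  ultimately show ?thesis by (rule ssubst[where P=countable])
qed

lemma loc_fin_bounded:
  assumes "loc_fin I x" "bounded A"
  shows "finite {i\<in>I. x i \<in> A}"
proof -
  obtain r where "\<forall>y\<in>A. norm y \<le> r" using assms(2) bounded_iff by blast
  then have "{i\<in>I. x i \<in> A} \<subseteq> {i\<in>I. norm (x i) \<le> r}" by auto
  then show ?thesis by (rule finite_subset) (use assms(1) in \<open>simp add: loc_fin_def\<close>)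
qed

lemma emeasure_conf_bounded:
  assumes "loc_fin I x" "bounded A" "A \<in> sets borel"
  shows "emeasure (conf I x) A = of_nat (card {i\<in>I. x i \<in> A})"
proof -
  have "emeasure (conf I x) A = (\<integral>\<^sup>+i. indicator {i\<in>I. x i \<in> A} i \<partial>count_space I)"
    unfolding emeasure_conf[OF assms(3)] by (intro nn_integral_cong) (auto simp: indicator_def)
  also have "\<dots> = emeasure (count_space I) {i\<in>I. x i \<in> A}" by (rule nn_integral_indicator) auto
  also have "\<dots> = of_nat (card {i\<in>I. x i \<in> A})"
    by (subst emeasure_count_space_finite) (use loc_fin_bounded[OF assms(1,2)] in auto)
  finally show ?thesis .
qed

lemma emeasure_config_measure:
  assumes "A \<in> sets borel"
  shows "emeasure (config_measure m) A = (\<integral>\<^sup>+y. of_nat (m y) * indicator A y \<partial>count_space UNIV)"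
  unfolding config_measure_def using assms by (simp add: emeasure_distr emeasure_density)

text \<open>Grouping the indices by their value exchanges two countable sums; local finiteness makes
  every fibre finite.\<close>

lemma conf_eq_config_measure:
  assumes lf: "loc_fin I x"
  shows "conf I x = config_measure (\<lambda>y. card {i\<in>I. x i = y})" (is "_ = config_measure ?m")
    and "locally_finite (\<lambda>y. card {i\<in>I. x i = y})"
proof -
  have fin: "finite {i\<in>I. x i = y}" for y
    using loc_fin_bounded[OF lf, of "{y}"] by simp
  show "conf I x = config_measure ?m"
  proof (rule measure_eqI)
    show "sets (conf I x) = sets (config_measure ?m)" by (simp add: config_measure_def)
    fix A assume "A \<in> sets (conf I x)"
    then have A: "A \<in> sets borel" by simp
    have "emeasure (config_measure ?m) A = (\<integral>\<^sup>+y. (\<integral>\<^sup>+i. indicator {y} (x i) * indicator A y \<partial>count_space I) \<partial>count_space UNIV)"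
      unfolding emeasure_config_measure[OF A]
    proof (intro nn_integral_cong)
      fix y
      have "(\<integral>\<^sup>+i. indicator {y} (x i) \<partial>count_space I) = of_nat (?m y)"
        using emeasure_conf_bounded[OF lf, of "{y}"] emeasure_conf[of "{y}" I x] by simp
      then show "of_nat (?m y) * indicator A y = (\<integral>\<^sup>+i. indicator {y} (x i) * indicator A y \<partial>count_space I)"
        by (simp add: nn_integral_multc)
    qed
    also have "\<dots> = (\<integral>\<^sup>+i. (\<integral>\<^sup>+y. indicator {y} (x i) * indicator A y \<partial>count_space UNIV) \<partial>count_space I)"
      by (rule nn_integral_count_space_nn_integral) (auto intro: loc_fin_countable[OF lf])
    also have "\<dots> = (\<integral>\<^sup>+i. indicator A (x i) \<partial>count_space I)"
    proof (intro nn_integral_cong)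
      fix i
      have "(\<integral>\<^sup>+y. indicator {y} (x i) * indicator A y \<partial>count_space UNIV) = (\<integral>\<^sup>+y. indicator A y * indicator {x i} y \<partial>count_space UNIV)"
        by (intro nn_integral_cong) (auto simp: indicator_def)
      also have "\<dots> = indicator A (x i)"
        by (subst nn_integral_indicator_singleton) (auto)
      finally show "(\<integral>\<^sup>+y. indicator {y} (x i) * indicator A y \<partial>count_space UNIV) = (indicator A (x i) :: ennreal)" .
    qed
    finally show "emeasure (conf I x) A = emeasure (config_measure ?m) A"
      using emeasure_conf[OF A] by simp
  qed
  show "locally_finite ?m"
    unfolding locally_finite_def
  proof (intro allI impI)
    fix K :: "plane set" assume "compact K"
    then have "finite {i\<in>I. x i \<in> K}"
      using lf loc_fin_bounded compact_imp_bounded by blast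
    moreover have "{y \<in> K. ?m y \<noteq> 0} \<subseteq> x ` {i\<in>I. x i \<in> K}"
      using fin by (auto simp: card_eq_0_iff)
    ultimately show "finite {y \<in> K. ?m y \<noteq> 0}" by (rule finite_surj)
  qed
qed

lemma conf_in_configs: "loc_fin I x \<Longrightarrow> conf I x \<in> configs"
  unfolding configs_def using conf_eq_config_measure(1)[of I x] conf_eq_config_measure(2)[of I x] by blast

lemma configs_conf:
  assumes "X \<in> configs"
  obtains I :: "(plane \<times> nat) set" where "loc_fin I fst" "X = conf I fst"
proof -
  obtain m where m: "X = config_measure m" "locally_finite m" using assms unfolding configs_def by blast
  define I where "I = {(y, k). k < m y}"
  have lf: "loc_fin I fst"
    unfolding loc_fin_def
  proof
    fix r
    have fin: "finite {y\<in>cball 0 r. m y \<noteq> 0}" using m(2)[unfolded locally_finite_def, rule_format, OF compact_cball] .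
    have "{i \<in> I. norm (fst i) \<le> r} \<subseteq> Sigma {y\<in>cball 0 r. m y \<noteq> 0} (\<lambda>y. {..<m y})"
      by (auto simp: I_def)
    then show "finite {i \<in> I. norm (fst i) \<le> r}"
      by (rule finite_subset) (rule finite_SigmaI[OF fin finite_lessThan])
  qed
  have "{i \<in> I. fst i = y} = {y} \<times> {..<m y}" for y by (auto simp: I_def)
  then have "(\<lambda>y. card {i\<in>I. fst i = y}) = m" by (auto simp: card_cartesian_product)
  then have "conf I fst = config_measure m" using conf_eq_config_measure(1)[OF lf] by (simp only:)
  then show ?thesis using that[OF lf] m(1) by (simp only:)
qed

lemma sets_configs: "X \<in> configs \<Longrightarrow> sets X = sets borel"
  by (erule configs_conf) simp

lemma space_configs: "X \<in> configs \<Longrightarrow> space X = UNIV"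
  by (erule configs_conf) simp

lemma configs_emeasure_bounded: "X \<in> configs \<Longrightarrow> bounded A \<Longrightarrow> A \<in> sets borel \<Longrightarrow> emeasure X A < \<infinity>"
  by (erule configs_conf) (simp add: emeasure_conf_bounded of_nat_less_top)

lemma translate_in_configs:
  assumes "X \<in> configs" shows "translate_config t X \<in> configs"
proof -
  obtain I :: "(plane \<times> nat) set" where I: "loc_fin I fst" "X = conf I fst" using configs_conf[OF assms] .
  have "loc_fin I (\<lambda>i. fst i + t)"
    unfolding loc_fin_def
  proof
    fix r
    have "{i \<in> I. norm (fst i + t) \<le> r} = {i\<in>I. fst i \<in> cball (-t) r}"
      by (auto simp: dist_norm norm_minus_commute[of "-t"])
    then show "finite {i \<in> I. norm (fst i + t) \<le> r}" using loc_fin_bounded[OF I(1) bounded_cball] by presburger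
  qed
  then show ?thesis using I by (simp add: translate_conf conf_in_configs)
qed

lemma space_config_algebra: "space config_algebra = configs"
proof -
  have "space config_algebra = (\<Union>A\<in>sets (borel :: plane measure). space (vimage_algebra configs (\<lambda>X. emeasure X A) borel))"
    unfolding config_algebra_def by (subst space_Sup_eq_UN) auto
  also have "\<dots> = configs" by auto
  finally show ?thesis .
qed

lemma measurable_config_algebra:
  assumes "\<And>w. w \<in> space M \<Longrightarrow> f w \<in> configs"
    and "\<And>A. A \<in> sets borel \<Longrightarrow> (\<lambda>w. emeasure (f w) A) \<in> borel_measurable M"
  shows "f \<in> measurable M config_algebra"
  unfolding config_algebra_def
proof (rule measurable_SUP2)
  fix A :: "plane set" assume "A \<in> sets borel"
  then show "f \<in> M \<rightarrow>\<^sub>M vimage_algebra configs (\<lambda>X. emeasure X A) borel"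
    using assms by (intro measurable_vimage_algebra2) auto
next
  show "sets (borel :: plane measure) \<noteq> {}" using sets.empty_sets by blast
  show "space (vimage_algebra configs (\<lambda>X. emeasure X A) borel) = space (vimage_algebra configs (\<lambda>X. emeasure X B) borel)" for A B
    by (simp only: space_vimage_algebra)
qed

lemma emeasure_config_measurable:
  assumes A: "A \<in> sets borel"
  shows "(\<lambda>X. emeasure X A) \<in> borel_measurable config_algebra"
proof -
  have 1: "(\<lambda>X. emeasure X A) \<in> vimage_algebra configs (\<lambda>X. emeasure X A) borel \<rightarrow>\<^sub>M borel"
    by (rule measurable_vimage_algebra1) simp
  show ?thesis unfolding config_algebra_def
    by (rule measurable_SUP1[where M="\<lambda>A. vimage_algebra configs (\<lambda>X. emeasure X A) borel" and i=A and I="sets borel", OF A 1])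
      (simp only: space_vimage_algebra)
qed

lemma configs_borel_measurable:
  "X \<in> space config_algebra \<Longrightarrow> u \<in> measurable borel N \<Longrightarrow> u \<in> measurable X N"
  using measurable_cong_sets[OF sets_configs refl, of X N] by (simp add: space_config_algebra)

text \<open>Monotone class induction, starting from indicators, whose integrals generate the
  sigma-algebra. It makes the tent integrals in \<open>gain\<close> measurable.\<close>

lemma nn_integral_config_measurable:
  fixes \<phi> :: "plane \<Rightarrow> ennreal"
  assumes "\<phi> \<in> borel_measurable borel"
  shows "(\<lambda>X. \<integral>\<^sup>+y. \<phi> y \<partial>X) \<in> borel_measurable config_algebra"
  using assms
proof (induction rule: borel_measurable_induct)
  case (cong f g)
  then have "f = g" by (intro ext) simp
  then show ?case using cong by blast
next
  case (set A)
  have "(\<lambda>X. integral\<^sup>N X (indicator A)) \<in> borel_measurable config_algebra \<longleftrightarrow> (\<lambda>X. emeasure X A) \<in> borel_measurable config_algebra"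
    by (rule measurable_cong) (use set in \<open>simp add: space_config_algebra sets_configs\<close>)
  then show ?case using emeasure_config_measurable[OF set] by blast
next
  case (mult u c)
  have "(\<lambda>X. \<integral>\<^sup>+ y. c * u y \<partial>X) \<in> borel_measurable config_algebra \<longleftrightarrow> (\<lambda>X. c * integral\<^sup>N X u) \<in> borel_measurable config_algebra"
  proof (rule measurable_cong)
    fix X assume "X \<in> space config_algebra"
    then have "u \<in> borel_measurable X" using mult(2) by (rule configs_borel_measurable)
    then show "(\<integral>\<^sup>+ y. c * u y \<partial>X) = c * integral\<^sup>N X u" by (rule nn_integral_cmult)
  qed
  then show ?case using mult by simp
next
  case (add u v)
  have "(\<lambda>X. \<integral>\<^sup>+ y. v y + u y \<partial>X) \<in> borel_measurable config_algebra \<longleftrightarrow> (\<lambda>X. integral\<^sup>N X v + integral\<^sup>N X u) \<in> borel_measurable config_algebra"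
  proof (rule measurable_cong)
    fix X assume "X \<in> space config_algebra"
    then have "u \<in> borel_measurable X" "v \<in> borel_measurable X" using add configs_borel_measurable by auto
    then show "(\<integral>\<^sup>+ y. v y + u y \<partial>X) = integral\<^sup>N X v + integral\<^sup>N X u" by (simp add: nn_integral_add)
  qed
  then show ?case using add by simp
next
  case (seq U)
  have "(\<lambda>X. integral\<^sup>N X (SUP i. U i)) \<in> borel_measurable config_algebra \<longleftrightarrow> (\<lambda>X. SUP i. integral\<^sup>N X (U i)) \<in> borel_measurable config_algebra"
  proof (rule measurable_cong)
    fix X assume "X \<in> space config_algebra"
    then have "\<And>i. U i \<in> borel_measurable X" using seq(1) by (rule configs_borel_measurable)
    then show "integral\<^sup>N X (SUP i. U i) = (SUP i. integral\<^sup>N X (U i))"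
      using \<open>incseq U\<close> unfolding SUP_apply image_comp by (subst nn_integral_monotone_convergence_SUP[symmetric]) (auto simp: image_comp)
  qed
  moreover have "(\<lambda>X. SUP i. integral\<^sup>N X (U i)) \<in> borel_measurable config_algebra"
    using seq by (intro borel_measurable_SUP) auto
  ultimately show ?case by (rule iffD2)
qed

lemma emeasure_translate_config:
  assumes "X \<in> configs" "A \<in> sets borel"
  shows "emeasure (translate_config t X) A = emeasure X ((\<lambda>x. x + t) -` A)"
proof -
  have "(\<lambda>x. x + t) \<in> measurable X borel" using measurable_cong_sets[OF sets_configs[OF assms(1)] refl, of "borel :: plane measure"] by simp
  then show ?thesis unfolding translate_config_def
    by (simp add: emeasure_distr assms space_configs)
qed

lemma translate_config_measurable [measurable]: "translate_config t \<in> measurable config_algebra config_algebra"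
proof (rule measurable_config_algebra)
  show "translate_config t w \<in> configs" if "w \<in> space config_algebra" for w
    using that translate_in_configs by (simp add: space_config_algebra)
  fix A :: "plane set" assume A: "A \<in> sets borel"
  have "(\<lambda>x. x + t) -` A \<in> sets borel"
    using measurable_sets[of "\<lambda>x. x + t" borel borel A] A by simp
  then have m: "(\<lambda>w. emeasure w ((\<lambda>x. x + t) -` A)) \<in> borel_measurable config_algebra"
    by (rule emeasure_config_measurable)
  show "(\<lambda>w. emeasure (translate_config t w) A) \<in> borel_measurable config_algebra"
  proof (rule iffD2[OF measurable_cong m])
    fix w assume "w \<in> space config_algebra"
    then show "emeasure (translate_config t w) A = emeasure w ((\<lambda>x. x + t) -` A)"
      by (intro emeasure_translate_config) (simp_all add: space_config_algebra A)
  qed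
qed

text \<open>\<open>compatible_process\<close> and \<open>stationary_field\<close> assert only
  equations \<open>distr M N f = P\<close>, and \<open>distr\<close> is total, so measurability of
  \<open>f\<close> has to be recovered. If the image set function were not a measure,
  \<open>distr\<close> would be the null measure and not a probability. Otherwise one of
  \<open>A\<close> and its complement has nonzero mass and hence a preimage in
  \<open>sets M\<close>, since \<open>emeasure\<close> is 0 off \<open>sets M\<close>; the other
  preimage is the complement of that one.\<close>

lemma measurable_of_distr_prob:
  assumes "prob_space P" "distr M N f = P" "f \<in> space M \<rightarrow> space N"
  shows "f \<in> measurable M N"
proof (rule measurableI)
  show "f w \<in> space N" if "w \<in> space M" for w using that assms(3) by auto
  fix A assume A: "A \<in> sets N"
  interpret P: prob_space P by (rule assms(1))
  have sp: "space P = space N" "sets P = sets N"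
    using space_distr[of M N f] sets_distr[of M N f] unfolding assms(2) by (simp_all only:)
  have eq: "emeasure P B = emeasure M (f -` B \<inter> space M)" if "B \<in> sets N" for B
  proof -
    have 1: "emeasure P B = (if B \<in> sets N \<and> measure_space (space N) (sets N) (\<lambda>A. emeasure M (f -` A \<inter> space M)) then emeasure M (f -` B \<inter> space M) else 0)" for B
      using fun_cong[OF emeasure_measure_of_conv[of "space N" "sets N" "\<lambda>A. emeasure M (f -` A \<inter> space M)"], of B]
      unfolding sets.sigma_sets_eq distr_def[symmetric] assms(2) .
    have "emeasure P (space N) = 1" using P.emeasure_space_1 sp(1) by (simp only:)
    then have "measure_space (space N) (sets N) (\<lambda>A. emeasure M (f -` A \<inter> space M))"
      using 1[of "space N"] by (metis zero_neq_one)
    then show ?thesis using 1[of B] that by (simp only: if_True simp_thms)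
  qed
  have c: "space N - A \<in> sets N" using A by auto
  have "A \<union> (space N - A) = space N" using sets.sets_into_space[OF A] by blast
  moreover have "emeasure P A + emeasure P (space N - A) = emeasure P (A \<union> (space N - A))"
    by (rule plus_emeasure) (use A c sp in auto)
  moreover have "emeasure P (space N) = 1" using P.emeasure_space_1 sp(1) by (simp only:)
  ultimately have "emeasure P A + emeasure P (space N - A) = 1" by simp
  then have "emeasure P A \<noteq> 0 \<or> emeasure P (space N - A) \<noteq> 0" by auto
  then show "f -` A \<inter> space M \<in> sets M"
  proof
    assume "emeasure P A \<noteq> 0"
    then have "emeasure M (f -` A \<inter> space M) \<noteq> 0" using eq[OF A] by simp
    then show ?thesis by (rule contrapos_np) (rule emeasure_notin_sets)
  next
    assume "emeasure P (space N - A) \<noteq> 0"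
    then have "emeasure M (f -` (space N - A) \<inter> space M) \<noteq> 0" using eq[OF c] by simp
    then have "f -` (space N - A) \<inter> space M \<in> sets M" by (rule contrapos_np) (rule emeasure_notin_sets)
    then have "space M - (f -` (space N - A) \<inter> space M) \<in> sets M" by auto
    moreover have "space M - (f -` (space N - A) \<inter> space M) = f -` A \<inter> space M"
      using assms(3) by auto
    ultimately show ?thesis by simp
  qed
qed

lemma integral_conf:
  fixes \<phi> :: "plane \<Rightarrow> real"
  assumes "loc_fin I x" "\<phi> \<in> borel_measurable borel" "bounded {y. \<phi> y \<noteq> 0}"
  shows "(\<integral>y. \<phi> y \<partial>conf I x) = (\<Sum>i | i \<in> I \<and> \<phi> (x i) \<noteq> 0. \<phi> (x i))"
    and "finite {i\<in>I. \<phi> (x i) \<noteq> 0}"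
    and "integrable (conf I x) \<phi>"
proof -
  have f: "finite {i\<in>I. x i \<in> {y. \<phi> y \<noteq> 0}}" by (rule loc_fin_bounded[OF assms(1,3)])
  then show f': "finite {i\<in>I. \<phi> (x i) \<noteq> 0}" by simp
  show "(\<integral>y. \<phi> y \<partial>conf I x) = (\<Sum>i | i \<in> I \<and> \<phi> (x i) \<noteq> 0. \<phi> (x i))"
    unfolding conf_def using assms(2) f' by (subst integral_distr) (auto simp: lebesgue_integral_count_space_finite_support)
  show "integrable (conf I x) \<phi>"
    unfolding conf_def using assms(2) f' by (subst integrable_distr_eq) (auto simp: integrable_iff_bounded nn_integral_count_space intro: finite_subset[OF _ f'])
qed

section \<open>The integer lattice and the tiling by unit cells\<close>

definition ZZ :: "plane set" where "ZZ = {z. \<forall>i. z $ i \<in> \<int>}"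

definition Cell :: "plane set" where "Cell = {x. \<forall>i. 0 \<le> x $ i \<and> x $ i < 1}"

definition flr :: "plane \<Rightarrow> plane" where "flr x = (\<chi> i. of_int \<lfloor>x $ i\<rfloor>)"

lemma flr_in_ZZ [simp]: "flr x \<in> ZZ" by (simp add: flr_def ZZ_def)

lemma sub_flr_in_Cell [simp]: "x - flr x \<in> Cell"
proof -
  have "0 \<le> t - of_int \<lfloor>t\<rfloor> \<and> t - of_int \<lfloor>t\<rfloor> < 1" for t :: real by linarith
  then show ?thesis by (simp add: flr_def Cell_def)
qed

lemma flr_unique:
  assumes "b \<in> ZZ" "x - b \<in> Cell" shows "flr x = b"
proof -
  have "of_int \<lfloor>x $ i\<rfloor> = b $ i" for i
  proof -
    obtain k where k: "b $ i = of_int k" using assms(1) unfolding ZZ_def Ints_def by blast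
    have "0 \<le> x $ i - b $ i" "x $ i - b $ i < 1" using assms(2) by (simp_all add: Cell_def)
    then have "\<lfloor>x $ i\<rfloor> = k" using k by linarith
    then show ?thesis using k by simp
  qed
  then show ?thesis by (simp add: flr_def vec_eq_iff)
qed

lemma Cell_iff_flr: "b \<in> ZZ \<Longrightarrow> x - b \<in> Cell \<longleftrightarrow> b = flr x"
  using flr_unique[of b x] sub_flr_in_Cell[of x] by blast

lemma ZZ_add [simp, intro]: "a \<in> ZZ \<Longrightarrow> b \<in> ZZ \<Longrightarrow> a + b \<in> ZZ"
  and ZZ_diff [simp, intro]: "a \<in> ZZ \<Longrightarrow> b \<in> ZZ \<Longrightarrow> a - b \<in> ZZ"
  and ZZ_uminus [simp, intro]: "a \<in> ZZ \<Longrightarrow> - a \<in> ZZ"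
  and ZZ_0 [simp]: "0 \<in> ZZ"
  by (auto simp: ZZ_def)

lemma finite_ZZ_bounded: "finite {b\<in>ZZ. norm b \<le> R}"
proof -
  define N where "N = \<lceil>R\<rceil>"
  have "{b\<in>ZZ. norm b \<le> R} \<subseteq> (\<lambda>f. \<chi> i. of_int (f i)) ` (UNIV \<rightarrow>\<^sub>E {-N..N})"
  proof
    fix b assume b: "b \<in> {b\<in>ZZ. norm b \<le> R}"
    have "\<forall>i. \<exists>k. b $ i = of_int k" using b by (auto simp: ZZ_def Ints_def)
    then obtain f where f: "\<And>i. b $ i = of_int (f i)" by metis
    have "f i \<in> {-N..N}" for i
    proof -
      have "\<bar>b $ i\<bar> \<le> R" using b component_le_norm_cart[of b i] by auto
      then show ?thesis unfolding f N_def by (auto; linarith)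
    qed
    moreover have "b = (\<chi> i. of_int (f i))" using f by (simp add: vec_eq_iff)
    ultimately show "b \<in> (\<lambda>f. \<chi> i. of_int (f i)) ` (UNIV \<rightarrow>\<^sub>E {-N..N})" by auto
  qed
  then show ?thesis by (rule finite_subset) (intro finite_imageI finite_PiE, auto)
qed

lemma countable_ZZ [simp]: "countable ZZ"
proof -
  have "loc_fin ZZ (\<lambda>b. b)" unfolding loc_fin_def using finite_ZZ_bounded by blast
  then show ?thesis by (rule loc_fin_countable)
qed

lemma Cell_borel [measurable, simp]: "Cell \<in> sets borel"
proof -
  have "Cell = {x\<in>space borel. \<forall>i. 0 \<le> x $ i \<and> x $ i < 1}" by (simp add: Cell_def)
  also have "\<dots> \<in> sets borel" by measurable
  finally show ?thesis .
qed

lemma norm_plane_le: "norm (x :: plane) \<le> \<bar>x $ 1\<bar> + \<bar>x $ 2\<bar>"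
  using norm_le_l1_cart[of x] by (simp add: sum_2)

lemma norm_Cell:
  assumes "x \<in> Cell" shows "norm x \<le> 2"
proof -
  have "0 \<le> x $ 1" "x $ 1 < 1" "0 \<le> x $ 2" "x $ 2 < 1" using assms by (simp_all add: Cell_def)
  then show ?thesis using norm_plane_le[of x] by linarith
qed

lemma emeasure_Cell [simp]: "emeasure lborel Cell = 1"
proof (rule antisym)
  have 1: "(1::plane) \<bullet> b = 1" if "b \<in> Basis" for b
    using that by (auto simp: Basis_vec_def inner_axis)
  have "emeasure lborel Cell \<le> emeasure lborel (cbox 0 (1::plane))"
    by (intro emeasure_mono) (auto simp: Cell_def mem_box_cart less_imp_le)
  also have "\<dots> = 1" using 1 by (simp add: emeasure_lborel_cbox_eq)
  finally show "emeasure lborel Cell \<le> 1" .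
  have "emeasure lborel (box 0 (1::plane)) \<le> emeasure lborel Cell"
    by (intro emeasure_mono) (auto simp: Cell_def mem_box_cart less_imp_le)
  moreover have "emeasure lborel (box 0 (1::plane)) = 1" using 1 by (simp add: emeasure_lborel_box_eq)
  ultimately show "1 \<le> emeasure lborel Cell" by simp
qed

lemma flr_measurable [measurable]: "flr \<in> measurable borel (count_space ZZ)"
proof (subst measurable_count_space_eq_countable, safe)
  fix b assume b: "b \<in> ZZ"
  have "flr -` {b} \<inter> space borel = {x\<in>space borel. x - b \<in> Cell}"
    using Cell_iff_flr[OF b] by auto
  also have "\<dots> \<in> sets borel" by measurable
  finally show "flr -` {b} \<inter> space borel \<in> sets borel" .
qed auto

lemma flr_borel [measurable]: "flr \<in> borel_measurable borel"
  using measurable_compose[OF flr_measurable, of "\<lambda>x. x" borel] by simp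

lemma sum_indicator_Cell:
  "(\<integral>\<^sup>+b. indicator Cell (x - b) \<partial>count_space ZZ) = (1::ennreal)"
proof -
  have "(\<integral>\<^sup>+b. indicator Cell (x - b) \<partial>count_space ZZ) = (\<integral>\<^sup>+b. indicator {flr x} b \<partial>count_space ZZ)"
    by (intro nn_integral_cong) (simp add: indicator_def Cell_iff_flr)
  also have "\<dots> = emeasure (count_space ZZ) {flr x}" by (rule nn_integral_indicator) simp
  also have "\<dots> = 1" by (subst emeasure_count_space_finite) auto
  finally show ?thesis .
qed

lemma nn_integral_lborel_translate:
  fixes f :: "plane \<Rightarrow> ennreal"
  assumes [measurable]: "f \<in> borel_measurable borel"
  shows "(\<integral>\<^sup>+x. f (x + a) \<partial>lborel) = (\<integral>\<^sup>+x. f x \<partial>lborel)"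
  by (subst (2) lborel_distr_plus[symmetric, of a]) (simp add: nn_integral_distr add.commute)

lemma nn_integral_tiling:
  fixes f :: "plane \<Rightarrow> ennreal"
  assumes [measurable]: "f \<in> borel_measurable borel"
  shows "(\<integral>\<^sup>+x. f x \<partial>lborel) = (\<integral>\<^sup>+b. (\<integral>\<^sup>+u. f (u + b) * indicator Cell u \<partial>lborel) \<partial>count_space ZZ)"
proof -
  have "(\<integral>\<^sup>+x. f x \<partial>lborel) = (\<integral>\<^sup>+x. (\<integral>\<^sup>+b. f x * indicator Cell (x - b) \<partial>count_space ZZ) \<partial>lborel)"
    by (simp add: nn_integral_cmult sum_indicator_Cell)
  also have "\<dots> = (\<integral>\<^sup>+b. (\<integral>\<^sup>+x. f x * indicator Cell (x - b) \<partial>lborel) \<partial>count_space ZZ)"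
    by (rule nn_integral_count_space_nn_integral) auto
  also have "\<dots> = (\<integral>\<^sup>+b. (\<integral>\<^sup>+u. f (u + b) * indicator Cell u \<partial>lborel) \<partial>count_space ZZ)"
  proof (rule nn_integral_cong)
    fix b :: plane
    show "(\<integral>\<^sup>+x. f x * indicator Cell (x - b) \<partial>lborel) = (\<integral>\<^sup>+u. f (u + b) * indicator Cell u \<partial>lborel)"
      using nn_integral_lborel_translate[of "\<lambda>x. f x * indicator Cell (x - b)" b] by simp
  qed
  finally show ?thesis .
qed

section \<open>The uniform law on the unit cell and its invariance under rotations of the
  torus\<close>

definition U :: "plane measure" where "U = restrict_space lborel Cell"

lemma space_U [simp]: "space U = Cell" by (simp add: U_def space_restrict_space)

lemma measurable_U: "f \<in> measurable borel N \<Longrightarrow> f \<in> measurable U N"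
  unfolding U_def by (rule measurable_restrict_space1) simp

lemma prob_space_U: "prob_space U"
  by (rule prob_spaceI) (simp add: U_def space_restrict_space emeasure_restrict_space)

lemma nn_integral_U: "(\<integral>\<^sup>+u. f u \<partial>U) = (\<integral>\<^sup>+u. f u * indicator Cell u \<partial>lborel)"
  unfolding U_def by (rule nn_integral_restrict_space) simp

lemma id_U [measurable]: "(\<lambda>u. u) \<in> measurable U borel"
  by (rule measurable_U) simp

lemma measurable_into_U:
  assumes "f \<in> measurable M borel" "\<And>w. w \<in> space M \<Longrightarrow> f w \<in> Cell"
  shows "f \<in> measurable M U"
  unfolding U_def using assms by (intro measurable_restrict_space2) auto

text \<open>Translation by \<open>t\<close> on the torus, with the unit cell as fundamental
  domain.\<close>

definition rot :: "plane \<Rightarrow> plane \<Rightarrow> plane" where "rot t u = u + t - flr (u + t)"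

lemma rot_measurable [measurable]: "rot t \<in> measurable U U"
  unfolding rot_def by (intro measurable_into_U) auto

text \<open>Extend \<open>f\<close> periodically to \<open>g\<close>, translate the integral over
  the cell, cut it along the tiling and move the pieces back by periodicity: they reassemble the
  cell.\<close>

lemma nn_integral_rot:
  assumes f [measurable]: "f \<in> borel_measurable U"
  shows "(\<integral>\<^sup>+u. f (rot t u) \<partial>U) = (\<integral>\<^sup>+u. f u \<partial>U)"
proof -
  define g where "g x = f (x - flr x)" for x
  have [measurable]: "g \<in> borel_measurable borel"
    unfolding g_def by (rule measurable_compose[OF _ f], intro measurable_into_U) auto
  have gp: "g (x + b) = g x" if "b \<in> ZZ" for x b
  proof -
    have "flr (x + b) = flr x + b" by (rule flr_unique) (use that in \<open>simp_all add: algebra_simps\<close>)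
    then show ?thesis by (simp add: g_def)
  qed
  have "(\<integral>\<^sup>+u. f (rot t u) \<partial>U) = (\<integral>\<^sup>+u. g (u + t) * indicator Cell u \<partial>lborel)"
    by (simp add: nn_integral_U rot_def g_def)
  also have "\<dots> = (\<integral>\<^sup>+x. g x * indicator Cell (x - t) \<partial>lborel)"
    using nn_integral_lborel_translate[of "\<lambda>x. g x * indicator Cell (x - t)" t] by simp
  also have "\<dots> = (\<integral>\<^sup>+b. (\<integral>\<^sup>+u. g (u + b) * indicator Cell (u + b - t) * indicator Cell u \<partial>lborel) \<partial>count_space ZZ)"
    by (rule nn_integral_tiling) simp
  also have "\<dots> = (\<integral>\<^sup>+b. (\<integral>\<^sup>+u. (g u * indicator Cell u) * indicator Cell (u + b - t) \<partial>lborel) \<partial>count_space ZZ)"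
    by (intro nn_integral_cong) (auto simp: gp mult_ac)
  also have "\<dots> = (\<integral>\<^sup>+u. (\<integral>\<^sup>+b. (g u * indicator Cell u) * indicator Cell (u + b - t) \<partial>count_space ZZ) \<partial>lborel)"
    by (rule nn_integral_count_space_nn_integral[symmetric]) auto
  also have "\<dots> = (\<integral>\<^sup>+u. g u * indicator Cell u \<partial>lborel)"
  proof (rule nn_integral_cong)
    fix u
    have "(\<integral>\<^sup>+b. indicator Cell (u + b - t) \<partial>count_space ZZ) = (\<integral>\<^sup>+b. indicator Cell (u - t - b) \<partial>count_space ZZ)"
    proof -
      have "bij_betw (uminus :: plane \<Rightarrow> plane) ZZ ZZ"
        by (rule bij_betw_byWitness[where f'=uminus]) auto
      from nn_integral_bij_count_space[OF this, of "\<lambda>b. indicator Cell (u - t - b)"] show ?thesis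
        by (simp add: algebra_simps)
    qed
    then have "(\<integral>\<^sup>+b. indicator Cell (u + b - t) \<partial>count_space ZZ) = (1::ennreal)" by (simp add: sum_indicator_Cell)
    then show "(\<integral>\<^sup>+b. (g u * indicator Cell u) * indicator Cell (u + b - t) \<partial>count_space ZZ) = g u * indicator Cell u"
      by (simp add: nn_integral_cmult)
  qed
  also have "\<dots> = (\<integral>\<^sup>+u. f u \<partial>U)"
    unfolding nn_integral_U
  proof (rule nn_integral_cong)
    fix u
    have "flr u = 0" if "u \<in> Cell" by (rule flr_unique) (use that in auto)
    then show "g u * indicator Cell u = f u * indicator Cell u" by (auto simp: g_def indicator_def)
  qed
  finally show ?thesis .
qed

section \<open>The probability space: a global shift and independent displacements\<close>

definition PP :: "(plane \<Rightarrow> plane) measure" where "PP = PiM ZZ (\<lambda>_. U)"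

definition Om :: "(plane \<times> (plane \<Rightarrow> plane)) measure" where "Om = U \<Otimes>\<^sub>M PP"

lemma prob_space_PP: "prob_space PP"
  unfolding PP_def by (intro prob_space_PiM prob_space_U)

lemma prob_space_Om: "prob_space Om"
  unfolding Om_def using prob_space_U prob_space_PP by (rule prob_space_pair)

interpretation U: prob_space U by (rule prob_space_U)
interpretation PP: prob_space PP by (rule prob_space_PP)
interpretation Om: prob_space Om by (rule prob_space_Om)
definition shift :: "plane \<Rightarrow> (plane \<Rightarrow> plane) \<Rightarrow> plane \<Rightarrow> plane" where
  "shift k v = (\<lambda>b\<in>ZZ. v (b - k))"

lemma comp_measurable [measurable]: "b \<in> ZZ \<Longrightarrow> (\<lambda>v. v b) \<in> measurable PP U"
  unfolding PP_def by (rule measurable_component_singleton)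

lemma comp_Cell: "v \<in> space PP \<Longrightarrow> b \<in> ZZ \<Longrightarrow> v b \<in> Cell"
  by (auto simp: PP_def space_PiM PiE_def Pi_iff)

lemma shift_measurable: "k \<in> ZZ \<Longrightarrow> shift k \<in> measurable PP PP"
  unfolding shift_def by (subst (2) PP_def) (intro measurable_restrict comp_measurable ZZ_diff)

lemma distr_shift: "k \<in> ZZ \<Longrightarrow> distr PP PP (shift k) = PP"
  unfolding PP_def shift_def
  using distr_PiM_reindex[of ZZ "\<lambda>_. U" "\<lambda>b. b - k" ZZ] prob_space_U
  by (auto simp: inj_on_def)

text \<open>The action of a translation, in units of the spacing. The integer part by which the
  global shift leaves the cell relabels the displacements, so that each site keeps its own
  displacement.\<close>

definition T :: "plane \<Rightarrow> plane \<times> (plane \<Rightarrow> plane) \<Rightarrow> plane \<times> (plane \<Rightarrow> plane)" where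
  "T t w = (rot t (fst w), shift (flr (fst w + t)) (snd w))"

lemma fst_Om [measurable]: "fst \<in> measurable Om U"
  and snd_Om [measurable]: "snd \<in> measurable Om PP"
  unfolding Om_def by measurable

lemma T_measurable [measurable]: "T t \<in> measurable Om Om"
proof -
  have f: "(\<lambda>w. rot t (fst w)) \<in> measurable Om U" by measurable
  have k: "(\<lambda>w. flr (fst w + t)) \<in> measurable Om (count_space ZZ)"
    by measurable
  have s: "(\<lambda>w. shift (flr (fst w + t)) (snd w)) \<in> measurable Om PP"
    by (rule measurable_compose_countable'[OF _ k]) (auto intro: measurable_compose[OF snd_Om shift_measurable])
  show ?thesis unfolding T_def using measurable_Pair[OF f s] by (simp add: Om_def)
qed

text \<open>Given the global shift, the relabelling is by a fixed lattice vector and preserves the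
  product law; what remains is the rotation of the shift.\<close>

lemma distr_T: "distr Om Om (T t) = Om"
proof (rule measure_eqI)
  fix A assume "A \<in> sets (distr Om Om (T t))"
  then have A: "A \<in> sets Om" by simp
  define F where "F = (indicator A :: _ \<Rightarrow> ennreal)"
  have F [measurable]: "F \<in> borel_measurable (U \<Otimes>\<^sub>M PP)" using A by (simp add: F_def Om_def)
  have FT: "(\<lambda>w. F (T t w)) \<in> borel_measurable (U \<Otimes>\<^sub>M PP)"
    using measurable_compose[OF T_measurable[of t], of F borel] F by (simp add: Om_def)
  have "emeasure (distr Om Om (T t)) A = (\<integral>\<^sup>+w. F (T t w) \<partial>Om)"
    using A nn_integral_distr[OF T_measurable[of t], of F] F by (simp add: F_def Om_def)
  also have "\<dots> = (\<integral>\<^sup>+u. (\<integral>\<^sup>+v. F (rot t u, shift (flr (u + t)) v) \<partial>PP) \<partial>U)"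
    unfolding Om_def by (subst PP.nn_integral_fst[symmetric, OF FT]) (simp add: T_def)
  also have "\<dots> = (\<integral>\<^sup>+u. (\<integral>\<^sup>+v. F (rot t u, v) \<partial>PP) \<partial>U)"
  proof (rule nn_integral_cong)
    fix u assume "u \<in> space U"
    then have r: "rot t u \<in> space U" by (simp add: rot_def)
    have [measurable]: "(\<lambda>v. F (rot t u, v)) \<in> borel_measurable PP"
      using r by measurable
    show "(\<integral>\<^sup>+v. F (rot t u, shift (flr (u + t)) v) \<partial>PP) = (\<integral>\<^sup>+v. F (rot t u, v) \<partial>PP)"
      by (subst (2) distr_shift[of "flr (u + t)", symmetric]) (simp_all add: nn_integral_distr shift_measurable)
  qed
  also have "\<dots> = (\<integral>\<^sup>+u. (\<integral>\<^sup>+v. F (u, v) \<partial>PP) \<partial>U)"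
    by (rule nn_integral_rot) measurable
  also have "\<dots> = emeasure Om A"
    using A by (subst PP.nn_integral_fst[OF F]) (simp add: F_def Om_def)
  finally show "emeasure (distr Om Om (T t)) A = emeasure Om A" .
qed simp

text \<open>
  A perturbed lattice: \<open>gl\<close> is the spacing, every site is displaced by \<open>gl * gs\<close> times its own uniform
  point of the unit cell, and carries \<open>gn\<close> points, at the offsets \<open>gc\<close>.
\<close>

record gspec =
  gl :: real
  gs :: real
  gn :: nat
  gc :: "nat \<Rightarrow> plane"

definition gpt :: "gspec \<Rightarrow> plane \<times> (plane \<Rightarrow> plane) \<Rightarrow> plane \<times> nat \<Rightarrow> plane" where
  "gpt G w = (\<lambda>(b, i). gl G *\<^sub>R (fst w + b + gs G *\<^sub>R snd w b) + gc G i)"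

definition gidx :: "gspec \<Rightarrow> (plane \<times> nat) set" where
  "gidx G = ZZ \<times> {..<gn G}"

definition sidx :: "gspec \<Rightarrow> gspec \<Rightarrow> ((plane \<times> nat) + (plane \<times> nat)) set" where
  "sidx G H = gidx G <+> gidx H"

definition spt :: "gspec \<Rightarrow> gspec \<Rightarrow> (plane \<times> (plane \<Rightarrow> plane)) \<times> (plane \<times> (plane \<Rightarrow> plane)) \<Rightarrow> (plane \<times> nat) + (plane \<times> nat) \<Rightarrow> plane" where
  "spt G H w = case_sum (gpt G (fst w)) (gpt H (snd w))"

abbreviation sconf where "sconf G H w \<equiv> conf (sidx G H) (spt G H w)"

lemma space_OmD:
  assumes "w \<in> space Om"
  shows "fst w \<in> Cell" "\<And>b. b \<in> ZZ \<Longrightarrow> snd w b \<in> Cell"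
  using assms comp_Cell by (auto simp: Om_def space_pair_measure)

lemma loc_fin_gpt:
  assumes "gl G > 0" "w \<in> space Om"
  shows "loc_fin (gidx G) (gpt G w)"
  unfolding loc_fin_def
proof
  fix r
  \<comment> \<open>Obtained by solving \<open>gpt\<close> for \<open>b\<close>; the global shift
    has norm at most 2 and the displacement norm at most \<open>2 * \<bar>gs G\<bar>\<close>, in
    units of the spacing.\<close>
  define R where "R = (r + (\<Sum>i<gn G. norm (gc G i))) / gl G + 2 + 2 * \<bar>gs G\<bar>"
  have "{i \<in> gidx G. norm (gpt G w i) \<le> r} \<subseteq> {b\<in>ZZ. norm b \<le> R} \<times> {..<gn G}"
  proof
    fix p assume p: "p \<in> {i \<in> gidx G. norm (gpt G w i) \<le> r}"
    obtain b i where pb: "p = (b, i)" by (cases p)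
    have bZ: "b \<in> ZZ" and i: "i \<in> {..<gn G}" and bi: "norm (gpt G w (b, i)) \<le> r"
      using p by (auto simp: gidx_def pb)
    have u: "norm (fst w) \<le> 2" and v: "norm (snd w b) \<le> 2"
      using space_OmD(1)[OF assms(2)] space_OmD(2)[OF assms(2) bZ] norm_Cell by blast+
    have ci: "norm (gc G i) \<le> (\<Sum>i<gn G. norm (gc G i))"
      by (rule member_le_sum) (use i in auto)
    have "b = (gpt G w (b, i) - gc G i) /\<^sub>R gl G - fst w - gs G *\<^sub>R snd w b"
      using assms(1) by (simp add: gpt_def)
    then have "norm b \<le> norm ((gpt G w (b, i) - gc G i) /\<^sub>R gl G) + norm (fst w) + norm (gs G *\<^sub>R snd w b)"
      by (smt (verit) norm_triangle_ineq4)
    also have "norm ((gpt G w (b, i) - gc G i) /\<^sub>R gl G) \<le> (r + (\<Sum>i<gn G. norm (gc G i))) / gl G"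
      using assms(1) bi ci norm_triangle_ineq4[of "gpt G w (b, i)" "gc G i"]
      by (simp add: divide_inverse mult.commute)
    also have "norm (gs G *\<^sub>R snd w b) \<le> 2 * \<bar>gs G\<bar>" using v by (simp add: mult.commute mult_left_mono)
    finally have "norm b \<le> R" using u by (simp add: R_def)
    then show "p \<in> {b\<in>ZZ. norm b \<le> R} \<times> {..<gn G}" using bZ i pb by simp
  qed
  then show "finite {i \<in> gidx G. norm (gpt G w i) \<le> r}"
    by (rule finite_subset) (intro finite_cartesian_product finite_ZZ_bounded finite_lessThan)
qed

lemma loc_fin_spt:
  assumes "gl G > 0" "gl H > 0" "w \<in> space (Om \<Otimes>\<^sub>M Om)"
  shows "loc_fin (sidx G H) (spt G H w)"
  unfolding loc_fin_def
proof
  fix r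
  have "fst w \<in> space Om" "snd w \<in> space Om" using assms(3) by (auto simp: space_pair_measure)
  then have "finite (Inl ` {i \<in> gidx G. norm (gpt G (fst w) i) \<le> r} \<union> Inr ` {i \<in> gidx H. norm (gpt H (snd w) i) \<le> r})"
    using loc_fin_gpt assms(1,2) unfolding loc_fin_def by blast
  moreover have "{i \<in> sidx G H. norm (spt G H w i) \<le> r} \<subseteq> (Inl ` {i \<in> gidx G. norm (gpt G (fst w) i) \<le> r} \<union> Inr ` {i \<in> gidx H. norm (gpt H (snd w) i) \<le> r})"
    by (auto simp: sidx_def spt_def)
  ultimately show "finite {i \<in> sidx G H. norm (spt G H w i) \<le> r}" by (rule rev_finite_subset)
qed

section \<open>Mixtures of randomly shifted, locally perturbed lattices\<close>

lemma measurable_nn_integral_count_space: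
  fixes f :: "'i \<Rightarrow> 'a \<Rightarrow> ennreal"
  assumes "countable I" "\<And>i. i \<in> I \<Longrightarrow> f i \<in> borel_measurable M"
  shows "(\<lambda>x. \<integral>\<^sup>+i. f i x \<partial>count_space I) \<in> borel_measurable M"
proof -
  interpret sigma_finite_measure "count_space I"
    using assms(1) by (rule sigma_finite_measure_count_space_countable)
  have "(\<lambda>p. f (fst p) (snd p)) \<in> borel_measurable (count_space I \<Otimes>\<^sub>M M)"
    by (rule measurable_pair_measure_countable1) (use assms in auto)
  then have "(\<lambda>p. f (snd p) (fst p)) \<in> borel_measurable (M \<Otimes>\<^sub>M count_space I)"
    by (subst measurable_pair_swap_iff) (simp add: case_prod_beta')
  then show ?thesis
    by (intro borel_measurable_nn_integral) (simp add: case_prod_beta')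
qed

text \<open>The translate of site \<open>b\<close> reappears at the index to which the integer part
  was carried, with the same displacement and offset.\<close>

lemma gpt_T:
  assumes "gl G > 0" "b \<in> ZZ"
  shows "gpt G (T (t /\<^sub>R gl G) w) (b + flr (fst w + t /\<^sub>R gl G), i) = gpt G w (b, i) + t"
  using assms by (simp add: gpt_def T_def rot_def shift_def algebra_simps)

text \<open>The two lattices may have different spacings, so one translation of the plane acts on
  the two factors by different amounts.\<close>

definition T2 :: "gspec \<Rightarrow> gspec \<Rightarrow> plane \<Rightarrow> (plane \<times> (plane \<Rightarrow> plane)) \<times> (plane \<times> (plane \<Rightarrow> plane)) \<Rightarrow> (plane \<times> (plane \<Rightarrow> plane)) \<times> (plane \<times> (plane \<Rightarrow> plane))" where
  "T2 G H t = (\<lambda>(x, y). (T (t /\<^sub>R gl G) x, T (t /\<^sub>R gl H) y))"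

abbreviation Om2 where "Om2 \<equiv> Om \<Otimes>\<^sub>M Om"

lemma prob_space_Om2: "prob_space Om2"
  using prob_space_Om prob_space_Om by (rule prob_space_pair)

interpretation Om2: prob_space Om2 by (rule prob_space_Om2)

lemma distr_T2: "distr Om2 Om2 (T2 G H t) = Om2"
proof -
  have "distr Om Om (T (t /\<^sub>R gl G)) \<Otimes>\<^sub>M distr Om Om (T (t /\<^sub>R gl H)) = distr Om2 Om2 (T2 G H t)"
    unfolding T2_def by (rule pair_measure_distr) (simp_all add: distr_T Om.sigma_finite_measure_axioms)
  then show ?thesis by (simp add: distr_T)
qed

lemma T2_measurable: "T2 G H t \<in> measurable Om2 Om2"
  unfolding T2_def by measurable

lemma bij_gidx: "k \<in> ZZ \<Longrightarrow> bij_betw (\<lambda>(b, i). (b + k, i)) (gidx G) (gidx G)"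
  by (rule bij_betw_byWitness[where f'="\<lambda>(b, i). (b - k, i)"]) (auto simp: gidx_def)

lemma bij_map_sum:
  assumes "bij_betw f A A'" "bij_betw g B B'"
  shows "bij_betw (map_sum f g) (A <+> B) (A' <+> B')"
proof (rule bij_betw_imageI)
  have "inj_on f A" "inj_on g B" using assms by (simp_all add: bij_betw_def)
  then show "inj_on (map_sum f g) (A <+> B)"
    by (intro inj_onI) (auto dest: inj_onD)
  have "map_sum f g ` (A <+> B) = f ` A <+> g ` B"
    by (simp add: Plus_def image_Un image_image)
  also have "\<dots> = A' <+> B'" using assms by (simp only: bij_betw_def)
  finally show "map_sum f g ` (A <+> B) = A' <+> B'" .
qed

text \<open>Both sides enumerate the same points, up to the bijection that adds the carried lattice
  vectors to the site indices.\<close>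

lemma translate_sconf:
  assumes "gl G > 0" "gl H > 0"
  shows "translate_config t (sconf G H w) = sconf G H (T2 G H t w)"
proof -
  define k1 k2 where "k1 = flr (fst (fst w) + t /\<^sub>R gl G)" and "k2 = flr (fst (snd w) + t /\<^sub>R gl H)"
  define g where "g = map_sum (\<lambda>(b, i). (b + k1, i :: nat)) (\<lambda>(b, i). (b + k2, i :: nat))"
  have bij: "bij_betw g (sidx G H) (sidx G H)"
    unfolding g_def sidx_def by (intro bij_map_sum bij_gidx) (simp_all add: k1_def k2_def)
  have "sconf G H (T2 G H t w) = conf (sidx G H) (\<lambda>p. spt G H (T2 G H t w) (g p))"
    by (rule conf_reindex[OF bij])
  also have "\<dots> = conf (sidx G H) (\<lambda>p. spt G H w p + t)"
  proof (rule conf_cong)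
    fix p assume "p \<in> sidx G H"
    then show "spt G H (T2 G H t w) (g p) = spt G H w p + t"
      using gpt_T[OF assms(1), of _ t "fst w"] gpt_T[OF assms(2), of _ t "snd w"]
      by (auto simp: sidx_def gidx_def spt_def g_def k1_def k2_def T2_def case_prod_beta')
  qed
  finally show ?thesis by (simp add: translate_conf)
qed

lemma countable_gidx: "countable (gidx G)" by (simp add: gidx_def)
lemma countable_sidx: "countable (sidx G H)" by (simp add: sidx_def countable_gidx Plus_def)

lemma snd_comp_measurable: "b \<in> ZZ \<Longrightarrow> (\<lambda>w. snd w b) \<in> borel_measurable Om"
  using measurable_compose[OF measurable_compose[OF snd_Om comp_measurable] id_U] by simp

lemma gpt_measurable: "p \<in> gidx G \<Longrightarrow> (\<lambda>w. gpt G w p) \<in> borel_measurable Om"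
proof -
  assume "p \<in> gidx G"
  then have [measurable]: "(\<lambda>w. snd w (fst p)) \<in> borel_measurable Om"
    by (intro snd_comp_measurable) (auto simp: gidx_def)
  have [measurable]: "fst \<in> borel_measurable Om"
    using measurable_compose[OF fst_Om id_U] by simp
  show ?thesis unfolding gpt_def case_prod_beta' by measurable
qed

lemma spt_measurable: "p \<in> sidx G H \<Longrightarrow> (\<lambda>w. spt G H w p) \<in> borel_measurable Om2"
  using measurable_compose[OF measurable_fst[of Om Om] gpt_measurable]
    measurable_compose[OF measurable_snd[of Om Om] gpt_measurable]
  by (auto simp: sidx_def spt_def)

lemma emeasure_conf_gpt_measurable:
  assumes A [measurable]: "A \<in> sets borel"
  shows "(\<lambda>w. emeasure (conf (gidx G) (gpt G w)) A) \<in> borel_measurable Om"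
  unfolding emeasure_conf[OF A]
proof (rule measurable_nn_integral_count_space[OF countable_gidx])
  fix p assume p: "p \<in> gidx G"
  note gpt_measurable[OF p, measurable]
  show "(\<lambda>w. indicator A (gpt G w p)) \<in> borel_measurable Om" by measurable
qed

lemma emeasure_sconf_measurable:
  assumes A [measurable]: "A \<in> sets borel"
  shows "(\<lambda>w. emeasure (sconf G H w) A) \<in> borel_measurable Om2"
  unfolding emeasure_conf[OF A]
proof (rule measurable_nn_integral_count_space[OF countable_sidx])
  fix p assume p: "p \<in> sidx G H"
  note spt_measurable[OF p, measurable]
  show "(\<lambda>w. indicator A (spt G H w p)) \<in> borel_measurable Om2" by measurable
qed

lemma sconf_measurable:
  assumes "gl G > 0" "gl H > 0"
  shows "sconf G H \<in> measurable Om2 config_algebra"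
  by (rule measurable_config_algebra) (auto intro!: conf_in_configs loc_fin_spt assms emeasure_sconf_measurable)

text \<open>The space \<open>Om2\<close> is common to all scales, so the mixture lives on a product
  space; only the lattices built from a sample depend on the scale.\<close>

definition mix :: "nat pmf \<Rightarrow> (nat \<Rightarrow> gspec) \<Rightarrow> (nat \<Rightarrow> gspec) \<Rightarrow> plane measure measure" where
  "mix J G H = distr (measure_pmf J \<Otimes>\<^sub>M Om2) config_algebra (\<lambda>p. sconf (G (fst p)) (H (fst p)) (snd p))"

context
  fixes J :: "nat pmf" and G H :: "nat \<Rightarrow> gspec"
  assumes GH: "\<And>j. gl (G j) > 0" "\<And>j. gl (H j) > 0"
begin

lemma mix_measurable: "(\<lambda>p. sconf (G (fst p)) (H (fst p)) (snd p)) \<in> measurable (measure_pmf J \<Otimes>\<^sub>M Om2) config_algebra"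
proof -
  have "(\<lambda>p. sconf (G (fst p)) (H (fst p)) (snd p)) \<in> measurable (count_space UNIV \<Otimes>\<^sub>M Om2) config_algebra"
    by (rule measurable_pair_measure_countable1) (simp_all add: sconf_measurable GH)
  also have "measurable (count_space UNIV \<Otimes>\<^sub>M Om2) config_algebra = measurable (measure_pmf J \<Otimes>\<^sub>M Om2) config_algebra"
    by (intro measurable_cong_sets sets_pair_measure_cong) auto
  finally show ?thesis .
qed

lemma prob_space_mix: "prob_space (mix J G H)"
proof -
  interpret prob_space "measure_pmf J \<Otimes>\<^sub>M Om2"
    using measure_pmf.prob_space_axioms prob_space_Om2 by (rule prob_space_pair)
  show ?thesis unfolding mix_def by (rule prob_space_distr[OF mix_measurable])
qed

lemma sets_mix: "sets (mix J G H) = sets config_algebra"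
  by (simp add: mix_def)

lemma nn_integral_mix:
  assumes F: "F \<in> borel_measurable config_algebra"
  shows "(\<integral>\<^sup>+X. F X \<partial>mix J G H) = (\<integral>\<^sup>+j. (\<integral>\<^sup>+w. F (sconf (G j) (H j) w) \<partial>Om2) \<partial>measure_pmf J)"
proof -
  have m: "(\<lambda>p. F (sconf (G (fst p)) (H (fst p)) (snd p))) \<in> borel_measurable (measure_pmf J \<Otimes>\<^sub>M Om2)"
    using measurable_compose[OF mix_measurable F] .
  show ?thesis
    unfolding mix_def using F m
    by (simp add: nn_integral_distr[OF mix_measurable] Om2.nn_integral_fst[symmetric])
qed

lemma AE_mix:
  assumes "{X\<in>configs. Q X} \<in> sets config_algebra"
    and "\<And>j w. w \<in> space Om2 \<Longrightarrow> Q (sconf (G j) (H j) w)"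
  shows "AE X in mix J G H. Q X"
  unfolding mix_def
  using assms by (subst AE_distr_iff[OF mix_measurable]) (auto simp: space_config_algebra space_pair_measure)

text \<open>Invariance holds at every fixed scale, where translating the configuration amounts to
  applying the measure-preserving map \<open>T2\<close> to the sample.\<close>

lemma stationary_mix: "stationary_process (mix J G H)"
  unfolding stationary_process_def point_process_def
proof (intro conjI allI prob_space_mix sets_mix measure_eqI)
  fix t
  have tm: "translate_config t \<in> measurable (mix J G H) config_algebra"
    using translate_config_measurable measurable_cong_sets[OF sets_mix refl] by blast
  show "sets (distr (mix J G H) config_algebra (translate_config t)) = sets (mix J G H)"
    by (simp add: sets_mix)
  fix A assume "A \<in> sets (distr (mix J G H) config_algebra (translate_config t))"
  then have A: "A \<in> sets config_algebra" by simp
  define F :: "plane measure \<Rightarrow> ennreal" where "F = indicator A"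
  have F: "F \<in> borel_measurable config_algebra" using A by (simp add: F_def)
  have Ft: "(\<lambda>X. F (translate_config t X)) \<in> borel_measurable config_algebra"
    using measurable_compose[OF translate_config_measurable F] .
  have "emeasure (distr (mix J G H) config_algebra (translate_config t)) A = (\<integral>\<^sup>+X. F X \<partial>distr (mix J G H) config_algebra (translate_config t))"
    using A by (simp add: F_def)
  also have "\<dots> = (\<integral>\<^sup>+X. F (translate_config t X) \<partial>mix J G H)"
    by (rule nn_integral_distr[OF tm]) (simp add: F)
  also have "\<dots> = (\<integral>\<^sup>+j. (\<integral>\<^sup>+w. F (sconf (G j) (H j) (T2 (G j) (H j) t w)) \<partial>Om2) \<partial>measure_pmf J)"
    unfolding nn_integral_mix[OF Ft] translate_sconf[OF GH] ..
  also have "\<dots> = (\<integral>\<^sup>+j. (\<integral>\<^sup>+w. F (sconf (G j) (H j) w) \<partial>Om2) \<partial>measure_pmf J)"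
  proof (rule nn_integral_cong)
    fix j
    have "(\<integral>\<^sup>+w. F (sconf (G j) (H j) w) \<partial>distr Om2 Om2 (T2 (G j) (H j) t)) = (\<integral>\<^sup>+w. F (sconf (G j) (H j) (T2 (G j) (H j) t w)) \<partial>Om2)"
      by (rule nn_integral_distr[OF T2_measurable]) (simp add: measurable_compose[OF sconf_measurable[OF GH] F])
    then show "(\<integral>\<^sup>+w. F (sconf (G j) (H j) (T2 (G j) (H j) t w)) \<partial>Om2) = (\<integral>\<^sup>+w. F (sconf (G j) (H j) w) \<partial>Om2)"
      by (simp add: distr_T2)
  qed
  also have "\<dots> = emeasure (mix J G H) A"
    unfolding nn_integral_mix[OF F, symmetric] using A by (simp add: F_def sets_mix)
  finally show "emeasure (distr (mix J G H) config_algebra (translate_config t)) A = emeasure (mix J G H) A" .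
qed

end

section \<open>The intensity of a mixture\<close>

lemma nn_integral_Plus:
  assumes "countable I" "countable J"
  shows "(\<integral>\<^sup>+p. f p \<partial>count_space (I <+> J)) = (\<integral>\<^sup>+i. f (Inl i) \<partial>count_space I) + (\<integral>\<^sup>+j. f (Inr j) \<partial>count_space J)"
proof -
  have 1: "(\<integral>\<^sup>+i. f (Inl i) \<partial>count_space I) = (\<integral>\<^sup>+p. f p * indicator (Inl ` I) p \<partial>count_space (I <+> J))"
  proof -
    have "(\<integral>\<^sup>+i. f (Inl i) \<partial>count_space I) = (\<integral>\<^sup>+p. f p \<partial>count_space (Inl ` I))"
      by (rule nn_integral_bij_count_space) (simp add: bij_betw_def)
    also have "\<dots> = (\<integral>\<^sup>+p. f p * indicator (Inl ` I) p \<partial>count_space (Inl ` I))"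
      by (rule nn_integral_cong) simp
    also have "\<dots> = (\<integral>\<^sup>+p. f p * indicator (Inl ` I) p \<partial>count_space (I <+> J))"
      by (rule nn_integral_count_space_eq) auto
    finally show ?thesis .
  qed
  have 2: "(\<integral>\<^sup>+i. f (Inr i) \<partial>count_space J) = (\<integral>\<^sup>+p. f p * indicator (Inr ` J) p \<partial>count_space (I <+> J))"
  proof -
    have "(\<integral>\<^sup>+i. f (Inr i) \<partial>count_space J) = (\<integral>\<^sup>+p. f p \<partial>count_space (Inr ` J))"
      by (rule nn_integral_bij_count_space) (simp add: bij_betw_def)
    also have "\<dots> = (\<integral>\<^sup>+p. f p * indicator (Inr ` J) p \<partial>count_space (Inr ` J))"
      by (rule nn_integral_cong) simp
    also have "\<dots> = (\<integral>\<^sup>+p. f p * indicator (Inr ` J) p \<partial>count_space (I <+> J))"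
      by (rule nn_integral_count_space_eq) auto
    finally show ?thesis .
  qed
  show ?thesis unfolding 1 2
    by (subst nn_integral_add[symmetric]) (auto intro!: nn_integral_cong simp: indicator_def)
qed

lemma nn_integral_sconf:
  assumes "f \<in> borel_measurable borel"
  shows "(\<integral>\<^sup>+y. f y \<partial>sconf G H w) = (\<integral>\<^sup>+y. f y \<partial>conf (gidx G) (gpt G (fst w))) + (\<integral>\<^sup>+y. f y \<partial>conf (gidx H) (gpt H (snd w)))"
  unfolding nn_integral_conf[OF assms] sidx_def nn_integral_Plus[OF countable_gidx countable_gidx]
  by (simp add: spt_def)

lemma emeasure_sconf:
  assumes "A \<in> sets borel"
  shows "emeasure (sconf G H w) A = emeasure (conf (gidx G) (gpt G (fst w))) A + emeasure (conf (gidx H) (gpt H (snd w))) A"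
  using nn_integral_sconf[of "indicator A" G H w] assms by simp

lemma nn_integral_gidx:
  "(\<integral>\<^sup>+p. f p \<partial>count_space (gidx G)) = (\<integral>\<^sup>+b. (\<Sum>i<gn G. f (b, i)) \<partial>count_space ZZ)"
proof -
  have "(\<integral>\<^sup>+p. f p \<partial>count_space (gidx G)) = (\<integral>\<^sup>+p. f p \<partial>(count_space ZZ \<Otimes>\<^sub>M count_space {..<gn G}))"
    by (simp add: gidx_def pair_measure_countable)
  also have "\<dots> = (\<integral>\<^sup>+b. (\<integral>\<^sup>+i. f (b, i) \<partial>count_space {..<gn G}) \<partial>count_space ZZ)"
  proof -
    interpret sigma_finite_measure "count_space {..<gn G}" by (rule sigma_finite_measure_count_space_finite) simp
    show ?thesis by (rule nn_integral_fst[symmetric]) (simp add: pair_measure_countable)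
  qed
  also have "\<dots> = (\<integral>\<^sup>+b. (\<Sum>i<gn G. f (b, i)) \<partial>count_space ZZ)"
    by (simp add: nn_integral_count_space_finite)
  finally show ?thesis .
qed

lemma nn_integral_lborel_affine:
  fixes f :: "plane \<Rightarrow> ennreal"
  assumes [measurable]: "f \<in> borel_measurable borel" and c: "c \<noteq> 0"
  shows "(\<integral>\<^sup>+x. f (t + c *\<^sub>R x) \<partial>lborel) = ennreal (1 / c\<^sup>2) * (\<integral>\<^sup>+x. f x \<partial>lborel)"
proof -
  have "(\<integral>\<^sup>+x. f x \<partial>lborel) = ennreal (c\<^sup>2) * (\<integral>\<^sup>+x. f (t + c *\<^sub>R x) \<partial>lborel)"
    by (subst lborel_affine[OF c, of t]) (simp add: nn_integral_density nn_integral_distr nn_integral_cmult)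
  then have "ennreal (1 / c\<^sup>2) * (\<integral>\<^sup>+x. f x \<partial>lborel) = (ennreal (1 / c\<^sup>2) * ennreal (c\<^sup>2)) * (\<integral>\<^sup>+x. f (t + c *\<^sub>R x) \<partial>lborel)"
    by (simp add: mult.assoc)
  also have "ennreal (1 / c\<^sup>2) * ennreal (c\<^sup>2) = 1"
    using c by (simp add: ennreal_mult[symmetric] ennreal_1[symmetric] del: ennreal_1)
  finally show ?thesis by simp
qed

lemma nn_integral_comp:
  assumes "b \<in> ZZ" "f \<in> borel_measurable U"
  shows "(\<integral>\<^sup>+v. f (v b) \<partial>PP) = (\<integral>\<^sup>+w. f w \<partial>U)"
proof -
  have "distr PP U (\<lambda>v. v b) = U"
    unfolding PP_def using distr_PiM_component[of ZZ "\<lambda>_. U" b] prob_space_U assms(1) by simp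
  then have "(\<integral>\<^sup>+w. f w \<partial>U) = (\<integral>\<^sup>+w. f w \<partial>distr PP U (\<lambda>v. v b))" by simp
  also have "\<dots> = (\<integral>\<^sup>+v. f (v b) \<partial>PP)"
    by (rule nn_integral_distr) (use assms in simp_all)
  finally show ?thesis by simp
qed

lemma nn_integral_ZZ_U:
  fixes f :: "plane \<Rightarrow> ennreal"
  assumes [measurable]: "f \<in> borel_measurable borel"
  shows "(\<integral>\<^sup>+b. (\<integral>\<^sup>+u. f (u + b) \<partial>U) \<partial>count_space ZZ) = (\<integral>\<^sup>+x. f x \<partial>lborel)"
  by (simp add: nn_integral_U nn_integral_tiling[OF assms])

text \<open>The global shift alone does the averaging: by the tiling, its mean summed over the sites
  is Lebesgue measure in units of the spacing. Displacements and offsets then merely translate, and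
  each of the \<open>gn G\<close> offsets contributes \<open>1 / (gl G)\<^sup>2\<close>.\<close>

lemma mean_conf_gpt:
  assumes A [measurable]: "A \<in> sets borel" and l: "gl G > 0"
  shows "(\<integral>\<^sup>+w. emeasure (conf (gidx G) (gpt G w)) A \<partial>Om) = ennreal (gn G / (gl G)\<^sup>2) * emeasure lborel A"
proof -
  let ?f = "\<lambda>i x. indicator A (gc G i + gl G *\<^sub>R x) :: ennreal"
  have idb [measurable]: "(\<lambda>u. u) \<in> measurable U borel" by (rule id_U)
  have "(\<integral>\<^sup>+w. emeasure (conf (gidx G) (gpt G w)) A \<partial>Om) = (\<integral>\<^sup>+p. (\<integral>\<^sup>+w. indicator A (gpt G w p) \<partial>Om) \<partial>count_space (gidx G))"
    unfolding emeasure_conf[OF A]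
  proof (rule nn_integral_count_space_nn_integral[OF countable_gidx])
    fix p assume p: "p \<in> gidx G"
    note gpt_measurable[OF p, measurable]
    show "(\<lambda>w. indicator A (gpt G w p)) \<in> borel_measurable Om" by measurable
  qed
  also have "\<dots> = (\<integral>\<^sup>+p. (\<integral>\<^sup>+w. (\<integral>\<^sup>+u. ?f (snd p) (u + fst p + gs G *\<^sub>R w) \<partial>U) \<partial>U) \<partial>count_space (gidx G))"
  proof (rule nn_integral_cong)
    fix p assume p: "p \<in> space (count_space (gidx G))"
    then have b: "fst p \<in> ZZ" by (auto simp: gidx_def)
    note gpt_measurable[of p G, measurable]
    have m: "(\<lambda>w. indicator A (gpt G w p) :: ennreal) \<in> borel_measurable (U \<Otimes>\<^sub>M PP)"
      using p unfolding Om_def[symmetric] by simp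
    have "(\<integral>\<^sup>+w. indicator A (gpt G w p) \<partial>Om) = (\<integral>\<^sup>+u. (\<integral>\<^sup>+v. indicator A (gpt G (u, v) p) \<partial>PP) \<partial>U)"
      unfolding Om_def by (rule PP.nn_integral_fst[OF m, symmetric])
    also have "\<dots> = (\<integral>\<^sup>+u. (\<integral>\<^sup>+v. ?f (snd p) (u + fst p + gs G *\<^sub>R v (fst p)) \<partial>PP) \<partial>U)"
      by (simp add: gpt_def case_prod_beta' add.commute)
    also have "\<dots> = (\<integral>\<^sup>+u. (\<integral>\<^sup>+w. ?f (snd p) (u + fst p + gs G *\<^sub>R w) \<partial>U) \<partial>U)"
      by (intro nn_integral_cong nn_integral_comp[OF b, where f="\<lambda>w. ?f (snd p) (_ + fst p + gs G *\<^sub>R w)"]) measurable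
    also have "\<dots> = (\<integral>\<^sup>+w. (\<integral>\<^sup>+u. ?f (snd p) (u + fst p + gs G *\<^sub>R w) \<partial>U) \<partial>U)"
    proof -
      interpret UU: pair_sigma_finite U U ..
      show ?thesis by (rule UU.Fubini'[symmetric]) measurable
    qed
    finally show "(\<integral>\<^sup>+w. indicator A (gpt G w p) \<partial>Om) = (\<integral>\<^sup>+w. (\<integral>\<^sup>+u. ?f (snd p) (u + fst p + gs G *\<^sub>R w) \<partial>U) \<partial>U)" .
  qed
  also have "\<dots> = (\<integral>\<^sup>+b. (\<Sum>i<gn G. (\<integral>\<^sup>+w. (\<integral>\<^sup>+u. ?f i (u + b + gs G *\<^sub>R w) \<partial>U) \<partial>U)) \<partial>count_space ZZ)"
    by (simp add: nn_integral_gidx)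
  also have "\<dots> = (\<Sum>i<gn G. (\<integral>\<^sup>+b. (\<integral>\<^sup>+w. (\<integral>\<^sup>+u. ?f i (u + b + gs G *\<^sub>R w) \<partial>U) \<partial>U) \<partial>count_space ZZ))"
    by (rule nn_integral_sum) simp
  also have "\<dots> = (\<Sum>i<gn G. ennreal (1 / (gl G)\<^sup>2) * emeasure lborel A)"
  proof (rule sum.cong[OF refl])
    fix i
    have "(\<integral>\<^sup>+b. (\<integral>\<^sup>+w. (\<integral>\<^sup>+u. ?f i (u + b + gs G *\<^sub>R w) \<partial>U) \<partial>U) \<partial>count_space ZZ)
        = (\<integral>\<^sup>+w. (\<integral>\<^sup>+b. (\<integral>\<^sup>+u. ?f i (u + b + gs G *\<^sub>R w) \<partial>U) \<partial>count_space ZZ) \<partial>U)"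
      by (rule nn_integral_count_space_nn_integral[symmetric]) (simp, measurable)
    also have "\<dots> = (\<integral>\<^sup>+w. ennreal (1 / (gl G)\<^sup>2) * emeasure lborel A \<partial>U)"
    proof (rule nn_integral_cong)
      fix w
      have "(\<integral>\<^sup>+b. (\<integral>\<^sup>+u. ?f i (u + b + gs G *\<^sub>R w) \<partial>U) \<partial>count_space ZZ) = (\<integral>\<^sup>+x. ?f i (x + gs G *\<^sub>R w) \<partial>lborel)"
        by (rule nn_integral_ZZ_U) measurable
      also have "\<dots> = (\<integral>\<^sup>+x. ?f i x \<partial>lborel)"
        by (rule nn_integral_lborel_translate) measurable
      also have "\<dots> = ennreal (1 / (gl G)\<^sup>2) * emeasure lborel A"
        using nn_integral_lborel_affine[of "indicator A" "gl G" "gc G i"] l by simp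
      finally show "(\<integral>\<^sup>+b. (\<integral>\<^sup>+u. ?f i (u + b + gs G *\<^sub>R w) \<partial>U) \<partial>count_space ZZ) = ennreal (1 / (gl G)\<^sup>2) * emeasure lborel A" .
    qed
    also have "\<dots> = ennreal (1 / (gl G)\<^sup>2) * emeasure lborel A"
      using U.emeasure_space_1 by simp
    finally show "(\<integral>\<^sup>+b. (\<integral>\<^sup>+w. (\<integral>\<^sup>+u. ?f i (u + b + gs G *\<^sub>R w) \<partial>U) \<partial>U) \<partial>count_space ZZ) = ennreal (1 / (gl G)\<^sup>2) * emeasure lborel A" .
  qed
  also have "\<dots> = ennreal (gn G / (gl G)\<^sup>2) * emeasure lborel A"
    by (simp add: ennreal_of_nat_eq_real_of_nat ennreal_mult[symmetric] mult.assoc[symmetric])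
  finally show ?thesis .
qed

lemma mean_sconf:
  assumes A: "A \<in> sets borel" and "gl G > 0" "gl H > 0"
  shows "(\<integral>\<^sup>+w. emeasure (sconf G H w) A \<partial>Om2) = ennreal (gn G / (gl G)\<^sup>2 + gn H / (gl H)\<^sup>2) * emeasure lborel A"
proof -
  have m1: "(\<lambda>w. emeasure (conf (gidx G) (gpt G (fst w))) A) \<in> borel_measurable Om2"
    by (rule measurable_compose[OF measurable_fst emeasure_conf_gpt_measurable[OF A]])
  have m2: "(\<lambda>w. emeasure (conf (gidx H) (gpt H (snd w))) A) \<in> borel_measurable Om2"
    by (rule measurable_compose[OF measurable_snd emeasure_conf_gpt_measurable[OF A]])
  have "(\<integral>\<^sup>+w. emeasure (sconf G H w) A \<partial>Om2) = (\<integral>\<^sup>+w. emeasure (conf (gidx G) (gpt G (fst w))) A \<partial>Om2) + (\<integral>\<^sup>+w. emeasure (conf (gidx H) (gpt H (snd w))) A \<partial>Om2)"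
    unfolding emeasure_sconf[OF A] by (rule nn_integral_add[OF m1 m2])
  also have "\<dots> = ennreal (gn G / (gl G)\<^sup>2) * emeasure lborel A + ennreal (gn H / (gl H)\<^sup>2) * emeasure lborel A"
    using Om.nn_integral_fst[OF m1] Om.nn_integral_fst[OF m2] mean_conf_gpt[OF A] assms(2,3) Om.emeasure_space_1
    by simp
  finally show ?thesis
    by (simp add: distrib_right[symmetric] ennreal_plus[symmetric] del: ennreal_plus)
qed

lemma intensity_mix:
  assumes "\<And>j. gl (G j) > 0" "\<And>j. gl (H j) > 0"
    and "\<And>j. gn (G j) / (gl (G j))\<^sup>2 + gn (H j) / (gl (H j))\<^sup>2 = 1"
  shows "has_intensity (mix J G H) 1"
  unfolding has_intensity_def
proof
  fix A :: "plane set" assume A: "A \<in> sets borel"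
  have "(\<integral>\<^sup>+X. emeasure X A \<partial>mix J G H) = (\<integral>\<^sup>+j. emeasure lborel A \<partial>measure_pmf J)"
    by (subst nn_integral_mix) (simp_all add: assms emeasure_config_measurable A mean_sconf)
  then show "(\<integral>\<^sup>+X. emeasure X A \<partial>mix J G H) = ennreal 1 * emeasure lborel A"
    by (simp add: measure_pmf.emeasure_space_1)
qed

section \<open>Number variance\<close>

lemma (in prob_space) variance_sum_orthogonal:
  fixes Z :: "'b \<Rightarrow> 'a \<Rightarrow> real"
  assumes "finite S" and Z [measurable]: "\<And>b. b \<in> S \<Longrightarrow> random_variable borel (Z b)"
    and bd: "\<And>b w. b \<in> S \<Longrightarrow> w \<in> space M \<Longrightarrow> \<bar>Z b w\<bar> \<le> C"
    and orth: "\<And>b b'. b \<in> S \<Longrightarrow> b' \<in> S \<Longrightarrow> b \<noteq> b' \<Longrightarrow> expectation (\<lambda>w. Z b w * Z b' w) = 0"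
  shows "expectation (\<lambda>w. (\<Sum>b\<in>S. Z b w)\<^sup>2) = (\<Sum>b\<in>S. expectation (\<lambda>w. (Z b w)\<^sup>2))"
proof -
  have int: "integrable M (\<lambda>w. Z b w * Z b' w)" if "b \<in> S" "b' \<in> S" for b b'
  proof (rule integrable_const_bound[where B="C * C"])
    show "AE x in M. norm (Z b x * Z b' x) \<le> C * C"
      using bd[OF that(1)] bd[OF that(2)] by (intro AE_I2) (simp add: abs_mult mult_mono')
  qed (use Z that in simp)
  have "expectation (\<lambda>w. (\<Sum>b\<in>S. Z b w)\<^sup>2) = expectation (\<lambda>w. \<Sum>b\<in>S. \<Sum>b'\<in>S. Z b w * Z b' w)"
    by (simp add: power2_eq_square sum_product)
  also have "\<dots> = (\<Sum>b\<in>S. \<Sum>b'\<in>S. expectation (\<lambda>w. Z b w * Z b' w))"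
    using int by (simp add: Bochner_Integration.integral_sum)
  also have "\<dots> = (\<Sum>b\<in>S. \<Sum>b'\<in>S. if b = b' then expectation (\<lambda>w. (Z b w)\<^sup>2) else 0)"
    by (intro sum.cong refl) (auto simp: orth power2_eq_square)
  also have "\<dots> = (\<Sum>b\<in>S. expectation (\<lambda>w. (Z b w)\<^sup>2))"
    using assms(1) by simp
  finally show ?thesis .
qed

lemma integral_comp:
  fixes f :: "plane \<Rightarrow> real"
  assumes "b \<in> ZZ" "f \<in> borel_measurable U"
  shows "(\<integral>v. f (v b) \<partial>PP) = (\<integral>w. f w \<partial>U)"
proof -
  have "distr PP U (\<lambda>v. v b) = U"
    unfolding PP_def using distr_PiM_component[of ZZ "\<lambda>_. U" b] prob_space_U assms(1) by simp
  then have "(\<integral>w. f w \<partial>U) = (\<integral>w. f w \<partial>distr PP U (\<lambda>v. v b))" by simp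
  also have "\<dots> = (\<integral>v. f (v b) \<partial>PP)"
    by (rule integral_distr) (use assms in simp_all)
  finally show ?thesis by simp
qed

text \<open>Independence of the displacements, in the form that makes mixed moments of centred
  variables vanish.\<close>

lemma integral_comp_mult:
  fixes f g :: "plane \<Rightarrow> real"
  assumes b: "b \<in> ZZ" "b' \<in> ZZ" "b \<noteq> b'" and fg: "f \<in> borel_measurable U" "g \<in> borel_measurable U"
    and "integrable U f" "integrable U g"
  shows "(\<integral>v. f (v b) * g (v b') \<partial>PP) = (\<integral>w. f w \<partial>U) * (\<integral>w. g w \<partial>U)"
proof -
  have dist: "distr PP U (\<lambda>v. v a) = U" if "a \<in> ZZ" for a
    unfolding PP_def using distr_PiM_component[of ZZ "\<lambda>_. U" a] prob_space_U that by simp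
  have "PP.indep_vars (\<lambda>_. U) (\<lambda>i v. v i) ZZ"
  proof (subst PP.indep_vars_iff_distr_eq_PiM')
    show "ZZ \<noteq> {}" using ZZ_0 by blast
    show "\<And>i. i \<in> ZZ \<Longrightarrow> (\<lambda>v. v i) \<in> measurable PP U" by (rule comp_measurable)
    have "distr PP (Pi\<^sub>M ZZ (\<lambda>i. U)) (\<lambda>x. \<lambda>i\<in>ZZ. x i) = distr PP PP (\<lambda>x. x)"
      by (rule distr_cong) (auto simp: PP_def space_PiM PiE_def extensional_restrict)
    also have "\<dots> = (Pi\<^sub>M ZZ (\<lambda>i. U))" by (simp add: PP_def)
    also have "\<dots> = (Pi\<^sub>M ZZ (\<lambda>i. distr PP U (\<lambda>v. v i)))"
      by (rule PiM_cong) (simp_all add: dist)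
    finally show "distr PP (Pi\<^sub>M ZZ (\<lambda>i. U)) (\<lambda>x. \<lambda>i\<in>ZZ. x i) = (Pi\<^sub>M ZZ (\<lambda>i. distr PP U (\<lambda>v. v i)))" .
  qed
  then have "PP.indep_vars (\<lambda>_. U) (\<lambda>i v. v i) {b, b'}"
    by (rule PP.indep_vars_subset) (use b in auto)
  then have ind: "PP.indep_vars (\<lambda>_. borel) (\<lambda>i v. (if i = b then f else g) (v i)) {b, b'}"
    by (rule PP.indep_vars_compose2[where Y="\<lambda>i. if i = b then f else g"]) (use fg in auto)
  have int: "integrable PP (\<lambda>v. h (v a))" if "a \<in> ZZ" "integrable U h" for h :: "plane \<Rightarrow> real" and a
    using that dist integrable_distr[OF comp_measurable[of a], of h] by simp
  have "(\<integral>v. (\<Prod>i\<in>{b, b'}. (if i = b then f else g) (v i)) \<partial>PP) = (\<Prod>i\<in>{b, b'}. \<integral>v. (if i = b then f else g) (v i) \<partial>PP)"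
    by (rule PP.indep_vars_lebesgue_integral[OF _ ind]) (use int assms in auto)
  then show ?thesis using b fg by (simp add: integral_comp)
qed

lemma emeasure_cball_plane: "r \<ge> 0 \<Longrightarrow> emeasure lborel (cball (x::plane) r) = ennreal (pi * r\<^sup>2)"
  by (simp add: emeasure_cball unit_ball_vol_2)

lemma emeasure_ball_plane: "r \<ge> 0 \<Longrightarrow> emeasure lborel (ball (x::plane) r) = ennreal (pi * r\<^sup>2)"
  by (simp add: emeasure_ball unit_ball_vol_2)

text \<open>For \<open>R \<ge> 3\<close> the difference of the two areas is
  \<open>12 * pi * R\<close>; the additional 36 covers small \<open>R\<close>, where the inner disk
  is empty and the outer one is bounded directly.\<close>

lemma annulus_area:
  assumes "R \<ge> 0"
  shows "emeasure lborel (cball (0::plane) (R + 3) - ball 0 (R - 3)) \<le> ennreal (pi * (12 * R + 36))"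
proof (cases "R \<ge> 3")
  case True
  have "emeasure lborel (cball (0::plane) (R + 3) - ball 0 (R - 3)) = ennreal (pi * (R + 3)\<^sup>2) - ennreal (pi * (R - 3)\<^sup>2)"
    using True by (subst emeasure_Diff) (auto simp: emeasure_cball_plane emeasure_ball_plane)
  also have "\<dots> = ennreal (pi * (R + 3)\<^sup>2 - pi * (R - 3)\<^sup>2)"
    by (rule ennreal_minus) simp
  also have "\<dots> \<le> ennreal (pi * (12 * R + 36))"
    by (intro ennreal_leI) (simp add: power2_eq_square algebra_simps)
  finally show ?thesis .
next
  case False
  have "emeasure lborel (cball (0::plane) (R + 3) - ball 0 (R - 3)) \<le> emeasure lborel (cball (0::plane) (R + 3))"
    by (intro emeasure_mono) auto
  also have "\<dots> = ennreal (pi * (R + 3)\<^sup>2)" using assms by (simp add: emeasure_cball_plane)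
  also have "\<dots> \<le> ennreal (pi * (12 * R + 36))"
  proof (intro ennreal_leI mult_left_mono)
    have "R * R \<le> 3 * R" using False assms by (intro mult_right_mono) auto
    then show "(R + 3)\<^sup>2 \<le> 12 * R + 36" using assms by (simp add: power2_eq_square algebra_simps)
  qed simp
  finally show ?thesis .
qed

text \<open>The unit cells with corners \<open>u + b\<close> are disjoint, have area 1 and lie in
  \<open>A\<close>.\<close>

lemma card_cells_le:
  assumes S: "finite S" "S \<subseteq> ZZ" and A [measurable]: "A \<in> sets borel"
    and sub: "\<And>b x. b \<in> S \<Longrightarrow> x - (u + b) \<in> Cell \<Longrightarrow> x \<in> A"
  shows "of_nat (card S) \<le> emeasure lborel A"
proof -
  have "of_nat (card S) = (\<Sum>b\<in>S. \<integral>\<^sup>+x. indicator Cell (x - (u + b)) \<partial>lborel)"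
  proof -
    have "(\<integral>\<^sup>+x. indicator Cell (x - (u + b)) \<partial>lborel) = (1::ennreal)" for b
    proof -
      have "(\<integral>\<^sup>+x. indicator Cell (x - (u + b)) \<partial>lborel) = (\<integral>\<^sup>+x. indicator Cell (x + - (u + b)) \<partial>lborel :: ennreal)"
        by (simp only: diff_conv_add_uminus)
      also have "\<dots> = 1" by (subst nn_integral_lborel_translate) simp_all
      finally show ?thesis .
    qed
    then show ?thesis by simp
  qed
  also have "\<dots> = (\<integral>\<^sup>+x. (\<Sum>b\<in>S. indicator Cell (x - (u + b))) \<partial>lborel)"
    by (rule nn_integral_sum[symmetric]) measurable
  also have "\<dots> \<le> (\<integral>\<^sup>+x. indicator A x \<partial>lborel)"
  proof (rule nn_integral_mono)
    fix x
    show "(\<Sum>b\<in>S. indicator Cell (x - (u + b))) \<le> (indicator A x :: ennreal)"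
    proof (cases "flr (x - u) \<in> S \<and> x \<in> A")
      case True
      have "(\<Sum>b\<in>S. indicator Cell (x - (u + b))) = (\<Sum>b\<in>S. if b = flr (x - u) then 1 else 0 :: ennreal)"
        using S(2) by (intro sum.cong refl) (auto simp: indicator_def Cell_iff_flr diff_diff_eq[symmetric])
      also have "\<dots> = 1" using True S(1) by simp
      finally show ?thesis using True by simp
    next
      case False
      have "x - (u + b) \<notin> Cell" if "b \<in> S" for b
        using sub[OF that, of x] that False S(2) Cell_iff_flr[of b "x - u"] by (auto simp: diff_diff_eq)
      then have "(\<Sum>b\<in>S. indicator Cell (x - (u + b))) = (0::ennreal)" by (intro sum.neutral) simp
      then show ?thesis by simp
    qed
  qed
  finally show ?thesis by simp
qed

text \<open>The contribution to the disk of a single site placed at \<open>x\<close>, in units of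
  the spacing.\<close>

definition cnt :: "gspec \<Rightarrow> real \<Rightarrow> plane \<Rightarrow> real" where
  "cnt G r x = (\<Sum>i<gn G. indicator (cball 0 r) (gl G *\<^sub>R x + gc G i))"

lemma cnt_nonneg: "0 \<le> cnt G r x" and cnt_le: "cnt G r x \<le> gn G"
proof -
  show "0 \<le> cnt G r x" unfolding cnt_def by (intro sum_nonneg) simp
  have "cnt G r x \<le> (\<Sum>i<gn G. 1)" unfolding cnt_def by (intro sum_mono) (simp add: indicator_def)
  then show "cnt G r x \<le> gn G" by simp
qed

lemma cball_borel [measurable]: "cball (x::plane) r \<in> sets borel" by simp

lemma cnt_borel [measurable]: "cnt G r \<in> borel_measurable borel"
  unfolding cnt_def by measurable

lemma nn_integral_cnt:
  assumes "gl G > 0" "r \<ge> 0"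
  shows "(\<integral>\<^sup>+x. ennreal (cnt G r x) \<partial>lborel) = ennreal (gn G * (pi * r\<^sup>2) / (gl G)\<^sup>2)"
proof -
  have "(\<integral>\<^sup>+x. ennreal (cnt G r x) \<partial>lborel) = (\<integral>\<^sup>+x. (\<Sum>i<gn G. indicator (cball 0 r) (gc G i + gl G *\<^sub>R x)) \<partial>lborel)"
    unfolding cnt_def by (intro nn_integral_cong) (simp add: sum_ennreal[symmetric] ennreal_indicator add.commute)
  also have "\<dots> = (\<Sum>i<gn G. \<integral>\<^sup>+x. indicator (cball 0 r) (gc G i + gl G *\<^sub>R x) \<partial>lborel)"
    by (rule nn_integral_sum) measurable
  also have "\<dots> = (\<Sum>i<gn G. ennreal (1 / (gl G)\<^sup>2) * ennreal (pi * r\<^sup>2))"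
    using assms by (intro sum.cong refl) (subst nn_integral_lborel_affine, simp_all add: emeasure_cball_plane)
  also have "\<dots> = ennreal (gn G * (pi * r\<^sup>2) / (gl G)\<^sup>2)"
    by (simp add: ennreal_of_nat_eq_real_of_nat ennreal_mult[symmetric])
  finally show ?thesis .
qed

lemma measure_U_Cell [simp]: "measure U Cell = 1"
  using U.prob_space by simp

lemma integrable_U_bounded:
  fixes f :: "plane \<Rightarrow> real"
  assumes "f \<in> borel_measurable U" "\<And>w. \<bar>f w\<bar> \<le> C"
  shows "integrable U f"
  by (rule U.integrable_const_bound[where B=C]) (use assms in auto)

context
  fixes G :: gspec and r :: real and u :: plane
  assumes l: "gl G > 0" and s: "gs G = 1" and r: "r \<ge> 0" and u: "u \<in> Cell"
    and c: "\<And>i. i < gn G \<Longrightarrow> norm (gc G i) \<le> gl G"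
begin

text \<open>Contains all sites that can contribute, given the global shift \<open>u\<close>. The
  offsets are at most one spacing long, and 4 bounds the shift plus the displacement.\<close>

definition "near = {b\<in>ZZ. norm b \<le> (r + gl G) / gl G + 4}"
definition "mean b = (\<integral>w. cnt G r (u + b + w) \<partial>U)"

lemma finite_near: "finite near" unfolding near_def by (rule finite_ZZ_bounded)
lemma near_ZZ: "b \<in> near \<Longrightarrow> b \<in> ZZ" by (simp add: near_def)

lemma cnt_shift_borel [measurable]: "(\<lambda>w. cnt G r (u + b + w)) \<in> borel_measurable U"
  by (rule measurable_U) measurable

lemma cnt_pos_bound:
  assumes "cnt G r x \<noteq> 0" shows "norm x \<le> (r + gl G) / gl G"
proof -
  obtain i where i: "i < gn G" "gl G *\<^sub>R x + gc G i \<in> cball 0 r"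
    using assms unfolding cnt_def by (auto simp: indicator_def split: if_splits dest!: sum.not_neutral_contains_not_neutral)
  have "norm (gl G *\<^sub>R x) \<le> norm (gl G *\<^sub>R x + gc G i) + norm (gc G i)"
    using norm_triangle_ineq4[of "gl G *\<^sub>R x + gc G i" "gc G i"] by simp
  also have "\<dots> \<le> r + gl G" using i c by (intro add_mono) auto
  finally show ?thesis using l by (simp add: field_simps)
qed

lemma cnt_far:
  assumes "b \<in> ZZ" "b \<notin> near" "w \<in> Cell"
  shows "cnt G r (u + b + w) = 0"
proof (rule ccontr)
  assume "cnt G r (u + b + w) \<noteq> 0"
  then have "norm (u + b + w) \<le> (r + gl G) / gl G" by (rule cnt_pos_bound)
  moreover have "norm b \<le> norm (u + b + w) + norm u + norm w"
    using norm_triangle_ineq4[of "u + b + w" "u + w"] norm_triangle_ineq[of u w] by (simp add: algebra_simps)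
  ultimately have "norm b \<le> (r + gl G) / gl G + 4"
    using norm_Cell[OF u] norm_Cell[OF assms(3)] by linarith
  then show False using assms by (simp add: near_def)
qed

lemma num_eq:
  assumes v: "v \<in> space PP"
  shows "measure (conf (gidx G) (gpt G (u, v))) (cball 0 r) = (\<Sum>b\<in>near. cnt G r (u + b + v b))"
proof -
  have "emeasure (conf (gidx G) (gpt G (u, v))) (cball 0 r) = (\<integral>\<^sup>+b. ennreal (cnt G r (u + b + v b)) \<partial>count_space ZZ)"
    unfolding emeasure_conf[OF cball_borel] nn_integral_gidx
    by (intro nn_integral_cong) (simp add: cnt_def gpt_def s sum_ennreal[symmetric] ennreal_indicator)
  also have "\<dots> = (\<Sum>b\<in>near. ennreal (cnt G r (u + b + v b)))"
    by (rule nn_integral_count_space') (auto simp: finite_near near_ZZ cnt_far comp_Cell[OF v])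
  also have "\<dots> = ennreal (\<Sum>b\<in>near. cnt G r (u + b + v b))"
    by (rule sum_ennreal) (rule cnt_nonneg)
  finally show ?thesis
    by (simp add: measure_def sum_nonneg cnt_nonneg)
qed

lemma mean_nonneg: "0 \<le> mean b" unfolding mean_def by (rule Bochner_Integration.integral_nonneg) (rule cnt_nonneg)

lemma mean_ennreal: "ennreal (mean b) = (\<integral>\<^sup>+w. ennreal (cnt G r (u + b + w)) \<partial>U)"
  unfolding mean_def
  by (rule nn_integral_eq_integral[symmetric])
     (auto intro!: integrable_U_bounded[where C="gn G"] simp: cnt_nonneg abs_of_nonneg cnt_le)

text \<open>A displacement uniform over the whole cell turns the sum over the sites into a Lebesgue
  integral. The mean given the shift is therefore independent of the shift, which thus contributes
  no variance.\<close>

lemma sum_mean: "(\<Sum>b\<in>near. mean b) = gn G * (pi * r\<^sup>2) / (gl G)\<^sup>2"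
proof -
  have "ennreal (\<Sum>b\<in>near. mean b) = (\<Sum>b\<in>near. ennreal (mean b))"
    by (rule sum_ennreal[symmetric]) (rule mean_nonneg)
  also have "\<dots> = (\<integral>\<^sup>+b. ennreal (mean b) \<partial>count_space ZZ)"
  proof (rule nn_integral_count_space'[symmetric])
    fix b assume "b \<in> ZZ" "b \<notin> near"
    then show "ennreal (mean b) = 0"
      unfolding mean_ennreal by (subst nn_integral_0_iff_AE) (auto simp: cnt_far)
  qed (auto simp: finite_near near_ZZ)
  also have "\<dots> = (\<integral>\<^sup>+b. (\<integral>\<^sup>+w. ennreal (cnt G r (w + b + u)) \<partial>U) \<partial>count_space ZZ)"
    unfolding mean_ennreal by (simp add: ac_simps)
  also have "\<dots> = (\<integral>\<^sup>+x. ennreal (cnt G r (x + u)) \<partial>lborel)"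
    by (rule nn_integral_ZZ_U) measurable
  also have "\<dots> = (\<integral>\<^sup>+x. ennreal (cnt G r x) \<partial>lborel)"
    by (rule nn_integral_lborel_translate) measurable
  also have "\<dots> = ennreal (gn G * (pi * r\<^sup>2) / (gl G)\<^sup>2)" using l r by (rule nn_integral_cnt)
  finally show ?thesis
    by (subst (asm) ennreal_inj) (auto intro!: sum_nonneg mean_nonneg)
qed

text \<open>Given the shift, the sites are independent, and by \<open>sum_mean\<close> the deviation
  from the area term is the sum of their centred contributions.\<close>

lemma variance_num:
  "(\<integral>\<^sup>+v. ennreal ((measure (conf (gidx G) (gpt G (u, v))) (cball 0 r) - gn G * (pi * r\<^sup>2) / (gl G)\<^sup>2)\<^sup>2) \<partial>PP)
     = ennreal (\<Sum>b\<in>near. (\<integral>w. (cnt G r (u + b + w) - mean b)\<^sup>2 \<partial>U))"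
proof -
  define Z where "Z b v = cnt G r (u + b + v b) - mean b" for b and v :: "plane \<Rightarrow> plane"
  have mle: "mean b \<le> gn G" for b
  proof -
    have "mean b \<le> (\<integral>w. real (gn G) \<partial>U)"
      unfolding mean_def by (rule Bochner_Integration.integral_mono) (auto intro!: integrable_U_bounded[where C="gn G"] simp: cnt_nonneg abs_of_nonneg cnt_le)
    then show ?thesis using U.prob_space by simp
  qed
  have bd: "\<bar>cnt G r x - mean b\<bar> \<le> gn G" for x b
    using mle[of b] mean_nonneg[of b] cnt_nonneg[of G r x] cnt_le[of G r x] by linarith
  have Zm: "Z b \<in> borel_measurable PP" if "b \<in> near" for b
    unfolding Z_def using measurable_compose[OF comp_measurable[OF near_ZZ[OF that]] cnt_shift_borel] by simp
  have orth: "(\<integral>v. Z b v * Z b' v \<partial>PP) = 0" if "b \<in> near" "b' \<in> near" "b \<noteq> b'" for b b'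
  proof -
    have i: "integrable U (\<lambda>w. cnt G r (u + a + w) - mean a)" for a
      by (rule integrable_U_bounded[OF _ bd]) simp
    have "(\<integral>v. Z b v * Z b' v \<partial>PP) = (\<integral>w. cnt G r (u + b + w) - mean b \<partial>U) * (\<integral>w. cnt G r (u + b' + w) - mean b' \<partial>U)"
      unfolding Z_def
      by (rule integral_comp_mult[where f="\<lambda>w. cnt G r (u + b + w) - mean b" and g="\<lambda>w. cnt G r (u + b' + w) - mean b'"])
         (use that near_ZZ i in auto)
    also have "(\<integral>w. cnt G r (u + b + w) - mean b \<partial>U) = 0"
      by (subst Bochner_Integration.integral_diff)
         (auto intro!: integrable_U_bounded[where C="gn G"] simp: cnt_nonneg abs_of_nonneg cnt_le mean_def U.prob_space)
    finally show ?thesis by simp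
  qed
  have "(\<integral>v. (\<Sum>b\<in>near. Z b v)\<^sup>2 \<partial>PP) = (\<Sum>b\<in>near. (\<integral>v. (Z b v)\<^sup>2 \<partial>PP))"
    by (rule PP.variance_sum_orthogonal[OF finite_near Zm _ orth, where C="gn G"]) (auto simp: Z_def bd)
  also have "\<dots> = (\<Sum>b\<in>near. (\<integral>w. (cnt G r (u + b + w) - mean b)\<^sup>2 \<partial>U))"
    unfolding Z_def
    by (intro sum.cong refl integral_comp[where f="\<lambda>w. (cnt G r (u + _ + w) - mean _)\<^sup>2"]) (auto simp: near_ZZ)
  finally have E: "(\<integral>v. (\<Sum>b\<in>near. Z b v)\<^sup>2 \<partial>PP) = (\<Sum>b\<in>near. (\<integral>w. (cnt G r (u + b + w) - mean b)\<^sup>2 \<partial>U))" .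
  have "(\<integral>\<^sup>+v. ennreal ((measure (conf (gidx G) (gpt G (u, v))) (cball 0 r) - gn G * (pi * r\<^sup>2) / (gl G)\<^sup>2)\<^sup>2) \<partial>PP)
      = (\<integral>\<^sup>+v. ennreal ((\<Sum>b\<in>near. Z b v)\<^sup>2) \<partial>PP)"
    by (intro nn_integral_cong) (simp add: num_eq sum_mean[symmetric] Z_def sum_subtractf)
  also have "\<dots> = ennreal (\<integral>v. (\<Sum>b\<in>near. Z b v)\<^sup>2 \<partial>PP)"
  proof (rule nn_integral_eq_integral)
    show "integrable PP (\<lambda>v. (\<Sum>b\<in>near. Z b v)\<^sup>2)"
    proof (rule PP.integrable_const_bound[where B="(\<Sum>b\<in>near. real (gn G))\<^sup>2"])
      show "AE v in PP. norm ((\<Sum>b\<in>near. Z b v)\<^sup>2) \<le> (\<Sum>b\<in>near. real (gn G))\<^sup>2"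
      proof (rule AE_I2)
        fix v
        have "\<bar>\<Sum>b\<in>near. Z b v\<bar> \<le> (\<Sum>b\<in>near. real (gn G))"
          by (rule order_trans[OF sum_abs]) (intro sum_mono, simp add: Z_def bd)
        then show "norm ((\<Sum>b\<in>near. Z b v)\<^sup>2) \<le> (\<Sum>b\<in>near. real (gn G))\<^sup>2"
          using abs_le_square_iff[of "\<Sum>b\<in>near. Z b v" "\<Sum>b\<in>near. real (gn G)"] by simp
      qed
    qed (use Zm in \<open>auto intro!: borel_measurable_power borel_measurable_sum\<close>)
  qed simp
  finally show ?thesis unfolding E .
qed

lemma variance_cell_le:
  "(\<integral>w. (cnt G r (u + b + w) - mean b)\<^sup>2 \<partial>U) \<le> (\<integral>w. (cnt G r (u + b + w))\<^sup>2 \<partial>U)"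
proof -
  have i1: "integrable U (\<lambda>w. cnt G r (u + b + w))"
    by (rule integrable_U_bounded[where C="gn G"]) (auto simp: cnt_nonneg abs_of_nonneg cnt_le)
  have i2: "integrable U (\<lambda>w. (cnt G r (u + b + w))\<^sup>2)"
    by (rule integrable_U_bounded[where C="(gn G)\<^sup>2"]) (auto simp: cnt_nonneg abs_of_nonneg cnt_le power_mono)
  have "(\<integral>w. (cnt G r (u + b + w) - mean b)\<^sup>2 \<partial>U) = (\<integral>w. (cnt G r (u + b + w))\<^sup>2 \<partial>U) - (mean b)\<^sup>2"
    unfolding mean_def by (rule U.variance_eq[OF i1 i2])
  then show ?thesis by simp
qed

text \<open>At each site the variance is at most the second moment, hence at most \<open>K\<close>
  times the mean. This bound is the efficient one for disks smaller than the clusters.\<close>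

lemma variance_num_le1:
  assumes K: "\<And>x. cnt G r x \<le> K"
  shows "(\<integral>\<^sup>+v. ennreal ((measure (conf (gidx G) (gpt G (u, v))) (cball 0 r) - gn G * (pi * r\<^sup>2) / (gl G)\<^sup>2)\<^sup>2) \<partial>PP)
     \<le> ennreal (K * (gn G * (pi * r\<^sup>2) / (gl G)\<^sup>2))"
  unfolding variance_num
proof (rule ennreal_leI)
  have "(\<Sum>b\<in>near. (\<integral>w. (cnt G r (u + b + w) - mean b)\<^sup>2 \<partial>U)) \<le> (\<Sum>b\<in>near. K * mean b)"
  proof (rule sum_mono)
    fix b
    have "(\<integral>w. (cnt G r (u + b + w))\<^sup>2 \<partial>U) \<le> (\<integral>w. K * cnt G r (u + b + w) \<partial>U)"
    proof (rule Bochner_Integration.integral_mono)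
      show "integrable U (\<lambda>w. (cnt G r (u + b + w))\<^sup>2)"
        by (rule integrable_U_bounded[where C="(gn G)\<^sup>2"]) (auto simp: cnt_nonneg abs_of_nonneg cnt_le power_mono)
      show "integrable U (\<lambda>w. K * cnt G r (u + b + w))"
        by (intro integrable_mult_right integrable_U_bounded[where C="gn G"]) (auto simp: cnt_nonneg abs_of_nonneg cnt_le)
    qed (simp add: power2_eq_square K cnt_nonneg mult_right_mono)
    also have "\<dots> = K * mean b" unfolding mean_def by simp
    finally show "(\<integral>w. (cnt G r (u + b + w) - mean b)\<^sup>2 \<partial>U) \<le> K * mean b"
      using variance_cell_le[of b] by linarith
  qed
  also have "\<dots> = K * (gn G * (pi * r\<^sup>2) / (gl G)\<^sup>2)" by (simp only: sum_distrib_left[symmetric] sum_mean)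
  finally show "(\<Sum>b\<in>near. (\<integral>w. (cnt G r (u + b + w) - mean b)\<^sup>2 \<partial>U)) \<le> K * (gn G * (pi * r\<^sup>2) / (gl G)\<^sup>2)" .
qed

definition "bdry = {b\<in>near. \<exists>w\<in>Cell. \<exists>w'\<in>Cell. cnt G r (u + b + w) \<noteq> cnt G r (u + b + w')}"

text \<open>For a site of \<open>bdry\<close> some offset leads to possible positions on both sides
  of the circle. In units of the spacing these positions are within 2 of every point of the cell and
  the offset has length at most 1, so the cell stays within 3 of the circle of radius
  \<open>r / gl G\<close>.\<close>

lemma card_bdry: "real (card bdry) \<le> pi * (12 * (r / gl G) + 36)"
proof -
  define R where "R = r / gl G"
  have R: "R \<ge> 0" using r l by (simp add: R_def)
  have "of_nat (card bdry) \<le> emeasure lborel (cball (0::plane) (R + 3) - ball 0 (R - 3))"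
  proof (rule card_cells_le[where u=u])
    show "finite bdry" using finite_near by (rule finite_subset[rotated]) (auto simp: bdry_def)
    show "bdry \<subseteq> ZZ" by (auto simp: bdry_def near_ZZ)
    fix b x assume b: "b \<in> bdry" and x: "x - (u + b) \<in> Cell"
    have d: "norm (x - (u + b + w)) \<le> 2" if "w \<in> Cell" for w
    proof -
      define y where "y = x - (u + b)"
      have "0 \<le> y $ i \<and> y $ i < 1 \<and> 0 \<le> w $ i \<and> w $ i < 1" for i using x that by (simp add: y_def Cell_def)
      from this[of 1] this[of 2] have "norm (y - w) \<le> 2" using norm_plane_le[of "y - w"] by auto
      moreover have "x - (u + b + w) = y - w" by (simp only: y_def diff_diff_eq add.assoc)
      ultimately show ?thesis by (simp only:)
    qed
    obtain w w' where w: "w \<in> Cell" "w' \<in> Cell" "cnt G r (u + b + w) \<noteq> cnt G r (u + b + w')"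
      using b by (auto simp: bdry_def)
    then obtain i where i: "i < gn G" "indicator (cball 0 r) (gl G *\<^sub>R (u + b + w) + gc G i) \<noteq> (indicator (cball 0 r) (gl G *\<^sub>R (u + b + w') + gc G i) :: real)"
      unfolding cnt_def by (meson lessThan_iff sum.cong)
    obtain z z' where z: "z \<in> Cell" "z' \<in> Cell" "norm (gl G *\<^sub>R (u + b + z) + gc G i) \<le> r" "norm (gl G *\<^sub>R (u + b + z') + gc G i) > r"
    proof -
      have "(norm (gl G *\<^sub>R (u + b + w) + gc G i) \<le> r) \<noteq> (norm (gl G *\<^sub>R (u + b + w') + gc G i) \<le> r)"
        using i(2) by (auto simp: indicator_def)
      then show ?thesis using that[of w w'] that[of w' w] w(1,2) by (meson not_le)
    qed
    have ci: "norm (gc G i) \<le> gl G" using c i by blast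
    have sc: "norm (gl G *\<^sub>R q) = gl G * norm q" for q using l by simp
    have "norm x \<le> norm (u + b + z) + 2"
      using d[OF z(1)] norm_triangle_sub[of x "u + b + z"] by linarith
    then have "gl G * norm x \<le> gl G * (norm (u + b + z) + 2)" using l by (intro mult_left_mono) auto
    also have "\<dots> = gl G * norm (u + b + z) + gl G * 2" by (rule distrib_left)
    also have "gl G * norm (u + b + z) \<le> r + gl G"
      using z(3) ci norm_triangle_ineq4[of "gl G *\<^sub>R (u + b + z) + gc G i" "gc G i"] l sc[of "u + b + z"] by simp
    finally have "norm x \<le> R + 3" using l by (simp add: R_def field_simps)
    moreover have "norm x \<ge> R - 3"
    proof -
      have "r \<le> gl G * norm (u + b + z') + gl G"
        using z(4) ci norm_triangle_ineq[of "gl G *\<^sub>R (u + b + z')" "gc G i"] l sc[of "u + b + z'"] by simp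
      also have "gl G * norm (u + b + z') \<le> gl G * (norm x + 2)"
      proof (rule mult_left_mono)
        show "norm (u + b + z') \<le> norm x + 2"
          using d[OF z(2)] norm_triangle_sub[of "u + b + z'" x] norm_minus_commute[of x "u + b + z'"] by linarith
      qed (use l in simp)
      finally show ?thesis using l by (simp add: R_def field_simps)
    qed
    ultimately show "x \<in> cball 0 (R + 3) - ball 0 (R - 3)" by simp
  qed simp
  also have "\<dots> \<le> ennreal (pi * (12 * R + 36))" by (rule annulus_area[OF R])
  finally have "ennreal (real (card bdry)) \<le> ennreal (pi * (12 * R + 36))" by (simp add: ennreal_of_nat_eq_real_of_nat)
  then show ?thesis using R by (subst (asm) ennreal_le_iff) (auto simp: R_def)
qed

text \<open>Sites outside \<open>bdry\<close> contribute a constant; a site of \<open>bdry\<close>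
  has variance at most \<open>(gn G)\<^sup>2\<close>. The growth in \<open>r\<close> is thus that of
  the perimeter.\<close>

lemma variance_num_le2:
  "(\<integral>\<^sup>+v. ennreal ((measure (conf (gidx G) (gpt G (u, v))) (cball 0 r) - gn G * (pi * r\<^sup>2) / (gl G)\<^sup>2)\<^sup>2) \<partial>PP)
     \<le> ennreal ((gn G)\<^sup>2 * (pi * (12 * (r / gl G) + 36)))"
  unfolding variance_num
proof (rule ennreal_leI)
  have "(\<Sum>b\<in>near. (\<integral>w. (cnt G r (u + b + w) - mean b)\<^sup>2 \<partial>U)) = (\<Sum>b\<in>bdry. (\<integral>w. (cnt G r (u + b + w) - mean b)\<^sup>2 \<partial>U))"
  proof (rule sum.mono_neutral_right[OF finite_near])
    show "\<forall>b\<in>near - bdry. (\<integral>w. (cnt G r (u + b + w) - mean b)\<^sup>2 \<partial>U) = 0"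
    proof
      fix b assume b: "b \<in> near - bdry"
      have 0: "(0::plane) \<in> Cell" by (simp add: Cell_def)
      have const: "cnt G r (u + b + w) = cnt G r (u + b)" if "w \<in> Cell" for w
        using b that 0 unfolding bdry_def by (metis (mono_tags, lifting) DiffE add.right_neutral mem_Collect_eq)
      have "mean b = (\<integral>w. cnt G r (u + b) \<partial>U)"
        unfolding mean_def by (rule Bochner_Integration.integral_cong) (simp_all add: const)
      then have "mean b = cnt G r (u + b)" using U.prob_space by simp
      then have "(\<integral>w. (cnt G r (u + b + w) - mean b)\<^sup>2 \<partial>U) = (\<integral>w. 0 \<partial>U)"
        by (intro Bochner_Integration.integral_cong) (simp_all add: const)
      then show "(\<integral>w. (cnt G r (u + b + w) - mean b)\<^sup>2 \<partial>U) = 0" by simp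
    qed
  qed (auto simp: bdry_def)
  also have "\<dots> \<le> (\<Sum>b\<in>bdry. (real (gn G))\<^sup>2)"
  proof (rule sum_mono)
    fix b
    have "(\<integral>w. (cnt G r (u + b + w))\<^sup>2 \<partial>U) \<le> (\<integral>w. (real (gn G))\<^sup>2 \<partial>U)"
      by (rule Bochner_Integration.integral_mono) (auto intro!: integrable_U_bounded[where C="(real (gn G))\<^sup>2"] power_mono simp: cnt_nonneg cnt_le)
    then show "(\<integral>w. (cnt G r (u + b + w) - mean b)\<^sup>2 \<partial>U) \<le> (real (gn G))\<^sup>2"
      using variance_cell_le[of b] U.prob_space by simp
  qed
  also have "\<dots> = (real (gn G))\<^sup>2 * real (card bdry)" by simp
  also have "\<dots> \<le> (gn G)\<^sup>2 * (pi * (12 * (r / gl G) + 36))"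
    by (simp only: of_nat_power) (intro mult_left_mono card_bdry, simp)
  finally show "(\<Sum>b\<in>near. (\<integral>w. (cnt G r (u + b + w) - mean b)\<^sup>2 \<partial>U)) \<le> (gn G)\<^sup>2 * (pi * (12 * (r / gl G) + 36))" .
qed

end

lemma num_measurable: "(\<lambda>w. measure (conf (gidx G) (gpt G w)) (cball 0 r)) \<in> borel_measurable Om"
  unfolding measure_def using emeasure_conf_gpt_measurable[of "cball 0 r" G] by measurable

text \<open>The bounds given the shift are uniform in the shift and centred at the same value
  \<open>\<mu>\<close>, so they can be integrated over the shift.\<close>

lemma variance_gpt:
  assumes l: "gl G > 0" and s: "gs G = 1" and r: "r \<ge> 0"
    and c: "\<And>i. i < gn G \<Longrightarrow> norm (gc G i) \<le> gl G"
  defines "\<mu> \<equiv> gn G * (pi * r\<^sup>2) / (gl G)\<^sup>2"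
  shows "(\<And>x. cnt G r x \<le> K) \<Longrightarrow> (\<integral>\<^sup>+w. ennreal ((measure (conf (gidx G) (gpt G w)) (cball 0 r) - \<mu>)\<^sup>2) \<partial>Om) \<le> ennreal (K * \<mu>)"
    and "(\<integral>\<^sup>+w. ennreal ((measure (conf (gidx G) (gpt G w)) (cball 0 r) - \<mu>)\<^sup>2) \<partial>Om) \<le> ennreal ((gn G)\<^sup>2 * (pi * (12 * (r / gl G) + 36)))"
proof -
  have m: "(\<lambda>w. ennreal ((measure (conf (gidx G) (gpt G w)) (cball 0 r) - \<mu>)\<^sup>2)) \<in> borel_measurable (U \<Otimes>\<^sub>M PP)"
    using num_measurable[of G r] unfolding Om_def by measurable
  have *: "(\<integral>\<^sup>+w. ennreal ((measure (conf (gidx G) (gpt G w)) (cball 0 r) - \<mu>)\<^sup>2) \<partial>Om) \<le> B"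
    if "\<And>u. u \<in> Cell \<Longrightarrow> (\<integral>\<^sup>+v. ennreal ((measure (conf (gidx G) (gpt G (u, v))) (cball 0 r) - \<mu>)\<^sup>2) \<partial>PP) \<le> B" for B
  proof -
    have "(\<integral>\<^sup>+w. ennreal ((measure (conf (gidx G) (gpt G w)) (cball 0 r) - \<mu>)\<^sup>2) \<partial>Om)
        = (\<integral>\<^sup>+u. (\<integral>\<^sup>+v. ennreal ((measure (conf (gidx G) (gpt G (u, v))) (cball 0 r) - \<mu>)\<^sup>2) \<partial>PP) \<partial>U)"
      unfolding Om_def by (rule PP.nn_integral_fst[OF m, symmetric])
    also have "\<dots> \<le> (\<integral>\<^sup>+u. B \<partial>U)"
      by (rule nn_integral_mono) (simp add: that)
    also have "\<dots> = B" using U.emeasure_space_1 by simp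
    finally show ?thesis .
  qed
  show "(\<And>x. cnt G r x \<le> K) \<Longrightarrow> (\<integral>\<^sup>+w. ennreal ((measure (conf (gidx G) (gpt G w)) (cball 0 r) - \<mu>)\<^sup>2) \<partial>Om) \<le> ennreal (K * \<mu>)"
    unfolding \<mu>_def by (rule *[unfolded \<mu>_def]) (rule variance_num_le1[OF l s r _ c])
  show "(\<integral>\<^sup>+w. ennreal ((measure (conf (gidx G) (gpt G w)) (cball 0 r) - \<mu>)\<^sup>2) \<partial>Om) \<le> ennreal ((gn G)\<^sup>2 * (pi * (12 * (r / gl G) + 36)))"
    unfolding \<mu>_def by (rule *[unfolded \<mu>_def]) (rule variance_num_le2[OF l s r _ c])
qed

text \<open>The cross term is absorbed by
  \<open>(x + y)\<^sup>2 \<le> 2 * x\<^sup>2 + 2 * y\<^sup>2\<close>.\<close>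

lemma variance_sconf:
  assumes l: "gl G > 0" "gl H > 0" and r: "r \<ge> 0"
    and bG: "(\<integral>\<^sup>+w. ennreal ((measure (conf (gidx G) (gpt G w)) (cball 0 r) - \<mu>)\<^sup>2) \<partial>Om) \<le> ennreal A"
    and bH: "(\<integral>\<^sup>+w. ennreal ((measure (conf (gidx H) (gpt H w)) (cball 0 r) - \<nu>)\<^sup>2) \<partial>Om) \<le> ennreal B"
    and "\<mu> + \<nu> = \<kappa>" "A \<ge> 0" "B \<ge> 0"
  shows "(\<integral>\<^sup>+w. ennreal ((num_points r (sconf G H w) - \<kappa>)\<^sup>2) \<partial>Om2) \<le> ennreal (2 * A + 2 * B)"
proof -
  let ?f = "\<lambda>w. ennreal ((measure (conf (gidx G) (gpt G w)) (cball 0 r) - \<mu>)\<^sup>2)"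
  let ?g = "\<lambda>w. ennreal ((measure (conf (gidx H) (gpt H w)) (cball 0 r) - \<nu>)\<^sup>2)"
  have f: "?f \<in> borel_measurable Om" using num_measurable[of G r] by measurable
  have g: "?g \<in> borel_measurable Om" using num_measurable[of H r] by measurable
  note f2 = measurable_compose[OF measurable_fst[of Om Om] f]
  note g2 = measurable_compose[OF measurable_snd[of Om Om] g]
  have "(\<integral>\<^sup>+w. ennreal ((num_points r (sconf G H w) - \<kappa>)\<^sup>2) \<partial>Om2) \<le> (\<integral>\<^sup>+w. 2 * ?f (fst w) + 2 * ?g (snd w) \<partial>Om2)"
  proof (rule nn_integral_mono)
    fix w assume w: "w \<in> space Om2"
    have w1: "fst w \<in> space Om" "snd w \<in> space Om" using w by (auto simp: space_pair_measure)
    have e: "emeasure (conf (gidx G) (gpt G (fst w))) (cball 0 r) < \<infinity>" "emeasure (conf (gidx H) (gpt H (snd w))) (cball 0 r) < \<infinity>"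
      by (rule configs_emeasure_bounded[OF conf_in_configs[OF loc_fin_gpt[OF l(1) w1(1)]] bounded_cball cball_borel])
         (rule configs_emeasure_bounded[OF conf_in_configs[OF loc_fin_gpt[OF l(2) w1(2)]] bounded_cball cball_borel])
    have n: "num_points r (sconf G H w) = measure (conf (gidx G) (gpt G (fst w))) (cball 0 r) + measure (conf (gidx H) (gpt H (snd w))) (cball 0 r)"
      unfolding num_points_def measure_def emeasure_sconf[OF cball_borel]
      by (rule enn2real_plus[OF e[unfolded infinity_ennreal_def]])
    have "(x + y)\<^sup>2 \<le> 2 * x\<^sup>2 + 2 * y\<^sup>2" for x y :: real
      using sum_squares_bound[of x y] by (simp add: power2_sum)
    then have "(num_points r (sconf G H w) - \<kappa>)\<^sup>2 \<le> 2 * (measure (conf (gidx G) (gpt G (fst w))) (cball 0 r) - \<mu>)\<^sup>2 + 2 * (measure (conf (gidx H) (gpt H (snd w))) (cball 0 r) - \<nu>)\<^sup>2"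
      unfolding n assms(6)[symmetric] add_diff_add .
    then have "ennreal ((num_points r (sconf G H w) - \<kappa>)\<^sup>2) \<le> ennreal (2 * (measure (conf (gidx G) (gpt G (fst w))) (cball 0 r) - \<mu>)\<^sup>2 + 2 * (measure (conf (gidx H) (gpt H (snd w))) (cball 0 r) - \<nu>)\<^sup>2)"
      by (rule ennreal_leI)
    then show "ennreal ((num_points r (sconf G H w) - \<kappa>)\<^sup>2) \<le> 2 * ?f (fst w) + 2 * ?g (snd w)"
      by (simp add: ennreal_mult)
  qed
  also have "\<dots> = 2 * (\<integral>\<^sup>+w. ?f (fst w) \<partial>Om2) + 2 * (\<integral>\<^sup>+w. ?g (snd w) \<partial>Om2)"
    using f2 g2 by (subst nn_integral_add) (simp_all add: nn_integral_cmult)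
  also have "(\<integral>\<^sup>+w. ?f (fst w) \<partial>Om2) = (\<integral>\<^sup>+w. ?f w \<partial>Om)"
    using Om.nn_integral_fst[OF f2] Om.emeasure_space_1 by simp
  also have "(\<integral>\<^sup>+w. ?g (snd w) \<partial>Om2) = (\<integral>\<^sup>+w. ?g w \<partial>Om)"
    using Om.nn_integral_fst[OF g2] Om.emeasure_space_1 by simp
  also have "2 * (\<integral>\<^sup>+w. ?f w \<partial>Om) + 2 * (\<integral>\<^sup>+w. ?g w \<partial>Om) \<le> 2 * ennreal A + 2 * ennreal B"
    by (intro add_mono mult_left_mono bG bH) auto
  also have "\<dots> = ennreal (2 * A + 2 * B)" using assms(7,8) by (simp add: ennreal_mult)
  finally show ?thesis .
qed

lemma num_points_measurable: "num_points r \<in> borel_measurable config_algebra"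
  unfolding num_points_def measure_def using emeasure_config_measurable[OF cball_borel] by measurable

text \<open>The second moment about any constant dominates the variance, so
  \<open>pi * r\<^sup>2\<close> may replace the mean. For radii below 1 only finiteness of the
  second moment is at stake, and it follows by monotonicity in the radius.\<close>

lemma hyperuniformI:
  assumes P: "prob_space P" "sets P = sets config_algebra"
    and s: "\<And>r. r \<ge> 1 \<Longrightarrow> (\<integral>\<^sup>+X. ennreal ((num_points r X - pi * r\<^sup>2)\<^sup>2) \<partial>P) \<le> ennreal (s r)"
    and s0: "\<And>r. 0 \<le> s r" and lim: "((\<lambda>r. s r / r\<^sup>2) \<longlongrightarrow> 0) at_top"
  shows "hyperuniform P"
proof -
  interpret prob_space P by fact
  have spP: "space P = configs" using P(2) sets_eq_imp_space_eq space_config_algebra by metis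
  have m [measurable]: "num_points r \<in> borel_measurable P" for r
    using num_points_measurable[of r] measurable_cong_sets[OF P(2) refl] by blast
  have c2: "integrable P (\<lambda>X. (num_points r X - pi * r\<^sup>2)\<^sup>2)" if "r \<ge> 1" for r
  proof (rule integrableI_bounded)
    have "(\<integral>\<^sup>+X. ennreal (norm ((num_points r X - pi * r\<^sup>2)\<^sup>2)) \<partial>P) \<le> ennreal (s r)" using s[OF that] by simp
    also have "\<dots> < \<infinity>" by simp
    finally show "(\<integral>\<^sup>+X. ennreal (norm ((num_points r X - pi * r\<^sup>2)\<^sup>2)) \<partial>P) < \<infinity>" .
  qed simp
  have i2': "integrable P (\<lambda>X. (num_points r X)\<^sup>2)" if r: "r \<ge> 1" for r
  proof (rule Bochner_Integration.integrable_bound)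
    show "integrable P (\<lambda>X. 2 * (num_points r X - pi * r\<^sup>2)\<^sup>2 + 2 * (pi * r\<^sup>2)\<^sup>2)"
      using c2[OF r] by simp
    have "x\<^sup>2 \<le> 2 * (x - y)\<^sup>2 + 2 * y\<^sup>2" for x y :: real
      using sum_squares_bound[of "x - y" y] power2_sum[of "x - y" y] by simp
    then show "AE X in P. norm ((num_points r X)\<^sup>2) \<le> norm (2 * (num_points r X - pi * r\<^sup>2)\<^sup>2 + 2 * (pi * r\<^sup>2)\<^sup>2)"
      by (intro AE_I2) simp
  qed simp
  have i2: "integrable P (\<lambda>X. (num_points r X)\<^sup>2)" if "r > 0" for r
  proof (rule Bochner_Integration.integrable_bound)
    show "integrable P (\<lambda>X. (num_points (max r 1) X)\<^sup>2)" by (rule i2') simp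
    show "AE X in P. norm ((num_points r X)\<^sup>2) \<le> norm ((num_points (max r 1) X)\<^sup>2)"
    proof (rule AE_I2)
      fix X assume "X \<in> space P"
      then have X: "X \<in> configs" by (simp add: spP)
      have "emeasure X (cball 0 r) \<le> emeasure X (cball 0 (max r 1))"
        by (rule emeasure_mono) (auto simp: sets_configs[OF X])
      then have "num_points r X \<le> num_points (max r 1) X"
        unfolding num_points_def measure_def
        using configs_emeasure_bounded[OF X bounded_cball cball_borel, of 0 "max r 1"]
        by (intro enn2real_mono) auto
      moreover have "0 \<le> num_points r X" by (simp add: num_points_def)
      ultimately show "norm ((num_points r X)\<^sup>2) \<le> norm ((num_points (max r 1) X)\<^sup>2)"
        by (simp add: power_mono)
    qed
  qed simp
  have var: "variance (num_points r) \<le> s r" if r: "r \<ge> 1" for r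
  proof -
    have i1: "integrable P (num_points r)"
      by (rule square_integrable_imp_integrable[OF m i2]) (use r in simp)
    have i3: "integrable P (\<lambda>X. (num_points r X)\<^sup>2)" using i2 r by simp
    define c where "c = pi * r\<^sup>2"
    have "expectation (\<lambda>X. (num_points r X - c)\<^sup>2) = expectation (\<lambda>X. (num_points r X)\<^sup>2) - 2 * c * expectation (num_points r) + c\<^sup>2"
    proof -
      have "expectation (\<lambda>X. (num_points r X - c)\<^sup>2) = expectation (\<lambda>X. ((num_points r X)\<^sup>2 - 2 * c * num_points r X) + c\<^sup>2)"
        by (simp add: power2_diff algebra_simps)
      also have "\<dots> = expectation (\<lambda>X. (num_points r X)\<^sup>2) - 2 * c * expectation (num_points r) + c\<^sup>2"
        using i1 i3 by (subst Bochner_Integration.integral_add) (simp_all add: prob_space)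
      finally show ?thesis .
    qed
    moreover have "variance (num_points r) = expectation (\<lambda>X. (num_points r X)\<^sup>2) - (expectation (num_points r))\<^sup>2"
      by (rule variance_eq[OF i1 i3])
    moreover have "0 \<le> (expectation (num_points r) - c)\<^sup>2" by simp
    ultimately have "variance (num_points r) \<le> expectation (\<lambda>X. (num_points r X - c)\<^sup>2)"
      by (simp add: power2_diff algebra_simps)
    also have "ennreal \<dots> \<le> ennreal (s r)"
      using s[OF r] c2[OF r] by (subst nn_integral_eq_integral[symmetric]) (simp_all add: c_def)
    then have "expectation (\<lambda>X. (num_points r X - c)\<^sup>2) \<le> s r" using s0 by simp
    finally show ?thesis .
  qed
  have area: "measure lborel (cball (0::plane) r) = pi * r\<^sup>2" if "r \<ge> 0" for r
    using emeasure_cball_plane[OF that, of 0] by (simp add: measure_def)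
  have "((\<lambda>r. variance (num_points r) / measure lborel (cball (0::plane) r)) \<longlongrightarrow> 0) at_top"
  proof (rule tendsto_sandwich)
    show "\<forall>\<^sub>F r in at_top. 0 \<le> variance (num_points r) / measure lborel (cball (0::plane) r)"
      by (intro always_eventually allI divide_nonneg_nonneg variance_positive) simp
    show "\<forall>\<^sub>F r in at_top. variance (num_points r) / measure lborel (cball (0::plane) r) \<le> s r / r\<^sup>2"
      using eventually_ge_at_top[of 1]
    proof eventually_elim
      fix r :: real assume r: "1 \<le> r"
      have "variance (num_points r) / (pi * r\<^sup>2) \<le> s r / (1 * r\<^sup>2)"
        using pi_gt3 r by (intro frac_le var mult_right_mono s0) auto
      then show "variance (num_points r) / measure lborel (cball (0::plane) r) \<le> s r / r\<^sup>2" using area[of r] r by simp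
    qed
  qed (use lim in auto)
  then show ?thesis unfolding hyperuniform_def using i2 by blast
qed

section \<open>The hyperuniform process\<close>

lemma pmf_of_summable:
  fixes f :: "nat \<Rightarrow> real"
  assumes "\<And>j. f j > 0" "summable f"
  obtains J where "\<And>j. pmf J j = f j / suminf f"
proof -
  have pos: "suminf f > 0" using assms by (intro suminf_pos) auto
  have "(\<integral>\<^sup>+j. ennreal (f j / suminf f) \<partial>count_space UNIV) = (\<Sum>j. ennreal (f j / suminf f))"
    by (rule nn_integral_count_space_nat)
  also have "\<dots> = ennreal (\<Sum>j. f j / suminf f)"
    using assms pos by (intro suminf_ennreal_eq) (auto simp: less_imp_le summable_divide intro!: summable_sums)
  also have "(\<Sum>j. f j / suminf f) = 1"
    using assms(2) pos by (simp add: suminf_divide)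
  finally have 1: "(\<integral>\<^sup>+j. ennreal (f j / suminf f) \<partial>count_space UNIV) = 1" by simp
  have "pmf (embed_pmf (\<lambda>j. f j / suminf f)) j = f j / suminf f" for j
    by (rule pmf_embed_pmf) (use assms pos 1 in \<open>auto simp: less_imp_le\<close>)
  then show ?thesis by (rule that)
qed

lemma nn_integral_nat_pmf:
  fixes J :: "nat pmf"
  shows "(\<integral>\<^sup>+j. f j \<partial>measure_pmf J) = (\<Sum>j. ennreal (pmf J j) * f j)"
  by (simp add: nn_integral_measure_pmf nn_integral_count_space_nat)

definition am :: "nat \<Rightarrow> nat" where "am j = nat \<lceil>sqrt (real (j + 1))\<rceil>"

lemma am_bounds: "sqrt (real (j + 1)) \<le> am j" "am j \<le> 2 * sqrt (real (j + 1))" "am j \<ge> 1" "real (am j) \<le> 2 * 4 ^ j"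
proof -
  have s1: "1 \<le> sqrt (real (j + 1))" by simp
  show "sqrt (real (j + 1)) \<le> am j" unfolding am_def by (rule real_nat_ceiling_ge)
  have "real (am j) < sqrt (real (j + 1)) + 1"
    unfolding am_def using s1 by (subst of_nat_nat) (linarith+)
  then show 2: "am j \<le> 2 * sqrt (real (j + 1))" using s1 by linarith
  show "am j \<ge> 1" unfolding am_def using s1 by linarith
  have "sqrt (real (j + 1)) \<le> real (j + 1)"
    by (rule real_le_lsqrt) (auto simp: power2_eq_square)
  also have "real (j + 1) \<le> 4 ^ j" by (induction j) auto
  finally show "real (am j) \<le> 2 * 4 ^ j" using 2 by linarith
qed

text \<open>The intensity of \<open>Hs j\<close>: \<open>am j * 4 ^ j\<close> points per cell of
  area \<open>(16 * 4 ^ j)\<^sup>2\<close>.\<close>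

definition eps :: "nat \<Rightarrow> real" where "eps j = am j / (256 * 4 ^ j)"

lemma eps_bounds: "0 \<le> eps j" "eps j \<le> 1 / 128"
  using am_bounds(4)[of j] by (auto simp: eps_def field_simps)

definition vvec :: "real \<Rightarrow> plane" where "vvec t = (\<chi> k. if k = 1 then 0 else t)"

lemma norm_vvec [simp]: "norm (vvec t) = \<bar>t\<bar>"
  by (simp add: vvec_def norm_vec_def L2_set_def sum_2)

text \<open>This spacing gives intensity \<open>1 - eps j\<close>, which leaves room for exactly the
  points of \<open>Hs j\<close>.\<close>

definition Gs :: "nat \<Rightarrow> gspec" where
  "Gs j = \<lparr>gl = 1 / sqrt (1 - eps j), gs = 1, gn = 1, gc = (\<lambda>_. 0)\<rparr>"

text \<open>The division by \<open>am j\<close> puts \<open>am j\<close> coinciding points at each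
  of the heights \<open>0, ..., 4 ^ j - 1\<close> of a vertical segment.\<close>

definition Hs :: "nat \<Rightarrow> gspec" where
  "Hs j = \<lparr>gl = 16 * 4 ^ j, gs = 1, gn = am j * 4 ^ j, gc = (\<lambda>i. vvec (real (i div am j)))\<rparr>"

lemma Gs_sel [simp]: "gl (Gs j) = 1 / sqrt (1 - eps j)" "gs (Gs j) = 1" "gn (Gs j) = 1" "gc (Gs j) i = 0"
  by (simp_all add: Gs_def)

lemma Hs_sel [simp]: "gl (Hs j) = 16 * 4 ^ j" "gs (Hs j) = 1" "gn (Hs j) = am j * 4 ^ j" "gc (Hs j) i = vvec (real (i div am j))"
  by (simp_all add: Hs_def)

lemma gl_Gs: "gl (Gs j) > 0" "1 \<le> gl (Gs j)" "gl (Gs j) \<le> 2" "1 / (gl (Gs j))\<^sup>2 = 1 - eps j"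
proof -
  have e: "1/4 \<le> 1 - eps j" "1 - eps j \<le> 1" using eps_bounds[of j] by auto
  show "1 / (gl (Gs j))\<^sup>2 = 1 - eps j" using e by (simp add: power_divide)
  have "sqrt (1/4) \<le> sqrt (1 - eps j)" using e by (intro real_sqrt_le_mono)
  then have h: "1/2 \<le> sqrt (1 - eps j)" by (simp add: real_sqrt_divide)
  have h2: "sqrt (1 - eps j) \<le> 1" using e by simp
  have e0: "eps j < 1" using e by simp
  show "gl (Gs j) > 0" using e0 by simp
  show "gl (Gs j) \<le> 2" "1 \<le> gl (Gs j)" using h h2 e0 by (simp_all add: field_simps)
qed

lemma gl_Hs: "gl (Hs j) > 0" by simp

lemma gc_Hs: "i < gn (Hs j) \<Longrightarrow> norm (gc (Hs j) i) \<le> 4 ^ j"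
proof -
  assume "i < gn (Hs j)"
  then have "i div am j < 4 ^ j" using am_bounds(3)[of j] by (simp add: div_less_iff_less_mult mult.commute)
  then have "real (i div am j) \<le> real (4 ^ j)" by (subst of_nat_le_iff) simp
  then show ?thesis by simp
qed

lemma gc_Hs': "i < gn (Hs j) \<Longrightarrow> norm (gc (Hs j) i) \<le> gl (Hs j)"
proof -
  assume "i < gn (Hs j)"
  then have "norm (gc (Hs j) i) \<le> 4 ^ j" by (rule gc_Hs)
  also have "\<dots> \<le> 16 * 4 ^ j" by simp
  also have "\<dots> = gl (Hs j)" by simp
  finally show ?thesis .
qed

text \<open>Equality at every scale serves hyperuniformity too: a mean that depended on the scale
  would add a variance of order \<open>r ^ 4\<close> to the mixture.\<close>

lemma intens: "gn (Gs j) / (gl (Gs j))\<^sup>2 + gn (Hs j) / (gl (Hs j))\<^sup>2 = 1"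
proof -
  have "gn (Hs j) / (gl (Hs j))\<^sup>2 = eps j" by (simp add: eps_def power2_eq_square)
  then show ?thesis by (simp only: Gs_sel(3) of_nat_1 gl_Gs(4))
qed

lemma card_div_le:
  assumes "a > (0::nat)" "finite S"
  shows "card {i. i < n \<and> i div a \<in> S} \<le> a * card S"
proof -
  have "{i. i < n \<and> i div a \<in> S} \<subseteq> (\<lambda>(s, t). s * a + t) ` (S \<times> {..<a})"
  proof
    fix i assume "i \<in> {i. i < n \<and> i div a \<in> S}"
    then have "(i div a, i mod a) \<in> S \<times> {..<a}" using assms(1) by simp
    moreover have "i = (\<lambda>(s, t). s * a + t) (i div a, i mod a)" by (simp add: mult.commute)
    ultimately show "i \<in> (\<lambda>(s, t). s * a + t) ` (S \<times> {..<a})" by blast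
  qed
  then have "card {i. i < n \<and> i div a \<in> S} \<le> card ((\<lambda>(s, t). s * a + t) ` (S \<times> {..<a}))"
    using assms(2) by (intro card_mono) auto
  also have "\<dots> \<le> card (S \<times> {..<a})" using assms(2) by (intro card_image_le) auto
  finally show ?thesis by (simp add: mult.commute card_cartesian_product)
qed

lemma card_nat_interval_le:
  assumes "r \<ge> 0"
  shows "finite {k::nat. \<bar>y + real k\<bar> \<le> r}" "real (card {k::nat. \<bar>y + real k\<bar> \<le> r}) \<le> 2 * r + 1"
proof -
  have sub: "int ` {k::nat. \<bar>y + real k\<bar> \<le> r} \<subseteq> {\<lceil>- y - r\<rceil>..\<lfloor>- y + r\<rfloor>}"
    by (auto simp: ceiling_le_iff le_floor_iff abs_le_iff)
  show "finite {k::nat. \<bar>y + real k\<bar> \<le> r}"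
    using finite_subset[OF sub] by (simp add: finite_image_iff)
  have "card {k::nat. \<bar>y + real k\<bar> \<le> r} = card (int ` {k::nat. \<bar>y + real k\<bar> \<le> r})"
    by (simp add: card_image)
  also have "\<dots> \<le> card {\<lceil>- y - r\<rceil>..\<lfloor>- y + r\<rfloor>}" using sub by (intro card_mono) auto
  also have "\<dots> = nat (\<lfloor>- y + r\<rfloor> - \<lceil>- y - r\<rceil> + 1)" by simp
  finally have "real (card {k::nat. \<bar>y + real k\<bar> \<le> r}) \<le> real (nat (\<lfloor>- y + r\<rfloor> - \<lceil>- y - r\<rceil> + 1))" by simp
  also have "\<dots> \<le> 2 * r + 1" using assms by linarith
  finally show "real (card {k::nat. \<bar>y + real k\<bar> \<le> r}) \<le> 2 * r + 1" .
qed

text \<open>The heights that can meet the disk lie in an interval of length \<open>2 * r\<close>, so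
  there are at most \<open>2 * r + 1 \<le> 3 * r\<close> of them, with \<open>am j\<close> points
  each.\<close>

lemma cnt_Hs:
  fixes r :: real
  assumes "r \<ge> 1" shows "cnt (Hs j) r x \<le> 3 * real (am j) * r"
proof -
  define y where "y = gl (Hs j) *\<^sub>R x"
  define S where "S = {k::nat. \<bar>y $ 2 + real k\<bar> \<le> r}"
  have S: "finite S" "real (card S) \<le> 2 * r + 1"
    using card_nat_interval_le[of r "y $ 2"] assms by (auto simp: S_def)
  have "cnt (Hs j) r x \<le> (\<Sum>i<gn (Hs j). indicator {i. i div am j \<in> S} i)"
    unfolding cnt_def
  proof (intro sum_mono)
    fix i
    have "i div am j \<in> S" if "norm (y + vvec (real (i div am j))) \<le> r"
      using component_le_norm_cart[of "y + vvec (real (i div am j))" 2] that by (simp add: S_def vvec_def)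
    then show "indicat_real (cball 0 r) (gl (Hs j) *\<^sub>R x + gc (Hs j) i) \<le> indicator {i. i div am j \<in> S} i"
      unfolding y_def by (auto simp: indicator_def)
  qed
  also have "\<dots> = real (card {i. i < gn (Hs j) \<and> i div am j \<in> S})"
    by (simp add: sum.If_cases indicator_def Collect_conj_eq lessThan_def Int_commute of_bool_def)
  also have "\<dots> \<le> real (am j * card S)"
    using card_div_le[of "am j" S "gn (Hs j)"] am_bounds(3)[of j] S(1) by (simp only: of_nat_le_iff)
  also have "\<dots> = am j * real (card S)" by simp
  also have "\<dots> \<le> am j * (3 * r)" using S(2) assms by (intro mult_left_mono) auto
  finally show ?thesis by simp
qed

text \<open>The profile of scale \<open>j\<close> in the variance per area: largest where
  \<open>4 ^ j\<close> is of order \<open>r\<close>, and geometrically decaying in \<open>j\<close>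
  to both sides.\<close>

definition mn :: "real \<Rightarrow> nat \<Rightarrow> real" where "mn r j = min (r / 4 ^ j) (4 ^ j / r)"

text \<open>For \<open>r\<close> up to the segment length, \<open>Hs j\<close> is treated by the
  bound through the mean, with \<open>K = 3 * am j * r\<close>; for larger \<open>r\<close> by the
  perimeter bound. The fine lattice has a perimeter term, at most \<open>200 * r\<close>. Both are
  doubled by \<open>variance_sconf\<close>.\<close>

lemma variance_j:
  assumes r: "r \<ge> 1"
  shows "(\<integral>\<^sup>+w. ennreal ((num_points r (sconf (Gs j) (Hs j) w) - pi * r\<^sup>2)\<^sup>2) \<partial>Om2)
    \<le> ennreal (400 * r + 320 * r\<^sup>2 * ((am j)\<^sup>2 * mn r j))"
proof -
  define m :: real where "m = 4 ^ j"
  have m: "m > 0" by (simp add: m_def)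
  define a where "a = real (am j)"
  have a: "a \<ge> 1" using am_bounds(3)[of j] by (simp add: a_def)
  have pi4: "pi \<le> 4" using pi_less_4 by simp
  define \<mu> where "\<mu> = gn (Gs j) * (pi * r\<^sup>2) / (gl (Gs j))\<^sup>2"
  define \<nu> where "\<nu> = gn (Hs j) * (pi * r\<^sup>2) / (gl (Hs j))\<^sup>2"
  have sum: "\<mu> + \<nu> = pi * r\<^sup>2"
  proof -
    have "\<mu> + \<nu> = (gn (Gs j) / (gl (Gs j))\<^sup>2 + gn (Hs j) / (gl (Hs j))\<^sup>2) * (pi * r\<^sup>2)"
      unfolding \<mu>_def \<nu>_def distrib_right by simp
    then show ?thesis unfolding intens by simp
  qed
  have bG: "(\<integral>\<^sup>+w. ennreal ((measure (conf (gidx (Gs j)) (gpt (Gs j) w)) (cball 0 r) - \<mu>)\<^sup>2) \<partial>Om) \<le> ennreal (200 * r)"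
  proof -
    have "(\<integral>\<^sup>+w. ennreal ((measure (conf (gidx (Gs j)) (gpt (Gs j) w)) (cball 0 r) - \<mu>)\<^sup>2) \<partial>Om)
      \<le> ennreal ((gn (Gs j))\<^sup>2 * (pi * (12 * (r / gl (Gs j)) + 36)))"
      unfolding \<mu>_def by (rule variance_gpt(2)) (use gl_Gs(1,2)[of j] r in auto)
    also have "\<dots> \<le> ennreal (200 * r)"
    proof (rule ennreal_leI)
      have "r / gl (Gs j) \<le> r / 1" by (rule divide_left_mono) (use gl_Gs(1,2)[of j] r in auto)
      then have "12 * (r / gl (Gs j)) + 36 \<le> 48 * r" using r by linarith
      then have "pi * (12 * (r / gl (Gs j)) + 36) \<le> pi * (48 * r)" by (rule mult_left_mono) simp
      also have "\<dots> \<le> 4 * (48 * r)" using pi4 r by (intro mult_right_mono) auto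
      finally show "(gn (Gs j))\<^sup>2 * (pi * (12 * (r / gl (Gs j)) + 36)) \<le> 200 * r" using r by simp
    qed
    finally show ?thesis .
  qed
  have bH: "(\<integral>\<^sup>+w. ennreal ((measure (conf (gidx (Hs j)) (gpt (Hs j) w)) (cball 0 r) - \<nu>)\<^sup>2) \<partial>Om) \<le> ennreal (160 * r\<^sup>2 * ((am j)\<^sup>2 * mn r j))"
  proof (cases "r \<le> m")
    case True
    have mn: "mn r j = r / m"
    proof -
      have "r / m \<le> m / r" using True r m by (simp add: field_simps mult_mono)
      then show ?thesis by (simp add: mn_def m_def)
    qed
    have "(\<integral>\<^sup>+w. ennreal ((measure (conf (gidx (Hs j)) (gpt (Hs j) w)) (cball 0 r) - \<nu>)\<^sup>2) \<partial>Om) \<le> ennreal (3 * real (am j) * r * \<nu>)"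
      unfolding \<nu>_def
    proof (rule variance_gpt(1))
      show "0 \<le> r" using r by simp
      show "norm (gc (Hs j) i) \<le> gl (Hs j)" if "i < gn (Hs j)" for i using that by (rule gc_Hs')
      show "cnt (Hs j) r x \<le> 3 * real (am j) * r" for x by (rule cnt_Hs[OF r])
    qed simp_all
    also have "\<dots> \<le> ennreal (160 * r\<^sup>2 * ((am j)\<^sup>2 * mn r j))"
    proof (rule ennreal_leI)
      have "\<nu> = a * (pi * r\<^sup>2) / (256 * m)"
        using m by (simp add: \<nu>_def a_def m_def power2_eq_square)
      then have "3 * real (am j) * r * \<nu> = pi * (3 / 256 * (r\<^sup>2 * (a\<^sup>2 * (r / m))))"
        by (simp add: a_def power2_eq_square)
      also have "\<dots> \<le> 4 * (3 / 256 * (r\<^sup>2 * (a\<^sup>2 * (r / m))))"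
        using pi4 r m by (intro mult_right_mono) auto
      also have "\<dots> \<le> 160 * (r\<^sup>2 * (a\<^sup>2 * (r / m)))"
      proof -
        have "0 \<le> r\<^sup>2 * (a\<^sup>2 * (r / m))" using r m by simp
        then show ?thesis by linarith
      qed
      also have "\<dots> = 160 * r\<^sup>2 * (a\<^sup>2 * (r / m))" by (rule mult.assoc[symmetric])
      finally show "3 * real (am j) * r * \<nu> \<le> 160 * r\<^sup>2 * ((am j)\<^sup>2 * mn r j)" by (simp add: mn a_def)
    qed
    finally show ?thesis .
  next
    case False
    have mn: "mn r j = m / r"
    proof -
      have "m / r \<le> r / m" using False r m by (simp add: field_simps mult_mono)
      then show ?thesis by (simp add: mn_def m_def)
    qed
    have "(\<integral>\<^sup>+w. ennreal ((measure (conf (gidx (Hs j)) (gpt (Hs j) w)) (cball 0 r) - \<nu>)\<^sup>2) \<partial>Om)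
      \<le> ennreal ((gn (Hs j))\<^sup>2 * (pi * (12 * (r / gl (Hs j)) + 36)))"
      unfolding \<nu>_def
    proof (rule variance_gpt(2))
      show "0 \<le> r" using r by simp
      show "norm (gc (Hs j) i) \<le> gl (Hs j)" if "i < gn (Hs j)" for i using that by (rule gc_Hs')
    qed simp_all
    also have "\<dots> \<le> ennreal (160 * r\<^sup>2 * ((am j)\<^sup>2 * mn r j))"
    proof (rule ennreal_leI)
      have "(gn (Hs j))\<^sup>2 * (pi * (12 * (r / gl (Hs j)) + 36)) = pi * (a\<^sup>2 * m\<^sup>2 * (12 * (r / (16 * m)) + 36))"
        by (simp add: a_def m_def power_mult_distrib)
      also have "\<dots> \<le> 4 * (a\<^sup>2 * m\<^sup>2 * (12 * (r / (16 * m)) + 36))"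
        using pi4 r m by (intro mult_right_mono) auto
      also have "a\<^sup>2 * m\<^sup>2 * (12 * (r / (16 * m)) + 36) = a\<^sup>2 * (m * (3/4 * r + 36 * m))"
        using m by (simp add: field_simps power2_eq_square)
      \<comment> \<open>Uses \<open>m < r\<close>; together with the bound 4 for \<open>pi\<close>
        it produces the constant 160.\<close>
      also have "\<dots> \<le> a\<^sup>2 * (m * (40 * r))"
        using False m by (intro mult_left_mono) auto
      also have "4 * (a\<^sup>2 * (m * (40 * r))) = 160 * r\<^sup>2 * (a\<^sup>2 * (m / r))"
        using r by (simp add: power2_eq_square field_simps)
      finally show "(gn (Hs j))\<^sup>2 * (pi * (12 * (r / gl (Hs j)) + 36)) \<le> 160 * r\<^sup>2 * ((am j)\<^sup>2 * mn r j)" by (simp add: mn a_def)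
    qed
    finally show ?thesis .
  qed
  have "(\<integral>\<^sup>+w. ennreal ((num_points r (sconf (Gs j) (Hs j) w) - pi * r\<^sup>2)\<^sup>2) \<partial>Om2) \<le> ennreal (2 * (200 * r) + 2 * (160 * r\<^sup>2 * ((am j)\<^sup>2 * mn r j)))"
    by (rule variance_sconf[OF gl_Gs(1) gl_Hs _ bG bH sum]) (use r in \<open>auto simp: mn_def\<close>)
  then show ?thesis by (simp add: mult.assoc)
qed

text \<open>With \<open>t = 4 ^ j / r\<close>, the increment of \<open>t / (1 + t)\<close> under
  \<open>t \<mapsto> 4 * t\<close> is \<open>3 * t / ((1 + 4 * t) * (1 + t))\<close>, which is
  comparable with \<open>min t (1 / t)\<close>; the 10 is \<open>5 * 2\<close> in both cases.
  Telescoping bounds the sum over the scales uniformly in \<open>r\<close>.\<close>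

lemma mn_telescope:
  assumes r: "r > 0"
  defines "h \<equiv> \<lambda>j. (4 ^ j / r) / (1 + 4 ^ j / r)"
  shows "mn r j \<le> 10 / 3 * (h (Suc j) - h j)"
proof -
  define t where "t = 4 ^ j / r"
  have t: "t > 0" using r by (simp add: t_def)
  have e: "h (Suc j) - h j = 3 * t / ((1 + 4 * t) * (1 + t))"
  proof -
    have "h (Suc j) = 4 * t / (1 + 4 * t)" "h j = t / (1 + t)" by (simp_all add: h_def t_def)
    moreover have "4 * t / (1 + 4 * t) - t / (1 + t) = (4 * t * (1 + t) - t * (1 + 4 * t)) / ((1 + 4 * t) * (1 + t))"
      using t by (intro diff_frac_eq) auto
    moreover have "4 * t * (1 + t) - t * (1 + 4 * t) = 3 * t" by (simp add: algebra_simps)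
    ultimately show ?thesis by simp
  qed
  have mn: "mn r j = min (1 / t) t" by (simp add: mn_def t_def)
  have "mn r j * ((1 + 4 * t) * (1 + t)) \<le> 10 * t"
  proof (cases "t \<le> 1")
    case True
    then have "mn r j \<le> t" by (simp add: mn)
    then have "mn r j * ((1 + 4 * t) * (1 + t)) \<le> t * ((1 + 4 * t) * (1 + t))" using t by (intro mult_right_mono) auto
    also have "\<dots> \<le> t * (5 * 2)" using True t by (intro mult_left_mono mult_mono) auto
    finally show ?thesis by simp
  next
    case False
    then have "mn r j \<le> 1 / t" by (simp add: mn)
    then have "mn r j * ((1 + 4 * t) * (1 + t)) \<le> 1 / t * ((1 + 4 * t) * (1 + t))" using t by (intro mult_right_mono) auto
    also have "\<dots> \<le> 1 / t * ((5 * t) * (2 * t))" using False t by (intro mult_left_mono mult_mono) auto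
    also have "\<dots> = 10 * t" using t by (simp add: field_simps)
    finally show ?thesis .
  qed
  then have "mn r j \<le> 10 * t / ((1 + 4 * t) * (1 + t))" using t by (subst pos_le_divide_eq) auto
  then show ?thesis unfolding e by simp
qed

lemma sum_mn:
  assumes r: "r > 0" shows "(\<Sum>j<n. mn r j) \<le> 4"
proof -
  define h where "h j = (4 ^ j / r) / (1 + 4 ^ j / r)" for j :: nat
  have h: "0 \<le> h j" "h j \<le> 1" for j
  proof -
    define t where "t = 4 ^ j / r"
    have "t \<ge> 0" using r by (simp add: t_def)
    then show "0 \<le> h j" "h j \<le> 1" by (simp_all add: h_def t_def[symmetric])
  qed
  have "(\<Sum>j<n. mn r j) \<le> (\<Sum>j<n. 10 / 3 * (h (Suc j) - h j))"
    by (intro sum_mono) (use mn_telescope[OF r] in \<open>simp add: h_def\<close>)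
  also have "\<dots> = 10 / 3 * (h n - h 0)"
    by (simp only: sum_distrib_left[symmetric] sum_lessThan_telescope)
  also have "\<dots> \<le> 10 / 3 * 1"
  proof (rule mult_left_mono)
    show "h n - h 0 \<le> 1" using h(1)[of 0] h(2)[of n] by simp
  qed simp
  also have "\<dots> \<le> 4" by simp
  finally show ?thesis .
qed

text \<open>Split the scales at \<open>J\<close>. The finitely many lower ones contribute a multiple
  of \<open>1 / r\<close>, since \<open>mn r j \<le> 4 ^ j / r\<close>; the others contribute at
  most 4 times a small bound for \<open>q\<close>, by \<open>sum_mn\<close>.\<close>

lemma weighted_mn_tendsto:
  fixes q :: "nat \<Rightarrow> real"
  assumes q0: "\<And>j. 0 \<le> q j" and q: "q \<longlonglongrightarrow> 0"
  defines "s \<equiv> \<lambda>r. (if r \<ge> 1 then (SUP n. \<Sum>j<n. q j * mn r j) else 0)"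
  shows "\<And>r n. r \<ge> 1 \<Longrightarrow> (\<Sum>j<n. q j * mn r j) \<le> s r" and "\<And>r. 0 \<le> s r" and "(s \<longlongrightarrow> 0) at_top"
proof -
  have mn0: "0 \<le> mn r j" if "r \<ge> 1" for r j using that by (simp add: mn_def)
  obtain Q where Q: "\<And>j. q j \<le> Q" using convergent_imp_Bseq[of q] q unfolding convergent_def Bseq_def by (metis abs_le_D1 real_norm_def)
  have Q0: "0 \<le> Q" using q0[of 0] Q[of 0] by linarith
  have part: "(\<Sum>j<n. q j * mn r j) \<le> Q * (\<Sum>j<J. 4 ^ j) / r + e * 4"
    if r: "r \<ge> 1" and J: "\<And>j. j \<ge> J \<Longrightarrow> q j \<le> e" and e: "e \<ge> 0" for n r J e
  proof -
    have "(\<Sum>j<n. q j * mn r j) \<le> (\<Sum>j<n. (if j < J then Q * 4 ^ j / r else 0) + e * mn r j)"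
    proof (rule sum_mono)
      fix j
      show "q j * mn r j \<le> (if j < J then Q * 4 ^ j / r else 0) + e * mn r j"
      proof (cases "j < J")
        case True
        have "q j * mn r j \<le> Q * (4 ^ j / r)"
          using Q[of j] Q0 q0[of j] mn0[OF r, of j] by (intro mult_mono) (auto simp: mn_def)
        then show ?thesis using True e mn0[OF r, of j] by (simp add: add_increasing2)
      next
        case False
        then show ?thesis using J[of j] mn0[OF r, of j] by (simp add: mult_right_mono)
      qed
    qed
    also have "\<dots> = (\<Sum>j<n. if j < J then Q * 4 ^ j / r else 0) + e * (\<Sum>j<n. mn r j)"
      by (simp add: sum.distrib sum_distrib_left)
    also have "(\<Sum>j<n. if j < J then Q * 4 ^ j / r else 0) \<le> (\<Sum>j<J. Q * 4 ^ j / r)"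
    proof -
      have "(\<Sum>j<n. if j < J then Q * 4 ^ j / r else 0) = (\<Sum>j\<in>{j. j < n \<and> j < J}. Q * 4 ^ j / r)"
        by (simp add: sum.If_cases Collect_conj_eq lessThan_def)
      also have "\<dots> \<le> (\<Sum>j<J. Q * 4 ^ j / r)" using Q0 r by (intro sum_mono2) auto
      finally show ?thesis .
    qed
    also have "(\<Sum>j<J. Q * 4 ^ j / r) = Q * (\<Sum>j<J. 4 ^ j) / r" by (simp add: sum_distrib_left sum_divide_distrib)
    also have "e * (\<Sum>j<n. mn r j) \<le> e * 4" using sum_mn[of r n] r e by (intro mult_left_mono) auto
    finally show ?thesis by simp
  qed
  have bdd: "bdd_above (range (\<lambda>n. \<Sum>j<n. q j * mn r j))" if "r \<ge> 1" for r
    using part[OF that, of 0 Q] Q Q0 by (intro bdd_aboveI[of _ "Q * 4"]) auto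
  show up: "(\<Sum>j<n. q j * mn r j) \<le> s r" if "r \<ge> 1" for r n
    unfolding s_def using that bdd[OF that] by (auto intro: cSUP_upper)
  show s0: "0 \<le> s r" for r using up[of r 0] by (cases "r \<ge> 1") (auto simp: s_def)
  have le: "s r \<le> Q * (\<Sum>j<J. 4 ^ j) / r + e * 4" if "r \<ge> 1" "\<And>j. j \<ge> J \<Longrightarrow> q j \<le> e" "e \<ge> 0" for r J e
    unfolding s_def using that part[OF that] by (auto intro!: cSUP_least)
  show "(s \<longlongrightarrow> 0) at_top"
  proof (rule tendstoI)
    fix d :: real assume d: "d > 0"
    obtain J where J: "\<And>j. j \<ge> J \<Longrightarrow> q j \<le> d / 16"
    proof -
      have "eventually (\<lambda>j. q j < d / 16) sequentially" using order_tendstoD(2)[OF q, of "d/16"] d by simp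
      then show ?thesis using that unfolding eventually_sequentially by (meson less_imp_le)
    qed
    define A where "A = Q * (\<Sum>j<J. 4 ^ j)"
    have A: "A \<ge> 0" using Q0 by (simp add: A_def sum_nonneg)
    show "\<forall>\<^sub>F r in at_top. dist (s r) 0 < d"
      using eventually_ge_at_top[of "max 1 (4 * A / d)"]
    proof eventually_elim
      fix r assume r: "max 1 (4 * A / d) \<le> r"
      then have "A / r \<le> d / 4" using d by (simp add: field_simps)
      moreover have "s r \<le> A / r + d / 16 * 4" unfolding A_def using r d J by (intro le) auto
      ultimately have "s r < d" using d by linarith
      then show "dist (s r) 0 < d" using s0[of r] by (simp add: dist_real_def)
    qed
  qed
qed

text \<open>With this exponent the weights are summable, their products with \<open>am j\<close>, of
  order \<open>1 / (j + 1)\<close>, are not, and their products with \<open>(am j)\<^sup>2\<close>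
  tend to 0.\<close>

definition wt :: "nat \<Rightarrow> real" where "wt j = real (j + 1) powr (-(3/2))"

lemma wt_pos: "wt j > 0" by (simp add: wt_def)

lemma summable_wt: "summable wt"
proof -
  have "summable (\<lambda>j. real j powr (-(3/2)))" by (subst summable_real_powr_iff) simp
  then have "summable (\<lambda>j. real (Suc j) powr (-(3/2)))" by (subst summable_Suc_iff)
  then show ?thesis by (simp add: wt_def[abs_def])
qed

definition J2 :: "nat pmf" where "J2 = (SOME J. \<forall>j. pmf J j = wt j / suminf wt)"

lemma pmf_J2: "pmf J2 j = wt j / suminf wt"
proof -
  have "\<exists>J. \<forall>j. pmf J j = wt j / suminf wt"
    using pmf_of_summable[OF wt_pos summable_wt] by metis
  then show ?thesis unfolding J2_def by (rule someI2_ex) blast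
qed

lemma suminf_wt_pos: "suminf wt > 0"
  using wt_pos summable_wt by (intro suminf_pos) auto

definition q2 :: "nat \<Rightarrow> real" where "q2 j = pmf J2 j * (real (am j))\<^sup>2"

lemma q2_tendsto: "q2 \<longlonglongrightarrow> 0"
proof (rule tendsto_sandwich)
  show "\<forall>\<^sub>F j in sequentially. 0 \<le> q2 j" by (simp add: q2_def)
  show "\<forall>\<^sub>F j in sequentially. q2 j \<le> 4 / suminf wt * real (j + 1) powr (-(1/2))"
  proof (intro always_eventually allI)
    fix j
    have "(real (am j))\<^sup>2 \<le> (2 * sqrt (real (j + 1)))\<^sup>2" using am_bounds(2)[of j] by (intro power_mono) auto
    also have "\<dots> = 4 * real (j + 1)" by (simp add: power_mult_distrib)
    finally have "wt j * (real (am j))\<^sup>2 \<le> wt j * (4 * real (j + 1))" using wt_pos[of j] by (intro mult_left_mono) auto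
    also have "\<dots> = 4 * (real (j + 1) powr (-(3/2)) * real (j + 1) powr 1)" by (simp add: wt_def)
    also have "\<dots> = 4 * real (j + 1) powr (-(1/2))" by (subst powr_add[symmetric]) simp
    finally have "wt j * (real (am j))\<^sup>2 \<le> 4 * real (j + 1) powr (-(1/2))" .
    then show "q2 j \<le> 4 / suminf wt * real (j + 1) powr (-(1/2))"
      using suminf_wt_pos by (simp add: q2_def pmf_J2 divide_right_mono)
  qed
  have "(\<lambda>j. real (j + 1) powr (-(1/2))) \<longlonglongrightarrow> 0"
  proof (rule tendsto_neg_powr)
    have "filterlim (\<lambda>j. real (Suc j)) at_top sequentially"
      by (rule filterlim_compose[OF filterlim_real_sequentially filterlim_Suc])
    then show "filterlim (\<lambda>j. real (j + 1)) at_top sequentially" by simp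
  qed simp
  then show "(\<lambda>j. 4 / suminf wt * real (j + 1) powr (-(1/2))) \<longlonglongrightarrow> 0"
    by (rule tendsto_mult_right_zero)
qed simp

lemma nn_integral_J2_am: "(\<integral>\<^sup>+j. ennreal (real (am j)) \<partial>measure_pmf J2) = \<infinity>"
proof (rule ccontr)
  assume "(\<integral>\<^sup>+j. ennreal (real (am j)) \<partial>measure_pmf J2) \<noteq> \<infinity>"
  then have fin: "(\<Sum>j. ennreal (pmf J2 j * real (am j))) \<noteq> \<top>"
    by (simp add: nn_integral_nat_pmf ennreal_mult)
  have s: "summable (\<lambda>j. pmf J2 j * real (am j))"
    by (rule summable_suminf_not_top[OF _ fin]) simp
  have le: "1 / real (j + 1) \<le> suminf wt * (pmf J2 j * real (am j))" for j
  proof -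
    have "1 / real (j + 1) = real (j + 1) powr (-(3/2)) * real (j + 1) powr (1/2)"
      by (subst powr_add[symmetric]) (simp add: powr_minus_divide)
    also have "\<dots> = wt j * sqrt (real (j + 1))" by (simp add: wt_def powr_half_sqrt)
    also have "\<dots> \<le> wt j * real (am j)" using am_bounds(1)[of j] wt_pos[of j] by (intro mult_left_mono) auto
    finally show ?thesis using suminf_wt_pos by (simp add: pmf_J2)
  qed
  have "summable (\<lambda>j. suminf wt * (pmf J2 j * real (am j)))" using s by (rule summable_mult)
  then have "summable (\<lambda>j. 1 / real (j + 1))"
    by (rule summable_comparison_test'[where N=0]) (use le in auto)
  then have "summable (\<lambda>j. inverse (real (Suc j)))" by (simp add: inverse_eq_divide)
  then show False using not_summable_harmonic[where 'a=real] summable_Suc_iff[of "\<lambda>n. inverse (real n)"] by blast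
qed

definition P2 :: "plane measure measure" where "P2 = mix J2 Gs Hs"

lemma stationary_P2: "stationary_process P2"
  unfolding P2_def by (rule stationary_mix) (rule gl_Gs(1) gl_Hs)+

lemma intensity_P2: "has_intensity P2 1"
  unfolding P2_def by (rule intensity_mix) (rule gl_Gs(1) gl_Hs intens)+

text \<open>All scales have mean \<open>pi * r\<^sup>2\<close>, so the second moment of the mixture
  about this value is the weighted sum of the variances at the scales. Divided by
  \<open>r\<^sup>2\<close>, the fine lattices leave \<open>400 / r\<close> and the segments
  \<open>320 * s r\<close>.\<close>

lemma hyperuniform_P2: "hyperuniform P2"
proof -
  define s where "s r = (if r \<ge> 1 then (SUP n. \<Sum>j<n. q2 j * mn r j) else 0)" for r
  have q0: "0 \<le> q2 j" for j by (simp add: q2_def)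
  have s1: "(\<Sum>j<n. q2 j * mn r j) \<le> s r" if "r \<ge> 1" for r n
    unfolding s_def using weighted_mn_tendsto(1)[OF q0 q2_tendsto that] .
  have s2: "0 \<le> s r" for r unfolding s_def using weighted_mn_tendsto(2)[OF q0 q2_tendsto] .
  have s3: "(s \<longlongrightarrow> 0) at_top" unfolding s_def using weighted_mn_tendsto(3)[OF q0 q2_tendsto] .
  define V where "V r = 400 * \<bar>r\<bar> + 320 * r\<^sup>2 * s r" for r
  show ?thesis
  proof (rule hyperuniformI[where s=V])
    show "prob_space P2" unfolding P2_def by (rule prob_space_mix) (rule gl_Gs(1) gl_Hs)+
    show "sets P2 = sets config_algebra" unfolding P2_def by (rule sets_mix) (rule gl_Gs(1) gl_Hs)+
    show "0 \<le> V r" for r using s2[of r] by (simp add: V_def)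
    show "(\<integral>\<^sup>+X. ennreal ((num_points r X - pi * r\<^sup>2)\<^sup>2) \<partial>P2) \<le> ennreal (V r)" if r: "1 \<le> r" for r
    proof -
      have mn0: "0 \<le> mn r j" for j using r by (simp add: mn_def)
      have m: "(\<lambda>X. ennreal ((num_points r X - pi * r\<^sup>2)\<^sup>2)) \<in> borel_measurable config_algebra"
        using num_points_measurable[of r] by measurable
      have "(\<integral>\<^sup>+X. ennreal ((num_points r X - pi * r\<^sup>2)\<^sup>2) \<partial>P2)
          = (\<integral>\<^sup>+j. (\<integral>\<^sup>+w. ennreal ((num_points r (sconf (Gs j) (Hs j) w) - pi * r\<^sup>2)\<^sup>2) \<partial>Om2) \<partial>measure_pmf J2)"
        unfolding P2_def by (rule nn_integral_mix[OF gl_Gs(1) gl_Hs m])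
      also have "\<dots> \<le> (\<integral>\<^sup>+j. ennreal (400 * r + 320 * r\<^sup>2 * ((am j)\<^sup>2 * mn r j)) \<partial>measure_pmf J2)"
        by (intro nn_integral_mono variance_j[OF r])
      also have "\<dots> = (\<integral>\<^sup>+j. ennreal (400 * r) + ennreal (320 * r\<^sup>2 * ((am j)\<^sup>2 * mn r j)) \<partial>measure_pmf J2)"
        using r mn0 by (intro nn_integral_cong) simp
      also have "\<dots> = ennreal (400 * r) + (\<integral>\<^sup>+j. ennreal (320 * r\<^sup>2 * ((am j)\<^sup>2 * mn r j)) \<partial>measure_pmf J2)"
        by (subst nn_integral_add) (simp_all add: measure_pmf.emeasure_space_1)
      also have "(\<integral>\<^sup>+j. ennreal (320 * r\<^sup>2 * ((am j)\<^sup>2 * mn r j)) \<partial>measure_pmf J2) = (\<Sum>j. ennreal (320 * r\<^sup>2 * (q2 j * mn r j)))"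
        unfolding nn_integral_nat_pmf using mn0 by (simp add: q2_def ennreal_mult[symmetric] mult_ac)
      also have "\<dots> \<le> ennreal (320 * r\<^sup>2 * s r)"
      proof (rule suminf_le_const)
        fix n
        have "(\<Sum>j<n. ennreal (320 * r\<^sup>2 * (q2 j * mn r j))) = ennreal (320 * r\<^sup>2 * (\<Sum>j<n. q2 j * mn r j))"
          using mn0 q0 by (subst sum_ennreal) (auto simp: sum_distrib_left)
        also have "\<dots> \<le> ennreal (320 * r\<^sup>2 * s r)"
          by (intro ennreal_leI mult_left_mono s1[OF r]) simp
        finally show "(\<Sum>j<n. ennreal (320 * r\<^sup>2 * (q2 j * mn r j))) \<le> ennreal (320 * r\<^sup>2 * s r)" .
      qed simp
      finally show ?thesis using r s2[of r] by (simp add: V_def add_left_mono)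
    qed
    have "((\<lambda>r. 400 / r + 320 * s r) \<longlongrightarrow> 400 * 0 + 320 * 0) at_top"
    proof (intro tendsto_add tendsto_mult tendsto_const s3)
      show "((\<lambda>r::real. 400 / r) \<longlongrightarrow> 400 * 0) at_top"
        by (simp add: tendsto_divide_0[OF tendsto_const] filterlim_at_top_imp_at_infinity filterlim_ident)
    qed
    then have "((\<lambda>r. 400 / r + 320 * s r) \<longlongrightarrow> 0) at_top" by simp
    moreover have "\<forall>\<^sub>F r in at_top. 400 / r + 320 * s r = V r / r\<^sup>2"
      using eventually_gt_at_top[of 0]
      by eventually_elim (simp add: V_def add_divide_distrib power2_eq_square)
    ultimately show "((\<lambda>r. V r / r\<^sup>2) \<longlongrightarrow> 0) at_top" by (rule Lim_transform_eventually)
  qed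
qed

section \<open>Lower bound for the transport cost\<close>

text \<open>A 1-Lipschitz potential for Kantorovich duality. The empty set is treated apart because
  \<open>infdist y {} = 0\<close> would give the constant \<open>R\<close>.\<close>

definition tent :: "plane set \<Rightarrow> real \<Rightarrow> plane \<Rightarrow> real" where
  "tent S R y = (if S = {} then 0 else max 0 (R - infdist y S))"

lemma tent_nonneg: "0 \<le> tent S R y" by (simp add: tent_def)

lemma tent_borel [measurable]: "tent S R \<in> borel_measurable borel"
proof -
  have "continuous_on UNIV (tent S R)"
    unfolding tent_def by (cases "S = {}") (auto intro!: continuous_intros)
  then show ?thesis by (rule borel_measurable_continuous_onI)
qed

lemma tent_lipschitz: "tent S R x \<le> tent S R y + dist x y"
  using infdist_triangle[of y S x] by (auto simp: tent_def dist_commute)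

lemma tent_pos:
  assumes "finite S" "tent S R y > 0"
  obtains t where "t \<in> S" "dist y t < R"
proof -
  have S: "S \<noteq> {}" and "infdist y S < R" using assms(2) by (auto simp: tent_def split: if_splits)
  moreover obtain t where "t \<in> S" "infdist y S = dist y t"
    using infdist_attains_inf[OF finite_imp_closed[OF assms(1)] S] by metis
  ultimately show ?thesis using that by auto
qed

lemma tent_le: "tent S R y \<le> max 0 R"
  using infdist_nonneg[of y S] by (auto simp: tent_def)

lemma tent_ge: "t \<in> S \<Longrightarrow> R - dist y t \<le> tent S R y"
  using infdist_le[of t S y] by (auto simp: tent_def)

definition qpts :: "plane set" where "qpts = {x. \<forall>i. x $ i \<in> \<rat>}"

lemma countable_qpts: "countable qpts"
proof -
  have "qpts \<subseteq> (\<lambda>(a, b). \<chi> i. if i = 1 then a else b) ` (\<rat> \<times> \<rat>)"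
  proof
    fix x assume "x \<in> qpts"
    then have "(x $ 1, x $ 2) \<in> \<rat> \<times> \<rat>" by (simp add: qpts_def)
    moreover have "x = (\<lambda>(a, b). \<chi> i. if i = 1 then a else b) (x $ 1, x $ 2)"
      by (simp add: vec_eq_iff forall_2)
    ultimately show "x \<in> (\<lambda>(a, b). \<chi> i. if i = 1 then a else b) ` (\<rat> \<times> \<rat>)" by blast
  qed
  then show ?thesis by (rule countable_subset) (simp add: countable_rat)
qed

lemma qpts_dense:
  assumes "e > 0" obtains t where "t \<in> qpts" "dist t x < e"
proof -
  have "\<exists>q\<in>\<rat>. \<bar>q - x $ i\<bar> < e / 2" for i
  proof -
    obtain q where "q \<in> \<rat>" "x $ i < q" "q < x $ i + e / 2"
      using Rats_dense_in_real[of "x $ i" "x $ i + e / 2"] assms by auto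
    then show ?thesis by (intro bexI[of _ q]) auto
  qed
  then obtain f where f: "\<And>i. f i \<in> \<rat>" "\<And>i. \<bar>f i - x $ i\<bar> < e / 2" by metis
  have "dist (\<chi> i. f i) x < e"
    using norm_plane_le[of "(\<chi> i. f i) - x"] f(2)[of 1] f(2)[of 2] by (simp add: dist_norm)
  moreover have "(\<chi> i. f i) \<in> qpts" using f(1) by (simp add: qpts_def)
  ultimately show ?thesis using that by blast
qed

text \<open>Rational centres and natural radii make the family countable, for the sake of
  measurability. The supports lie in \<open>Lambda n\<close> because the cost counts only mass that
  starts there.\<close>

definition adm :: "nat \<Rightarrow> (plane set \<times> nat) set" where
  "adm n = {(S, R). finite S \<and> S \<subseteq> qpts \<and> (\<forall>t\<in>S. cball t (real R) \<subseteq> Lambda n)}"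

lemma countable_adm: "countable (adm n)"
proof -
  have "adm n \<subseteq> {S. finite S \<and> S \<subseteq> qpts} \<times> UNIV" by (auto simp: adm_def)
  moreover have "countable ({S. finite S \<and> S \<subseteq> qpts} \<times> (UNIV :: nat set))"
    using countable_Collect_finite_subset[OF countable_qpts] by (simp add: conj_commute)
  ultimately show ?thesis by (rule countable_subset)
qed

text \<open>A dual lower bound for the cost in \<open>Lambda n\<close>. The number of points is
  subtracted because the potential controls distances, and a distance exceeds its
  \<open>p\<close>-th power by at most 1.\<close>

definition gain :: "nat \<Rightarrow> plane measure \<Rightarrow> ennreal" where
  "gain n X = (SUP (S, R)\<in>adm n. ((\<integral>\<^sup>+y. ennreal (tent S (real R) y) \<partial>X)
     - ((\<integral>\<^sup>+y. ennreal (tent S (real R) y) \<partial>lborel) + emeasure X (Lambda n))) / ennreal ((real n)\<^sup>2))"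

definition wlow :: "plane measure \<Rightarrow> ennreal" where "wlow X = limsup (\<lambda>n. gain n X)"

lemma Lambda_cbox: "Lambda n = cbox (\<chi> i. - (real n / 2)) (\<chi> i. real n / 2)"
proof -
  have "(\<forall>i. \<bar>x $ i\<bar> \<le> real n / 2) \<longleftrightarrow> (\<forall>i. - (real n / 2) \<le> x $ i \<and> x $ i \<le> real n / 2)" for x :: plane
    by (intro iff_allI) linarith
  then show ?thesis by (simp only: Lambda_def mem_box_cart set_eq_iff mem_Collect_eq vec_lambda_beta simp_thms)
qed

lemma Lambda_closed: "closed (Lambda n)" and Lambda_bounded: "bounded (Lambda n)"
  by (simp_all only: Lambda_cbox closed_cbox bounded_cbox)

lemma Lambda_borel [measurable]: "Lambda n \<in> sets borel"
  using Lambda_closed by (rule borel_closed)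

lemma wlow_measurable: "wlow \<in> borel_measurable config_algebra"
proof -
  have "(\<lambda>X. ((\<integral>\<^sup>+y. ennreal (tent S (real R) y) \<partial>X) - ((\<integral>\<^sup>+y. ennreal (tent S (real R) y) \<partial>lborel) + emeasure X (Lambda n))) / ennreal ((real n)\<^sup>2)) \<in> borel_measurable config_algebra" for S R n
  proof -
    have *: "(\<lambda>X. (F X - (c + H X)) / d) \<in> borel_measurable config_algebra"
      if "F \<in> borel_measurable config_algebra" "H \<in> borel_measurable config_algebra" for F H :: "plane measure \<Rightarrow> ennreal" and c d
      using that by measurable
    show ?thesis by (intro * nn_integral_config_measurable emeasure_config_measurable Lambda_borel) simp
  qed
  then have "gain n \<in> borel_measurable config_algebra" for n
    unfolding gain_def[abs_def] by (intro borel_measurable_SUP countable_adm) (auto simp: case_prod_beta')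
  then show ?thesis unfolding wlow_def[abs_def] by measurable
qed

lemma le_one_plus_powr: "x \<ge> 0 \<Longrightarrow> p \<ge> 1 \<Longrightarrow> x \<le> 1 + x powr p" for x p :: real
proof (cases "x \<le> 1")
  case False
  assume "p \<ge> 1"
  then have "x powr 1 \<le> x powr p" using False by (intro powr_mono) auto
  then show ?thesis using False by simp
qed (simp add: add_increasing2)

lemma nn_integral_tent_le:
  assumes "finite S" "R \<ge> 0"
  shows "(\<integral>\<^sup>+y. ennreal (tent S R y) \<partial>lborel) \<le> ennreal (real (card S) * (R * (pi * R\<^sup>2)))"
proof -
  have "(\<integral>\<^sup>+y. ennreal (tent S R y) \<partial>lborel) \<le> (\<integral>\<^sup>+y. (\<Sum>t\<in>S. ennreal R * indicator (cball t R) y) \<partial>lborel)"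
  proof (rule nn_integral_mono)
    fix y
    show "ennreal (tent S R y) \<le> (\<Sum>t\<in>S. ennreal R * indicator (cball t R) y)"
    proof (cases "tent S R y > 0")
      case True
      then obtain t where t: "t \<in> S" "dist y t < R" using tent_pos[OF assms(1)] by blast
      have "ennreal (tent S R y) \<le> ennreal R * indicator (cball t R) y"
        using tent_le[of S R y] t assms(2) by (auto simp: dist_commute indicator_def intro!: ennreal_leI)
      also have "\<dots> \<le> (\<Sum>t\<in>S. ennreal R * indicator (cball t R) y)"
        by (rule member_le_sum[OF t(1)]) (use assms in auto)
      finally show ?thesis .
    qed (simp add: not_less ennreal_neg)
  qed
  also have "\<dots> = (\<Sum>t\<in>S. \<integral>\<^sup>+y. ennreal R * indicator (cball t R) y \<partial>lborel)"
    by (rule nn_integral_sum) simp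
  also have "\<dots> = (\<Sum>t\<in>S. ennreal (R * (pi * R\<^sup>2)))"
    using assms(2) by (intro sum.cong refl) (simp add: nn_integral_cmult emeasure_cball_plane ennreal_mult[symmetric])
  also have "\<dots> = ennreal (real (card S) * (R * (pi * R\<^sup>2)))"
    using assms(2) by (simp add: ennreal_of_nat_eq_real_of_nat ennreal_mult[symmetric])
  finally show ?thesis .
qed

text \<open>Integrate the Lipschitz bound for the potential over the coupling, replacing each
  distance by 1 plus its \<open>p\<close>-th power; the marginals turn the first two terms into
  integrals over Lebesgue measure and \<open>X\<close>.\<close>

lemma kantorovich_bound:
  assumes X: "sets X = sets borel" and q: "q \<in> cpl X lborel" and p: "p \<ge> 1" and a: "(S, R) \<in> adm n"
  shows "(\<integral>\<^sup>+y. ennreal (tent S (real R) y) \<partial>X) \<le> (\<integral>\<^sup>+y. ennreal (tent S (real R) y) \<partial>lborel) + emeasure X (Lambda n)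
     + (\<integral>\<^sup>+z\<in>Lambda n \<times> UNIV. ennreal (dist (fst z) (snd z) powr p) \<partial>q)"
proof -
  let ?t = "tent S (real R)"
  have sq: "sets q = sets borel" using q by (simp add: cpl_def radon_measure_def)
  have f: "fst \<in> measurable q borel" and s: "snd \<in> measurable q borel"
    using measurable_cong_sets[OF sq refl, of "borel :: plane measure"] borel_measurable_continuous_onI[OF continuous_on_fst[OF continuous_on_id]] borel_measurable_continuous_onI[OF continuous_on_snd[OF continuous_on_id]]
    by (simp_all add: id_def)
  have dX: "distr q borel fst = X" and dL: "distr q borel snd = lborel" using q by (auto simp: cpl_def)
  note [measurable] = f s
  \<comment> \<open>Mass that starts outside \<open>Lambda n\<close> does not enter the cost, so the
    potential has to vanish there.\<close>
  have zero: "?t x = 0" if "x \<notin> Lambda n" for x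
  proof (rule ccontr)
    assume "?t x \<noteq> 0"
    then have "?t x > 0" using tent_nonneg[of S "real R" x] by linarith
    then obtain t where "t \<in> S" "dist x t < real R" using tent_pos[of S "real R" x] a by (auto simp: adm_def)
    then show False using a that by (auto simp: adm_def subset_eq dist_commute less_imp_le)
  qed
  have "(\<integral>\<^sup>+y. ennreal (?t y) \<partial>X) = (\<integral>\<^sup>+z. ennreal (?t (fst z)) \<partial>q)"
    unfolding dX[symmetric] by (rule nn_integral_distr) simp_all
  also have "\<dots> \<le> (\<integral>\<^sup>+z. ennreal (?t (snd z)) + indicator (Lambda n) (fst z) + ennreal (dist (fst z) (snd z) powr p) * indicator (Lambda n \<times> UNIV) z \<partial>q)"
  proof (rule nn_integral_mono)
    fix z :: "plane \<times> plane"
    show "ennreal (?t (fst z)) \<le> ennreal (?t (snd z)) + indicator (Lambda n) (fst z) + ennreal (dist (fst z) (snd z) powr p) * indicator (Lambda n \<times> UNIV) z"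
    proof (cases "fst z \<in> Lambda n")
      case True
      have "?t (fst z) \<le> ?t (snd z) + 1 + dist (fst z) (snd z) powr p"
        using tent_lipschitz[of S "real R" "fst z" "snd z"] le_one_plus_powr[OF _ p, of "dist (fst z) (snd z)"] by simp
      then have "ennreal (?t (fst z)) \<le> ennreal (?t (snd z) + 1 + dist (fst z) (snd z) powr p)" by (rule ennreal_leI)
      also have "\<dots> = ennreal (?t (snd z)) + 1 + ennreal (dist (fst z) (snd z) powr p)"
        by (simp add: tent_nonneg)
      finally show ?thesis using True by (cases z) simp
    next
      case False
      then have "?t (fst z) = 0" by (rule zero)
      then show ?thesis by simp
    qed
  qed
  also have "\<dots> = (\<integral>\<^sup>+z. ennreal (?t (snd z)) \<partial>q) + (\<integral>\<^sup>+z. indicator (Lambda n) (fst z) \<partial>q) + (\<integral>\<^sup>+z\<in>Lambda n \<times> UNIV. ennreal (dist (fst z) (snd z) powr p) \<partial>q)"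
  proof -
    have "{z \<in> space q. fst z \<in> Lambda n} \<in> sets q" by measurable
    moreover have "{z \<in> space q. fst z \<in> Lambda n} = Lambda n \<times> UNIV"
      using sets_eq_imp_space_eq[OF sq] by auto
    ultimately have [measurable]: "Lambda n \<times> UNIV \<in> sets q" by simp
    have m1: "(\<lambda>z. ennreal (?t (snd z))) \<in> borel_measurable q" by measurable
    have m2: "(\<lambda>z. indicator (Lambda n) (fst z) :: ennreal) \<in> borel_measurable q" by measurable
    have m3: "(\<lambda>z. ennreal (dist (fst z) (snd z) powr p) * indicator (Lambda n \<times> UNIV) z) \<in> borel_measurable q" by measurable
    show ?thesis using m1 m2 m3 by (simp only: nn_integral_add borel_measurable_add)
  qed
  also have "(\<integral>\<^sup>+z. ennreal (?t (snd z)) \<partial>q) = (\<integral>\<^sup>+y. ennreal (?t y) \<partial>lborel)"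
    unfolding dL[symmetric] by (rule nn_integral_distr[symmetric]) simp_all
  also have "(\<integral>\<^sup>+z. indicator (Lambda n) (fst z) \<partial>q) = emeasure X (Lambda n)"
  proof -
    have "(\<integral>\<^sup>+x. indicator (Lambda n) x \<partial>distr q borel fst) = (\<integral>\<^sup>+z. indicator (Lambda n) (fst z) \<partial>q)"
      by (rule nn_integral_distr[OF f]) simp
    then show ?thesis unfolding dX using X by simp
  qed
  finally show ?thesis .
qed

lemma ennpowr_inverse:
  assumes "p > 0" shows "ennpowr (ennpowr x (1 / p)) p = x"
  using assms by (cases x) (auto simp: ennpowr_def powr_powr)

lemma wlow_le:
  assumes X: "X \<in> configs" and p: "p \<ge> 1"
  shows "wlow X \<le> ennpowr (wasserstein p X lborel) p"
proof -
  have "wlow X \<le> transport_cost p q" if q: "q \<in> cpl X lborel" for q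
    unfolding wlow_def transport_cost_def
  proof (rule Limsup_mono, rule always_eventually, rule allI)
    fix n
    show "gain n X \<le> (\<integral>\<^sup>+z\<in>Lambda n \<times> UNIV. ennreal (dist (fst z) (snd z) powr p) \<partial>q) / ennreal ((real n)\<^sup>2)"
      unfolding gain_def
    proof (rule SUP_least, clarify)
      fix S R assume a: "(S, R) \<in> adm n"
      show "((\<integral>\<^sup>+y. ennreal (tent S (real R) y) \<partial>X) - ((\<integral>\<^sup>+y. ennreal (tent S (real R) y) \<partial>lborel) + emeasure X (Lambda n))) / ennreal ((real n)\<^sup>2)
        \<le> (\<integral>\<^sup>+z\<in>Lambda n \<times> UNIV. ennreal (dist (fst z) (snd z) powr p) \<partial>q) / ennreal ((real n)\<^sup>2)"
      proof (rule divide_right_mono_ennreal)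
        \<comment> \<open>Both subtracted terms are finite, so the subtraction in
          \<open>ennreal\<close> can be turned into an addition.\<close>
        have "(\<integral>\<^sup>+y. ennreal (tent S (real R) y) \<partial>lborel) < \<infinity>"
          using a by (intro le_less_trans[OF nn_integral_tent_le]) (auto simp: adm_def)
        moreover have "emeasure X (Lambda n) < \<infinity>"
          by (rule configs_emeasure_bounded[OF X Lambda_bounded Lambda_borel])
        ultimately show "(\<integral>\<^sup>+y. ennreal (tent S (real R) y) \<partial>X) - ((\<integral>\<^sup>+y. ennreal (tent S (real R) y) \<partial>lborel) + emeasure X (Lambda n))
          \<le> (\<integral>\<^sup>+z\<in>Lambda n \<times> UNIV. ennreal (dist (fst z) (snd z) powr p) \<partial>q)"
          using kantorovich_bound[OF sets_configs[OF X] q p a] unfolding ennreal_minus_le_iff by auto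
      qed
    qed
  qed
  then have "wlow X \<le> (INF q\<in>cpl X lborel. transport_cost p q)" by (rule INF_greatest)
  then show ?thesis using p by (simp add: wasserstein_def ennpowr_inverse)
qed

text \<open>Monotonicity of \<open>nn_integral\<close> holds for arbitrary functions, so it is
  enough to compare the integrand of \<open>Wass\<close> with the measurable
  \<open>wlow\<close>.\<close>

lemma Wass_infinite:
  assumes P: "space P = configs" and p: "p \<ge> 1" and inf: "(\<integral>\<^sup>+X. wlow X \<partial>P) = \<infinity>"
  shows "Wass p P = \<infinity>"
proof -
  have "(\<integral>\<^sup>+X. wlow X \<partial>P) \<le> (\<integral>\<^sup>+X. ennpowr (wasserstein p X lborel) p \<partial>P)"
    by (rule nn_integral_mono) (use wlow_le[OF _ p] P in auto)
  then have "(\<integral>\<^sup>+X. ennpowr (wasserstein p X lborel) p \<partial>P) = \<infinity>" using inf by (simp add: top_unique)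
  then show ?thesis by (simp add: Wass_def ennpowr_def)
qed

section \<open>The test potential for the second process\<close>

definition BK :: "nat \<Rightarrow> plane set" where "BK K = {b\<in>ZZ. \<forall>i. \<bar>b $ i\<bar> \<le> real K}"

lemma BK_image: "BK K = (\<lambda>f. \<chi> i. of_int (f i)) ` (UNIV \<rightarrow>\<^sub>E {- int K..int K})"
proof
  show "BK K \<subseteq> (\<lambda>f. \<chi> i. of_int (f i)) ` (UNIV \<rightarrow>\<^sub>E {- int K..int K})"
  proof
    fix b assume b: "b \<in> BK K"
    have "\<forall>i. \<exists>k. b $ i = of_int k" using b by (auto simp: BK_def ZZ_def Ints_def)
    then obtain f where f: "\<And>i. b $ i = of_int (f i)" by metis
    have "\<bar>b $ i\<bar> \<le> real K" for i using b by (simp add: BK_def)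
    then have "f i \<in> {- int K..int K}" for i unfolding f by (simp add: abs_le_iff) (metis abs_le_iff minus_le_iff of_int_abs of_int_le_iff of_int_of_nat_eq)
    moreover have "b = (\<chi> i. of_int (f i))" using f by (simp add: vec_eq_iff)
    ultimately show "b \<in> (\<lambda>f. \<chi> i. of_int (f i)) ` (UNIV \<rightarrow>\<^sub>E {- int K..int K})" by auto
  qed
  show "(\<lambda>f. \<chi> i. of_int (f i)) ` (UNIV \<rightarrow>\<^sub>E {- int K..int K}) \<subseteq> BK K"
  proof
    fix b :: plane assume "b \<in> (\<lambda>f. \<chi> i. of_int (f i)) ` (UNIV \<rightarrow>\<^sub>E {- int K..int K})"
    then obtain f where f: "b = (\<chi> i. of_int (f i))" "\<And>i. f i \<in> {- int K..int K}" by (auto simp: PiE_iff)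
    have "\<bar>f i\<bar> \<le> int K" for i using f(2)[of i] by auto
    then have "\<bar>real_of_int (f i)\<bar> \<le> real K" for i by (metis of_int_abs of_int_le_iff of_int_of_nat_eq)
    then show "b \<in> BK K" using f(1) by (simp add: BK_def ZZ_def)
  qed
qed

lemma finite_BK: "finite (BK K)" and card_BK: "card (BK K) = (2 * K + 1)\<^sup>2"
proof -
  show "finite (BK K)" unfolding BK_image by (intro finite_imageI finite_PiE) auto
  have inj: "inj_on (\<lambda>f. (\<chi> i. of_int (f i)) :: plane) (UNIV \<rightarrow>\<^sub>E {- int K..int K})"
    by (rule inj_onI) (simp add: vec_eq_iff fun_eq_iff)
  have "card (BK K) = card ((UNIV :: 2 set) \<rightarrow>\<^sub>E {- int K..int K})"
    unfolding BK_image by (rule card_image[OF inj])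
  also have "\<dots> = (2 * K + 1)\<^sup>2" by (simp add: card_PiE nat_add_distrib)
  finally show "card (BK K) = (2 * K + 1)\<^sup>2" .
qed

lemma BK_ZZ: "b \<in> BK K \<Longrightarrow> b \<in> ZZ" by (simp add: BK_def)

lemma in_BK:
  assumes "b \<in> ZZ" "\<And>i. \<bar>b $ i\<bar> < real K + 1" shows "b \<in> BK K"
proof -
  have "\<bar>b $ i\<bar> \<le> real K" for i
  proof -
    obtain k where k: "b $ i = of_int k" using assms(1) by (auto simp: ZZ_def Ints_def)
    have "\<bar>real_of_int k\<bar> < real K + 1" using assms(2)[of i] k by simp
    then have "real_of_int \<bar>k\<bar> < real_of_int (int K + 1)" by simp
    then have "\<bar>k\<bar> < int K + 1" by (simp only: of_int_less_iff)
    then have "real_of_int \<bar>k\<bar> \<le> real_of_int (int K)" by (simp only: of_int_le_iff)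
    then show ?thesis unfolding k by simp
  qed
  then show ?thesis using assms(1) by (simp add: BK_def)
qed

lemma nn_integral_ZZ_le:
  assumes "finite S" "S \<subseteq> ZZ" "\<And>b. b \<in> ZZ \<Longrightarrow> f b \<le> c * indicator S b"
  shows "(\<integral>\<^sup>+b. f b \<partial>count_space ZZ) \<le> c * of_nat (card S)"
proof -
  have "(\<integral>\<^sup>+b. f b \<partial>count_space ZZ) \<le> (\<integral>\<^sup>+b. c * indicator S b \<partial>count_space ZZ)"
    by (rule nn_integral_mono) (use assms in auto)
  also have "\<dots> = (\<Sum>b\<in>S. c * indicator S b)"
    by (rule nn_integral_count_space') (use assms in auto)
  also have "\<dots> = c * of_nat (card S)" by (simp add: mult.commute)
  finally show ?thesis .
qed

lemma nn_integral_ZZ_ge: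
  assumes "finite S" "S \<subseteq> ZZ" "\<And>b. b \<in> S \<Longrightarrow> c \<le> f b"
  shows "c * of_nat (card S) \<le> (\<integral>\<^sup>+b. f b \<partial>count_space ZZ)"
proof -
  have "c * of_nat (card S) = (\<Sum>b\<in>S. c * indicator S b)" by (simp add: mult.commute)
  also have "\<dots> = (\<integral>\<^sup>+b. c * indicator S b \<partial>count_space ZZ)"
    by (rule nn_integral_count_space'[symmetric]) (use assms in auto)
  also have "\<dots> \<le> (\<integral>\<^sup>+b. f b \<partial>count_space ZZ)"
    by (rule nn_integral_mono) (use assms in \<open>auto simp: indicator_def\<close>)
  finally show ?thesis .
qed

lemma Cell_comp: "x \<in> Cell \<Longrightarrow> 0 \<le> x $ i \<and> x $ i < 1" by (simp add: Cell_def)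

definition mmg :: "nat \<Rightarrow> nat" where "mmg j = 4 ^ j"

text \<open>The side of a window for the clusters with index in \<open>BK K\<close>: their sites
  have coordinates up to \<open>16 * mmg j * (K + 2)\<close>, and the remaining margin
  \<open>32 * mmg j\<close> holds the tents.\<close>

definition nng :: "nat \<Rightarrow> nat \<Rightarrow> nat" where "nng j K = 32 * mmg j * (K + 4)"

context
  fixes j K :: nat and w w' :: "plane \<times> (plane \<Rightarrow> plane)"
  assumes w: "w \<in> space Om" "w' \<in> space Om" and K3: "K \<ge> 3"
begin

abbreviation "mm \<equiv> mmg j"
abbreviation "nn \<equiv> nng j K"
definition "ctr b = (16 * real mm) *\<^sub>R (fst w' + b + snd w' b)"
text \<open>\<open>adm\<close> asks for rational centres. The error 1/4 is harmless, because the
  highest point of the segment is only \<open>mm - 1\<close> above its base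
  \<open>ctr b\<close>.\<close>

definition "rc b = (SOME t. t \<in> qpts \<and> dist t (ctr b) < 1 / 4)"
definition "SS = rc ` BK K"
text \<open>Twice the segment length: the potential is then at least \<open>mm\<close> at every
  point of the segment, while its Lebesgue integral is of order \<open>mm ^ 3\<close> per
  cluster.\<close>

definition "RR = 2 * mm"

lemma mm1: "mm \<ge> 1" by (simp add: mmg_def)

lemma rc: "rc b \<in> qpts" "dist (rc b) (ctr b) < 1 / 4"
proof -
  have "\<exists>t. t \<in> qpts \<and> dist t (ctr b) < 1 / 4" using qpts_dense[of "1/4" "ctr b"] by auto
  then have "rc b \<in> qpts \<and> dist (rc b) (ctr b) < 1 / 4" unfolding rc_def by (rule someI_ex)
  then show "rc b \<in> qpts" "dist (rc b) (ctr b) < 1 / 4" by auto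
qed

lemma adm_SS: "(SS, RR) \<in> adm nn"
proof -
  have "cball (rc b) (real RR) \<subseteq> Lambda nn" if b: "b \<in> BK K" for b
  proof
    fix y assume "y \<in> cball (rc b) (real RR)"
    then have d: "dist y (ctr b) \<le> 2 * real mm + 1 / 4"
      using rc(2)[of b] dist_triangle[of y "ctr b" "rc b"] by (simp add: RR_def dist_commute)
    have "\<bar>y $ i\<bar> \<le> real nn / 2" for i
    proof -
      define c where "c = fst w' $ i + b $ i + snd w' b $ i"
      have "\<bar>c\<bar> \<le> real K + 2"
        using Cell_comp[OF space_OmD(1)[OF w(2)], of i] Cell_comp[OF space_OmD(2)[OF w(2) BK_ZZ[OF b]], of i] b
        unfolding BK_def c_def by (auto simp: abs_le_iff) (smt (verit))+
      then have "\<bar>ctr b $ i\<bar> \<le> (16 * real mm) * (real K + 2)"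
        by (simp add: ctr_def c_def[symmetric] abs_mult mult_left_mono)
      moreover have "\<bar>y $ i - ctr b $ i\<bar> \<le> 2 * real mm + 1 / 4"
        using component_le_norm_cart[of "y - ctr b" i] d by (simp add: dist_norm)
      moreover have "real nn / 2 = 16 * real mm * (real K + 2) + 32 * real mm"
        by (simp add: nng_def algebra_simps)
      moreover have "real mm \<ge> 1" using mm1 by simp
      ultimately show ?thesis by linarith
    qed
    then show "y \<in> Lambda nn" by (simp add: Lambda_def)
  qed
  then show ?thesis using rc(1) finite_BK by (auto simp: adm_def SS_def)
qed

lemma finite_SS: "finite SS" using finite_BK by (simp add: SS_def)
lemma card_SS: "card SS \<le> card (BK K)" unfolding SS_def by (rule card_image_le[OF finite_BK])

abbreviation "tt \<equiv> tent SS (real RR)"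

lemma tt_H:
  assumes b: "b \<in> BK K" and i: "i < gn (Hs j)"
  shows "real mm \<le> tt (gpt (Hs j) w' (b, i))"
proof -
  have i1: "real (i div am j) \<le> real mm - 1"
  proof -
    have "i div am j < mm" using i am_bounds(3)[of j] by (simp add: div_less_iff_less_mult mult.commute mmg_def)
    then have "real (i div am j) + 1 \<le> real mm" by linarith
    then show ?thesis by simp
  qed
  have "gpt (Hs j) w' (b, i) = ctr b + vvec (real (i div am j))"
    by (simp add: gpt_def ctr_def mmg_def)
  then have "dist (gpt (Hs j) w' (b, i)) (ctr b) = real (i div am j)" by (simp add: dist_norm)
  then have "dist (gpt (Hs j) w' (b, i)) (rc b) \<le> real mm"
    using i1 rc(2)[of b] dist_triangle[of "gpt (Hs j) w' (b, i)" "rc b" "ctr b"] by (simp add: dist_commute)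
  moreover have "rc b \<in> SS" using b by (simp add: SS_def)
  ultimately show ?thesis using tent_ge[of "rc b" SS "real RR" "gpt (Hs j) w' (b, i)"] by (simp add: RR_def)
qed

lemma tent_H_ge:
  "ennreal (real (card (BK K)) * (real (am j) * real mm * real mm)) \<le> (\<integral>\<^sup>+y. ennreal (tt y) \<partial>conf (gidx (Hs j)) (gpt (Hs j) w'))"
proof -
  have "ennreal (real (am j) * real mm * real mm) * of_nat (card (BK K)) \<le> (\<integral>\<^sup>+b. (\<Sum>i<gn (Hs j). ennreal (tt (gpt (Hs j) w' (b, i)))) \<partial>count_space ZZ)"
  proof (rule nn_integral_ZZ_ge[OF finite_BK])
    show "BK K \<subseteq> ZZ" using BK_ZZ by auto
    fix b assume b: "b \<in> BK K"
    have "ennreal (real (am j) * real mm * real mm) = (\<Sum>i<gn (Hs j). ennreal (real mm))"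
      by (simp add: ennreal_of_nat_eq_real_of_nat ennreal_mult[symmetric] mmg_def)
    also have "\<dots> \<le> (\<Sum>i<gn (Hs j). ennreal (tt (gpt (Hs j) w' (b, i))))"
      by (intro sum_mono ennreal_leI tt_H[OF b]) simp
    finally show "ennreal (real (am j) * real mm * real mm) \<le> (\<Sum>i<gn (Hs j). ennreal (tt (gpt (Hs j) w' (b, i))))" .
  qed
  then show ?thesis
    by (simp add: nn_integral_conf nn_integral_gidx ennreal_of_nat_eq_real_of_nat ennreal_mult[symmetric] mult.commute)
qed

definition "Bx = BK (16 * mm * (K + 4) + 2)"

lemma nn_half: "real nn / 2 = real (16 * mm * (K + 4))" by (simp add: nng_def)

text \<open>The spacing of \<open>Gs j\<close> is at least 1, so the window is no larger in units of
  the spacing; the 2 in \<open>Bx\<close> accounts for the shift and the displacement.\<close>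

lemma Lambda_G:
  assumes b: "b \<in> ZZ" and x: "x \<in> Cell" and L: "gl (Gs j) *\<^sub>R (fst w + b + x) \<in> Lambda nn"
  shows "b \<in> Bx"
  unfolding Bx_def
proof (rule in_BK[OF b])
  fix i
  have "\<bar>gl (Gs j) * (fst w $ i + b $ i + x $ i)\<bar> \<le> real nn / 2"
    using L by (simp add: Lambda_def)
  then have "gl (Gs j) * \<bar>fst w $ i + b $ i + x $ i\<bar> \<le> real nn / 2"
    using gl_Gs(1)[of j] by (simp only: abs_mult abs_of_pos)
  moreover have "1 * \<bar>fst w $ i + b $ i + x $ i\<bar> \<le> gl (Gs j) * \<bar>fst w $ i + b $ i + x $ i\<bar>"
    by (rule mult_right_mono[OF gl_Gs(2)]) simp
  ultimately have "\<bar>fst w $ i + b $ i + x $ i\<bar> \<le> real (16 * mm * (K + 4))"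
    unfolding nn_half mult_1_left by (rule order_trans[rotated])
  then show "\<bar>b $ i\<bar> < real (16 * mm * (K + 4) + 2) + 1"
    using Cell_comp[OF space_OmD(1)[OF w(1)], of i] Cell_comp[OF x, of i] by linarith
qed

lemma card_Bx: "real (card Bx) \<le> 4 * (real nn)\<^sup>2"
proof -
  have "2 * (16 * mm * (K + 4) + 2) + 1 = nn + 5" by (simp add: nng_def)
  then have "card Bx = (nn + 5)\<^sup>2" by (simp add: Bx_def card_BK)
  moreover have "nn \<ge> 5"
  proof -
    have "32 \<le> 32 * mm" using mm1 by simp
    also have "32 * mm \<le> 32 * mm * (K + 4)" by simp
    finally show ?thesis unfolding nng_def by linarith
  qed
  then have "(nn + 5)\<^sup>2 \<le> (2 * nn)\<^sup>2" by (intro power_mono) auto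
  ultimately have "card Bx \<le> 4 * nn\<^sup>2" by (simp add: power_mult_distrib)
  then show ?thesis by (metis of_nat_le_iff of_nat_mult of_nat_numeral of_nat_power)
qed

text \<open>Each cell of the fine lattice contains its own point. The spacing is at most 2 and two
  points of the unit cell are within 2, so replacing the potential on a cell by its value at that
  point costs at most 4, on at most \<open>4 * nn\<^sup>2\<close> cells. The factor
  \<open>1 - eps j\<close> is the inverse area of a cell.\<close>

lemma tent_G:
  "(\<integral>\<^sup>+y. ennreal (tt y) \<partial>lborel) * ennreal (1 - eps j) \<le> (\<integral>\<^sup>+y. ennreal (tt y) \<partial>conf (gidx (Gs j)) (gpt (Gs j) w)) + ennreal (16 * (real nn)\<^sup>2)"
proof -
  let ?g = "gl (Gs j)"
  have g0: "?g \<noteq> 0" using gl_Gs(1)[of j] by (metis order_less_irrefl)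
  have "(\<integral>\<^sup>+y. ennreal (tt y) \<partial>lborel) * ennreal (1 - eps j) = (\<integral>\<^sup>+x. ennreal (tt (?g *\<^sub>R x)) \<partial>lborel)"
    using nn_integral_lborel_affine[OF _ g0, of "\<lambda>y. ennreal (tt y)" 0] unfolding gl_Gs(4) by (simp add: mult.commute)
  also have "\<dots> = (\<integral>\<^sup>+x. ennreal (tt (?g *\<^sub>R (x + fst w))) \<partial>lborel)"
    by (rule nn_integral_lborel_translate[symmetric]) measurable
  also have "\<dots> = (\<integral>\<^sup>+b. (\<integral>\<^sup>+u. ennreal (tt (?g *\<^sub>R (u + b + fst w))) \<partial>U) \<partial>count_space ZZ)"
    by (rule nn_integral_ZZ_U[symmetric]) measurable
  also have "\<dots> \<le> (\<integral>\<^sup>+b. ennreal (tt (gpt (Gs j) w (b, 0))) + 4 * indicator Bx b \<partial>count_space ZZ)"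
  proof (rule nn_integral_mono)
    fix b assume "b \<in> space (count_space ZZ)"
    then have b: "b \<in> ZZ" by simp
    have gp: "gpt (Gs j) w (b, 0) = ?g *\<^sub>R (fst w + b + snd w b)" by (simp add: gpt_def)
    have "(\<integral>\<^sup>+u. ennreal (tt (?g *\<^sub>R (u + b + fst w))) \<partial>U) \<le> (\<integral>\<^sup>+u. ennreal (tt (gpt (Gs j) w (b, 0))) + 4 * indicator Bx b \<partial>U)"
    proof (rule nn_integral_mono)
      fix u assume "u \<in> space U"
      then have u: "u \<in> Cell" by simp
      define y where "y = ?g *\<^sub>R (u + b + fst w)"
      show "ennreal (tt y) \<le> ennreal (tt (gpt (Gs j) w (b, 0))) + 4 * indicator Bx b"
      proof (cases "tt y > 0")
        case True
        then obtain t where t: "t \<in> SS" "dist y t < real RR" using tent_pos[OF finite_SS] by blast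
        then have "y \<in> Lambda nn" using adm_SS by (auto simp: adm_def subset_eq dist_commute less_imp_le)
        moreover have "y = ?g *\<^sub>R (fst w + b + u)" by (simp only: y_def ac_simps)
        ultimately have Bx: "b \<in> Bx" using Lambda_G[OF b u] by (simp only:)
        have v: "snd w b \<in> Cell" by (rule space_OmD(2)[OF w(1) b])
        have "norm (u - snd w b) \<le> 2"
          using norm_plane_le[of "u - snd w b"] Cell_comp[OF u, of 1] Cell_comp[OF u, of 2] Cell_comp[OF v, of 1] Cell_comp[OF v, of 2]
          by simp linarith
        then have "?g * norm (u - snd w b) \<le> 2 * 2"
          by (rule mult_mono[OF gl_Gs(3)]) auto
        moreover have "dist y (gpt (Gs j) w (b, 0)) = ?g * norm (u - snd w b)"
        proof -
          have "y - gpt (Gs j) w (b, 0) = ?g *\<^sub>R (u - snd w b)"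
            unfolding y_def gp by (simp only: scaleR_diff_right[symmetric]) (simp add: algebra_simps)
          then have "dist y (gpt (Gs j) w (b, 0)) = \<bar>?g\<bar> * norm (u - snd w b)" by (simp only: dist_norm norm_scaleR)
          then show ?thesis using gl_Gs(1)[of j] by (simp only: abs_of_pos)
        qed
        ultimately have "tt y \<le> tt (gpt (Gs j) w (b, 0)) + 4"
          using tent_lipschitz[of SS "real RR" y "gpt (Gs j) w (b, 0)"] by linarith
        then have "ennreal (tt y) \<le> ennreal (tt (gpt (Gs j) w (b, 0)) + 4)" by (rule ennreal_leI)
        then show ?thesis using Bx by (simp add: tent_nonneg)
      qed (simp add: not_less ennreal_neg)
    qed
    then show "(\<integral>\<^sup>+u. ennreal (tt (?g *\<^sub>R (u + b + fst w))) \<partial>U) \<le> ennreal (tt (gpt (Gs j) w (b, 0))) + 4 * indicator Bx b"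
      using U.emeasure_space_1 by simp
  qed
  also have "\<dots> = (\<integral>\<^sup>+b. ennreal (tt (gpt (Gs j) w (b, 0))) \<partial>count_space ZZ) + (\<integral>\<^sup>+b. 4 * indicator Bx b \<partial>count_space ZZ)"
    by (rule nn_integral_add) auto
  also have "\<dots> \<le> (\<integral>\<^sup>+y. ennreal (tt y) \<partial>conf (gidx (Gs j)) (gpt (Gs j) w)) + ennreal (16 * (real nn)\<^sup>2)"
  proof (rule add_mono)
    show "(\<integral>\<^sup>+b. ennreal (tt (gpt (Gs j) w (b, 0))) \<partial>count_space ZZ) \<le> (\<integral>\<^sup>+y. ennreal (tt y) \<partial>conf (gidx (Gs j)) (gpt (Gs j) w))"
      by (simp add: nn_integral_conf nn_integral_gidx)
    have "(\<integral>\<^sup>+b. 4 * indicator Bx b \<partial>count_space ZZ) \<le> 4 * of_nat (card Bx)"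
      by (rule nn_integral_ZZ_le) (auto simp: Bx_def finite_BK BK_ZZ)
    also have "\<dots> = ennreal (4 * real (card Bx))" by (simp add: ennreal_of_nat_eq_real_of_nat ennreal_mult)
    also have "\<dots> \<le> ennreal (16 * (real nn)\<^sup>2)" using card_Bx by (intro ennreal_leI) simp
    finally show "(\<integral>\<^sup>+b. 4 * indicator Bx b \<partial>count_space ZZ) \<le> ennreal (16 * (real nn)\<^sup>2)" .
  qed
  finally show ?thesis .
qed

lemma count_G: "emeasure (conf (gidx (Gs j)) (gpt (Gs j) w)) (Lambda nn) \<le> ennreal (4 * (real nn)\<^sup>2)"
proof -
  have "emeasure (conf (gidx (Gs j)) (gpt (Gs j) w)) (Lambda nn) = (\<integral>\<^sup>+b. indicator (Lambda nn) (gpt (Gs j) w (b, 0)) \<partial>count_space ZZ)"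
    unfolding emeasure_conf[OF Lambda_borel] nn_integral_gidx by simp
  also have "\<dots> \<le> 1 * of_nat (card Bx)"
  proof (rule nn_integral_ZZ_le)
    fix b assume b: "b \<in> ZZ"
    have "b \<in> Bx" if "gpt (Gs j) w (b, 0) \<in> Lambda nn"
    proof (rule Lambda_G[OF b space_OmD(2)[OF w(1) b]])
      have "gpt (Gs j) w (b, 0) = gl (Gs j) *\<^sub>R (fst w + b + snd w b)" by (simp add: gpt_def)
      then show "gl (Gs j) *\<^sub>R (fst w + b + snd w b) \<in> Lambda nn" using that by (simp only:)
    qed
    then show "indicator (Lambda nn) (gpt (Gs j) w (b, 0)) \<le> 1 * (indicator Bx b :: ennreal)"
      by (auto simp: indicator_def)
  qed (auto simp: Bx_def finite_BK BK_ZZ)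
  also have "\<dots> = ennreal (real (card Bx))" by (simp add: ennreal_of_nat_eq_real_of_nat)
  also have "\<dots> \<le> ennreal (4 * (real nn)\<^sup>2)" by (intro ennreal_leI card_Bx)
  finally show ?thesis .
qed

lemma count_H: "emeasure (conf (gidx (Hs j)) (gpt (Hs j) w')) (Lambda nn) \<le> ennreal (9 * real (card (BK K)) * (real (am j) * real mm))"
proof -
  have "emeasure (conf (gidx (Hs j)) (gpt (Hs j) w')) (Lambda nn) = (\<integral>\<^sup>+b. (\<Sum>i<gn (Hs j). indicator (Lambda nn) (gpt (Hs j) w' (b, i))) \<partial>count_space ZZ)"
    unfolding emeasure_conf[OF Lambda_borel] nn_integral_gidx by simp
  also have "\<dots> \<le> of_nat (gn (Hs j)) * of_nat (card (BK (K + 7)))"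
  proof (rule nn_integral_ZZ_le)
    fix b assume b: "b \<in> ZZ"
    have bk: "b \<in> BK (K + 7)" if i: "i < gn (Hs j)" and L: "gpt (Hs j) w' (b, i) \<in> Lambda nn" for i
    proof (rule in_BK[OF b])
      fix k
      define c where "c = fst w' $ k + b $ k + snd w' b $ k"
      have e: "gpt (Hs j) w' (b, i) $ k = 16 * real mm * c + vvec (real (i div am j)) $ k"
        by (simp add: gpt_def mmg_def c_def)
      have v: "\<bar>vvec (real (i div am j)) $ k\<bar> \<le> real mm"
      proof (rule order_trans[OF component_le_norm_cart])
        show "norm (vvec (real (i div am j))) \<le> real mm"
          using gc_Hs[OF i] by (simp only: Hs_sel mmg_def of_nat_power of_nat_numeral)
      qed
      have "\<bar>gpt (Hs j) w' (b, i) $ k\<bar> \<le> 16 * real mm * (real K + 4)"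
        using L by (simp add: Lambda_def nng_def mult.assoc)
      then have "\<bar>16 * real mm * c\<bar> \<le> 16 * real mm * (real K + 4) + real mm" using e v by linarith
      also have "\<dots> \<le> 16 * real mm * (real K + 5)" by (simp add: algebra_simps)
      finally have "16 * real mm * \<bar>c\<bar> \<le> 16 * real mm * (real K + 5)" by (simp add: abs_mult)
      then have "\<bar>c\<bar> \<le> real K + 5" using mm1 by (subst (asm) mult_le_cancel_left_pos) auto
      then show "\<bar>b $ k\<bar> < real (K + 7) + 1"
        using Cell_comp[OF space_OmD(1)[OF w(2)], of k] Cell_comp[OF space_OmD(2)[OF w(2) b], of k] unfolding c_def by simp linarith
    qed
    show "(\<Sum>i<gn (Hs j). indicator (Lambda nn) (gpt (Hs j) w' (b, i))) \<le> of_nat (gn (Hs j)) * (indicator (BK (K + 7)) b :: ennreal)"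
    proof (cases "b \<in> BK (K + 7)")
      case True
      have "(\<Sum>i<gn (Hs j). indicator (Lambda nn) (gpt (Hs j) w' (b, i))) \<le> (\<Sum>i<gn (Hs j). 1 :: ennreal)"
        by (intro sum_mono) (simp add: indicator_def)
      then show ?thesis using True by simp
    next
      case False
      then have "(\<Sum>i<gn (Hs j). indicator (Lambda nn) (gpt (Hs j) w' (b, i))) = (0 :: ennreal)"
        using bk by (intro sum.neutral) (auto simp: indicator_def)
      then show ?thesis by simp
    qed
  qed (auto simp: finite_BK BK_ZZ)
  also have "\<dots> = ennreal (real (gn (Hs j)) * real (card (BK (K + 7))))"
    by (simp only: ennreal_of_nat_eq_real_of_nat ennreal_mult of_nat_0_le_iff)
  also have "\<dots> \<le> ennreal (9 * real (card (BK K)) * (real (am j) * real mm))"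
  proof (rule ennreal_leI)
    \<comment> \<open>\<open>2 * K + 15 \<le> 3 * (2 * K + 1)\<close> is equivalent to
      \<open>K \<ge> 3\<close>.\<close>
    have "(2 * (K + 7) + 1)\<^sup>2 \<le> (3 * (2 * K + 1))\<^sup>2" using K3 by (intro power_mono) auto
    then have "card (BK (K + 7)) \<le> 9 * card (BK K)" by (simp only: card_BK power_mult_distrib) simp
    then have "real (card (BK (K + 7))) \<le> 9 * real (card (BK K))" by linarith
    then have "real (gn (Hs j)) * real (card (BK (K + 7))) \<le> real (gn (Hs j)) * (9 * real (card (BK K)))" by (rule mult_left_mono) simp
    then show "real (gn (Hs j)) * real (card (BK (K + 7))) \<le> 9 * real (card (BK K)) * (real (am j) * real mm)"
      by (simp add: mmg_def mult_ac)
  qed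
  finally show ?thesis .
qed

text \<open>The clusters contribute at least \<open>N * a * m\<^sup>2\<close>. The fine lattice
  balances the Lebesgue integral, up to an error of order \<open>n\<^sup>2\<close>, except for the
  fraction \<open>eps j\<close>, which is at most \<open>N * 32 * m ^ 3 * a / (256 * m)\<close>, an
  eighth of the gain. The remaining losses are of order \<open>n\<^sup>2\<close>, whereas
  \<open>N * m\<^sup>2 \<ge> n\<^sup>2 / 1024\<close>.\<close>

lemma gain_ge: "ennreal (real (am j) / 2048 - 30) \<le> gain nn (sconf (Gs j) (Hs j) (w, w'))"
proof -
  define N where "N = real (card (BK K))"
  define a where "a = real (am j)"
  define m where "m = real mm"
  define n where "n = real nn"
  define A where "A = (\<integral>\<^sup>+y. ennreal (tt y) \<partial>conf (gidx (Gs j)) (gpt (Gs j) w))"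
  define B where "B = (\<integral>\<^sup>+y. ennreal (tt y) \<partial>conf (gidx (Hs j)) (gpt (Hs j) w'))"
  define Lb where "Lb = (\<integral>\<^sup>+y. ennreal (tt y) \<partial>lborel)"
  define E where "E = emeasure (sconf (Gs j) (Hs j) (w, w')) (Lambda nn)"
  have m1: "m \<ge> 1" using mm1 by (simp add: m_def)
  have a0: "a \<ge> 0" by (simp add: a_def)
  have N0: "N \<ge> 0" by (simp add: N_def)
  have epsm: "eps j = a / (256 * m)" by (simp add: eps_def a_def m_def mmg_def)
  have nm: "n = 32 * m * (real K + 4)" by (simp add: n_def nng_def m_def)
  have Nv: "N = (2 * real K + 1)\<^sup>2" by (simp add: N_def card_BK)
  have n0: "n > 0" using m1 by (simp add: nm add_pos_pos)
  have Nlow: "N * m\<^sup>2 \<ge> n\<^sup>2 / 1024"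
  proof -
    have "(real K + 4)\<^sup>2 \<le> N" unfolding Nv using K3 by (intro power_mono) auto
    then have "(real K + 4)\<^sup>2 * m\<^sup>2 \<le> N * m\<^sup>2" by (rule mult_right_mono) simp
    moreover have "n\<^sup>2 / 1024 = (real K + 4)\<^sup>2 * m\<^sup>2" by (simp add: nm power_mult_distrib)
    ultimately show ?thesis by simp
  qed
  have Nup: "9 * N * (a * m) \<le> n\<^sup>2"
  proof -
    have "N \<le> (2 * (real K + 4))\<^sup>2" unfolding Nv by (intro power_mono) auto
    also have "\<dots> = n\<^sup>2 / (256 * m\<^sup>2)" unfolding nm power_mult_distrib using m1 by simp
    finally have "9 * N * (a * m) \<le> 9 * (n\<^sup>2 / (256 * m\<^sup>2)) * (a * m)" using a0 m1 by (intro mult_right_mono mult_left_mono) auto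
    also have "\<dots> = (9 * eps j) * n\<^sup>2" using m1 by (simp add: epsm power2_eq_square)
    also have "\<dots> \<le> 1 * n\<^sup>2" using eps_bounds[of j] by (intro mult_right_mono) auto
    finally show ?thesis by simp
  qed
  have T: "(\<integral>\<^sup>+y. ennreal (tt y) \<partial>sconf (Gs j) (Hs j) (w, w')) = A + B"
    by (simp add: nn_integral_sconf A_def B_def)
  have hB: "ennreal (N * (a * m * m)) \<le> B" using tent_H_ge by (simp add: B_def N_def a_def m_def)
  have hA: "Lb * ennreal (1 - eps j) \<le> A + ennreal (16 * n\<^sup>2)" using tent_G by (simp add: A_def Lb_def n_def)
  have hL: "Lb \<le> ennreal (N * (32 * m ^ 3))"
  proof -
    have "Lb \<le> ennreal (real (card SS) * (real RR * (pi * (real RR)\<^sup>2)))"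
      unfolding Lb_def by (rule nn_integral_tent_le[OF finite_SS]) simp
    also have "\<dots> \<le> ennreal (N * (32 * m ^ 3))"
    proof (rule ennreal_leI, rule mult_mono)
      show "real (card SS) \<le> N" using card_SS by (simp add: N_def)
      have "real RR * (pi * (real RR)\<^sup>2) = pi * (8 * m ^ 3)" by (simp add: RR_def m_def power2_eq_square power3_eq_cube)
      also have "\<dots> \<le> 4 * (8 * m ^ 3)" using pi_less_4 m1 by (intro mult_right_mono) auto
      finally show "real RR * (pi * (real RR)\<^sup>2) \<le> 32 * m ^ 3" by simp
    qed (use N0 in auto)
    finally show ?thesis .
  qed
  have hE: "E \<le> ennreal (5 * n\<^sup>2)"
  proof -
    have "E \<le> ennreal (4 * n\<^sup>2) + ennreal (9 * N * (a * m))"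
      unfolding E_def emeasure_sconf[OF Lambda_borel] using count_G count_H
      by (auto simp: n_def N_def a_def m_def intro!: add_mono)
    also have "\<dots> \<le> ennreal (4 * n\<^sup>2) + ennreal (n\<^sup>2)" using Nup by (intro add_mono ennreal_leI) auto
    also have "\<dots> = ennreal (5 * n\<^sup>2)" by (subst ennreal_plus[symmetric]) auto
    finally show ?thesis .
  qed
  have hLb: "Lb \<le> A + ennreal (16 * n\<^sup>2 + N * (a * m * m) / 8)"
  proof -
    have "Lb = Lb * ennreal (1 - eps j) + Lb * ennreal (eps j)"
      using eps_bounds[of j] by (simp add: distrib_left[symmetric] ennreal_plus[symmetric] del: ennreal_plus)
    also have "\<dots> \<le> (A + ennreal (16 * n\<^sup>2)) + ennreal (N * (32 * m ^ 3)) * ennreal (eps j)"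
      by (intro add_mono hA mult_right_mono hL) simp
    also have "ennreal (N * (32 * m ^ 3)) * ennreal (eps j) = ennreal (N * (a * m * m) / 8)"
      using m1 N0 eps_bounds[of j] by (subst ennreal_mult[symmetric]) (auto simp: epsm power3_eq_cube mult.assoc)
    finally show ?thesis using N0 a0 m1 by (simp add: add.assoc)
  qed
  \<comment> \<open>Half of \<open>a / 1024\<close> leaves room for the eighth lost in
    \<open>hLb\<close>, and 30 exceeds the sum \<open>16 + 5\<close> of the other errors.\<close>
  define g where "g = a / 2048 - 30"
  have main: "ennreal (n\<^sup>2 * g) \<le> (A + B) - (Lb + E)"
  proof (cases "g \<le> 0")
    case True
    then have "n\<^sup>2 * g \<le> 0" by (simp add: mult_nonneg_nonpos)
    then show ?thesis by (simp add: ennreal_neg)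
  next
    case False
    have "ennreal (n\<^sup>2 * g) + (Lb + E) \<le> ennreal (n\<^sup>2 * g) + ((A + ennreal (16 * n\<^sup>2 + N * (a * m * m) / 8)) + ennreal (5 * n\<^sup>2))"
      by (intro add_mono hLb hE order_refl)
    also have "\<dots> = A + ennreal (n\<^sup>2 * g + (16 * n\<^sup>2 + N * (a * m * m) / 8) + 5 * n\<^sup>2)"
    proof -
      have "ennreal x + ((A + ennreal y) + ennreal z) = A + ennreal (x + y + z)" if "0 \<le> x" "0 \<le> y" "0 \<le> z" for x y z
        using that by (simp add: ac_simps)
      then show ?thesis by this (use False N0 a0 m1 in auto)
    qed
    also have "\<dots> \<le> A + ennreal (N * (a * m * m))"
    proof (intro add_mono order_refl ennreal_leI)
      have "n\<^sup>2 / 1024 * a \<le> N * m\<^sup>2 * a" using Nlow a0 by (rule mult_right_mono)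
      then have 1: "n\<^sup>2 * a / 1024 \<le> N * (a * m * m)" by (simp add: power2_eq_square mult_ac)
      have "n\<^sup>2 * g = n\<^sup>2 * a / 2048 - 30 * n\<^sup>2" by (simp add: g_def algebra_simps)
      moreover have "0 \<le> n\<^sup>2" "0 \<le> N * (a * m * m)" using N0 a0 m1 by auto
      ultimately show "n\<^sup>2 * g + (16 * n\<^sup>2 + N * (a * m * m) / 8) + 5 * n\<^sup>2 \<le> N * (a * m * m)"
        using 1 by linarith
    qed
    also have "\<dots> \<le> A + B" by (intro add_mono order_refl hB)
    finally show ?thesis unfolding ennreal_le_minus_iff by simp
  qed
  have "ennreal g = ennreal (n\<^sup>2 * g) / ennreal (n\<^sup>2)"
  proof (cases "g \<ge> 0")
    case True
    then show ?thesis using n0 by (simp add: divide_ennreal)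
  next
    case False
    then have "n\<^sup>2 * g \<le> 0" by (simp add: mult_nonneg_nonpos)
    then show ?thesis using False by (simp add: ennreal_neg)
  qed
  also have "\<dots> \<le> ((A + B) - (Lb + E)) / ennreal (n\<^sup>2)" by (rule divide_right_mono_ennreal[OF main])
  also have "\<dots> \<le> gain nn (sconf (Gs j) (Hs j) (w, w'))"
    unfolding gain_def using adm_SS
    by (intro SUP_upper2[of "(SS, RR)"]) (simp_all add: T Lb_def E_def n_def)
  finally show ?thesis by (simp add: g_def a_def)
qed

end

text \<open>\<open>gain_ge\<close> applies to special window sizes, one for each
  \<open>K \<ge> 3\<close>; a limsup is bounded below along this subsequence.\<close>

lemma wlow_ge:
  assumes w: "w \<in> space Om2"
  shows "ennreal (real (am j) / 2048 - 30) \<le> wlow (sconf (Gs j) (Hs j) w)"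
proof -
  have w': "fst w \<in> space Om" "snd w \<in> space Om" using w by (auto simp: space_pair_measure)
  define r where "r K = 32 * 4 ^ j * ((K + 3) + 4)" for K :: nat
  have r: "strict_mono r" by (rule strict_monoI) (simp add: r_def)
  have ge: "ennreal (real (am j) / 2048 - 30) \<le> gain (r K) (sconf (Gs j) (Hs j) w)" for K
    using gain_ge[OF w', of "K + 3" j] by (simp add: r_def nng_def mmg_def)
  have "ennreal (real (am j) / 2048 - 30) \<le> limsup ((\<lambda>n. gain n (sconf (Gs j) (Hs j) w)) \<circ> r)"
    by (rule order_trans[OF _ Liminf_le_Limsup]) (auto intro!: Liminf_bounded always_eventually ge)
  also have "\<dots> \<le> wlow (sconf (Gs j) (Hs j) w)"
    unfolding wlow_def by (rule limsup_subseq_mono[OF r])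
  finally show ?thesis .
qed

lemma nn_integral_wlow_P2: "(\<integral>\<^sup>+X. wlow X \<partial>P2) = \<infinity>"
proof -
  \<comment> \<open>Since \<open>61440 = 2048 * 30\<close>, the cut-off at 0 and the subtracted
    constant cost only a finite amount of the infinite mean of \<open>am\<close>.\<close>
  have "(\<integral>\<^sup>+j. ennreal (real (am j)) \<partial>measure_pmf J2) \<le> (\<integral>\<^sup>+j. 2048 * ennreal (real (am j) / 2048 - 30) + ennreal 61440 \<partial>measure_pmf J2)"
  proof (rule nn_integral_mono)
    fix j
    have "ennreal (real (am j)) \<le> ennreal (2048 * max 0 (real (am j) / 2048 - 30) + 61440)" by (intro ennreal_leI) (simp add: max_def)
    also have "\<dots> = 2048 * ennreal (max 0 (real (am j) / 2048 - 30)) + ennreal 61440" by (simp add: ennreal_mult)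
    finally show "ennreal (real (am j)) \<le> 2048 * ennreal (real (am j) / 2048 - 30) + ennreal 61440" by simp
  qed
  also have "\<dots> = 2048 * (\<integral>\<^sup>+j. ennreal (real (am j) / 2048 - 30) \<partial>measure_pmf J2) + ennreal 61440"
    by (simp add: nn_integral_add nn_integral_cmult measure_pmf.emeasure_space_1)
  finally have "(\<integral>\<^sup>+j. ennreal (real (am j) / 2048 - 30) \<partial>measure_pmf J2) = \<infinity>"
    unfolding nn_integral_J2_am by (simp add: top_unique ennreal_mult_eq_top_iff)
  moreover have "(\<integral>\<^sup>+j. ennreal (real (am j) / 2048 - 30) \<partial>measure_pmf J2) \<le> (\<integral>\<^sup>+j. (\<integral>\<^sup>+w. wlow (sconf (Gs j) (Hs j) w) \<partial>Om2) \<partial>measure_pmf J2)"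
  proof (rule nn_integral_mono)
    fix j
    have "ennreal (real (am j) / 2048 - 30) = (\<integral>\<^sup>+w. ennreal (real (am j) / 2048 - 30) \<partial>Om2)" using Om2.emeasure_space_1 by simp
    also have "\<dots> \<le> (\<integral>\<^sup>+w. wlow (sconf (Gs j) (Hs j) w) \<partial>Om2)" by (intro nn_integral_mono wlow_ge)
    finally show "ennreal (real (am j) / 2048 - 30) \<le> (\<integral>\<^sup>+w. wlow (sconf (Gs j) (Hs j) w) \<partial>Om2)" .
  qed
  moreover have "\<dots> = (\<integral>\<^sup>+X. wlow X \<partial>P2)"
    unfolding P2_def by (rule nn_integral_mix[OF gl_Gs(1) gl_Hs wlow_measurable, symmetric])
  ultimately show ?thesis by (simp add: top_unique)
qed

lemma Wass_P2: "p \<ge> 1 \<Longrightarrow> Wass p P2 = \<infinity>"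
proof (rule Wass_infinite[OF _ _ nn_integral_wlow_P2])
  show "space P2 = configs" by (simp add: P2_def mix_def space_config_algebra)
qed

section \<open>The clustered lattices\<close>

lemma sigma_finite_configs:
  assumes X: "X \<in> configs" shows "sigma_finite_measure X"
proof
  show "\<exists>A. countable A \<and> A \<subseteq> sets X \<and> \<Union> A = space X \<and> (\<forall>a\<in>A. emeasure X a \<noteq> \<infinity>)"
  proof (intro exI conjI ballI)
    show "countable (range (\<lambda>n::nat. cball (0::plane) (real n)))" by simp
    show "range (\<lambda>n::nat. cball (0::plane) (real n)) \<subseteq> sets X" by (auto simp: sets_configs[OF X])
    show "\<Union> (range (\<lambda>n::nat. cball (0::plane) (real n))) = space X"
      using real_arch_simple by (auto simp: space_configs[OF X])
    fix a assume "a \<in> range (\<lambda>n::nat. cball (0::plane) (real n))"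
    then show "emeasure X a \<noteq> \<infinity>"
      using configs_emeasure_bounded[OF X bounded_cball cball_borel] by (metis image_iff less_irrefl)
  qed
qed

definition gcell :: "real \<Rightarrow> plane \<Rightarrow> plane set" where "gcell L b = {y. y /\<^sub>R L - b \<in> Cell}"

lemma gcell_borel [measurable]: "gcell L b \<in> sets borel"
proof -
  have "gcell L b = {y\<in>space borel. y /\<^sub>R L - b \<in> Cell}" by (simp add: gcell_def)
  also have "\<dots> \<in> sets borel" by measurable
  finally show ?thesis .
qed

lemma emeasure_gcell:
  assumes "L > 0" shows "emeasure lborel (gcell L b) = ennreal (L\<^sup>2)"
proof -
  have "emeasure lborel (gcell L b) = (\<integral>\<^sup>+y. indicator Cell (- b + (1 / L) *\<^sub>R y) \<partial>lborel)"
  proof -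
    have "emeasure lborel (gcell L b) = (\<integral>\<^sup>+y. indicator (gcell L b) y \<partial>lborel)" by simp
    also have "\<dots> = (\<integral>\<^sup>+y. indicator Cell (- b + (1 / L) *\<^sub>R y) \<partial>lborel)"
      by (intro nn_integral_cong) (simp add: gcell_def indicator_def inverse_eq_divide)
    finally show ?thesis .
  qed
  also have "\<dots> = ennreal (1 / (1 / L)\<^sup>2) * 1"
    using nn_integral_lborel_affine[of "indicator Cell" "1 / L" "- b"] assms by simp
  finally show ?thesis by (simp add: power_divide)
qed

lemma gcell_iff: "b \<in> ZZ \<Longrightarrow> y \<in> gcell L b \<longleftrightarrow> b = flr (y /\<^sub>R L)"
  by (simp add: gcell_def Cell_iff_flr)

text \<open>Each point is spread uniformly over its own cell. Every cell holds mass equal to its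
  area, so the images add up to Lebesgue measure. Distances are at most \<open>2 * L\<close>, and
  mass that starts in \<open>Lambda n\<close> ends in a box enlarged by \<open>L\<close>, of area at
  most \<open>4 * n\<^sup>2\<close> once \<open>n \<ge> 2 * L\<close>.\<close>

lemma cell_transport:
  assumes X: "X \<in> configs" and L: "L > 0"
    and c: "\<And>b. b \<in> ZZ \<Longrightarrow> emeasure X (gcell L b) = ennreal (L\<^sup>2)"
  shows "(INF q\<in>cpl X lborel. transport_cost 2 q) \<le> ennreal (16 * L\<^sup>2)"
proof -
  interpret X: sigma_finite_measure X by (rule sigma_finite_configs[OF X])
  interpret P: pair_sigma_finite X lborel ..
  have sX [measurable_cong]: "sets X = sets borel" by (rule sets_configs[OF X])
  \<comment> \<open>Constant on pairs of points in a common cell and 0 elsewhere; this symmetry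
    yields both marginals.\<close>
  define h where "h = (\<lambda>z::plane\<times>plane. indicator (gcell L (flr (fst z /\<^sub>R L))) (snd z) / ennreal (L\<^sup>2))"
  have hm [measurable]: "h \<in> borel_measurable (X \<Otimes>\<^sub>M lborel)"
  proof -
    have "h = (\<lambda>z. indicator Cell (snd z /\<^sub>R L - flr (fst z /\<^sub>R L)) / ennreal (L\<^sup>2))"
      by (auto simp: h_def gcell_def indicator_def)
    then show ?thesis by simp
  qed
  define q where "q = density (X \<Otimes>\<^sub>M lborel) h"
  have L2: "ennreal (L\<^sup>2) \<noteq> 0" "ennreal (L\<^sup>2) \<noteq> \<top>" using L by auto
  have sq: "sets q = sets borel"
  proof -
    have "sets q = sets (X \<Otimes>\<^sub>M lborel)" by (simp add: q_def)
    also have "\<dots> = sets (borel \<Otimes>\<^sub>M borel :: (plane \<times> plane) measure)" using sX by (intro sets_pair_measure_cong) auto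
    finally show ?thesis unfolding borel_prod .
  qed
  have int1: "(\<integral>\<^sup>+y. h (x, y) \<partial>lborel) = 1" for x
    unfolding h_def using L2 by (simp add: nn_integral_divide emeasure_gcell[OF L] ennreal_divide_self)
  have int2: "(\<integral>\<^sup>+x. h (x, y) \<partial>X) = 1" for y
  proof -
    have "(\<integral>\<^sup>+x. h (x, y) \<partial>X) = (\<integral>\<^sup>+x. indicator (gcell L (flr (y /\<^sub>R L))) x / ennreal (L\<^sup>2) \<partial>X)"
      unfolding h_def by (intro nn_integral_cong) (auto simp: indicator_def gcell_iff)
    also have "\<dots> = 1"
    proof -
      have "gcell L (flr (y /\<^sub>R L)) \<in> sets X" using sX by simp
      then have "(\<integral>\<^sup>+x. indicator (gcell L (flr (y /\<^sub>R L))) x / ennreal (L\<^sup>2) \<partial>X) = emeasure X (gcell L (flr (y /\<^sub>R L))) / ennreal (L\<^sup>2)"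
        by (simp only: nn_integral_divide borel_measurable_indicator nn_integral_indicator)
      then show ?thesis using L2 c[OF flr_in_ZZ, of "y /\<^sub>R L"] by (simp add: ennreal_divide_self)
    qed
    finally show ?thesis .
  qed
  have nq: "(\<integral>\<^sup>+z. f z \<partial>q) = (\<integral>\<^sup>+z. h z * f z \<partial>(X \<Otimes>\<^sub>M lborel))" if "f \<in> borel_measurable (X \<Otimes>\<^sub>M lborel)" for f
    unfolding q_def using that by (intro nn_integral_density) simp_all
  have f: "fst \<in> measurable q borel" and s: "snd \<in> measurable q borel"
  proof -
    have "fst \<in> measurable (X \<Otimes>\<^sub>M lborel) X" by (rule measurable_fst)
    then have "fst \<in> measurable (X \<Otimes>\<^sub>M lborel) borel"
      using measurable_cong_sets[OF refl sX, of "X \<Otimes>\<^sub>M lborel"] by blast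
    then show "fst \<in> measurable q borel" unfolding q_def by simp
    have "snd \<in> measurable (X \<Otimes>\<^sub>M lborel) borel" by simp
    then show "snd \<in> measurable q borel" unfolding q_def by simp
  qed
  have e1: "emeasure (distr q borel fst) A = emeasure X A" if A: "A \<in> sets borel" for A
  proof -
    have [measurable]: "A \<in> sets X" unfolding sX by (rule A)
    have "emeasure (distr q borel fst) A = (\<integral>\<^sup>+z. indicator A (fst z) \<partial>q)"
      using A nn_integral_distr[OF f, of "indicator A"] by simp
    also have "\<dots> = (\<integral>\<^sup>+x. (\<integral>\<^sup>+y. h (x, y) * indicator A x \<partial>lborel) \<partial>X)"
      by (subst nq) (simp_all add: lborel.nn_integral_fst[symmetric])
    also have "\<dots> = (\<integral>\<^sup>+x. indicator A x \<partial>X)"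
      by (intro nn_integral_cong) (simp add: nn_integral_multc int1)
    finally show ?thesis by simp
  qed
  have e2: "emeasure (distr q borel snd) A = emeasure lborel A" if A: "A \<in> sets borel" for A
  proof -
    have [measurable]: "A \<in> sets borel" using A .
    have m: "(\<lambda>(x, y). h (x, y) * indicator A y) \<in> borel_measurable (X \<Otimes>\<^sub>M lborel)" by measurable
    have "emeasure (distr q borel snd) A = (\<integral>\<^sup>+z. indicator A (snd z) \<partial>q)"
      using A nn_integral_distr[OF s, of "indicator A"] by simp
    also have "\<dots> = (\<integral>\<^sup>+x. (\<integral>\<^sup>+y. h (x, y) * indicator A y \<partial>lborel) \<partial>X)"
      by (subst nq) (simp_all add: lborel.nn_integral_fst[symmetric])
    also have "\<dots> = (\<integral>\<^sup>+y. (\<integral>\<^sup>+x. h (x, y) * indicator A y \<partial>X) \<partial>lborel)"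
      by (rule P.Fubini'[OF m, symmetric])
    also have "\<dots> = (\<integral>\<^sup>+y. indicator A y \<partial>lborel)"
      by (intro nn_integral_cong) (simp add: nn_integral_multc int2)
    finally show ?thesis by simp
  qed
  have d1: "distr q borel fst = X" by (rule measure_eqI) (use e1 sX in auto)
  have d2: "distr q borel snd = lborel" by (rule measure_eqI) (use e2 in auto)
  have rad: "radon_measure q"
    unfolding radon_measure_def
  proof (intro conjI allI impI sq)
    fix K :: "(plane \<times> plane) set" assume K: "compact K"
    then have K1: "compact (fst ` K)" by (intro compact_continuous_image continuous_on_fst continuous_on_id)
    then have b1: "fst ` K \<in> sets borel" by (simp add: borel_compact)
    have "emeasure q K \<le> emeasure q (fst -` (fst ` K) \<inter> space q)"
      using measurable_sets[OF f b1] sets_eq_imp_space_eq[OF sq] by (intro emeasure_mono) auto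
    also have "\<dots> = emeasure (distr q borel fst) (fst ` K)" by (rule emeasure_distr[OF f b1, symmetric])
    also have "\<dots> < \<infinity>" unfolding d1 by (rule configs_emeasure_bounded[OF X compact_imp_bounded[OF K1] b1])
    finally show "emeasure q K < \<infinity>" .
  qed
  have q: "q \<in> cpl X lborel" using rad d1 d2 by (simp add: cpl_def)
  have comp: "\<bar>x $ i - y $ i\<bar> \<le> L" and dist: "dist x y \<le> 2 * L" if "flr (x /\<^sub>R L) = flr (y /\<^sub>R L)" for x y i
  proof -
    define b where "b = flr (x /\<^sub>R L)"
    have x: "x /\<^sub>R L - b \<in> Cell" by (simp add: b_def)
    have y: "y /\<^sub>R L - b \<in> Cell" unfolding b_def that by simp
    have 1: "\<bar>x $ i / L - y $ i / L\<bar> \<le> 1" for i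
    proof -
      have "(x /\<^sub>R L - b) $ i = x $ i / L - b $ i" "(y /\<^sub>R L - b) $ i = y $ i / L - b $ i"
        by (simp_all add: inverse_eq_divide)
      then show ?thesis using Cell_comp[OF x, of i] Cell_comp[OF y, of i] by linarith
    qed
    show c: "\<bar>x $ i - y $ i\<bar> \<le> L" for i
      using 1[of i] L by (simp add: diff_divide_distrib[symmetric])
    show "dist x y \<le> 2 * L" using norm_plane_le[of "x - y"] c[of 1] c[of 2] by (simp add: dist_norm)
  qed
  have cost: "(\<integral>\<^sup>+z\<in>Lambda n \<times> UNIV. ennreal (dist (fst z) (snd z) powr 2) \<partial>q) / ennreal ((real n)\<^sup>2) \<le> ennreal (16 * L\<^sup>2)"
    if n: "real n \<ge> 2 * L" for n
  proof -
    define B where "B = cbox (\<chi> i. - (real n / 2 + L)) ((\<chi> i. real n / 2 + L) :: plane)"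
    have Bv: "emeasure lborel B = ennreal ((real n + 2 * L)\<^sup>2)"
    proof -
      have "(\<Prod>b\<in>Basis. ((\<chi> i. real n / 2 + L) - (\<chi> i. - (real n / 2 + L)) :: plane) \<bullet> b) = (\<Prod>b\<in>(Basis :: plane set). real n + 2 * L)"
        by (rule prod.cong) (auto simp: Basis_vec_def inner_axis)
      moreover have "\<forall>b\<in>Basis. ((\<chi> i. - (real n / 2 + L)) :: plane) \<bullet> b \<le> (\<chi> i. real n / 2 + L) \<bullet> b"
        using L by (auto simp: Basis_vec_def inner_axis)
      ultimately show ?thesis unfolding B_def by (simp add: emeasure_lborel_cbox_eq)
    qed
    have "(\<integral>\<^sup>+z\<in>Lambda n \<times> UNIV. ennreal (dist (fst z) (snd z) powr 2) \<partial>q) = (\<integral>\<^sup>+z. h z * (ennreal (dist (fst z) (snd z) powr 2) * indicator (Lambda n \<times> UNIV) z) \<partial>(X \<Otimes>\<^sub>M lborel))"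
    proof (rule nq)
      have "Lambda n \<in> sets X" using sX by simp
      then show "(\<lambda>z. ennreal (dist (fst z) (snd z) powr 2) * indicator (Lambda n \<times> UNIV) z) \<in> borel_measurable (X \<Otimes>\<^sub>M lborel)"
        by measurable
    qed
    also have "\<dots> \<le> (\<integral>\<^sup>+z. h z * (ennreal (4 * L\<^sup>2) * indicator B (snd z)) \<partial>(X \<Otimes>\<^sub>M lborel))"
    proof (rule nn_integral_mono)
      fix z :: "plane \<times> plane"
      show "h z * (ennreal (dist (fst z) (snd z) powr 2) * indicator (Lambda n \<times> UNIV) z) \<le> h z * (ennreal (4 * L\<^sup>2) * indicator B (snd z))"
      proof (cases "snd z \<in> gcell L (flr (fst z /\<^sub>R L)) \<and> fst z \<in> Lambda n")
        case True
        then have fl: "flr (fst z /\<^sub>R L) = flr (snd z /\<^sub>R L)" by (simp add: gcell_iff)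
        have "dist (fst z) (snd z) powr 2 \<le> (2 * L) powr 2" using dist[OF fl] by (intro powr_mono2) auto
        also have "\<dots> = 4 * L\<^sup>2" using L by (simp add: power_mult_distrib powr_numeral)
        finally have d: "dist (fst z) (snd z) powr 2 \<le> 4 * L\<^sup>2" .
        have "snd z \<in> B"
        proof -
          have "\<bar>snd z $ i\<bar> \<le> real n / 2 + L" for i
          proof -
            have "\<bar>fst z $ i\<bar> \<le> real n / 2" using True by (simp add: Lambda_def)
            then show ?thesis using comp[OF fl, of i] by linarith
          qed
          then show ?thesis by (auto simp: B_def mem_box_cart abs_le_iff) (smt (verit))+
        qed
        then show ?thesis using d True by (cases z) (auto intro!: mult_left_mono ennreal_leI)
      next
        case False
        then show ?thesis by (cases z) (auto simp: h_def indicator_def)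
      qed
    qed
    also have "\<dots> = (\<integral>\<^sup>+z. ennreal (4 * L\<^sup>2) * indicator B (snd z) \<partial>q)"
      by (rule nq[symmetric]) (simp add: B_def)
    also have "\<dots> = (\<integral>\<^sup>+y. ennreal (4 * L\<^sup>2) * indicator B y \<partial>distr q borel snd)"
      by (rule nn_integral_distr[OF s, symmetric]) (simp add: B_def)
    also have "\<dots> = ennreal (4 * L\<^sup>2) * ennreal ((real n + 2 * L)\<^sup>2)"
      unfolding d2 Bv[symmetric] by (simp add: nn_integral_cmult B_def)
    also have "\<dots> \<le> ennreal (16 * L\<^sup>2) * ennreal ((real n)\<^sup>2)"
    proof -
      have "(real n + 2 * L)\<^sup>2 \<le> (2 * real n)\<^sup>2" using n L by (intro power_mono) auto
      then have "4 * L\<^sup>2 * (real n + 2 * L)\<^sup>2 \<le> 4 * L\<^sup>2 * (4 * (real n)\<^sup>2)" by (intro mult_left_mono) (auto simp: power_mult_distrib)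
      then show ?thesis by (simp add: ennreal_mult[symmetric])
    qed
    finally have "(\<integral>\<^sup>+z\<in>Lambda n \<times> UNIV. ennreal (dist (fst z) (snd z) powr 2) \<partial>q) / ennreal ((real n)\<^sup>2) \<le> ennreal (16 * L\<^sup>2) * ennreal ((real n)\<^sup>2) / ennreal ((real n)\<^sup>2)"
      by (rule divide_right_mono_ennreal)
    also have "\<dots> = ennreal (16 * L\<^sup>2)"
      using n L by (simp add: ennreal_mult_divide_eq)
    finally show ?thesis .
  qed
  have "transport_cost 2 q \<le> ennreal (16 * L\<^sup>2)"
    unfolding transport_cost_def
  proof (rule Limsup_bounded)
    obtain n0 :: nat where n0: "2 * L \<le> real n0" using real_arch_simple[of "2 * L"] by blast
    show "\<forall>\<^sub>F n in sequentially. (\<integral>\<^sup>+z\<in>Lambda n \<times> UNIV. ennreal (dist (fst z) (snd z) powr 2) \<partial>q) / ennreal ((real n)\<^sup>2) \<le> ennreal (16 * L\<^sup>2)"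
      using eventually_ge_at_top[of n0]
    proof (rule eventually_mono)
      fix n assume "n0 \<le> n"
      then have "real n0 \<le> real n" by simp
      then have "2 * L \<le> real n" using n0 by linarith
      then show "(\<integral>\<^sup>+z\<in>Lambda n \<times> UNIV. ennreal (dist (fst z) (snd z) powr 2) \<partial>q) / ennreal ((real n)\<^sup>2) \<le> ennreal (16 * L\<^sup>2)"
        by (rule cost)
    qed
  qed
  then show ?thesis using q by (rule INF_lower2[rotated])
qed

section \<open>The first process and the events that recognise its scale\<close>

definition ll :: "nat \<Rightarrow> real" where "ll k = 16 * 4 ^ k"

text \<open>The area of a cell as a natural number, so that clusters of this size give intensity 1
  at every scale.\<close>

definition Mk :: "nat \<Rightarrow> nat" where "Mk k = (16 * 4 ^ k)\<^sup>2"

lemma ll_pos: "ll k > 0" "ll k \<ge> 1" and Mk_ll: "real (Mk k) = (ll k)\<^sup>2" and Mk_pos: "Mk k > 0"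
proof -
  show "ll k > 0" by (simp add: ll_def)
  have "(1::real) \<le> 4 ^ k" by simp
  then show "ll k \<ge> 1" unfolding ll_def by linarith
  show "real (Mk k) = (ll k)\<^sup>2" "Mk k > 0" by (simp_all add: Mk_def ll_def)
qed

lemma Mk_eq: "Mk k = 256 * 16 ^ k" by (simp add: Mk_def power_mult_distrib power_even_eq[symmetric] power2_eq_square) (simp add: power_mult_distrib[symmetric])

lemma Mk_inj: "Mk i = Mk k \<Longrightarrow> i = k" by (simp add: Mk_eq)

definition G1 :: "nat \<Rightarrow> gspec" where "G1 k = \<lparr>gl = ll k, gs = 0, gn = Mk k, gc = (\<lambda>_. 0)\<rparr>"

text \<open>A lattice without points, so that \<open>mix\<close> also covers a single lattice per
  scale.\<close>

definition H0 :: gspec where "H0 = \<lparr>gl = 1, gs = 0, gn = 0, gc = (\<lambda>_. 0)\<rparr>"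

lemma G1_sel [simp]: "gl (G1 k) = ll k" "gs (G1 k) = 0" "gn (G1 k) = Mk k" "gc (G1 k) i = 0"
  and H0_sel [simp]: "gl H0 = 1" "gn H0 = 0"
  by (simp_all add: G1_def H0_def)

abbreviation X1 where "X1 k w \<equiv> sconf (G1 k) H0 w"

lemma emeasure_X1:
  assumes "A \<in> sets borel"
  shows "emeasure (X1 k w) A = of_nat (Mk k) * (\<integral>\<^sup>+b. indicator A (ll k *\<^sub>R (fst (fst w) + b)) \<partial>count_space ZZ)"
  by (subst emeasure_sconf[OF assms]) (simp add: emeasure_conf[OF assms] nn_integral_gidx gpt_def nn_integral_cmult)

definition hbox :: "plane \<Rightarrow> real \<Rightarrow> plane set" where "hbox p s = {y. (y - p) /\<^sub>R s \<in> Cell}"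

lemma hbox_borel [measurable]: "hbox p s \<in> sets borel"
proof -
  have "hbox p s = {y\<in>space borel. (y - p) /\<^sub>R s \<in> Cell}" by (simp add: hbox_def)
  also have "\<dots> \<in> sets borel" by measurable
  finally show ?thesis .
qed

lemma hbox_iff:
  assumes "s > 0" shows "y \<in> hbox p s \<longleftrightarrow> (\<forall>i. p $ i \<le> y $ i \<and> y $ i < p $ i + s)"
proof -
  have "(0 \<le> ((y - p) /\<^sub>R s) $ i \<and> ((y - p) /\<^sub>R s) $ i < 1) \<longleftrightarrow> (p $ i \<le> y $ i \<and> y $ i < p $ i + s)" for i
    using assms by (simp add: field_simps)
  then show ?thesis by (simp only: hbox_def Cell_def mem_Collect_eq)
qed

lemma gcell_hbox: "L > 0 \<Longrightarrow> gcell L b = hbox (L *\<^sub>R b) L"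
  by (simp add: gcell_def hbox_def scaleR_diff_right)

text \<open>A half-open box whose side is the spacing is a fundamental domain of the lattice,
  wherever its corner lies.\<close>

lemma count_hbox:
  assumes "p \<in> UNIV"
  shows "(\<integral>\<^sup>+b. indicator (hbox p (ll k)) (ll k *\<^sub>R (u + b)) \<partial>count_space ZZ) = (1::ennreal)"
proof -
  have l: "ll k \<noteq> 0" using ll_pos[of k] by simp
  have e: "(ll k *\<^sub>R (u + b) \<in> hbox p (ll k)) \<longleftrightarrow> - b = flr (u - p /\<^sub>R ll k)" if "b \<in> ZZ" for b
  proof -
    have "(ll k *\<^sub>R (u + b) - p) /\<^sub>R ll k = (u - p /\<^sub>R ll k) - (- b)"
      using l by (simp add: scaleR_diff_right)
    then show ?thesis unfolding hbox_def using Cell_iff_flr[of "- b" "u - p /\<^sub>R ll k"] that by simp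
  qed
  have "(\<integral>\<^sup>+b. indicator (hbox p (ll k)) (ll k *\<^sub>R (u + b)) \<partial>count_space ZZ) = (\<integral>\<^sup>+b. indicator {- flr (u - p /\<^sub>R ll k)} b \<partial>count_space ZZ :: ennreal)"
  proof (rule nn_integral_cong)
    fix b assume "b \<in> space (count_space ZZ)"
    then have b: "b \<in> ZZ" by simp
    have "b = - flr (u - p /\<^sub>R ll k) \<longleftrightarrow> - b = flr (u - p /\<^sub>R ll k)" by (metis minus_minus)
    then show "indicator (hbox p (ll k)) (ll k *\<^sub>R (u + b)) = (indicator {- flr (u - p /\<^sub>R ll k)} b :: ennreal)"
      by (simp only: indicator_def singleton_iff e[OF b])
  qed
  also have "\<dots> = emeasure (count_space ZZ) {- flr (u - p /\<^sub>R ll k)}" by (rule nn_integral_indicator) simp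
  also have "\<dots> = 1" by (subst emeasure_count_space_finite) auto
  finally show ?thesis .
qed

lemma X1_hbox: "emeasure (X1 k w) (hbox p (ll k)) = of_nat (Mk k)"
  unfolding emeasure_X1[OF hbox_borel] by (simp add: count_hbox)

text \<open>A box inside a fundamental domain holds at most one site, and a site carries all its
  \<open>Mk k\<close> points at one place.\<close>

lemma X1_small_hbox:
  assumes s: "0 < s" "s \<le> ll k"
  shows "emeasure (X1 k w) (hbox p s) = (if \<exists>b\<in>ZZ. ll k *\<^sub>R (fst (fst w) + b) \<in> hbox p s then of_nat (Mk k) else 0)"
proof -
  define u where "u = fst (fst w)"
  have le: "hbox p s \<subseteq> hbox p (ll k)"
    using s hbox_iff[OF s(1)] hbox_iff[OF ll_pos(1)] by (auto; smt (verit))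
  show ?thesis
  proof (cases "\<exists>b\<in>ZZ. ll k *\<^sub>R (u + b) \<in> hbox p s")
    case True
    then obtain b where b: "b \<in> ZZ" "ll k *\<^sub>R (u + b) \<in> hbox p s" by blast
    have "1 * of_nat (card {b}) \<le> (\<integral>\<^sup>+b. indicator (hbox p s) (ll k *\<^sub>R (u + b)) \<partial>count_space ZZ :: ennreal)"
      by (rule nn_integral_ZZ_ge) (use b in auto)
    moreover have "(\<integral>\<^sup>+b. indicator (hbox p s) (ll k *\<^sub>R (u + b)) \<partial>count_space ZZ :: ennreal) \<le> 1"
      unfolding count_hbox[symmetric, of p k u, OF UNIV_I] using le by (intro nn_integral_mono) (auto simp: indicator_def)
    ultimately have "(\<integral>\<^sup>+b. indicator (hbox p s) (ll k *\<^sub>R (u + b)) \<partial>count_space ZZ :: ennreal) = 1" by simp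
    then show ?thesis using True unfolding emeasure_X1[OF hbox_borel] u_def by simp
  next
    case False
    then have "(\<integral>\<^sup>+b. indicator (hbox p s) (ll k *\<^sub>R (u + b)) \<partial>count_space ZZ :: ennreal) = (\<integral>\<^sup>+b. 0 \<partial>count_space ZZ)"
      by (intro nn_integral_cong) auto
    then show ?thesis using False unfolding emeasure_X1[OF hbox_borel] u_def by simp
  qed
qed

text \<open>
  The configurations of scale \<open>k\<close>, recognised from the numbers of points in countably many boxes, so
  that the event is measurable.
\<close>

definition GG :: "nat \<Rightarrow> plane measure set" where
  "GG k = {X\<in>configs. (\<forall>p\<in>qpts. emeasure X (hbox p (ll k)) = of_nat (Mk k)) \<and>
     (\<forall>p\<in>qpts. \<forall>n::nat. emeasure X (hbox p (1 / real (n + 1))) \<in> {0, of_nat (Mk k)})}"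

lemma ZZ_qpts: "b \<in> ZZ \<Longrightarrow> b \<in> qpts"
  by (auto simp: ZZ_def qpts_def intro: subsetD[OF Ints_subset_Rats])

lemma GG_sets: "GG k \<in> sets config_algebra"
proof -
  have e: "{X\<in>space config_algebra. emeasure X (hbox p s) \<in> {c, d}} \<in> sets config_algebra" for p s c d
    using emeasure_config_measurable[OF hbox_borel[of p s]] by measurable
  have e1: "{X\<in>space config_algebra. emeasure X (hbox p s) = c} \<in> sets config_algebra" for p s c
    using e[of p s c c] by simp
  have ball: "{X\<in>space config_algebra. \<forall>p\<in>qpts. Q p X} \<in> sets config_algebra"
    if "\<And>p. {X\<in>space config_algebra. Q p X} \<in> sets config_algebra" for Q
    using that by (rule sets.sets_Collect_countable_All'[OF _ countable_qpts])
  have "{X\<in>space config_algebra. (\<forall>p\<in>qpts. emeasure X (hbox p (ll k)) = of_nat (Mk k)) \<and>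
     (\<forall>p\<in>qpts. \<forall>n::nat. emeasure X (hbox p (1 / real (n + 1))) \<in> {0, of_nat (Mk k)})} \<in> sets config_algebra"
    by (intro sets.sets_Collect_conj ball sets.sets_Collect_countable_All e e1)
  then show ?thesis by (simp only: GG_def space_config_algebra)
qed

lemma X1_in_configs: "w \<in> space Om2 \<Longrightarrow> X1 k w \<in> configs"
  by (intro conf_in_configs loc_fin_spt) (auto simp: ll_pos)

lemma X1_GG: "w \<in> space Om2 \<Longrightarrow> X1 k w \<in> GG k"
proof -
  assume w: "w \<in> space Om2"
  have "1 / real (n + 1) \<le> ll k" for n
  proof -
    have "1 / real (n + 1) \<le> 1" by simp
    then show ?thesis using ll_pos(2)[of k] by linarith
  qed
  then show ?thesis
    using X1_in_configs[OF w, of k] by (simp add: GG_def X1_hbox X1_small_hbox)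
qed

text \<open>A unit box around a site of scale \<open>i\<close> holds \<open>Mk i\<close> points,
  which is neither 0 nor \<open>Mk k\<close>.\<close>

lemma X1_not_GG: "w \<in> space Om2 \<Longrightarrow> i \<noteq> k \<Longrightarrow> X1 i w \<notin> GG k"
proof
  assume ik: "i \<noteq> k" and X: "X1 i w \<in> GG k"
  define x where "x = ll i *\<^sub>R (fst (fst w) + 0)"
  \<comment> \<open>\<open>flr x\<close> is a rational corner, and side 1 is the case
    \<open>n = 0\<close> of the small boxes in \<open>GG\<close>.\<close>
  have x: "x \<in> hbox (flr x) 1" using sub_flr_in_Cell[of x] by (simp add: hbox_def)
  have "emeasure (X1 i w) (hbox (flr x) (1 / real (0 + 1))) \<in> {0, of_nat (Mk k)}"
    using X ZZ_qpts[OF flr_in_ZZ, of x] unfolding GG_def by blast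
  moreover have "emeasure (X1 i w) (hbox (flr x) 1) = of_nat (Mk i)"
  proof -
    have "\<exists>b\<in>ZZ. ll i *\<^sub>R (fst (fst w) + b) \<in> hbox (flr x) 1"
      using x unfolding x_def by (intro bexI[of _ 0]) auto
    then show ?thesis using X1_small_hbox[of 1 i w "flr x"] ll_pos(2)[of i] by simp
  qed
  ultimately show False using Mk_pos[of i] Mk_inj[of i k] ik by simp
qed

lemma GG_wasserstein:
  assumes X: "X \<in> GG k"
  shows "ennpowr (wasserstein 2 X lborel) 2 \<le> ennreal (16 * real (Mk k))"
proof -
  have "(INF q\<in>cpl X lborel. transport_cost 2 q) \<le> ennreal (16 * (ll k)\<^sup>2)"
  proof (rule cell_transport)
    show "X \<in> configs" using X by (simp add: GG_def)
    fix b assume b: "b \<in> ZZ"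
    \<comment> \<open>The spacing is an integer, so the cells of the lattice through the origin are
      among the boxes tested by \<open>GG\<close>.\<close>
    have "ll k *\<^sub>R b \<in> qpts" using b ZZ_qpts[OF b] by (simp add: qpts_def ll_def)
    then have "emeasure X (hbox (ll k *\<^sub>R b) (ll k)) = of_nat (Mk k)" using X by (simp add: GG_def)
    then show "emeasure X (gcell (ll k) b) = ennreal ((ll k)\<^sup>2)"
      by (simp add: gcell_hbox ll_pos ennreal_of_nat_eq_real_of_nat Mk_ll)
  qed (rule ll_pos)
  then show ?thesis by (simp add: wasserstein_def ennpowr_inverse Mk_ll)
qed

definition wt1 :: "nat \<Rightarrow> real" where "wt1 k = 1 / (real (Mk k) * (real (k + 1))\<^sup>2)"

lemma wt1_pos: "wt1 k > 0" using Mk_pos[of k] by (simp add: wt1_def)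

lemma summable_inv_sq: "summable (\<lambda>k. 1 / (real (k + 1))\<^sup>2)"
proof -
  have "summable (\<lambda>n. inverse (real n ^ 2))" by (rule inverse_power_summable) simp
  then have "summable (\<lambda>n. inverse (real (Suc n) ^ 2))" by (subst summable_Suc_iff)
  then show ?thesis by (simp add: inverse_eq_divide)
qed

lemma summable_wt1: "summable wt1"
proof (rule summable_comparison_test'[OF summable_inv_sq, of 0])
  fix k
  have "1 * (real (k + 1))\<^sup>2 \<le> real (Mk k) * (real (k + 1))\<^sup>2" using Mk_pos[of k] by (intro mult_right_mono) auto
  then show "norm (wt1 k) \<le> 1 / (real (k + 1))\<^sup>2"
    using Mk_pos[of k] by (simp add: wt1_def frac_le)
qed

definition J1 :: "nat pmf" where "J1 = (SOME J. \<forall>j. pmf J j = wt1 j / suminf wt1)"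

lemma pmf_J1: "pmf J1 j = wt1 j / suminf wt1"
proof -
  have "\<exists>J. \<forall>j. pmf J j = wt1 j / suminf wt1"
    using pmf_of_summable[OF wt1_pos summable_wt1] by metis
  then show ?thesis unfolding J1_def by (rule someI2_ex) blast
qed

lemma suminf_wt1_pos: "suminf wt1 > 0"
  using wt1_pos summable_wt1 by (intro suminf_pos) auto

lemma pmf_J1_Mk: "pmf J1 k * real (Mk k) = 1 / suminf wt1 * (1 / (real (k + 1))\<^sup>2)"
  using Mk_pos[of k] by (simp add: pmf_J1 wt1_def)

definition P1 :: "plane measure measure" where "P1 = mix J1 G1 (\<lambda>_. H0)"

lemma gl_G1: "gl (G1 k) > 0" and gl_H0: "gl H0 > 0" by (simp_all add: ll_pos)

lemma stationary_P1: "stationary_process P1"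
  unfolding P1_def by (rule stationary_mix) (rule gl_G1 gl_H0)+

text \<open>The function \<open>g\<close> is a measurable majorant of the cost, read off from the
  events \<open>GG k\<close>, so its integral over the mixture can be computed scale by scale. What
  results is a multiple of the sum of \<open>1 / (k + 1)\<^sup>2\<close>.\<close>

lemma Wass_P1: "Wass 2 P1 < \<infinity>"
proof -
  define g :: "plane measure \<Rightarrow> ennreal" where "g X = (INF k. (if X \<in> GG k then ennreal (16 * real (Mk k)) else \<top>))" for X
  have gm: "g \<in> borel_measurable config_algebra"
    unfolding g_def[abs_def]
    by (intro borel_measurable_INF measurable_If_set) (simp_all add: GG_sets sets.Int_space_eq2)
  have "(\<integral>\<^sup>+X. ennpowr (wasserstein 2 X lborel) 2 \<partial>P1) \<le> (\<integral>\<^sup>+X. g X \<partial>P1)"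
    unfolding g_def by (intro nn_integral_mono INF_greatest) (simp add: GG_wasserstein)
  also have "\<dots> = (\<integral>\<^sup>+k. (\<integral>\<^sup>+w. g (X1 k w) \<partial>Om2) \<partial>measure_pmf J1)"
    unfolding P1_def by (rule nn_integral_mix[OF gl_G1 gl_H0 gm])
  also have "\<dots> \<le> (\<integral>\<^sup>+k. ennreal (16 * real (Mk k)) \<partial>measure_pmf J1)"
  proof (rule nn_integral_mono)
    fix k
    have "(\<integral>\<^sup>+w. g (X1 k w) \<partial>Om2) \<le> (\<integral>\<^sup>+w. ennreal (16 * real (Mk k)) \<partial>Om2)"
    proof (rule nn_integral_mono)
      fix w assume "w \<in> space Om2"
      then have "X1 k w \<in> GG k" by (rule X1_GG)
      then show "g (X1 k w) \<le> ennreal (16 * real (Mk k))"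
        unfolding g_def by (intro INF_lower2[of k]) auto
    qed
    then show "(\<integral>\<^sup>+w. g (X1 k w) \<partial>Om2) \<le> ennreal (16 * real (Mk k))" using Om2.emeasure_space_1 by simp
  qed
  also have "\<dots> = (\<Sum>k. ennreal (pmf J1 k) * ennreal (16 * real (Mk k)))" by (rule nn_integral_nat_pmf)
  also have "\<dots> = (\<Sum>k. ennreal (16 / suminf wt1 * (1 / (real (k + 1))\<^sup>2)))"
    using pmf_J1_Mk by (simp add: ennreal_mult[symmetric] mult.left_commute[of _ 16])
  also have "\<dots> = ennreal (\<Sum>k. 16 / suminf wt1 * (1 / (real (k + 1))\<^sup>2))"
  proof (rule suminf_ennreal2)
    show "0 \<le> 16 / suminf wt1 * (1 / (real (k + 1))\<^sup>2)" for k using suminf_wt1_pos by simp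
    show "summable (\<lambda>k. 16 / suminf wt1 * (1 / (real (k + 1))\<^sup>2))" by (rule summable_mult[OF summable_inv_sq])
  qed
  also have "\<dots> < \<top>" by simp
  finally have "(\<integral>\<^sup>+X. ennpowr (wasserstein 2 X lborel) 2 \<partial>P1) < \<top>" .
  then show ?thesis by (auto simp: Wass_def ennpowr_def)
qed

lemma nn_integral_J1_Mk: "(\<integral>\<^sup>+k. ennreal (real k * real (Mk k)) \<partial>measure_pmf J1) = \<infinity>"
proof (rule ccontr)
  assume "(\<integral>\<^sup>+k. ennreal (real k * real (Mk k)) \<partial>measure_pmf J1) \<noteq> \<infinity>"
  then have fin: "(\<Sum>k. ennreal (pmf J1 k * (real k * real (Mk k)))) \<noteq> \<top>"
    by (simp add: nn_integral_nat_pmf ennreal_mult)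
  have s: "summable (\<lambda>k. pmf J1 k * (real k * real (Mk k)))"
    by (rule summable_suminf_not_top[OF _ fin]) simp
  \<comment> \<open>The first term is \<open>k / (k + 1)\<^sup>2\<close>; adding the summable
    \<open>1 / (k + 1)\<^sup>2\<close> gives exactly the harmonic term
    \<open>1 / (k + 1)\<close>.\<close>
  have "summable (\<lambda>k. suminf wt1 * (pmf J1 k * (real k * real (Mk k))) + 1 / (real (k + 1))\<^sup>2)"
    by (intro summable_add summable_mult s summable_inv_sq)
  moreover have "suminf wt1 * (pmf J1 k * (real k * real (Mk k))) + 1 / (real (k + 1))\<^sup>2 = inverse (real (Suc k))" for k
  proof -
    have "suminf wt1 * (pmf J1 k * (real k * real (Mk k))) = suminf wt1 * (pmf J1 k * real (Mk k)) * real k" by simp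
    also have "\<dots> = real k / (real (k + 1))\<^sup>2" unfolding pmf_J1_Mk using suminf_wt1_pos by simp
    finally have "suminf wt1 * (pmf J1 k * (real k * real (Mk k))) + 1 / (real (k + 1))\<^sup>2 = real (k + 1) / (real (k + 1))\<^sup>2"
      by (simp add: add_divide_distrib)
    also have "\<dots> = inverse (real (Suc k))"
    proof -
      have "x / x\<^sup>2 = inverse x" if "x \<noteq> 0" for x :: real
        using that by (simp add: power2_eq_square inverse_eq_divide)
      from this[of "real (k + 1)"] show ?thesis by simp
    qed
    finally show ?thesis .
  qed
  ultimately have "summable (\<lambda>k. inverse (real (Suc k)))" by simp
  then show False using not_summable_harmonic[where 'a=real] summable_Suc_iff[of "\<lambda>n. inverse (real n)"] by blast
qed

section \<open>Cut-off functions and electric energy\<close>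

lemma GDERIV_unique: "GDERIV f x :> D \<Longrightarrow> GDERIV f x :> D' \<Longrightarrow> D = D'"
proof -
  assume "GDERIV f x :> D" "GDERIV f x :> D'"
  then have "(\<lambda>h. h \<bullet> D) = (\<lambda>h. h \<bullet> D')" unfolding gderiv_def by (rule has_derivative_unique)
  then have "(D - D') \<bullet> D = (D - D') \<bullet> D'" by meson
  then have "(D - D') \<bullet> (D - D') = 0" by (simp add: inner_diff_right)
  then show ?thesis by simp
qed

lemma gradient_eq: "GDERIV f x :> D \<Longrightarrow> gradient f x = D"
  unfolding gradient_def by (rule the_equality) (auto intro: GDERIV_unique)

lemma smooth_GDERIV: "smooth f \<Longrightarrow> GDERIV f x :> gradient f x"
proof -
  assume "smooth f"
  then have "Ck (Suc 0) f" unfolding smooth_def by blast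
  then obtain g where "\<forall>x. GDERIV f x :> g x" by auto
  then show ?thesis using gradient_eq by metis
qed

lemma smooth_gradient: "smooth f \<Longrightarrow> smooth (\<lambda>x. gradient f x $ i)"
  unfolding smooth_def
proof
  fix k assume "\<forall>k. Ck k f"
  then have "Ck (Suc k) f" by blast
  then obtain g where g: "\<forall>x. GDERIV f x :> g x" "\<forall>i. Ck k (\<lambda>x. g x $ i)" by auto
  then have "gradient f = g" using gradient_eq by blast
  then show "Ck k (\<lambda>x. gradient f x $ i)" using g by simp
qed

lemma smooth_continuous: "smooth f \<Longrightarrow> continuous_on UNIV f"
  unfolding smooth_def by (metis Ck.simps(1))

lemma smooth_borel: "smooth f \<Longrightarrow> f \<in> borel_measurable borel"
  by (intro borel_measurable_continuous_onI smooth_continuous)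

lemma vec_continuous_components:
  assumes "\<And>i. continuous_on UNIV (\<lambda>x. g x $ i)"
  shows "continuous_on UNIV (g :: plane \<Rightarrow> plane)"
proof -
  have "continuous_on UNIV (\<lambda>x. \<chi> i. g x $ i)" by (rule continuous_on_vec_lambda) (rule assms)
  then show ?thesis by simp
qed

lemma gradient_continuous: "smooth f \<Longrightarrow> continuous_on UNIV (gradient f)"
  by (rule vec_continuous_components) (intro smooth_continuous smooth_gradient)

lemma gradient_locally_const:
  assumes "open S" "x \<in> S" "\<And>y. y \<in> S \<Longrightarrow> f y = c"
  shows "gradient f x = 0"
proof (rule gradient_eq)
  have "((\<lambda>y. c) has_derivative (\<lambda>h. h \<bullet> 0)) (at x)" by simp
  then have "(f has_derivative (\<lambda>h. h \<bullet> 0)) (at x)"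
    by (rule has_derivative_transform_within_open[OF _ assms(1,2)]) (simp add: assms(3))
  then show "GDERIV f x :> 0" by (simp add: gderiv_def)
qed

lemma GDERIV_affine:
  assumes "GDERIV f (t *\<^sub>R x + b) :> g"
  shows "GDERIV (\<lambda>x. c * f (t *\<^sub>R x + b)) x :> (c * t) *\<^sub>R g"
proof -
  have "((\<lambda>x. t *\<^sub>R x + b) has_derivative (\<lambda>h. t *\<^sub>R h)) (at x)" by (auto intro!: derivative_eq_intros)
  from has_derivative_compose[OF this assms[unfolded gderiv_def]]
  have "((\<lambda>x. f (t *\<^sub>R x + b)) has_derivative (\<lambda>h. (t *\<^sub>R h) \<bullet> g)) (at x)" .
  then have "((\<lambda>x. c * f (t *\<^sub>R x + b)) has_derivative (\<lambda>h. c * ((t *\<^sub>R h) \<bullet> g))) (at x)"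
    by (rule has_derivative_mult_right)
  then show ?thesis by (simp add: gderiv_def mult.assoc)
qed

lemma Ck_affine: "Ck k f \<Longrightarrow> Ck k (\<lambda>x. c * f (t *\<^sub>R x + b))"
proof (induction k arbitrary: f c)
  case 0
  then show ?case
    by (auto intro!: continuous_intros continuous_on_compose2[of UNIV f])
next
  case (Suc k)
  then obtain g where g: "\<forall>x. GDERIV f x :> g x" "\<forall>i. Ck k (\<lambda>x. g x $ i)" by auto
  have "\<forall>x. GDERIV (\<lambda>x. c * f (t *\<^sub>R x + b)) x :> (c * t) *\<^sub>R g (t *\<^sub>R x + b)"
    using g(1) GDERIV_affine by blast
  moreover have "\<forall>i. Ck k (\<lambda>x. ((c * t) *\<^sub>R g (t *\<^sub>R x + b)) $ i)"
    using Suc.IH[of "\<lambda>x. g x $ _" "c * t"] g(2) by simp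
  ultimately show ?case unfolding Ck.simps by (intro exI conjI)
qed

text \<open>Convolution of \<open>f\<close> with the indicator of the square of half-side
  \<open>r\<close>. Applied to the given smooth profile it yields smooth cut-off functions.\<close>

definition bconv :: "real \<Rightarrow> (plane \<Rightarrow> real) \<Rightarrow> plane \<Rightarrow> real" where
  "bconv r f x = integral (cbox (\<chi> i. - r) (\<chi> i. r)) (\<lambda>z. f (x - z))"

lemma bconv_continuous:
  assumes "continuous_on UNIV f" shows "continuous_on UNIV (bconv r f)"
  unfolding bconv_def
proof (rule integral_continuous_on_param)
  show "continuous_on (UNIV \<times> cbox (\<chi> i. - r) (\<chi> i. r)) (\<lambda>(x, z). f (x - z))"
    unfolding case_prod_beta' by (intro continuous_on_compose2[OF assms] continuous_intros) auto
qed

text \<open>Differentiation under the integral sign over the compact square; the gradient is encoded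
  as a bounded linear map for the Leibniz rule.\<close>

lemma bconv_GDERIV:
  assumes f: "\<And>x. GDERIV f x :> g x" and g: "continuous_on UNIV g"
  shows "GDERIV (bconv r f) x :> (\<chi> i. bconv r (\<lambda>y. g y $ i) x)"
proof -
  let ?C = "cbox (\<chi> i. - r) ((\<chi> i. r) :: plane)"
  have cf: "continuous_on UNIV f"
    using f unfolding gderiv_def by (metis continuous_at_imp_continuous_on has_derivative_continuous)
  have cont: "continuous_on (UNIV \<times> ?C) (\<lambda>(x, z). blinfun_inner_left (g (x - z)))"
    unfolding case_prod_beta'
    by (intro bounded_linear.continuous_on[OF bounded_linear_blinfun_inner_left] continuous_on_compose2[OF g] continuous_intros) auto
  have d: "((\<lambda>x. integral ?C (\<lambda>z. f (x - z))) has_derivative blinfun_apply (integral ?C (\<lambda>z. blinfun_inner_left (g (x - z))))) (at x within UNIV)"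
  proof (rule leibniz_rule[where fx="\<lambda>x z. blinfun_inner_left (g (x - z))"])
    fix y z :: plane
    have "((\<lambda>x. x - z) has_derivative (\<lambda>h. h)) (at y)" by (auto intro!: derivative_eq_intros)
    from has_derivative_compose[OF this f[of "y - z", unfolded gderiv_def]]
    show "((\<lambda>x. f (x - z)) has_derivative blinfun_apply (blinfun_inner_left (g (y - z)))) (at y within UNIV)"
      by (simp add: inner_commute)
  next
    fix y :: plane
    show "(\<lambda>z. f (y - z)) integrable_on ?C"
      by (intro integrable_continuous continuous_on_compose2[OF cf] continuous_intros) auto
  qed (use cont in auto)
  have int: "(\<lambda>z. blinfun_inner_left (g (x - z))) integrable_on ?C"
    by (intro integrable_continuous bounded_linear.continuous_on[OF bounded_linear_blinfun_inner_left] continuous_on_compose2[OF g] continuous_intros) auto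
  have "blinfun_apply (integral ?C (\<lambda>z. blinfun_inner_left (g (x - z)))) h = h \<bullet> (\<chi> i. bconv r (\<lambda>y. g y $ i) x)" for h
  proof -
    have intg: "(\<lambda>z. g (x - z) $ i) integrable_on ?C" for i
      by (intro integrable_continuous continuous_on_component continuous_on_compose2[OF g] continuous_intros) auto
    have "blinfun_apply (integral ?C (\<lambda>z. blinfun_inner_left (g (x - z)))) h = integral ?C (\<lambda>z. blinfun_apply (blinfun_inner_left (g (x - z))) h)"
      using int by (rule blinfun_apply_integral)
    also have "\<dots> = integral ?C (\<lambda>z. \<Sum>i\<in>UNIV. h $ i * g (x - z) $ i)"
      by (simp add: inner_vec_def inner_commute mult.commute)
    also have "\<dots> = (\<Sum>i\<in>UNIV. h $ i * integral ?C (\<lambda>z. g (x - z) $ i))"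
      using intg by (subst Henstock_Kurzweil_Integration.integral_sum) (auto intro: integrable_on_mult_right)
    also have "\<dots> = h \<bullet> (\<chi> i. bconv r (\<lambda>y. g y $ i) x)"
      by (simp add: inner_vec_def bconv_def)
    finally show ?thesis .
  qed
  then have e: "blinfun_apply (integral ?C (\<lambda>z. blinfun_inner_left (g (x - z)))) = (\<lambda>h. h \<bullet> (\<chi> i. bconv r (\<lambda>y. g y $ i) x))"
    by (intro ext)
  have "(bconv r f has_derivative blinfun_apply (integral ?C (\<lambda>z. blinfun_inner_left (g (x - z))))) (at x)"
    using d unfolding bconv_def[abs_def] by simp
  then show ?thesis unfolding e gderiv_def .
qed

lemma Ck_bconv: "Ck k f \<Longrightarrow> Ck k (bconv r f)"
proof (induction k arbitrary: f)
  case 0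
  then show ?case using bconv_continuous by simp
next
  case (Suc k)
  then obtain g where g: "\<forall>x. GDERIV f x :> g x" "\<forall>i. Ck k (\<lambda>x. g x $ i)" by auto
  have cont: "Ck k h \<Longrightarrow> continuous_on UNIV h" for k h
  proof (cases k)
    case (Suc m)
    assume "Ck k h"
    then obtain g' where "\<forall>x. GDERIV h x :> g' x" using Suc by auto
    then show ?thesis unfolding gderiv_def by (metis continuous_at_imp_continuous_on has_derivative_continuous)
  qed simp
  have "continuous_on UNIV g" using g(2) cont by (intro vec_continuous_components) blast
  then have "\<forall>x. GDERIV (bconv r f) x :> (\<chi> i. bconv r (\<lambda>y. g y $ i) x)" using g(1) bconv_GDERIV by blast
  moreover have "\<forall>i. Ck k (\<lambda>x. (\<chi> i. bconv r (\<lambda>y. g y $ i) x) $ i)" using Suc.IH g(2) by simp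
  ultimately show ?case unfolding Ck.simps by (intro exI conjI)
qed

context
  fixes \<rho> :: "plane \<Rightarrow> real" assumes moll: "mollifier \<rho>"
begin

lemma \<rho>_smooth: "smooth \<rho>" and \<rho>_nonneg: "0 \<le> \<rho> x" and \<rho>_zero: "1 < norm x \<Longrightarrow> \<rho> x = 0"
  and \<rho>_radial: "norm x = norm y \<Longrightarrow> \<rho> x = \<rho> y" and \<rho>_int: "(\<integral>x. \<rho> x \<partial>lborel) = 1"
  using moll unfolding mollifier_def by blast+

lemma \<rho>_borel [measurable]: "\<rho> \<in> borel_measurable borel" by (rule smooth_borel[OF \<rho>_smooth])

text \<open>If \<open>norm x \<le> 1.1\<close>, the unit disk about \<open>x\<close> lies in the
  square of half-side 2.1 and the value is the full integral 1. The square lies in the disk of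
  radius 2.98, so the value is 0 from radius 3.99 on. The slack makes the gradient vanish for
  \<open>norm x \<le> 1\<close> and for \<open>norm x \<ge> 4\<close>.\<close>

definition "bump = bconv (21/10) \<rho>"

lemma bump_smooth: "smooth bump"
  using \<rho>_smooth unfolding bump_def smooth_def by (auto intro: Ck_bconv)

lemma \<rho>_shift: "(\<integral>z. \<rho> (x - z) \<partial>lborel) = 1" "integrable lborel (\<lambda>z. \<rho> (x - z))"
proof -
  have e: "\<rho> (x - z) = \<rho> (- x + z)" for z by (rule \<rho>_radial) (simp add: norm_minus_commute)
  have "(\<integral>z. \<rho> z \<partial>lborel) = (\<integral>z. \<rho> z \<partial>distr lborel borel (\<lambda>z. - x + z))"
    using lborel_distr_plus[of "- x"] by (simp only:)
  also have "\<dots> = (\<integral>z. \<rho> (x - z) \<partial>lborel)" unfolding e by (rule integral_distr) simp_all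
  finally show "(\<integral>z. \<rho> (x - z) \<partial>lborel) = 1" by (simp add: \<rho>_int)
  \<comment> \<open>A non-integrable function would have Bochner integral 0 instead of 1.\<close>
  then show "integrable lborel (\<lambda>z. \<rho> (x - z))" using not_integrable_integral_eq by fastforce
qed

lemma bump_lebesgue: "bump x = (\<integral>z. indicator (cbox (\<chi> i. - (21/10)) (\<chi> i. 21/10)) z * \<rho> (x - z) \<partial>lborel)"
proof -
  let ?C = "cbox (\<chi> i. - (21/10)) ((\<chi> i. 21/10) :: plane)"
  have "set_integrable lborel ?C (\<lambda>z. \<rho> (x - z))"
    unfolding set_integrable_def using \<rho>_shift(2)[of x]
    by (intro integrable_mult_indicator) auto
  from set_borel_integral_eq_integral(2)[OF this] show ?thesis
    by (simp add: bump_def bconv_def set_lebesgue_integral_def)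
qed

lemma bump_nonneg: "0 \<le> bump x"
  unfolding bump_lebesgue by (rule Bochner_Integration.integral_nonneg) (simp add: \<rho>_nonneg)

lemma bump_le: "bump x \<le> 1"
proof -
  have "bump x \<le> (\<integral>z. \<rho> (x - z) \<partial>lborel)"
    unfolding bump_lebesgue
    by (rule integral_mono_AE') (use \<rho>_shift in \<open>auto simp: \<rho>_nonneg indicator_def\<close>)
  then show ?thesis by (simp add: \<rho>_shift)
qed

lemma bump_one: "norm x \<le> 11/10 \<Longrightarrow> bump x = 1"
proof -
  assume x: "norm x \<le> 11/10"
  have "bump x = (\<integral>z. \<rho> (x - z) \<partial>lborel)"
    unfolding bump_lebesgue
  proof (rule Bochner_Integration.integral_cong[OF refl])
    fix z :: plane
    have "z \<in> cbox (\<chi> i. - (21/10)) (\<chi> i. 21/10)" if "\<rho> (x - z) \<noteq> 0"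
    proof -
      have "norm (x - z) \<le> 1" using \<rho>_zero that by force
      then have "norm z \<le> 21/10" using x norm_triangle_ineq4[of x "x - z"] by simp
      then have "\<bar>z $ i\<bar> \<le> 21/10" for i using component_le_norm_cart[of z i] by linarith
      then have "- (21/10) \<le> z $ i \<and> z $ i \<le> 21/10" for i
        using component_le_norm_cart[of z i] \<open>norm z \<le> 21/10\<close> by (intro conjI; linarith)
      then show ?thesis by (simp add: mem_box_cart)
    qed
    then show "indicator (cbox (\<chi> i. - (21/10)) (\<chi> i. 21/10)) z * \<rho> (x - z) = \<rho> (x - z)"
      by (auto simp: indicator_def)
  qed
  then show ?thesis by (simp add: \<rho>_shift)
qed

lemma bump_zero: "norm x \<ge> 399/100 \<Longrightarrow> bump x = 0"
proof -
  assume x: "norm x \<ge> 399/100"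
  have "bump x = integral\<^sup>L lborel (\<lambda>z::plane. 0::real)"
    unfolding bump_lebesgue
  proof (rule Bochner_Integration.integral_cong[OF refl])
    fix z :: plane
    have "\<rho> (x - z) = 0" if z: "z \<in> cbox (\<chi> i. - (21/10)) (\<chi> i. 21/10)"
    proof (rule \<rho>_zero)
      have zi: "- (21/10) \<le> z $ i \<and> z $ i \<le> 21/10" for i using z by (simp add: mem_box_cart)
      have "(z $ i)\<^sup>2 \<le> (21/10)\<^sup>2" for i
      proof -
        have "\<bar>z $ i\<bar> \<le> 21/10" using zi[of i] by linarith
        then have "\<bar>z $ i\<bar>\<^sup>2 \<le> (21/10)\<^sup>2" by (rule power_mono) simp
        then show ?thesis by simp
      qed
      from this[of 1] this[of 2] have "(z $ 1)\<^sup>2 \<le> (21/10)\<^sup>2" "(z $ 2)\<^sup>2 \<le> (21/10)\<^sup>2" .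
      then have "(norm z)\<^sup>2 \<le> (298/100)\<^sup>2" by (simp add: norm_vec_def L2_set_def sum_2 power2_eq_square)
      then have "norm z \<le> 298/100" by (rule power2_le_imp_le) simp
      then show "1 < norm (x - z)" using x norm_triangle_ineq2[of x z] by linarith
    qed
    then show "indicator (cbox (\<chi> i. - (21/10)) (\<chi> i. 21/10)) z * \<rho> (x - z) = 0"
      by (auto simp: indicator_def)
  qed
  then show ?thesis by simp
qed

definition "sbump s a x = bump ((x - a) /\<^sub>R s)"

lemma sbump_test: "s > 0 \<Longrightarrow> test_function (sbump s a)"
proof -
  assume s: "s > 0"
  have "sbump s a = (\<lambda>x. 1 * bump ((1 / s) *\<^sub>R x + - (a /\<^sub>R s)))"
    by (auto simp: sbump_def inverse_eq_divide scaleR_diff_right)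
  moreover have "smooth (\<lambda>x. 1 * bump ((1 / s) *\<^sub>R x + - (a /\<^sub>R s)))"
    using bump_smooth unfolding smooth_def by (intro allI Ck_affine) blast
  ultimately have "smooth (sbump s a)" by (simp only:)
  moreover have "{x. sbump s a x \<noteq> 0} \<subseteq> cball a (4 * s)"
  proof
    fix x assume "x \<in> {x. sbump s a x \<noteq> 0}"
    then have "\<not> 399/100 \<le> norm ((x - a) /\<^sub>R s)" using bump_zero[of "(x - a) /\<^sub>R s"] unfolding sbump_def by blast
    moreover have "norm ((x - a) /\<^sub>R s) = norm (x - a) / s" using s by (simp add: divide_inverse mult.commute)
    ultimately have "norm (x - a) / s \<le> 4" by linarith
    then have "norm (x - a) \<le> 4 * s" using s by (simp add: pos_divide_le_eq)
    then show "x \<in> cball a (4 * s)" by (simp add: dist_norm norm_minus_commute)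
  qed
  ultimately show ?thesis unfolding test_function_def using bounded_subset[OF bounded_cball] by blast
qed

lemma sbump_gradient: "s > 0 \<Longrightarrow> gradient (sbump s a) x = (1 / s) *\<^sub>R gradient bump ((x - a) /\<^sub>R s)"
proof -
  assume s: "s > 0"
  have "sbump s a = (\<lambda>x. 1 * bump ((1 / s) *\<^sub>R x + - (a /\<^sub>R s)))"
    by (auto simp: sbump_def inverse_eq_divide scaleR_diff_right)
  moreover have "GDERIV (\<lambda>x. 1 * bump ((1 / s) *\<^sub>R x + - (a /\<^sub>R s))) x :> (1 * (1 / s)) *\<^sub>R gradient bump ((1 / s) *\<^sub>R x + - (a /\<^sub>R s))"
    by (rule GDERIV_affine) (rule smooth_GDERIV[OF bump_smooth])
  ultimately have "gradient (sbump s a) x = (1 / s) *\<^sub>R gradient bump ((1 / s) *\<^sub>R x + - (a /\<^sub>R s))"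
    by (intro gradient_eq) simp
  then show ?thesis by (simp add: inverse_eq_divide scaleR_diff_right)
qed

lemma bump_gradient_zero: "norm x \<le> 1 \<or> norm x \<ge> 4 \<Longrightarrow> gradient bump x = 0"
proof -
  assume "norm x \<le> 1 \<or> norm x \<ge> 4"
  then show ?thesis
  proof
    assume "norm x \<le> 1"
    then show ?thesis by (intro gradient_locally_const[of "ball 0 (11/10)" _ _ 1]) (auto intro!: bump_one)
  next
    assume "norm x \<ge> 4"
    moreover have "open {x :: plane. 399/100 < norm x}" by (intro open_Collect_less continuous_intros)
    ultimately show ?thesis by (intro gradient_locally_const[of "{x. 399/100 < norm x}" _ _ 0]) (auto intro!: bump_zero)
  qed
qed

end

section \<open>The configuration determined by a field, and the energy on annuli\<close>

lemma isolate_point: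
  assumes "loc_fin I x"
  obtains d where "d > 0" "\<And>i. i \<in> I \<Longrightarrow> x i \<noteq> y \<Longrightarrow> d \<le> dist y (x i)"
proof -
  have "finite {i\<in>I. x i \<in> cball y 1}" by (rule loc_fin_bounded[OF assms bounded_cball])
  then have "finite (x ` {i\<in>I. x i \<in> cball y 1})" by simp
  from finite_set_avoid[OF this, of y] obtain d where d: "d > 0" "\<And>z. z \<in> x ` {i\<in>I. x i \<in> cball y 1} \<Longrightarrow> z \<noteq> y \<Longrightarrow> d \<le> dist y z"
    by blast
  show ?thesis
  proof (rule that[of "min d 1"])
    show "min d 1 > 0" using d(1) by simp
    fix i assume i: "i \<in> I" "x i \<noteq> y"
    show "min d 1 \<le> dist y (x i)"
    proof (cases "x i \<in> cball y 1")
      case True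
      then show ?thesis using d(2)[of "x i"] i by auto
    next
      case False
      then show ?thesis by simp
    qed
  qed
qed

text \<open>A non-integrable function has Bochner integral 0, so the bound is unconditional.\<close>

lemma norm_integral_le_nn:
  fixes f :: "'a \<Rightarrow> real"
  shows "ennreal \<bar>\<integral>x. f x \<partial>M\<bar> \<le> (\<integral>\<^sup>+x. ennreal \<bar>f x\<bar> \<partial>M)"
proof (cases "integrable M f")
  case True
  then show ?thesis using integral_norm_bound_ennreal[OF True] by simp
qed (simp add: not_integrable_integral_eq)

context
  fixes \<rho> :: "plane \<Rightarrow> real" assumes moll: "mollifier \<rho>"
begin

abbreviation sb where "sb \<equiv> sbump \<rho>"

lemma sb_props:
  assumes "s > 0"
  shows "0 \<le> sb s a x" "sb s a x \<le> 1" "sb s a a = 1" "dist a x \<ge> 4 * s \<Longrightarrow> sb s a x = 0"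
    "sb s a \<in> borel_measurable borel" "bounded {x. sb s a x \<noteq> 0}"
proof -
  show "0 \<le> sb s a x" "sb s a x \<le> 1" unfolding sbump_def[OF moll] by (rule bump_nonneg[OF moll] bump_le[OF moll])+
  show "sb s a a = 1" unfolding sbump_def[OF moll] by (rule bump_one[OF moll]) simp
  show "sb s a x = 0" if "dist a x \<ge> 4 * s"
  proof -
    have n: "norm ((x - a) /\<^sub>R s) = dist a x / s"
      using assms by (simp add: divide_inverse mult.commute dist_norm norm_minus_commute)
    have "4 \<le> dist a x / s" using that assms by (simp add: pos_le_divide_eq)
    then have "399/100 \<le> norm ((x - a) /\<^sub>R s)" unfolding n by linarith
    then show ?thesis unfolding sbump_def[OF moll] by (rule bump_zero[OF moll])
  qed
  show "sb s a \<in> borel_measurable borel" "bounded {x. sb s a x \<noteq> 0}"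
    using sbump_test[OF moll assms, of a] smooth_borel by (auto simp: test_function_def)
qed

text \<open>A cut-off at \<open>y\<close>, narrow enough to avoid every other point of both
  configurations, reads off the multiplicity of \<open>y\<close> from the divergence of the field.
  Hence the definite description in \<open>field_config\<close> is sound.\<close>

lemma configs_unique:
  assumes X: "X \<in> configs" "compatible E X" and Y: "Y \<in> configs" "compatible E Y"
  shows "X = Y"
proof -
  obtain I :: "(plane \<times> nat) set" where I: "loc_fin I fst" "X = conf I fst" using configs_conf[OF X(1)] .
  obtain J :: "(plane \<times> nat) set" where J: "loc_fin J fst" "Y = conf J fst" using configs_conf[OF Y(1)] .
  have mult: "(\<integral>z. sb s y z \<partial>conf K fst) = card {i\<in>K. fst i = y}"
    if K: "loc_fin K fst" and s: "s > 0" and d: "\<And>i. i \<in> K \<Longrightarrow> fst i \<noteq> y \<Longrightarrow> 4 * s \<le> dist y (fst i)"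
    for K :: "(plane \<times> nat) set" and s y
  proof -
    have "{i\<in>K. sb s y (fst i) \<noteq> 0} = {i\<in>K. fst i = y}"
      using sb_props(3,4)[OF s, of y] d by (auto; metis zero_neq_one)
    then have "(\<integral>z. sb s y z \<partial>conf K fst) = (\<Sum>i | i \<in> K \<and> fst i = y. sb s y (fst i))"
      using integral_conf(1)[OF K sb_props(5,6)[OF s]] by simp
    also have "\<dots> = (\<Sum>i | i \<in> K \<and> fst i = y. 1)" by (intro sum.cong refl) (auto simp: sb_props(3)[OF s])
    finally show ?thesis by simp
  qed
  have "card {i\<in>I. fst i = y} = card {i\<in>J. fst i = y}" for y
  proof -
    obtain d1 where d1: "d1 > 0" "\<And>i. i \<in> I \<Longrightarrow> fst i \<noteq> y \<Longrightarrow> d1 \<le> dist y (fst i)" using isolate_point[OF I(1)] by metis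
    obtain d2 where d2: "d2 > 0" "\<And>i. i \<in> J \<Longrightarrow> fst i \<noteq> y \<Longrightarrow> d2 \<le> dist y (fst i)" using isolate_point[OF J(1)] by metis
    define s where "s = min d1 d2 / 4"
    have s: "s > 0" using d1 d2 by (simp add: s_def)
    have "test_function (sb s y)" by (rule sbump_test[OF moll s])
    then have "2 * pi * ((\<integral>z. sb s y z \<partial>X) - (\<integral>z. sb s y z \<partial>lborel)) = 2 * pi * ((\<integral>z. sb s y z \<partial>Y) - (\<integral>z. sb s y z \<partial>lborel))"
      using X(2) Y(2) unfolding compatible_def by metis
    then have eq: "(\<integral>z. sb s y z \<partial>X) = (\<integral>z. sb s y z \<partial>Y)" by simp
    have "(\<integral>z. sb s y z \<partial>X) = card {i\<in>I. fst i = y}" unfolding I(2)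
      by (rule mult[OF I(1) s]) (use d1(2) in \<open>force simp: s_def\<close>)
    moreover have "(\<integral>z. sb s y z \<partial>Y) = card {i\<in>J. fst i = y}" unfolding J(2)
      by (rule mult[OF J(1) s]) (use d2(2) in \<open>force simp: s_def\<close>)
    ultimately show ?thesis using eq by simp
  qed
  then show ?thesis unfolding I(2) J(2) conf_eq_config_measure(1)[OF I(1)] conf_eq_config_measure(1)[OF J(1)] by simp
qed

lemma field_config_eq:
  assumes "X \<in> configs" "compatible E X" shows "field_config E = X"
proof -
  have "(THE X. X \<in> configs \<and> compatible E X) = X"
    by (rule the_equality) (use assms configs_unique in blast)+
  then show ?thesis using assms unfolding field_config_def by auto
qed

definition "D0 = (\<integral>\<^sup>+z. ennreal ((norm (gradient (bump \<rho>) z))\<^sup>2) \<partial>lborel)"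

lemma gb_borel [measurable]: "gradient (bump \<rho>) \<in> borel_measurable borel"
  by (rule borel_measurable_continuous_onI) (rule gradient_continuous[OF bump_smooth[OF moll]])

lemma D0_finite: "D0 < \<infinity>"
proof -
  have "compact (gradient (bump \<rho>) ` cball 0 4)"
    by (intro compact_continuous_image continuous_on_subset[OF gradient_continuous[OF bump_smooth[OF moll]]]) auto
  then obtain B where B: "\<And>z. z \<in> cball 0 4 \<Longrightarrow> norm (gradient (bump \<rho>) z) \<le> B"
    using compact_imp_bounded bounded_iff by (metis (no_types, lifting) imageI)
  have "D0 \<le> (\<integral>\<^sup>+z. ennreal (B\<^sup>2) * indicator (cball 0 4) z \<partial>(lborel :: plane measure))"
    unfolding D0_def
  proof (rule nn_integral_mono)
    fix z :: plane
    show "ennreal ((norm (gradient (bump \<rho>) z))\<^sup>2) \<le> ennreal (B\<^sup>2) * indicator (cball 0 4) z"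
    proof (cases "z \<in> cball 0 4")
      case True
      then show ?thesis using B[OF True] by (auto intro!: ennreal_leI power_mono)
    next
      case False
      then have "gradient (bump \<rho>) z = 0" by (intro bump_gradient_zero[OF moll]) auto
      then show ?thesis by simp
    qed
  qed
  also have "\<dots> = ennreal (B\<^sup>2) * ennreal (pi * 4\<^sup>2)"
    using emeasure_cball_plane[of 4 0] by (simp add: nn_integral_cmult)
  also have "\<dots> < \<infinity>" by (simp add: ennreal_mult_less_top)
  finally show ?thesis .
qed

definition annulus :: "plane \<Rightarrow> real \<Rightarrow> plane set" where
  "annulus y s = {z. s \<le> dist y z \<and> dist y z < 4 * s}"

lemma annulus_borel [measurable]: "annulus y s \<in> sets borel"
proof -
  have "annulus y s = {z\<in>space borel. s \<le> dist y z \<and> dist y z < 4 * s}" by (simp add: annulus_def)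
  also have "\<dots> \<in> sets borel" by measurable
  finally show ?thesis .
qed

text \<open>Scale invariance of the Dirichlet integral in dimension 2: the factor
  \<open>1 / s\<^sup>2\<close> of the squared gradient cancels the change of area. Hence all annuli
  around a cluster yield lower bounds of the same order, which produces the factor
  \<open>k\<close>.\<close>

lemma sb_gradient_energy:
  assumes s: "s > 0"
  shows "(\<integral>\<^sup>+z. ennreal ((norm (gradient (sb s y) z))\<^sup>2) \<partial>lborel) = D0"
proof -
  have s0: "1 / s \<noteq> 0" using s by simp
  have m0: "(\<lambda>z. ennreal ((norm (gradient (bump \<rho>) z))\<^sup>2)) \<in> borel_measurable borel" by measurable
  have m: "(\<lambda>z. ennreal ((norm (gradient (bump \<rho>) (- (y /\<^sub>R s) + (1 / s) *\<^sub>R z)))\<^sup>2)) \<in> borel_measurable lborel"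
    using measurable_compose[OF _ m0, of "\<lambda>z. - (y /\<^sub>R s) + (1 / s) *\<^sub>R z" lborel] by simp
  have "(\<integral>\<^sup>+z. ennreal ((norm (gradient (sb s y) z))\<^sup>2) \<partial>lborel)
     = (\<integral>\<^sup>+z. ennreal (1 / s\<^sup>2) * ennreal ((norm (gradient (bump \<rho>) (- (y /\<^sub>R s) + (1 / s) *\<^sub>R z)))\<^sup>2) \<partial>lborel)"
  proof (rule nn_integral_cong)
    fix z
    have "(z - y) /\<^sub>R s = - (y /\<^sub>R s) + (1 / s) *\<^sub>R z" by (simp add: inverse_eq_divide scaleR_diff_right)
    then show "ennreal ((norm (gradient (sb s y) z))\<^sup>2) = ennreal (1 / s\<^sup>2) * ennreal ((norm (gradient (bump \<rho>) (- (y /\<^sub>R s) + (1 / s) *\<^sub>R z)))\<^sup>2)"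
      unfolding sbump_gradient[OF moll s] using s by (simp add: power_divide ennreal_mult[symmetric])
  qed
  also have "\<dots> = ennreal (1 / s\<^sup>2) * (ennreal (1 / (1 / s)\<^sup>2) * D0)"
    unfolding D0_def nn_integral_cmult[OF m]
    by (subst nn_integral_lborel_affine[OF m0 s0]) simp
  also have "\<dots> = D0"
  proof -
    have "ennreal (1 / s\<^sup>2) * ennreal (1 / (1 / s)\<^sup>2) = 1"
      using s by (simp add: ennreal_mult[symmetric] power_divide)
    then show ?thesis by (simp add: mult.assoc[symmetric])
  qed
  finally show ?thesis .
qed

lemma sb_gradient_zero: "s > 0 \<Longrightarrow> z \<notin> annulus y s \<Longrightarrow> gradient (sb s y) z = 0"
proof -
  assume s: "s > 0" and z: "z \<notin> annulus y s"
  have n: "norm ((z - y) /\<^sub>R s) = dist y z / s" using s by (simp add: divide_inverse mult.commute dist_norm norm_minus_commute)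
  have "dist y z / s \<le> 1 \<or> 4 \<le> dist y z / s" using z s by (auto simp: annulus_def pos_divide_le_eq pos_le_divide_eq not_le not_less)
  then have "gradient (bump \<rho>) ((z - y) /\<^sub>R s) = 0" unfolding n[symmetric] by (intro bump_gradient_zero[OF moll]) 
  then show ?thesis unfolding sbump_gradient[OF moll s] by simp
qed

lemma sb_integral_le: "s > 0 \<Longrightarrow> (\<integral>z. sb s y z \<partial>lborel) \<le> 64 * s\<^sup>2"
proof -
  assume s: "s > 0"
  have "(\<integral>z. sb s y z \<partial>lborel) \<le> (\<integral>z. indicator (cball y (4 * s)) z \<partial>lborel)"
  proof (rule integral_mono_AE')
    show "integrable lborel (indicator (cball y (4 * s)) :: plane \<Rightarrow> real)"
      using emeasure_cball_plane[of "4 * s" y] s by (simp add: integrable_indicator_iff)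
    show "AE x in lborel. sb s y x \<le> indicator (cball y (4 * s)) x"
      using sb_props(2,4)[OF s, of y] by (intro AE_I2) (auto simp: indicator_def)
  qed (use sb_props(1)[OF s] in simp)
  also have "\<dots> = pi * (4 * s)\<^sup>2" using emeasure_cball_plane[of "4 * s" y] s by (simp add: measure_def)
  also have "\<dots> \<le> 4 * (4 * s)\<^sup>2" using pi_less_4 by (intro mult_right_mono) auto
  finally show ?thesis by (simp add: power_mult_distrib)
qed

text \<open>Testing the divergence equation with the cut-off at \<open>y\<close> gives at least
  \<open>2 * pi * (M - 64 * s\<^sup>2)\<close>, hence at least \<open>pi * M\<close>; further points
  under the cut-off only increase it. The gradient of the cut-off lives on the annulus, so the
  Cauchy-Schwarz inequality localises the energy there.\<close>

lemma annulus_energy: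
  assumes E: "E \<in> borel_measurable borel" and X: "X \<in> configs" and c: "compatible E X"
    and s: "s > 0" and M: "of_nat M \<le> emeasure X {y}" "128 * s\<^sup>2 \<le> real M"
  shows "ennreal ((pi * real M)\<^sup>2) \<le> (\<integral>\<^sup>+z\<in>annulus y s. ennreal ((norm (E z))\<^sup>2) \<partial>lborel) * D0"
proof -
  let ?f = "sb s y"
  have mE: "(\<lambda>z. ennreal (norm (E z)) * indicator (annulus y s) z) \<in> borel_measurable lborel"
    using E annulus_borel[of y s] by (intro borel_measurable_times_ennreal borel_measurable_indicator) auto
  have mg: "gradient ?f \<in> borel_measurable lborel"
    using sbump_test[OF moll s, of y] borel_measurable_continuous_onI[OF gradient_continuous, of ?f] by (simp add: test_function_def)
  have mG: "(\<lambda>z. ennreal (norm (gradient ?f z))) \<in> borel_measurable lborel"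
    by (rule measurable_compose[OF measurable_compose[OF mg borel_measurable_norm] measurable_ennreal])
  obtain I :: "(plane \<times> nat) set" where I: "loc_fin I fst" "X = conf I fst" using configs_conf[OF X] .
  have "real M \<le> real (card {i\<in>I. fst i = y})"
  proof -
    have "of_nat M \<le> (of_nat (card {i\<in>I. fst i = y}) :: ennreal)"
      using M(1) emeasure_conf_bounded[OF I(1), of "{y}"] by (simp add: I(2))
    then show ?thesis by simp
  qed
  also have "\<dots> = (\<Sum>i | i \<in> I \<and> fst i = y. ?f (fst i))"
    by (simp add: sb_props(3)[OF s])
  also have "\<dots> \<le> (\<Sum>i | i \<in> I \<and> ?f (fst i) \<noteq> 0. ?f (fst i))"
    by (rule sum_mono2) (use integral_conf(2)[OF I(1) sb_props(5,6)[OF s]] sb_props(1,3)[OF s] in auto)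
  also have "\<dots> = (\<integral>z. ?f z \<partial>X)" using integral_conf(1)[OF I(1) sb_props(5,6)[OF s]] by (simp add: I(2))
  finally have "real M / 2 \<le> (\<integral>z. ?f z \<partial>X) - (\<integral>z. ?f z \<partial>lborel)"
    using sb_integral_le[OF s, of y] M(2) by linarith
  then have "pi * real M \<le> 2 * pi * ((\<integral>z. ?f z \<partial>X) - (\<integral>z. ?f z \<partial>lborel))"
    using mult_left_mono[of "real M / 2" _ "2 * pi"] by simp
  also have "\<dots> = (\<integral>z. E z \<bullet> gradient ?f z \<partial>lborel)"
    using c sbump_test[OF moll s, of y] by (simp add: compatible_def)
  finally have "ennreal (pi * real M) \<le> ennreal \<bar>\<integral>z. E z \<bullet> gradient ?f z \<partial>lborel\<bar>" by (intro ennreal_leI) linarith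
  also have "\<dots> \<le> (\<integral>\<^sup>+z. ennreal \<bar>E z \<bullet> gradient ?f z\<bar> \<partial>lborel)" by (rule norm_integral_le_nn)
  also have "\<dots> \<le> (\<integral>\<^sup>+z. (ennreal (norm (E z)) * indicator (annulus y s) z) * ennreal (norm (gradient ?f z)) \<partial>lborel)"
  proof (rule nn_integral_mono)
    fix z
    show "ennreal \<bar>E z \<bullet> gradient ?f z\<bar> \<le> (ennreal (norm (E z)) * indicator (annulus y s) z) * ennreal (norm (gradient ?f z))"
    proof (cases "z \<in> annulus y s")
      case True
      then show ?thesis using Cauchy_Schwarz_ineq2[of "E z" "gradient ?f z"] by (simp add: ennreal_mult[symmetric])
    next
      case False
      then show ?thesis using sb_gradient_zero[OF s False] by simp
    qed
  qed
  finally have "(ennreal (pi * real M))\<^sup>2 \<le> (\<integral>\<^sup>+z. (ennreal (norm (E z)) * indicator (annulus y s) z) * ennreal (norm (gradient ?f z)) \<partial>lborel)\<^sup>2"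
    by (rule power_mono) simp
  also have "\<dots> \<le> (\<integral>\<^sup>+z. (ennreal (norm (E z)) * indicator (annulus y s) z)\<^sup>2 \<partial>lborel) * (\<integral>\<^sup>+z. (ennreal (norm (gradient ?f z)))\<^sup>2 \<partial>lborel)"
    by (rule Cauchy_Schwarz_nn_integral[OF mE mG])
  also have "(\<integral>\<^sup>+z. (ennreal (norm (gradient ?f z)))\<^sup>2 \<partial>lborel) = D0"
    using sb_gradient_energy[OF s, of y] by (simp add: ennreal_power)
  also have "(\<integral>\<^sup>+z. (ennreal (norm (E z)) * indicator (annulus y s) z)\<^sup>2 \<partial>lborel) = (\<integral>\<^sup>+z\<in>annulus y s. ennreal ((norm (E z))\<^sup>2) \<partial>lborel)"
    by (intro nn_integral_cong) (simp add: ennreal_power indicator_def)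
  finally show ?thesis by (simp add: ennreal_power)
qed

end

section \<open>Lebesgue differentiation\<close>

declare comp_measurable [measurable del] \<rho>_borel [measurable del] gb_borel [measurable del]

text \<open>Vitali's covering argument. The measure with density \<open>g\<close> has no mass on
  \<open>A\<close>, so by outer regularity some open \<open>U\<close> around a bounded part of
  \<open>A\<close> has small mass. The disks in \<open>U\<close> with too large an average contain a
  disjoint subfamily whose fivefold enlargements cover the bad points; the total area of these is at
  most \<open>25 / e\<close> times the mass of \<open>U\<close>.\<close>

lemma small_averages:
  fixes g :: "plane \<Rightarrow> real"
  assumes g[measurable]: "g \<in> borel_measurable borel" and A[measurable]: "A \<in> sets borel" and gA: "\<And>y. y \<in> A \<Longrightarrow> g y \<le> 0"
    and fin: "\<And>R. (\<integral>\<^sup>+z\<in>cball 0 R. ennreal (g z) \<partial>lborel) < \<infinity>" and e: "e > 0"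
  shows "AE y in lborel. y \<in> A \<longrightarrow>
     (\<forall>\<^sub>F r in at_right 0. (\<integral>\<^sup>+z\<in>cball y r. ennreal (g z) \<partial>lborel) \<le> ennreal e * emeasure lborel (cball y r))"
proof -
  define ok where "ok y r \<longleftrightarrow> (\<integral>\<^sup>+z\<in>cball y r. ennreal (g z) \<partial>lborel) \<le> ennreal e * emeasure lborel (cball y r)" for y r
  define S where "S n = {y\<in>A \<inter> ball 0 (real n). \<not> (\<forall>\<^sub>F r in at_right 0. ok y r)}" for n
  have "negligible (S n)" for n
    unfolding negligible_outer_le
  proof safe
    fix \<epsilon> :: real assume eps: "\<epsilon> > 0"
    define B where "B = (ball 0 (real n + 1) :: plane set)"
    have B[measurable]: "B \<in> sets borel" by (simp add: B_def)
    define \<nu> where "\<nu> = density lborel (\<lambda>z. ennreal (g z) * indicator B z)"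
    have nu: "emeasure \<nu> V = (\<integral>\<^sup>+z. ennreal (g z) * indicator B z * indicator V z \<partial>lborel)" if "V \<in> sets borel" for V
      unfolding \<nu>_def using that by (subst emeasure_density) auto
    have "emeasure \<nu> (space \<nu>) \<le> (\<integral>\<^sup>+z\<in>cball 0 (real n + 1). ennreal (g z) \<partial>lborel)"
    proof -
      have "emeasure \<nu> (space \<nu>) = (\<integral>\<^sup>+z. ennreal (g z) * indicator B z * indicator UNIV z \<partial>lborel)"
        using nu[of UNIV] by (simp add: \<nu>_def)
      also have "\<dots> \<le> (\<integral>\<^sup>+z\<in>cball 0 (real n + 1). ennreal (g z) \<partial>lborel)"
        by (rule nn_integral_mono) (auto simp: B_def indicator_def)
      finally show ?thesis .
    qed
    then have nufin: "emeasure \<nu> (space \<nu>) \<noteq> \<infinity>" using fin[of "real n + 1"] by auto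
    define A' where "A' = A \<inter> ball 0 (real n)"
    have A': "A' \<in> sets borel" by (simp add: A'_def)
    have "emeasure \<nu> A' = (\<integral>\<^sup>+z. 0 \<partial>(lborel :: plane measure))"
      unfolding nu[OF A'] by (rule nn_integral_cong) (use gA in \<open>auto simp: A'_def indicator_def ennreal_neg\<close>)
    then have z: "(INF U\<in>{U. A' \<subseteq> U \<and> open U}. emeasure \<nu> U) = 0"
      using outer_regular[of \<nu>, OF _ nufin A'] by (simp add: \<nu>_def)
    have "(INF U\<in>{U. A' \<subseteq> U \<and> open U}. emeasure \<nu> U) < ennreal (\<epsilon> * e / 25)" unfolding z using eps e by simp
    then obtain U where U: "A' \<subseteq> U" "open U" "emeasure \<nu> U < ennreal (\<epsilon> * e / 25)" unfolding INF_less_iff by blast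
    \<comment> \<open>The covering lemma asks for bounded radii, and inside \<open>B\<close> the
      integral of \<open>g\<close> over a disk is its \<open>\<nu>\<close>-mass.\<close>
    define K where "K = {(y, r). 0 < r \<and> r \<le> 1 \<and> cball y r \<subseteq> U \<inter> B \<and> \<not> ok y r}"
    have cov: "S n \<subseteq> (\<Union>i\<in>K. cball (fst i) (snd i))"
    proof
      fix y assume y: "y \<in> S n"
      then have "y \<in> U \<inter> B" using U(1) by (auto simp: S_def A'_def B_def)
      moreover have "open (U \<inter> B)" using U(2) by (auto simp: B_def)
      ultimately obtain d where d: "d > 0" "cball y d \<subseteq> U \<inter> B" using open_contains_cball by metis
      have "\<not> (\<exists>b>0. \<forall>r>0. r < b \<longrightarrow> ok y r)" using y unfolding S_def eventually_at_right_field by blast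
      then obtain r where r: "0 < r" "r < min d 1" "\<not> ok y r" using d(1) by (metis min_less_iff_conj zero_less_one)
      have "cball y r \<subseteq> cball y d" using r(2) by (intro subset_cball) simp
      then have "cball y r \<subseteq> U \<inter> B" using d(2) by (rule subset_trans)
      then have "(y, r) \<in> K" unfolding K_def using r by simp
      then show "y \<in> (\<Union>i\<in>K. cball (fst i) (snd i))" using r(1) by (intro UN_I[of "(y, r)"]) auto
    qed
    have rK: "\<And>i. i \<in> K \<Longrightarrow> 0 < snd i \<and> snd i \<le> 1" by (simp add: K_def split_beta)
    obtain C where C: "countable C" "C \<subseteq> K"
        "pairwise (\<lambda>i j. disjnt (cball (fst i) (snd i)) (cball (fst j) (snd j))) C"
        "S n \<subseteq> (\<Union>i\<in>C. cball (fst i) (5 * snd i))"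
      by (rule Vitali_covering_lemma_cballs[OF cov rK])
    define T where "T = (\<Union>i\<in>C. cball (fst i) (5 * snd i))"
    have T: "T \<in> sets borel" unfolding T_def using C(1) by (intro sets.countable_UN'') auto
    have "ennreal e * emeasure lborel T \<le> ennreal e * (\<integral>\<^sup>+x. \<integral>\<^sup>+i. indicator (cball (fst i) (5 * snd i)) x \<partial>count_space C \<partial>lborel)"
    proof (rule mult_left_mono)
      have "emeasure lborel T = (\<integral>\<^sup>+x. indicator T x \<partial>lborel)" using T by simp
      also have "\<dots> \<le> (\<integral>\<^sup>+x. \<integral>\<^sup>+i. indicator (cball (fst i) (5 * snd i)) x \<partial>count_space C \<partial>lborel)"
      proof (rule nn_integral_mono)
        fix x show "indicator T x \<le> (\<integral>\<^sup>+i. indicator (cball (fst i) (5 * snd i)) x \<partial>count_space C)"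
        proof (cases "x \<in> T")
          case True
          then obtain i where i: "i \<in> C" "x \<in> cball (fst i) (5 * snd i)" unfolding T_def by blast
          show ?thesis using nn_integral_ge_point[OF i(1), of "\<lambda>i. indicator (cball (fst i) (5 * snd i)) x :: ennreal"] i(2) True by simp
        qed simp
      qed
      finally show "emeasure lborel T \<le> (\<integral>\<^sup>+x. \<integral>\<^sup>+i. indicator (cball (fst i) (5 * snd i)) x \<partial>count_space C \<partial>lborel)" .
    qed simp
    also have "(\<integral>\<^sup>+x. \<integral>\<^sup>+i. indicator (cball (fst i) (5 * snd i)) x \<partial>count_space C \<partial>(lborel :: plane measure))
       = (\<integral>\<^sup>+i. emeasure lborel (cball (fst i) (5 * snd i)) \<partial>count_space C)"
      by (subst nn_integral_count_space_nn_integral[OF C(1)]) auto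
    also have "ennreal e * \<dots> = (\<integral>\<^sup>+i. ennreal e * emeasure lborel (cball (fst i) (5 * snd i)) \<partial>count_space C)"
      by (rule nn_integral_cmult[symmetric]) simp
    also have "\<dots> \<le> (\<integral>\<^sup>+i. ennreal 25 * emeasure \<nu> (cball (fst i) (snd i)) \<partial>count_space C)"
    proof (rule nn_integral_mono)
      fix i assume "i \<in> space (count_space C)"
      then have i: "i \<in> K" using C(2) by auto
      then have r: "0 < snd i" and sub: "cball (fst i) (snd i) \<subseteq> B" and nok: "\<not> ok (fst i) (snd i)" by (auto simp: K_def)
      have "emeasure lborel (cball (fst i) (5 * snd i)) = ennreal 25 * emeasure lborel (cball (fst i) (snd i))"
        using emeasure_cball_plane[of "5 * snd i" "fst i"] emeasure_cball_plane[of "snd i" "fst i"] r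
        by (simp add: power_mult_distrib ennreal_mult[symmetric] mult_ac del: ennreal_numeral)
      moreover have "ennreal e * emeasure lborel (cball (fst i) (snd i)) \<le> (\<integral>\<^sup>+z\<in>cball (fst i) (snd i). ennreal (g z) \<partial>lborel)"
        using nok unfolding ok_def by simp
      moreover have "(\<integral>\<^sup>+z\<in>cball (fst i) (snd i). ennreal (g z) \<partial>lborel) = emeasure \<nu> (cball (fst i) (snd i))"
        unfolding nu[OF cball_borel] by (rule nn_integral_cong) (use sub in \<open>auto simp: indicator_def\<close>)
      ultimately show "ennreal e * emeasure lborel (cball (fst i) (5 * snd i)) \<le> ennreal 25 * emeasure \<nu> (cball (fst i) (snd i))"
        by (simp only: mult.left_commute[of "ennreal e"]) (auto intro!: mult_left_mono)
    qed
    also have "\<dots> = ennreal 25 * (\<integral>\<^sup>+i. emeasure \<nu> (cball (fst i) (snd i)) \<partial>count_space C)"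
      by (rule nn_integral_cmult) simp
    also have "(\<integral>\<^sup>+i. emeasure \<nu> (cball (fst i) (snd i)) \<partial>count_space C) = emeasure \<nu> (\<Union>i\<in>C. cball (fst i) (snd i))"
      by (rule emeasure_UN_countable[symmetric])
        (use C(1,3) in \<open>auto simp: \<nu>_def disjoint_family_on_def pairwise_def disjnt_def\<close>)
    also have "\<dots> \<le> emeasure \<nu> U"
    proof (rule emeasure_mono)
      have "cball (fst i) (snd i) \<subseteq> U" if "i \<in> C" for i
        using subsetD[OF C(2) that] by (simp add: K_def split_beta)
      then show "(\<Union>i\<in>C. cball (fst i) (snd i)) \<subseteq> U" by (rule UN_least)
      show "U \<in> sets \<nu>" using U(2) by (simp add: \<nu>_def)
    qed
    also have "ennreal 25 * emeasure \<nu> U \<le> ennreal 25 * ennreal (\<epsilon> * e / 25)" using U(3) by (intro mult_left_mono) auto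
    also have "\<dots> = ennreal e * ennreal \<epsilon>" using e eps by (simp add: ennreal_mult[symmetric] mult.commute del: ennreal_numeral)
    finally have "ennreal e * emeasure lborel T \<le> ennreal e * ennreal \<epsilon>" by (simp add: mult_left_mono)
    then have Te: "emeasure lborel T \<le> ennreal \<epsilon>" using e by (simp add: ennreal_mult_le_mult_iff)
    show "\<exists>T. S n \<subseteq> T \<and> T \<in> lmeasurable \<and> measure lebesgue T \<le> \<epsilon>"
    proof (intro exI conjI)
      show "S n \<subseteq> T" using C(4) by (simp add: T_def)
      have eq: "emeasure lebesgue T = emeasure lborel T" using T by simp
      have lt: "ennreal \<epsilon> < \<infinity>" by simp
      have Ts: "T \<in> sets lebesgue" using T by simp
      show "T \<in> lmeasurable"
        by (rule fmeasurableI[OF Ts]) (use eq le_less_trans[OF Te lt] in simp)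
      show "measure lebesgue T \<le> \<epsilon>" unfolding measure_def eq using Te eps by (intro enn2real_leI) auto
    qed
  qed
  then have "negligible (\<Union>n. S n)" by (intro negligible_countable_Union) auto
  then have "(\<Union>n. S n) \<in> null_sets lebesgue" by (simp add: negligible_iff_null_sets)
  then have "AE y in lebesgue. y \<notin> (\<Union>n. S n)" by (rule AE_not_in)
  then have "AE y in lborel. y \<notin> (\<Union>n. S n)" unfolding AE_completion_iff .
  then show ?thesis
  proof (rule AE_mp, intro AE_I2 impI)
    fix y :: plane assume y: "y \<notin> (\<Union>n. S n)" "y \<in> A"
    obtain n where n: "norm y < real n" using reals_Archimedean2 by blast
    have "y \<in> A \<inter> ball 0 (real n)" by (simp only: Int_iff mem_ball dist_0_norm n y(2) simp_thms)
    moreover have "y \<notin> S n" using y(1) by blast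
    ultimately have "\<forall>\<^sub>F r in at_right 0. ok y r" unfolding S_def by blast
    then show "\<forall>\<^sub>F r in at_right 0. (\<integral>\<^sup>+z\<in>cball y r. ennreal (g z) \<partial>lborel) \<le> ennreal e * emeasure lborel (cball y r)"
      unfolding ok_def .
  qed
qed

lemma set_integrable_cball:
  fixes f :: "plane \<Rightarrow> real"
  assumes f[measurable]: "f \<in> borel_measurable borel" and fin: "\<And>R. (\<integral>\<^sup>+z\<in>cball 0 R. ennreal \<bar>f z\<bar> \<partial>lborel) < \<infinity>"
  shows "set_integrable lborel (cball y r) f"
  unfolding set_integrable_def
proof (rule integrableI_bounded)
  show "(\<lambda>x. indicator (cball y r) x *\<^sub>R f x) \<in> borel_measurable lborel"
    using f by (intro borel_measurable_scaleR borel_measurable_indicator) auto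
  have "(\<integral>\<^sup>+x. ennreal (norm (indicator (cball y r) x *\<^sub>R f x)) \<partial>lborel) \<le> (\<integral>\<^sup>+z\<in>cball 0 (norm y + r). ennreal \<bar>f z\<bar> \<partial>lborel)"
  proof (rule nn_integral_mono)
    fix x
    have "x \<in> cball y r \<Longrightarrow> x \<in> cball 0 (norm y + r)" using norm_triangle_sub[of x y] by (auto simp: dist_norm norm_minus_commute)
    then show "ennreal (norm (indicator (cball y r) x *\<^sub>R f x)) \<le> ennreal \<bar>f x\<bar> * indicator (cball 0 (norm y + r)) x"
      by (auto simp: indicator_def)
  qed
  then show "(\<integral>\<^sup>+x. ennreal (norm (indicator (cball y r) x *\<^sub>R f x)) \<partial>lborel) < \<infinity>" using fin by (rule le_less_trans)
qed

text \<open>For a rational \<open>c\<close> slightly above \<open>f y\<close>, the function is at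
  most \<open>c\<close> plus its excess over \<open>c\<close>, and the excess has small averages at
  almost every point of \<open>{z. f z \<le> c}\<close>. Countably many levels and tolerances
  suffice.\<close>

lemma averages_upper:
  fixes f :: "plane \<Rightarrow> real"
  assumes f[measurable]: "f \<in> borel_measurable borel" and fin: "\<And>R. (\<integral>\<^sup>+z\<in>cball 0 R. ennreal \<bar>f z\<bar> \<partial>lborel) < \<infinity>"
  shows "AE y in lborel. \<forall>e>0. \<forall>\<^sub>F r in at_right 0. (LINT z:cball y r|lborel. f z) / measure lborel (cball y r) < f y + e"
proof -
  define g where "g c z = max 0 (f z - c)" for c z
  have g[measurable]: "g c \<in> borel_measurable borel" for c unfolding g_def by measurable
  have gfin: "(\<integral>\<^sup>+z\<in>cball 0 R. ennreal \<bar>g c z\<bar> \<partial>lborel) < \<infinity>" for R c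
  proof -
    have "(\<integral>\<^sup>+z\<in>cball 0 R. ennreal \<bar>g c z\<bar> \<partial>lborel)
       \<le> (\<integral>\<^sup>+z. ennreal \<bar>f z\<bar> * indicator (cball 0 R) z + ennreal \<bar>c\<bar> * indicator (cball 0 R) z \<partial>lborel)"
      by (rule nn_integral_mono) (auto simp: g_def indicator_def ennreal_plus[symmetric] simp del: ennreal_plus intro!: ennreal_leI)
    also have "\<dots> = (\<integral>\<^sup>+z\<in>cball 0 R. ennreal \<bar>f z\<bar> \<partial>lborel) + ennreal \<bar>c\<bar> * emeasure lborel (cball (0::plane) R)"
      by (subst nn_integral_add) (auto simp: nn_integral_cmult)
    also have "\<dots> < \<infinity>" using fin[of R] emeasure_bounded_finite[OF bounded_cball, of "0::plane" R]
      by (auto simp: ennreal_mult_less_top)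
    finally show ?thesis .
  qed
  have gfin': "(\<integral>\<^sup>+z\<in>cball 0 R. ennreal (g c z) \<partial>lborel) < \<infinity>" for R c
    using gfin[of c R] by (simp add: g_def)
  define ok where "ok c k y \<longleftrightarrow> (y \<in> {z. f z \<le> c} \<longrightarrow> (\<forall>\<^sub>F r in at_right 0.
      (\<integral>\<^sup>+z\<in>cball y r. ennreal (g c z) \<partial>lborel) \<le> ennreal (1 / (real k + 1)) * emeasure lborel (cball y r)))" for c k y
  have "AE y in lborel. ok c k y" for c k
  proof -
    have b: "{z. f z \<le> c} \<in> sets borel" by measurable
    have g0: "\<And>y. y \<in> {z. f z \<le> c} \<Longrightarrow> g c y \<le> 0" by (auto simp: g_def)
    have p: "0 < 1 / (real k + 1)" by simp
    show ?thesis unfolding ok_def by (rule small_averages[OF g b g0 gfin' p])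
  qed
  then have "AE y in lborel. \<forall>c\<in>\<rat>. \<forall>k. ok c k y"
    by (subst AE_ball_countable[OF countable_rat]) (simp add: AE_all_countable)
  then show ?thesis
  proof (rule AE_mp, intro AE_I2 impI allI)
    fix y :: plane and e :: real assume ok: "\<forall>c\<in>\<rat>. \<forall>k. ok c k y" and e: "e > 0"
    have "f y < f y + e / 2" using e by simp
    then obtain c where c: "c \<in> \<rat>" "f y < c" "c < f y + e / 2" using Rats_dense_in_real by blast
    obtain k where k: "1 / (real k + 1) < e / 2" using nat_approx_posE[of "e / 2"] e by (auto simp: add.commute)
    have ev: "\<forall>\<^sub>F r in at_right 0. (\<integral>\<^sup>+z\<in>cball y r. ennreal (g c z) \<partial>lborel) \<le> ennreal (1 / (real k + 1)) * emeasure lborel (cball y r)"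
      using ok c unfolding ok_def by auto
    have "\<forall>\<^sub>F r in at_right (0::real). r > 0" by (simp add: eventually_at_right_less)
    with ev show "\<forall>\<^sub>F r in at_right 0. (LINT z:cball y r|lborel. f z) / measure lborel (cball y r) < f y + e"
    proof eventually_elim
      case (elim r)
      define m where "m = measure lborel (cball y r)"
      have m: "m = pi * r\<^sup>2" "emeasure lborel (cball y r) = ennreal m" "m > 0"
        using emeasure_cball_plane[of r y] elim(2) by (auto simp: m_def measure_def)
      have si: "set_integrable lborel (cball y r) f" "set_integrable lborel (cball y r) (g c)" "set_integrable lborel (cball y r) (\<lambda>z. c)"
        using set_integrable_cball[OF f fin] set_integrable_cball[OF g gfin] m(2)
        by (blast, blast, simp add: set_integrable_def)
      have "ennreal (LINT z:cball y r|lborel. g c z) = (\<integral>\<^sup>+z. ennreal (indicator (cball y r) z *\<^sub>R g c z) \<partial>lborel)"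
        unfolding set_lebesgue_integral_def using si(2)
        by (subst nn_integral_eq_integral) (auto simp: set_integrable_def g_def)
      also have "\<dots> = (\<integral>\<^sup>+z\<in>cball y r. ennreal (g c z) \<partial>lborel)"
        by (rule nn_integral_cong) (auto simp: indicator_def)
      also have "\<dots> \<le> ennreal (1 / (real k + 1)) * ennreal m" using elim(1) unfolding m(2) .
      also have "\<dots> = ennreal (1 / (real k + 1) * m)" using m(3) by (intro ennreal_mult[symmetric]) auto
      finally have gi: "(LINT z:cball y r|lborel. g c z) \<le> 1 / (real k + 1) * m" using m(3) by simp
      have "(LINT z:cball y r|lborel. f z) \<le> (LINT z:cball y r|lborel. c + g c z)"
        by (rule set_integral_mono[OF si(1) set_integral_add(1)[OF si(3,2)]]) (auto simp: g_def)
      also have "\<dots> = (LINT z:cball y r|lborel. c) + (LINT z:cball y r|lborel. g c z)" by (rule set_integral_add(2)[OF si(3,2)])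
      also have "(LINT z:cball y r|lborel. c) = c * m" using m(2) by (simp add: set_lebesgue_integral_def m_def)
      also have "c * m + (LINT z:cball y r|lborel. g c z) \<le> (c + 1 / (real k + 1)) * m" using gi by (simp add: distrib_right)
      also have "\<dots> < (f y + e) * m" using c(3) k m(3) by (intro mult_strict_right_mono) auto
      finally show ?case using m(3) by (simp add: m_def pos_divide_less_eq)
    qed
  qed
qed

lemma lebesgue_differentiation_real:
  fixes f :: "plane \<Rightarrow> real"
  assumes f: "f \<in> borel_measurable borel" and fin: "\<And>R. (\<integral>\<^sup>+z\<in>cball 0 R. ennreal \<bar>f z\<bar> \<partial>lborel) < \<infinity>"
  shows "AE y in lborel. ((\<lambda>r. (LINT z:cball y r|lborel. f z) / measure lborel (cball y r)) \<longlongrightarrow> f y) (at_right 0)"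
proof -
  have f': "(\<lambda>z. - f z) \<in> borel_measurable borel" using f by simp
  have fin': "\<And>R. (\<integral>\<^sup>+z\<in>cball 0 R. ennreal \<bar>- f z\<bar> \<partial>lborel) < \<infinity>" using fin by simp
  have neg: "(LINT z:cball y r|lborel. - f z) = - (LINT z:cball y r|lborel. f z)" for y r
    unfolding set_lebesgue_integral_def by (simp only: scaleR_minus_right Bochner_Integration.integral_minus)
  show ?thesis using averages_upper[OF f fin] averages_upper[OF f' fin']
  proof eventually_elim
    case (elim y)
    show ?case
    proof (rule order_tendstoI)
      fix a assume "a < f y"
      then have "\<forall>\<^sub>F r in at_right 0. (LINT z:cball y r|lborel. - f z) / measure lborel (cball y r) < - f y + (f y - a)"
        by (intro elim(2)[rule_format]) simp
      then show "\<forall>\<^sub>F r in at_right 0. a < (LINT z:cball y r|lborel. f z) / measure lborel (cball y r)"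
        by eventually_elim (simp add: neg)
    next
      fix a assume "f y < a"
      then have "\<forall>\<^sub>F r in at_right 0. (LINT z:cball y r|lborel. f z) / measure lborel (cball y r) < f y + (a - f y)"
        by (intro elim(1)[rule_format]) simp
      then show "\<forall>\<^sub>F r in at_right 0. (LINT z:cball y r|lborel. f z) / measure lborel (cball y r) < a" by simp
    qed
  qed
qed

definition avg :: "real \<Rightarrow> plane \<Rightarrow> (plane \<Rightarrow> plane) \<Rightarrow> plane" where
  "avg r y F = (LINT z:cball y r|lborel. F z) /\<^sub>R measure lborel (cball y r)"

lemma Lp_loc_cball:
  assumes "Lp_loc 1 F"
  shows "F \<in> borel_measurable borel" "(\<integral>\<^sup>+z\<in>cball 0 R. ennreal (norm (F z)) \<partial>lborel) < \<infinity>"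
    "set_integrable lborel (cball y r) F"
proof -
  show F[measurable]: "F \<in> borel_measurable borel" using assms by (simp add: Lp_loc_def)
  show fin: "(\<integral>\<^sup>+z\<in>cball 0 R. ennreal (norm (F z)) \<partial>lborel) < \<infinity>" for R
    using assms compact_cball[of 0 R] by (auto simp: Lp_loc_def)
  have "set_integrable lborel (cball y r) (\<lambda>z. norm (F z))"
    by (rule set_integrable_cball) (use fin in auto)
  then have "integrable lborel (\<lambda>z. norm (indicator (cball y r) z *\<^sub>R F z))" by (simp add: set_integrable_def)
  moreover have "(\<lambda>z. indicator (cball y r) z *\<^sub>R F z) \<in> borel_measurable lborel"
    using F by (intro borel_measurable_scaleR borel_measurable_indicator) auto
  ultimately show "set_integrable lborel (cball y r) F"
    unfolding set_integrable_def by (subst (asm) integrable_norm_iff)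
qed

lemma lebesgue_differentiation:
  assumes F: "Lp_loc 1 F"
  shows "AE y in lborel. ((\<lambda>r. avg r y F) \<longlongrightarrow> F y) (at_right 0)"
proof -
  note F1[measurable] = Lp_loc_cball(1)[OF F]
  have comp: "AE y in lborel. ((\<lambda>r. avg r y F $ i) \<longlongrightarrow> F y $ i) (at_right 0)" for i
  proof -
    have c: "(\<lambda>v :: plane. v $ i) \<in> borel_measurable borel" by (intro borel_measurable_continuous_onI continuous_intros)
    have m: "(\<lambda>z. F z $ i) \<in> borel_measurable borel" by (rule measurable_compose[OF F1 c])
    have fin: "(\<integral>\<^sup>+z\<in>cball 0 R. ennreal \<bar>F z $ i\<bar> \<partial>lborel) < \<infinity>" for R
    proof -
      have "(\<integral>\<^sup>+z\<in>cball 0 R. ennreal \<bar>F z $ i\<bar> \<partial>lborel) \<le> (\<integral>\<^sup>+z\<in>cball 0 R. ennreal (norm (F z)) \<partial>lborel)"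
        by (intro nn_integral_mono mult_right_mono ennreal_leI component_le_norm_cart) simp
      then show ?thesis using Lp_loc_cball(2)[OF F] by (rule le_less_trans)
    qed
    have "avg r y F $ i = (LINT z:cball y r|lborel. F z $ i) / measure lborel (cball y r)" for r y
      using integral_bounded_linear[OF bounded_linear_vec_nth[of i] Lp_loc_cball(3)[OF F, of y r, unfolded set_integrable_def]]
      by (simp add: avg_def set_lebesgue_integral_def divide_inverse mult.commute)
    then show ?thesis using lebesgue_differentiation_real[OF m fin] by simp
  qed
  then have "AE y in lborel. \<forall>i\<in>UNIV. ((\<lambda>r. avg r y F $ i) \<longlongrightarrow> F y $ i) (at_right 0)"
    by (subst AE_finite_all[OF finite, simplified]) simp
  then show ?thesis by eventually_elim (auto intro: vec_tendstoI)
qed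

section \<open>The truncation potential\<close>

text \<open>Joint integrability, for exchanging integrals over a parameter in the unit interval and
  over the plane.\<close>

lemma integrable_strip:
  fixes h :: "real \<times> plane \<Rightarrow> real"
  assumes h: "h \<in> borel_measurable (lborel \<Otimes>\<^sub>M lborel)"
    and B: "\<And>t x. \<bar>h (t, x)\<bar> \<le> B" and z: "\<And>t x. t \<notin> {0..1} \<or> norm x > R \<Longrightarrow> h (t, x) = 0"
  shows "integrable (lborel \<Otimes>\<^sub>M lborel) h"
proof (rule integrableI_bounded[OF h])
  have B0: "0 \<le> B" using B[of 0 0] by linarith
  have "(\<integral>\<^sup>+p. ennreal (norm (h p)) \<partial>(lborel \<Otimes>\<^sub>M lborel)) \<le> (\<integral>\<^sup>+p. ennreal B * indicator ({0..1::real} \<times> cball 0 R) p \<partial>(lborel \<Otimes>\<^sub>M (lborel :: plane measure)))"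
  proof (rule nn_integral_mono)
    fix p :: "real \<times> plane"
    show "ennreal (norm (h p)) \<le> ennreal B * indicator ({0..1} \<times> cball 0 R) p"
    proof (cases "p \<in> {0..1} \<times> cball 0 R")
      case True
      then show ?thesis using B[of "fst p" "snd p"] by (simp add: ennreal_leI)
    next
      case False
      then have "h (fst p, snd p) = 0" by (intro z) (auto simp: mem_Times_iff)
      then show ?thesis by simp
    qed
  qed
  also have "\<dots> = ennreal B * (emeasure lborel {0..1::real} * emeasure lborel (cball (0::plane) R))"
    by (subst nn_integral_cmult_indicator) (auto simp: lborel.emeasure_pair_measure_Times)
  also have "\<dots> < \<infinity>" using emeasure_bounded_finite[OF bounded_cball, of "0::plane" R] by (simp add: ennreal_mult_less_top)
  finally show "(\<integral>\<^sup>+p. ennreal (norm (h p)) \<partial>(lborel \<Otimes>\<^sub>M lborel)) < \<infinity>" .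
qed

lemma integral_swap:
  fixes h :: "real \<Rightarrow> plane \<Rightarrow> real"
  assumes "integrable (lborel \<Otimes>\<^sub>M lborel) (\<lambda>(t, x). h t x)"
  shows "(\<integral>x. \<integral>t. h t x \<partial>lborel \<partial>lborel) = (\<integral>t. \<integral>x. h t x \<partial>lborel \<partial>lborel)"
proof -
  show ?thesis by (rule lborel_pair.Fubini_integral[OF assms])
qed

lemma continuous_compact_bound:
  fixes g :: "plane \<Rightarrow> real"
  assumes g: "continuous_on UNIV g" and z: "\<And>x. norm x > R \<Longrightarrow> g x = 0"
  obtains B where "\<And>x. \<bar>g x\<bar> \<le> B"
proof -
  have "compact (g ` cball 0 R)" by (intro compact_continuous_image continuous_on_subset[OF g]) auto
  then obtain B where B: "\<And>v. v \<in> g ` cball 0 R \<Longrightarrow> norm v \<le> B" using compact_imp_bounded bounded_iff by metis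
  show ?thesis
  proof (rule that)
    fix x show "\<bar>g x\<bar> \<le> max B 0"
    proof (cases "norm x > R")
      case True
      then show ?thesis using z by simp
    next
      case False
      then have "g x \<in> g ` cball 0 R" by auto
      from B[OF this] show ?thesis by simp
    qed
  qed
qed

lemma continuous_compact_integrable:
  fixes g :: "plane \<Rightarrow> real"
  assumes g: "continuous_on UNIV g" and z: "\<And>x. norm x > R \<Longrightarrow> g x = 0"
  shows "integrable lborel g"
proof (rule integrableI_bounded)
  show m: "g \<in> borel_measurable lborel" using borel_measurable_continuous_onI[OF g] by simp
  obtain B where B: "\<And>x. \<bar>g x\<bar> \<le> B" using continuous_compact_bound[OF g z] by blast
  have "(\<integral>\<^sup>+x. ennreal (norm (g x)) \<partial>lborel) \<le> (\<integral>\<^sup>+x. ennreal B * indicator (cball 0 R) x \<partial>(lborel :: plane measure))"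
  proof (rule nn_integral_mono)
    fix x show "ennreal (norm (g x)) \<le> ennreal B * indicator (cball 0 R) x"
      using B[of x] z[of x] by (cases "norm x > R") (auto intro: ennreal_leI)
  qed
  also have "\<dots> = ennreal B * emeasure lborel (cball (0::plane) R)" by (simp add: nn_integral_cmult)
  also have "\<dots> < \<infinity>" using emeasure_bounded_finite[OF bounded_cball, of "0::plane" R] by (simp add: ennreal_mult_less_top)
  finally show "(\<integral>\<^sup>+x. ennreal (norm (g x)) \<partial>lborel) < \<infinity>" .
qed

lemma GDERIV_line:
  fixes g :: "plane \<Rightarrow> plane"
  assumes "\<And>x. GDERIV u x :> g x"
  shows "((\<lambda>t. u (x + t *\<^sub>R v)) has_real_derivative g (x + t *\<^sub>R v) \<bullet> v) (at t)"
proof -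
  have 1: "((\<lambda>t. x + t *\<^sub>R v) has_derivative (\<lambda>s. s *\<^sub>R v)) (at t)"
    by (auto intro!: derivative_eq_intros)
  have 2: "(u has_derivative (\<lambda>h. h \<bullet> g (x + t *\<^sub>R v))) (at (x + t *\<^sub>R v))"
    using assms by (simp add: gderiv_def inner_commute)
  have "((\<lambda>t. u (x + t *\<^sub>R v)) has_derivative (\<lambda>s. (s *\<^sub>R v) \<bullet> g (x + t *\<^sub>R v))) (at t)"
    by (rule has_derivative_compose[OF 1 2])
  then show ?thesis unfolding has_field_derivative_def
    by (rule has_derivative_eq_rhs) (simp add: fun_eq_iff inner_commute mult.commute)
qed

lemma line_FTC:
  fixes g :: "plane \<Rightarrow> plane"
  assumes u: "\<And>x. GDERIV u x :> g x" and g: "continuous_on UNIV g"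
  shows "u (x + v) - u x = (\<integral>t. indicator {0..1} t * (g (x + t *\<^sub>R v) \<bullet> v) \<partial>lborel)"
proof -
  have cont: "isCont (\<lambda>t. g (x + t *\<^sub>R v) \<bullet> v) t" for t
    using continuous_on_compose2[OF g, of UNIV "\<lambda>t. x + t *\<^sub>R v"]
    by (intro continuous_intros) (auto simp: continuous_on_eq_continuous_at intro!: continuous_intros)
  have "(\<integral>t. (g (x + t *\<^sub>R v) \<bullet> v) * indicator {0..1} t \<partial>lborel) = u (x + 1 *\<^sub>R v) - u (x + 0 *\<^sub>R v)"
    by (rule integral_FTC_Icc_real) (auto intro: GDERIV_line[OF u] cont)
  then show ?thesis by (simp add: mult.commute)
qed

text \<open>The integral of \<open>u (x + e) - u x\<close> is 0 by translation invariance. Written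
  as an integral of the derivative along the segment and exchanged, it is the integral of the
  partial derivative.\<close>

lemma integral_partial_zero:
  fixes g :: "plane \<Rightarrow> plane"
  assumes u: "\<And>x. GDERIV u x :> g x" and g: "continuous_on UNIV g" and z: "\<And>x. norm x > R \<Longrightarrow> u x = 0"
  shows "(\<integral>x. g x $ i \<partial>lborel) = 0"
proof -
  define e where "e = (axis i 1 :: plane)"
  have ge: "g x \<bullet> e = g x $ i" for x by (simp add: e_def inner_axis)
  have ne: "norm e = 1" by (simp add: e_def)
  have gi: "continuous_on UNIV (\<lambda>x. g x $ i)" using g by (intro continuous_intros)
  have gm[measurable]: "(\<lambda>x. g x $ i) \<in> borel_measurable borel" by (rule borel_measurable_continuous_onI[OF gi])
  have uc: "continuous_on UNIV u"
  proof (rule differentiable_imp_continuous_on)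
    show "u differentiable_on UNIV"
      using u by (auto simp: differentiable_on_def differentiable_def gderiv_def)
  qed
  have gz: "g x $ i = 0" if "norm x > R" for x
  proof -
    have "gradient u x = 0"
      by (rule gradient_locally_const[of "{x. R < norm x}" _ _ 0]) (use that z in \<open>auto intro!: open_Collect_less continuous_intros\<close>)
    then have "g x = 0" using gradient_eq[OF u[of x]] by simp
    then show ?thesis by simp
  qed
  obtain B where B: "\<And>x. \<bar>g x $ i\<bar> \<le> B" using continuous_compact_bound[OF gi gz] by blast
  define h where "h t x = indicator {0..1} t * (g (x + t *\<^sub>R e) $ i)" for t x
  have int: "integrable (lborel \<Otimes>\<^sub>M lborel) (\<lambda>(t, x). h t x)"
  proof (rule integrable_strip)
    show "(\<lambda>(t, x). h t x) \<in> borel_measurable (lborel \<Otimes>\<^sub>M lborel)"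
    proof -
      have "(\<lambda>p :: real \<times> plane. snd p + fst p *\<^sub>R e) \<in> borel_measurable (lborel \<Otimes>\<^sub>M lborel)" by measurable
      from measurable_compose[OF this gm]
      have [measurable]: "(\<lambda>p :: real \<times> plane. g (snd p + fst p *\<^sub>R e) $ i) \<in> borel_measurable (lborel \<Otimes>\<^sub>M lborel)" .
      show ?thesis unfolding h_def split_beta by measurable
    qed
    show "\<bar>(\<lambda>(t, x). h t x) (t, x)\<bar> \<le> B" for t x
      using B[of "x + t *\<^sub>R e"] by (auto simp: h_def indicator_def)
    show "(\<lambda>(t, x). h t x) (t, x) = 0" if "t \<notin> {0..1} \<or> norm x > R + 1" for t x
    proof (cases "t \<in> {0..1}")
      case True
      then have "norm (t *\<^sub>R e) \<le> 1" by (simp add: ne)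
      moreover have "norm x \<le> norm (x + t *\<^sub>R e) + norm (t *\<^sub>R e)" using norm_triangle_ineq4[of "x + t *\<^sub>R e" "t *\<^sub>R e"] by simp
      ultimately have "norm (x + t *\<^sub>R e) > R" using that True by auto
      then show ?thesis by (simp add: h_def gz)
    qed (simp add: h_def)
  qed
  have tr: "(\<integral>x. f (x + c) \<partial>lborel) = (\<integral>x. f x \<partial>lborel)" if "f \<in> borel_measurable borel" for f :: "plane \<Rightarrow> real" and c :: plane
  proof -
    have "(\<integral>x. f x \<partial>distr lborel borel ((+) c)) = (\<integral>x. f (c + x) \<partial>lborel)" by (rule integral_distr) (use that in auto)
    then show ?thesis by (simp add: lborel_distr_plus add.commute)
  qed
  have "(\<integral>x. u (x + e) - u x \<partial>lborel) = (\<integral>x. u (x + e) \<partial>lborel) - (\<integral>x. u x \<partial>lborel)"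
  proof (rule Bochner_Integration.integral_diff)
    show ui: "integrable lborel u" by (rule continuous_compact_integrable[OF uc z])
    show "integrable lborel (\<lambda>x. u (x + e))"
    proof (rule continuous_compact_integrable)
      show "continuous_on UNIV (\<lambda>x. u (x + e))" by (rule continuous_on_compose2[OF uc]) (auto intro!: continuous_intros)
      show "u (x + e) = 0" if "norm x > R + 1" for x
        using that norm_triangle_ineq4[of "x + e" e] by (intro z) (simp add: ne)
    qed
  qed
  also have "\<dots> = 0" using tr[of u e] borel_measurable_continuous_onI[OF uc] by simp
  finally have "0 = (\<integral>x. u (x + e) - u x \<partial>lborel)" ..
  also have "\<dots> = (\<integral>x. \<integral>t. h t x \<partial>lborel \<partial>lborel)" unfolding line_FTC[OF u g] h_def ge ..
  also have "\<dots> = (\<integral>t. \<integral>x. h t x \<partial>lborel \<partial>lborel)" by (rule integral_swap[OF int])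
  also have "\<dots> = (\<integral>t. indicator {0..1::real} t * (\<integral>x. g x $ i \<partial>lborel) \<partial>lborel)"
    by (simp only: h_def integral_mult_right_zero tr[OF gm])
  also have "\<dots> = (\<integral>x. g x $ i \<partial>lborel)" by (simp add: measure_lborel_Icc)
  finally show ?thesis by simp
qed

text \<open>\<open>f_trunc\<close> is chosen by \<open>SOME\<close>, so its properties depend on
  existence. Write \<open>\<phi> x - \<phi> 0\<close> as the integral of
  \<open>x \<bullet> gradient \<phi> (t *\<^sub>R x)\<close> over \<open>t\<close> in the unit
  interval and average against the smeared density \<open>m\<close>. Since
  \<open>m x *\<^sub>R x = - gradient K x\<close> for a compactly supported radial \<open>K\<close>,
  integration by parts and the substitution \<open>y = t *\<^sub>R x\<close> leave the Laplacian of
  \<open>\<phi>\<close> paired with the integral of \<open>K (y / t) / t\<close> over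
  \<open>t\<close>. Up to the factor \<open>- 2 * pi\<close> this integral is the potential, so no
  explicit logarithm has to be handled.\<close>

lemma truncation_exists:
  assumes moll: "mollifier \<rho>" and eta: "\<eta> > 0"
  shows "\<exists>f. truncation_potential \<rho> \<eta> f"
proof -
  define m where "m x = \<rho> (x /\<^sub>R \<eta>) / \<eta>\<^sup>2" for x
  have mc: "continuous_on UNIV m" unfolding m_def
    by (intro continuous_intros continuous_on_compose2[OF smooth_continuous[OF \<rho>_smooth[OF moll]]]) (use eta in auto)
  have m0: "0 \<le> m x" for x unfolding m_def using \<rho>_nonneg[OF moll] by simp
  have nrm: "norm (x /\<^sub>R \<eta>) = norm x / \<eta>" for x :: plane using eta by (simp add: divide_inverse mult.commute)
  have mz: "m x = 0" if "norm x > \<eta>" for x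
  proof -
    have "1 < norm (x /\<^sub>R \<eta>)" unfolding nrm using that eta by simp
    then show ?thesis unfolding m_def using \<rho>_zero[OF moll] by simp
  qed
  have mr: "m x = m y" if "norm x = norm y" for x y
  proof -
    have "norm (x /\<^sub>R \<eta>) = norm (y /\<^sub>R \<eta>)" unfolding nrm that ..
    then show ?thesis unfolding m_def using moll unfolding mollifier_def by metis
  qed
  have mm[measurable]: "m \<in> borel_measurable borel" by (rule borel_measurable_continuous_onI[OF mc])
  have mi: "integrable lborel m" by (rule continuous_compact_integrable[OF mc mz])
  have sm: "smeared \<rho> \<eta> 0 = density lborel (\<lambda>y. ennreal (m y))" by (simp add: smeared_def m_def)
  define e1 where "e1 = (axis 1 1 :: plane)"
  define \<mu> where "\<mu> u = m (sqrt \<bar>u\<bar> *\<^sub>R e1)" for u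
  have muc: "continuous_on S \<mu>" for S unfolding \<mu>_def
    by (intro continuous_on_compose2[OF mc] continuous_intros) auto
  have mux: "\<mu> (x \<bullet> x) = m x" for x unfolding \<mu>_def by (rule mr) (simp add: e1_def norm_eq_sqrt_inner)
  \<comment> \<open>An antiderivative of \<open>- \<mu> / 2\<close> that vanishes from
    \<open>\<eta>\<^sup>2\<close> on. Starting the integrals at -1 makes 0 an interior point, so
    that \<open>K\<close> is differentiable at the origin as well.\<close>
  define Gf where "Gf w = (integral {-1..\<eta>\<^sup>2} \<mu> - integral {-1..w} \<mu>) / 2" for w
  have Gd: "(Gf has_real_derivative - \<mu> w / 2) (at w)" if "w \<ge> 0" for w
  proof -
    have "((\<lambda>w. integral {-1..w} \<mu>) has_real_derivative \<mu> w) (at w within {-1..w+1})"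
      by (rule integral_has_real_derivative[OF muc]) (use that in auto)
    then have "((\<lambda>w. integral {-1..w} \<mu>) has_real_derivative \<mu> w) (at w)"
      using that by (subst (asm) at_within_interior) auto
    then show ?thesis unfolding Gf_def by (auto intro!: derivative_eq_intros)
  qed
  have Gz: "Gf w = 0" if "w \<ge> \<eta>\<^sup>2" for w
  proof -
    have "(\<mu> has_integral 0) {\<eta>\<^sup>2..w}"
    proof (rule has_integral_negligible[of "{\<eta>\<^sup>2}"])
      fix u assume u: "u \<in> {\<eta>\<^sup>2..w} - {\<eta>\<^sup>2}"
      then have "\<eta>\<^sup>2 < u" by auto
      then have "\<eta> < sqrt \<bar>u\<bar>" using eta by (simp add: real_less_rsqrt)
      then show "\<mu> u = 0" unfolding \<mu>_def by (intro mz) (simp add: e1_def)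
    qed simp
    then have i0: "integral {\<eta>\<^sup>2..w} \<mu> = 0" by (rule integral_unique)
    have "- 1 \<le> \<eta>\<^sup>2" using zero_le_power2[of \<eta>] by linarith
    then have "integral {-1..\<eta>\<^sup>2} \<mu> + integral {\<eta>\<^sup>2..w} \<mu> = integral {-1..w} \<mu>"
      by (rule Henstock_Kurzweil_Integration.integral_combine) (use that integrable_continuous_interval[OF muc] in auto)
    with i0 show ?thesis by (simp add: Gf_def)
  qed
  define K where "K x = Gf (x \<bullet> x)" for x :: plane
  have Kg: "GDERIV K x :> - (m x *\<^sub>R x)" for x
  proof -
    have "((\<lambda>x :: plane. x \<bullet> x) has_derivative (\<lambda>h. 2 * (x \<bullet> h))) (at x)"
      by (auto intro!: derivative_eq_intros simp: inner_commute)
    from has_derivative_compose[OF this Gd[OF inner_ge_zero, unfolded has_field_derivative_def]]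
    have "((\<lambda>x. Gf (x \<bullet> x)) has_derivative (\<lambda>h. - \<mu> (x \<bullet> x) / 2 * (2 * (x \<bullet> h)))) (at x)" .
    then show ?thesis unfolding gderiv_def K_def
      by (rule has_derivative_eq_rhs) (simp add: fun_eq_iff mux inner_commute)
  qed
  have Kz: "K x = 0" if "norm x \<ge> \<eta>" for x
    unfolding K_def by (rule Gz) (use that eta in \<open>simp add: power2_norm_eq_inner[symmetric] power_mono\<close>)
  have Kc: "continuous_on UNIV K"
    by (rule differentiable_imp_continuous_on)
      (use Kg in \<open>auto simp: differentiable_on_def differentiable_def gderiv_def\<close>)
  have Km[measurable]: "K \<in> borel_measurable borel" by (rule borel_measurable_continuous_onI[OF Kc])
  have Kz': "K x = 0" if "norm x > \<eta>" for x using Kz that by simp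
  have Ki: "integrable lborel K" by (rule continuous_compact_integrable[OF Kc Kz'])
  obtain BK where BK: "\<And>x. \<bar>K x\<bar> \<le> BK" using continuous_compact_bound[OF Kc Kz'] by blast
  define k where "k t y = indicator {0<..1} t * (K (inverse t *\<^sub>R y) / t)" for t :: real and y
  have km[measurable]: "(\<lambda>p. k (fst p) (snd p)) \<in> borel_measurable (lborel \<Otimes>\<^sub>M lborel)"
  proof -
    have "(\<lambda>p :: real \<times> plane. inverse (fst p) *\<^sub>R snd p) \<in> borel_measurable (lborel \<Otimes>\<^sub>M lborel)" by measurable
    from measurable_compose[OF this Km]
    have [measurable]: "(\<lambda>p :: real \<times> plane. K (inverse (fst p) *\<^sub>R snd p)) \<in> borel_measurable (lborel \<Otimes>\<^sub>M lborel)" .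
    show ?thesis unfolding k_def by measurable
  qed
  \<comment> \<open>The factor \<open>1 / t\<close> meets the Jacobian \<open>t\<^sup>2\<close>, so
    the inner integral is \<open>t\<close> times the integral of \<open>\<bar>K\<bar>\<close> and
    there is no singularity at \<open>t = 0\<close>.\<close>
  have kfin: "(\<integral>\<^sup>+t. \<integral>\<^sup>+y. ennreal \<bar>k t y\<bar> \<partial>lborel \<partial>lborel) < \<infinity>"
  proof -
    have "(\<integral>\<^sup>+t. \<integral>\<^sup>+y. ennreal \<bar>k t y\<bar> \<partial>lborel \<partial>lborel) \<le> (\<integral>\<^sup>+t. indicator {0..1::real} t * (\<integral>\<^sup>+x. ennreal \<bar>K x\<bar> \<partial>lborel) \<partial>lborel)"
    proof (rule nn_integral_mono)
      fix t :: real
      show "(\<integral>\<^sup>+y. ennreal \<bar>k t y\<bar> \<partial>lborel) \<le> indicator {0..1} t * (\<integral>\<^sup>+x. ennreal \<bar>K x\<bar> \<partial>lborel)"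
      proof (cases "t \<in> {0<..1}")
        case True
        then have t: "0 < t" "t \<le> 1" "inverse t \<noteq> 0" by auto
        have "(\<integral>\<^sup>+y. ennreal \<bar>k t y\<bar> \<partial>lborel) = (\<integral>\<^sup>+y. ennreal (1 / t) * ennreal \<bar>K (0 + inverse t *\<^sub>R y)\<bar> \<partial>lborel)"
          using t by (intro nn_integral_cong) (simp add: k_def ennreal_mult[symmetric] abs_mult)
        also have "\<dots> = ennreal (1 / t) * (\<integral>\<^sup>+y. ennreal \<bar>K (0 + inverse t *\<^sub>R y)\<bar> \<partial>lborel)"
          by (rule nn_integral_cmult) simp
        also have "(\<integral>\<^sup>+y. ennreal \<bar>K (0 + inverse t *\<^sub>R y)\<bar> \<partial>lborel) = ennreal (1 / (inverse t)\<^sup>2) * (\<integral>\<^sup>+x. ennreal \<bar>K x\<bar> \<partial>lborel)"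
          by (rule nn_integral_lborel_affine[OF _ t(3), of "\<lambda>x. ennreal \<bar>K x\<bar>" 0]) simp
        also have "ennreal (1 / t) * (ennreal (1 / (inverse t)\<^sup>2) * (\<integral>\<^sup>+x. ennreal \<bar>K x\<bar> \<partial>lborel)) = ennreal t * (\<integral>\<^sup>+x. ennreal \<bar>K x\<bar> \<partial>lborel)"
        proof -
          have "ennreal (1 / t) * ennreal (1 / (inverse t)\<^sup>2) = ennreal (1 / t * (1 / (inverse t)\<^sup>2))"
            using t by (intro ennreal_mult[symmetric]) auto
          also have "1 / t * (1 / (inverse t)\<^sup>2) = t" using t by (simp add: power2_eq_square field_simps)
          finally have "ennreal (1 / t) * ennreal (1 / (inverse t)\<^sup>2) = ennreal t" .
          then show ?thesis by (simp only: mult.assoc[symmetric])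
        qed
        also have "\<dots> \<le> 1 * (\<integral>\<^sup>+x. ennreal \<bar>K x\<bar> \<partial>lborel)" using t by (intro mult_right_mono) (auto simp: ennreal_le_1)
        finally show ?thesis using t by simp
      qed (simp add: k_def)
    qed
    also have "\<dots> = (\<integral>\<^sup>+x. ennreal \<bar>K x\<bar> \<partial>lborel)" by (simp add: nn_integral_multc)
    also have "\<dots> < \<infinity>" using Ki by (simp add: integrable_iff_bounded)
    finally show ?thesis .
  qed
  define f where "f y = - (2 * pi) * (\<integral>t. k t y \<partial>lborel)" for y
  have kint: "integrable (lborel \<Otimes>\<^sub>M lborel) (\<lambda>(t, y). k t y * b y)"
    if b: "continuous_on UNIV b" "\<And>y. \<bar>b y\<bar> \<le> B" for b :: "plane \<Rightarrow> real" and B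
  proof (rule integrableI_bounded)
    have bm: "b \<in> borel_measurable borel" by (rule borel_measurable_continuous_onI[OF b(1)])
    have [measurable]: "(\<lambda>p :: real \<times> plane. b (snd p)) \<in> borel_measurable (lborel \<Otimes>\<^sub>M lborel)"
      by (rule measurable_compose[OF _ bm]) measurable
    show mb: "(\<lambda>(t, y). k t y * b y) \<in> borel_measurable (lborel \<Otimes>\<^sub>M lborel)" unfolding split_beta by measurable
    have "(\<integral>\<^sup>+p. ennreal (norm (case p of (t, y) \<Rightarrow> k t y * b y)) \<partial>(lborel \<Otimes>\<^sub>M lborel))
       \<le> (\<integral>\<^sup>+p. ennreal B * ennreal \<bar>k (fst p) (snd p)\<bar> \<partial>(lborel \<Otimes>\<^sub>M lborel))"
    proof (rule nn_integral_mono)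
      fix p :: "real \<times> plane"
      have "\<bar>k (fst p) (snd p)\<bar> * \<bar>b (snd p)\<bar> \<le> \<bar>k (fst p) (snd p)\<bar> * B" using b(2) by (intro mult_left_mono) auto
      moreover have "0 \<le> B" using b(2)[of 0] by linarith
      ultimately show "ennreal (norm (case p of (t, y) \<Rightarrow> k t y * b y)) \<le> ennreal B * ennreal \<bar>k (fst p) (snd p)\<bar>"
        by (simp add: split_beta abs_mult ennreal_mult[symmetric] mult.commute ennreal_leI)
    qed
    also have "\<dots> = ennreal B * (\<integral>\<^sup>+p. ennreal \<bar>k (fst p) (snd p)\<bar> \<partial>(lborel \<Otimes>\<^sub>M lborel))"
      by (rule nn_integral_cmult) measurable
    also have "(\<integral>\<^sup>+p. ennreal \<bar>k (fst p) (snd p)\<bar> \<partial>(lborel \<Otimes>\<^sub>M lborel)) = (\<integral>\<^sup>+t. \<integral>\<^sup>+y. ennreal \<bar>k t y\<bar> \<partial>lborel \<partial>lborel)"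
      using lborel.nn_integral_fst[OF measurable_compose[OF borel_measurable_abs[OF km] measurable_ennreal]] by simp
    also have "ennreal B * \<dots> < \<infinity>" using kfin by (simp add: ennreal_mult_less_top)
    finally show "(\<integral>\<^sup>+p. ennreal (norm (case p of (t, y) \<Rightarrow> k t y * b y)) \<partial>(lborel \<Otimes>\<^sub>M lborel)) < \<infinity>" .
  qed
  have kint1: "integrable (lborel \<Otimes>\<^sub>M lborel) (\<lambda>(t, y). k t y)" using kint[of "\<lambda>_. 1" 1] by simp
  have fm: "f \<in> borel_measurable borel"
  proof -
    have "(\<lambda>y. \<integral>t. k t y \<partial>lborel) \<in> borel_measurable lborel"
    proof (rule lborel.borel_measurable_lebesgue_integral)
      have "(\<lambda>q. k (fst (snd q, fst q)) (snd (snd q, fst q))) \<in> borel_measurable ((lborel :: plane measure) \<Otimes>\<^sub>M (lborel :: real measure))"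
        by (rule measurable_compose[OF _ km]) measurable
      then show "(\<lambda>(y, t). k t y) \<in> borel_measurable ((lborel :: plane measure) \<Otimes>\<^sub>M lborel)" by (simp add: split_beta)
    qed
    then show ?thesis unfolding f_def by simp
  qed
  have f0: "f y = 0" if "y \<notin> cball 0 \<eta>" for y
  proof -
    have "k t y = 0" for t
    proof (cases "t \<in> {0<..1}")
      case True
      then have t: "0 < t" "t \<le> 1" by auto
      have "norm y \<le> norm y / t" using t by (simp add: pos_le_divide_eq mult_left_le)
      then have "norm (inverse t *\<^sub>R y) > \<eta>" using that t by (simp add: divide_inverse mult.commute)
      then show ?thesis by (simp add: k_def Kz')
    qed (simp add: k_def)
    then show ?thesis by (simp add: f_def)
  qed
  have fLp: "Lp_loc 1 f" unfolding Lp_loc_def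
  proof (intro conjI allI impI fm)
    fix C :: "plane set" assume "compact C"
    have "integrable lborel (\<lambda>y. \<integral>t. k t y \<partial>lborel)" by (rule lborel_pair.integrable_snd[OF kint1])
    then have "integrable lborel f" unfolding f_def by simp
    then have "(\<integral>\<^sup>+x. ennreal (norm (f x)) \<partial>lborel) < \<infinity>" by (simp add: integrable_iff_bounded)
    moreover have "(\<integral>\<^sup>+x\<in>C. ennreal (norm (f x) powr 1) \<partial>lborel) \<le> (\<integral>\<^sup>+x. ennreal (norm (f x)) \<partial>lborel)"
      by (rule nn_integral_mono) (auto simp: indicator_def)
    ultimately show "(\<integral>\<^sup>+x\<in>C. ennreal (norm (f x) powr 1) \<partial>lborel) < \<infinity>" by simp
  qed
  have fcont: "continuous_on (- {0}) f"
  proof -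
    have "isCont f a" if a: "a \<noteq> 0" for a
    proof -
      \<comment> \<open>For \<open>norm y > norm a / 2\<close> the kernel vanishes at all
        \<open>t \<le> \<delta>\<close>, as \<open>K\<close> is supported in the disk of radius
        \<open>\<eta>\<close>. Near \<open>a\<close> the kernel is therefore bounded, and dominated
        convergence applies.\<close>
      define \<delta> where "\<delta> = norm a / (2 * \<eta>)"
      have d: "\<delta> > 0" using a eta by (simp add: \<delta>_def)
      define kd where "kd t y = indicator {\<delta><..} t * k t y" for t y
      have eq: "k t y = kd t y" if "norm y > norm a / 2" for t y
      proof (cases "t > \<delta> \<or> t \<notin> {0<..1}")
        case False
        then have t: "0 < t" "t \<le> norm a / (2 * \<eta>)" by (auto simp: \<delta>_def)
        then have "t * \<eta> \<le> norm a / 2" using eta by (simp add: pos_le_divide_eq mult_ac)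
        then have "\<eta> \<le> norm y / t" using that t(1) by (simp add: pos_le_divide_eq mult.commute)
        then have "K (inverse t *\<^sub>R y) = 0" using t(1) by (intro Kz) (simp add: divide_inverse mult.commute)
        then show ?thesis by (simp add: kd_def k_def)
      qed (auto simp: kd_def k_def)
      have "open {y :: plane. norm a / 2 < norm y}" by (intro open_Collect_less continuous_intros)
      then have ev: "\<forall>\<^sub>F y in nhds a. f y = - (2 * pi) * (\<integral>t. kd t y \<partial>lborel)"
        unfolding eventually_nhds by (intro exI[of _ "{y. norm a / 2 < norm y}"]) (use a eq in \<open>auto simp: f_def\<close>)
      have kdm: "(\<lambda>t. kd t y) \<in> borel_measurable lborel" for y
      proof -
        have "(\<lambda>t. k (fst (t, y)) (snd (t, y))) \<in> borel_measurable lborel" by (rule measurable_compose[OF _ km]) simp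
        then show ?thesis unfolding kd_def by simp
      qed
      have "isCont (\<lambda>y. \<integral>t. kd t y \<partial>lborel) a"
        unfolding continuous_at_sequentially o_def
      proof (intro allI impI)
        fix s :: "nat \<Rightarrow> plane" assume s: "s \<longlonglongrightarrow> a"
        show "(\<lambda>n. \<integral>t. kd t (s n) \<partial>lborel) \<longlonglongrightarrow> (\<integral>t. kd t a \<partial>lborel)"
        proof (rule integral_dominated_convergence[where w="\<lambda>t. indicator {0..1} t * (BK / \<delta>)"])
          show "integrable lborel (\<lambda>t::real. indicator {0..1} t * (BK / \<delta>))"
            by (intro integrable_mult_left integrable_real_indicator) auto
          show "AE t in lborel. (\<lambda>n. kd t (s n)) \<longlonglongrightarrow> kd t a"
          proof (rule AE_I2)
            fix t
            have "(\<lambda>n. K (inverse t *\<^sub>R s n)) \<longlonglongrightarrow> K (inverse t *\<^sub>R a)"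
              using Kc s by (intro isCont_tendsto_compose[of _ K]) (auto simp: continuous_on_eq_continuous_at intro!: tendsto_intros)
            then show "(\<lambda>n. kd t (s n)) \<longlonglongrightarrow> kd t a" unfolding kd_def k_def divide_inverse
              by (intro tendsto_intros)
          qed
          show "AE t in lborel. norm (kd t (s n)) \<le> indicator {0..1} t * (BK / \<delta>)" for n
          proof (rule AE_I2)
            fix t :: real
            show "norm (kd t (s n)) \<le> indicator {0..1} t * (BK / \<delta>)"
            proof (cases "\<delta> < t \<and> t \<le> 1")
              case True
              have "\<bar>K (inverse t *\<^sub>R s n)\<bar> / t \<le> BK / \<delta>" using True d BK[of 0] BK by (intro frac_le) (auto intro: order_trans[OF abs_ge_zero])
              then show ?thesis using True d by (simp add: kd_def k_def)
            next
              case False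
              moreover have "0 \<le> BK / \<delta>" using BK[of 0] d by simp
              ultimately show ?thesis using d by (auto simp: kd_def k_def indicator_def)
            qed
          qed
        qed (use kdm in auto)
      qed
      then show ?thesis unfolding isCont_cong[OF ev] by (intro continuous_intros)
    qed
    then show ?thesis by (simp add: continuous_at_imp_continuous_on)
  qed
  have weak: "- (\<integral>x. f x * laplacian \<phi> x \<partial>lborel) = 2 * pi * ((\<integral>x. \<phi> x \<partial>smeared \<rho> \<eta> 0) - (\<integral>x. \<phi> x \<partial>return borel 0))"
    if \<phi>: "test_function \<phi>" for \<phi>
  proof -
    have sm\<phi>: "smooth \<phi>" and bd: "bounded {x. \<phi> x \<noteq> 0}" using \<phi> by (auto simp: test_function_def)
    obtain R where R: "\<And>x. \<phi> x \<noteq> 0 \<Longrightarrow> norm x \<le> R" using bd unfolding bounded_iff by blast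
    have phz: "\<phi> x = 0" if "norm x > R" for x using R[of x] that by (rule_tac ccontr) linarith
    let ?g = "gradient \<phi>"
    define H where "H i x = gradient (\<lambda>y. ?g y $ i) x" for i x
    have gd: "GDERIV \<phi> x :> ?g x" for x by (rule smooth_GDERIV[OF sm\<phi>])
    have gc: "continuous_on UNIV ?g" by (rule gradient_continuous[OF sm\<phi>])
    have gd2: "GDERIV (\<lambda>y. ?g y $ i) x :> H i x" for i x unfolding H_def by (rule smooth_GDERIV[OF smooth_gradient[OF sm\<phi>]])
    have Hc: "continuous_on UNIV (H i)" for i unfolding H_def by (rule gradient_continuous[OF smooth_gradient[OF sm\<phi>]])
    have lap: "laplacian \<phi> x = (\<Sum>i\<in>UNIV. H i x $ i)" for x by (simp add: laplacian_def H_def)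
    have lapc: "continuous_on UNIV (laplacian \<phi>)" unfolding lap by (intro continuous_intros Hc)
    have gz: "?g x = 0" if "norm x > R" for x
      by (rule gradient_locally_const[of "{x. R < norm x}" _ _ 0]) (use that phz in \<open>auto intro!: open_Collect_less continuous_intros\<close>)
    have Hz: "H i x = 0" if "norm x > R" for x i unfolding H_def
      by (rule gradient_locally_const[of "{x. R < norm x}" _ _ 0]) (use that gz in \<open>auto intro!: open_Collect_less continuous_intros\<close>)
    have lapz: "laplacian \<phi> x = 0" if "norm x > R" for x by (simp add: lap Hz[OF that])
    obtain BL where BL: "\<And>x. \<bar>laplacian \<phi> x\<bar> \<le> BL" using continuous_compact_bound[OF lapc lapz] by blast
    define h where "h t x = indicator {0..1} t * (m x * (x \<bullet> ?g (t *\<^sub>R x)))" for t :: real and x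
    have int: "integrable (lborel \<Otimes>\<^sub>M lborel) (\<lambda>(t, x). h t x)"
    proof -
      have "continuous_on UNIV (\<lambda>p :: real \<times> plane. m (snd p) * (snd p \<bullet> ?g (fst p *\<^sub>R snd p)))"
        by (intro continuous_intros continuous_on_compose2[OF mc] continuous_on_compose2[OF gc]) auto
      from borel_measurable_continuous_onI[OF this]
      have c[measurable]: "(\<lambda>p :: real \<times> plane. m (snd p) * (snd p \<bullet> ?g (fst p *\<^sub>R snd p))) \<in> borel_measurable (lborel \<Otimes>\<^sub>M lborel)"
        by (simp add: lborel_prod)
      have ind: "(\<lambda>p :: real \<times> plane. indicator {0..1} (fst p) :: real) \<in> borel_measurable (lborel \<Otimes>\<^sub>M lborel)" by measurable
      have "continuous_on UNIV (\<lambda>x. norm (?g x))" using gc by (intro continuous_intros)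
      then obtain BG where BG: "\<And>x. \<bar>norm (?g x)\<bar> \<le> BG" using continuous_compact_bound[of "\<lambda>x. norm (?g x)" R] gz by auto
      obtain BM where BM: "\<And>x. \<bar>m x\<bar> \<le> BM" using continuous_compact_bound[OF mc mz] by blast
      show ?thesis
      proof (rule integrable_strip)
        show "(\<lambda>(t, x). h t x) \<in> borel_measurable (lborel \<Otimes>\<^sub>M lborel)" 
          unfolding h_def split_beta by (rule borel_measurable_times[OF ind c])
        show "(\<lambda>(t, x). h t x) (t, x) = 0" if "t \<notin> {0..1} \<or> norm x > \<eta>" for t x using that mz by (auto simp: h_def)
        show "\<bar>(\<lambda>(t, x). h t x) (t, x)\<bar> \<le> BM * (\<eta> * BG)" for t x
        proof (cases "norm x > \<eta>")
          case True
          have "0 \<le> BM" "0 \<le> BG" using BM[of 0] BG[of 0] by linarith+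
          then show ?thesis using mz[OF True] eta by (simp add: h_def)
        next
          case False
          have "\<bar>x \<bullet> ?g (t *\<^sub>R x)\<bar> \<le> norm x * norm (?g (t *\<^sub>R x))" by (rule Cauchy_Schwarz_ineq2)
          also have "\<dots> \<le> \<eta> * BG" using False BG[of "t *\<^sub>R x"] eta by (intro mult_mono) auto
          finally have 1: "\<bar>m x\<bar> * \<bar>x \<bullet> ?g (t *\<^sub>R x)\<bar> \<le> BM * (\<eta> * BG)" using BM[of x] by (intro mult_mono) auto
          have "\<bar>h t x\<bar> \<le> \<bar>m x\<bar> * \<bar>x \<bullet> ?g (t *\<^sub>R x)\<bar>" by (simp add: h_def indicator_def abs_mult)
          with 1 show ?thesis by simp
        qed
      qed
    qed
    have inner: "(\<integral>x. h t x \<partial>lborel) = (\<integral>y. k t y * laplacian \<phi> y \<partial>lborel)" if t0: "t \<noteq> 0" for t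
    proof (cases "t \<in> {0<..1}")
      case False
      then have "t \<notin> {0..1}" using t0 by auto
      then show ?thesis using False by (simp add: h_def k_def)
    next
      case True
      then have t: "0 < t" "t \<le> 1" by auto
      \<comment> \<open>The integration by parts: the integrand is the \<open>i\<close>-th partial
        derivative of the product of \<open>K\<close> and the \<open>i\<close>-th component of the
        dilated gradient.\<close>
      have zero: "(\<integral>x. (- (m x * x $ i) * (?g (t *\<^sub>R x) $ i)) + K x * (t * H i (t *\<^sub>R x) $ i) \<partial>lborel) = 0"
        and ii: "integrable lborel (\<lambda>x. m x * (x $ i * ?g (t *\<^sub>R x) $ i))" "integrable lborel (\<lambda>x. K x * H i (t *\<^sub>R x) $ i)" for i
      proof -
        define v where "v x = ?g (t *\<^sub>R x) $ i" for x
        have vd: "GDERIV v x :> t *\<^sub>R H i (t *\<^sub>R x)" for x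
        proof -
          from GDERIV_affine[where f="\<lambda>y. ?g y $ i" and t=t and x=x and b=0 and c=1, OF gd2]
          show ?thesis by (simp add: v_def[abs_def])
        qed
        have d: "GDERIV (\<lambda>x. K x * v x) x :> K x *\<^sub>R (t *\<^sub>R H i (t *\<^sub>R x)) + v x *\<^sub>R (- (m x *\<^sub>R x))" for x
          by (rule GDERIV_mult[OF Kg vd])
        have c1: "continuous_on UNIV v" unfolding v_def
          by (intro continuous_intros continuous_on_compose2[OF gc]) auto
        have c2: "continuous_on UNIV (\<lambda>x. H i (t *\<^sub>R x))" by (intro continuous_on_compose2[OF Hc] continuous_intros) auto
        have c: "continuous_on UNIV (\<lambda>x. K x *\<^sub>R (t *\<^sub>R H i (t *\<^sub>R x)) + v x *\<^sub>R (- (m x *\<^sub>R x)))"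
          by (intro continuous_intros Kc mc c1 c2)
        have z: "norm x > \<eta> \<Longrightarrow> K x * v x = 0" for x by (simp add: Kz')
        from integral_partial_zero[OF d c z, where i=i]
        show "(\<integral>x. (- (m x * x $ i) * (?g (t *\<^sub>R x) $ i)) + K x * (t * H i (t *\<^sub>R x) $ i) \<partial>lborel) = 0"
          by (simp add: v_def mult_ac add.commute)
        show "integrable lborel (\<lambda>x. m x * (x $ i * ?g (t *\<^sub>R x) $ i))"
          by (rule continuous_compact_integrable[of _ \<eta>]) (auto intro!: continuous_intros mc continuous_on_compose2[OF gc] simp: mz)
        show "integrable lborel (\<lambda>x. K x * H i (t *\<^sub>R x) $ i)"
          by (rule continuous_compact_integrable[of _ \<eta>]) (auto intro!: continuous_intros Kc c2 simp: Kz')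
      qed
      have comp: "(\<integral>x. m x * (x $ i * ?g (t *\<^sub>R x) $ i) \<partial>lborel) = t * (\<integral>x. K x * H i (t *\<^sub>R x) $ i \<partial>lborel)" for i
      proof -
        have "(\<integral>x. (- (m x * x $ i) * (?g (t *\<^sub>R x) $ i)) + K x * (t * H i (t *\<^sub>R x) $ i) \<partial>lborel)
          = (\<integral>x. t * (K x * H i (t *\<^sub>R x) $ i) - m x * (x $ i * ?g (t *\<^sub>R x) $ i) \<partial>lborel)"
          by (rule Bochner_Integration.integral_cong) (auto simp: algebra_simps)
        also have "\<dots> = t * (\<integral>x. K x * H i (t *\<^sub>R x) $ i \<partial>lborel) - (\<integral>x. m x * (x $ i * ?g (t *\<^sub>R x) $ i) \<partial>lborel)"
          using ii by (subst Bochner_Integration.integral_diff) auto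
        finally show ?thesis using zero by simp
      qed
      have "(\<integral>x. h t x \<partial>lborel) = (\<integral>x. (\<Sum>i\<in>UNIV. m x * (x $ i * ?g (t *\<^sub>R x) $ i)) \<partial>lborel)"
        using t by (intro Bochner_Integration.integral_cong) (auto simp: h_def inner_vec_def sum_distrib_left)
      also have "\<dots> = (\<Sum>i\<in>UNIV. \<integral>x. m x * (x $ i * ?g (t *\<^sub>R x) $ i) \<partial>lborel)"
        by (rule Bochner_Integration.integral_sum) (use ii in auto)
      also have "\<dots> = t * (\<Sum>i\<in>UNIV. \<integral>x. K x * H i (t *\<^sub>R x) $ i \<partial>lborel)" by (simp only: comp sum_distrib_left)
      also have "(\<Sum>i\<in>UNIV. \<integral>x. K x * H i (t *\<^sub>R x) $ i \<partial>lborel) = (\<integral>x. (\<Sum>i\<in>UNIV. K x * H i (t *\<^sub>R x) $ i) \<partial>lborel)"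
        by (rule Bochner_Integration.integral_sum[symmetric]) (use ii in auto)
      also have "\<dots> = (\<integral>x. K x * laplacian \<phi> (t *\<^sub>R x) \<partial>lborel)" by (simp add: lap sum_distrib_left)
      also have "t * \<dots> = (\<integral>y. k t y * laplacian \<phi> y \<partial>lborel)"
      proof -
        let ?F = "\<lambda>y. k t y * laplacian \<phi> y"
        have lm: "laplacian \<phi> \<in> borel_measurable borel" by (rule borel_measurable_continuous_onI[OF lapc])
        have Fm[measurable]: "?F \<in> borel_measurable borel"
        proof -
          have "(\<lambda>y. K (inverse t *\<^sub>R y)) \<in> borel_measurable borel" by (rule measurable_compose[OF _ Km]) simp
          then show ?thesis using lm unfolding k_def by simp
        qed
        have tn: "t \<noteq> 0" using t by simp
        have "(\<integral>y. ?F y \<partial>lborel) = (\<integral>y. ?F y \<partial>density (distr lborel borel (\<lambda>x. 0 + t *\<^sub>R x)) (\<lambda>_. ennreal (\<bar>t\<bar> ^ DIM(plane))))"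
          by (subst lborel_affine[OF tn, of "0 :: plane"]) (rule refl)
        also have "\<dots> = (\<integral>y. (\<bar>t\<bar> ^ DIM(plane)) *\<^sub>R ?F y \<partial>distr lborel borel (\<lambda>x. 0 + t *\<^sub>R x))"
          by (rule integral_density) (use Fm in auto)
        also have "\<dots> = (\<integral>x. (\<bar>t\<bar> ^ DIM(plane)) *\<^sub>R ?F (0 + t *\<^sub>R x) \<partial>lborel)"
          by (rule integral_distr) (use Fm in auto)
        also have "\<dots> = (\<integral>x. t * (K x * laplacian \<phi> (t *\<^sub>R x)) \<partial>lborel)"
          using t by (intro Bochner_Integration.integral_cong) (auto simp: k_def power2_eq_square)
        finally show ?thesis by simp
      qed
      finally show ?thesis .
    qed
    have "(\<integral>x. \<phi> x \<partial>smeared \<rho> \<eta> 0) - (\<integral>x. \<phi> x \<partial>return borel 0) = (\<integral>x. m x * \<phi> x \<partial>lborel) - \<phi> 0"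
      unfolding sm using m0 smooth_borel[OF sm\<phi>] by (subst integral_density) (auto simp: integral_return)
    also have "\<phi> 0 = (\<integral>x. m x * \<phi> 0 \<partial>lborel)"
    proof -
      have "(\<integral>x. m x \<partial>lborel) = 1"
      proof -
        have inz: "inverse \<eta> \<noteq> 0" using eta by simp
        have "1 = (\<integral>y. \<rho> y \<partial>lborel)" using moll unfolding mollifier_def by (elim conjE) (rule sym)
        also have "\<dots> = (\<integral>y. \<rho> y \<partial>density (distr lborel borel (\<lambda>x. 0 + inverse \<eta> *\<^sub>R x)) (\<lambda>_. ennreal (\<bar>inverse \<eta>\<bar> ^ DIM(plane))))"
          by (subst lborel_affine[OF inz, of "0 :: plane"]) (rule refl)
        also have "\<dots> = (\<integral>y. (\<bar>inverse \<eta>\<bar> ^ DIM(plane)) *\<^sub>R \<rho> y \<partial>distr lborel borel (\<lambda>x. 0 + inverse \<eta> *\<^sub>R x))"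
          by (rule integral_density) (use \<rho>_borel[OF moll] in auto)
        also have "\<dots> = (\<integral>x. (\<bar>inverse \<eta>\<bar> ^ DIM(plane)) *\<^sub>R \<rho> (0 + inverse \<eta> *\<^sub>R x) \<partial>lborel)"
          by (rule integral_distr) (use \<rho>_borel[OF moll] in auto)
        also have "\<dots> = (\<integral>x. m x \<partial>lborel)"
          using eta by (intro Bochner_Integration.integral_cong) (auto simp: m_def field_simps power2_eq_square)
        finally show ?thesis by simp
      qed
      then show ?thesis by simp
    qed
    also have "(\<integral>x. m x * \<phi> x \<partial>lborel) - (\<integral>x. m x * \<phi> 0 \<partial>lborel) = (\<integral>x. m x * \<phi> x - m x * \<phi> 0 \<partial>lborel)"
    proof (rule Bochner_Integration.integral_diff[symmetric])
      show "integrable lborel (\<lambda>x. m x * \<phi> x)"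
        by (rule continuous_compact_integrable[of _ \<eta>]) (auto intro!: continuous_intros mc smooth_continuous[OF sm\<phi>] simp: mz)
    qed (use mi in simp)
    also have "\<dots> = (\<integral>x. \<integral>t. h t x \<partial>lborel \<partial>lborel)"
    proof (rule Bochner_Integration.integral_cong)
      fix x
      have "\<phi> (0 + x) - \<phi> 0 = (\<integral>t. indicator {0..1} t * (?g (0 + t *\<^sub>R x) \<bullet> x) \<partial>lborel)" by (rule line_FTC[OF gd gc])
      then have "m x * (\<phi> x - \<phi> 0) = (\<integral>t. m x * (indicator {0..1} t * (?g (t *\<^sub>R x) \<bullet> x)) \<partial>lborel)" by simp
      also have "\<dots> = (\<integral>t. h t x \<partial>lborel)" by (rule Bochner_Integration.integral_cong) (auto simp: h_def inner_commute)
      finally show "m x * \<phi> x - m x * \<phi> 0 = (\<integral>t. h t x \<partial>lborel)" by (simp add: right_diff_distrib)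
    qed simp
    also have "\<dots> = (\<integral>t. \<integral>x. h t x \<partial>lborel \<partial>lborel)" by (rule integral_swap[OF int])
    also have "\<dots> = (\<integral>t. \<integral>y. k t y * laplacian \<phi> y \<partial>lborel \<partial>lborel)"
    proof (rule integral_cong_AE)
        \<comment> \<open>At \<open>t = 0\<close> the substitution fails, and \<open>k\<close> is 0
          there by definition; one parameter value is negligible.\<close>
        show "AE t in lborel. (\<integral>x. h t x \<partial>lborel) = (\<integral>y. k t y * laplacian \<phi> y \<partial>lborel)"
        using AE_lborel_singleton[of "0::real"] by eventually_elim (rule inner)
      show "(\<lambda>t. \<integral>x. h t x \<partial>lborel) \<in> borel_measurable lborel" using lborel_pair.integrable_fst[OF int] by (rule borel_measurable_integrable)
      show "(\<lambda>t. \<integral>y. k t y * laplacian \<phi> y \<partial>lborel) \<in> borel_measurable lborel" using lborel_pair.integrable_fst[OF kint[OF lapc BL]] by (rule borel_measurable_integrable)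
    qed
    also have "\<dots> = (\<integral>y. \<integral>t. k t y * laplacian \<phi> y \<partial>lborel \<partial>lborel)" by (rule integral_swap[OF kint[OF lapc BL], symmetric])
    also have "\<dots> = (\<integral>y. (\<integral>t. k t y \<partial>lborel) * laplacian \<phi> y \<partial>lborel)" by simp
    finally have "2 * pi * ((\<integral>x. \<phi> x \<partial>smeared \<rho> \<eta> 0) - (\<integral>x. \<phi> x \<partial>return borel 0))
       = 2 * pi * (\<integral>y. (\<integral>t. k t y \<partial>lborel) * laplacian \<phi> y \<partial>lborel)" by simp
    also have "\<dots> = - (\<integral>x. f x * laplacian \<phi> x \<partial>lborel)" by (simp add: f_def mult.assoc)
    finally show ?thesis by simp
  qed
  have "truncation_potential \<rho> \<eta> f" unfolding truncation_potential_def
    by (intro conjI allI impI fLp fcont f0 weak)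
  then show ?thesis by blast
qed

text \<open>Truncation affects a field only within distance \<open>\<eta>\<close> of the
  points.\<close>

lemma f_trunc_gradient_zero:
  assumes "mollifier \<rho>" "\<eta> > 0" "norm z > \<eta>"
  shows "gradient (f_trunc \<rho> \<eta>) z = 0"
proof -
  have "truncation_potential \<rho> \<eta> (f_trunc \<rho> \<eta>)" unfolding f_trunc_def by (rule someI_ex[OF truncation_exists[OF assms(1,2)]])
  then have "\<And>x. x \<notin> cball 0 \<eta> \<Longrightarrow> f_trunc \<rho> \<eta> x = 0" by (simp add: truncation_potential_def)
  then show ?thesis
    by (intro gradient_locally_const[of "- cball 0 \<eta>" _ _ 0]) (use assms in auto)
qed

section \<open>Random electric fields\<close>

lemma space_field_algebra: "space field_algebra = electric_fields"
proof -
  let ?I = "{\<psi> :: plane \<Rightarrow> plane. continuous_on UNIV \<psi> \<and> bounded {x. \<psi> x \<noteq> 0}}"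
  have z: "(\<lambda>_. 0) \<in> ?I" by simp
  have "space field_algebra = (\<Union>\<psi>\<in>?I. space (vimage_algebra electric_fields (\<lambda>E. \<integral>y. E y \<bullet> \<psi> y \<partial>lborel) borel))"
    unfolding field_algebra_def by (subst space_Sup_eq_UN) auto
  also have "\<dots> = electric_fields" using z by (simp only: space_vimage_algebra) blast
  finally show ?thesis .
qed

lemma pairing_measurable:
  assumes "continuous_on UNIV \<psi>" "bounded {x. \<psi> x \<noteq> (0 :: plane)}"
  shows "(\<lambda>E. \<integral>y. E y \<bullet> \<psi> y \<partial>lborel) \<in> borel_measurable field_algebra"
proof -
  let ?I = "{\<psi> :: plane \<Rightarrow> plane. continuous_on UNIV \<psi> \<and> bounded {x. \<psi> x \<noteq> 0}}"
  have 1: "(\<lambda>E. \<integral>y. E y \<bullet> \<psi> y \<partial>lborel) \<in> vimage_algebra electric_fields (\<lambda>E. \<integral>y. E y \<bullet> \<psi> y \<partial>lborel) borel \<rightarrow>\<^sub>M borel"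
    by (rule measurable_vimage_algebra1) simp
  have 2: "\<psi> \<in> ?I" using assms by simp
  show ?thesis unfolding field_algebra_def
    by (rule measurable_SUP1[where M="\<lambda>\<psi>. vimage_algebra electric_fields (\<lambda>E. \<integral>y. E y \<bullet> \<psi> y \<partial>lborel) borel" and i=\<psi> and I="?I", OF 2 1])
      (simp only: space_vimage_algebra)
qed

lemma electric_Lp: "E \<in> electric_fields \<Longrightarrow> Lp_loc 1 E"
  by (simp add: electric_fields_def)

lemma lborel_integral_shift:
  fixes f :: "plane \<Rightarrow> 'b :: {banach, second_countable_topology}"
  assumes "f \<in> borel_measurable borel"
  shows "(\<integral>x. f (x + c) \<partial>lborel) = (\<integral>x. f x \<partial>lborel)"
proof -
  have "(\<integral>x. f x \<partial>distr lborel borel ((+) c)) = (\<integral>x. f (c + x) \<partial>lborel)" by (rule integral_distr) (use assms in auto)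
  then show ?thesis by (simp add: lborel_distr_plus add.commute)
qed

text \<open>\<open>field_algebra\<close> is generated by pairings with continuous fields, whereas an
  average over a disk pairs with a discontinuous one. It is a limit of pairings with the cut-offs
  \<open>c n\<close>, which equal 1 on the disk and drop to 0 with slope
  \<open>Suc n\<close>.\<close>

lemma avg_measurable: "(\<lambda>E. avg r y E) \<in> borel_measurable field_algebra"
  unfolding borel_measurable_euclidean_space[of "\<lambda>E. avg r y E"]
proof
  fix b :: plane assume b: "b \<in> Basis"
  then have nb: "norm b = 1" by simp
  define c where "c n z = max 0 (min 1 (1 + real (Suc n) * (r - dist y z)))" for n z
  have c0: "0 \<le> c n z" "c n z \<le> 1" for n z by (auto simp: c_def)
  have cz: "c n z = 0" if "dist y z > r + 1" for n z
  proof -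
    have "real (Suc n) * (r - dist y z) \<le> real (Suc n) * (- 1)" using that by (intro mult_left_mono) auto
    then have "1 + real (Suc n) * (r - dist y z) \<le> 0" by simp
    then show ?thesis by (simp add: c_def)
  qed
  have cc: "continuous_on UNIV (c n)" for n unfolding c_def by (intro continuous_intros)
  have "(\<lambda>E. \<integral>z. E z \<bullet> (indicator (cball y r) z *\<^sub>R b) \<partial>lborel) \<in> borel_measurable field_algebra"
  proof (rule borel_measurable_LIMSEQ_real)
    show "(\<lambda>E. \<integral>z. E z \<bullet> (c n z *\<^sub>R b) \<partial>lborel) \<in> borel_measurable field_algebra" for n
    proof (rule pairing_measurable)
      show "continuous_on UNIV (\<lambda>z. c n z *\<^sub>R b)" by (intro continuous_intros cc)
      have "{x. c n x *\<^sub>R b \<noteq> 0} \<subseteq> cball y (r + 1)" using cz[of _ n] by (force simp: not_le)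
      then show "bounded {x. c n x *\<^sub>R b \<noteq> 0}" using bounded_cball by (rule bounded_subset[rotated])
    qed
    fix E assume "E \<in> space field_algebra"
    then have E: "Lp_loc 1 E" by (simp add: space_field_algebra electric_Lp)
    note Em = Lp_loc_cball(1)[OF E]
    show "(\<lambda>n. \<integral>z. E z \<bullet> (c n z *\<^sub>R b) \<partial>lborel) \<longlonglongrightarrow> (\<integral>z. E z \<bullet> (indicator (cball y r) z *\<^sub>R b) \<partial>lborel)"
    proof (rule integral_dominated_convergence[where w="\<lambda>z. norm (indicator (cball y (r + 1)) z *\<^sub>R E z)"])
      show "integrable lborel (\<lambda>z. norm (indicator (cball y (r + 1)) z *\<^sub>R E z))"
        using Lp_loc_cball(3)[OF E, of y "r + 1"] unfolding set_integrable_def by (rule integrable_norm)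
      show "(\<lambda>z. E z \<bullet> (indicator (cball y r) z *\<^sub>R b)) \<in> borel_measurable lborel"
        using Em by (intro borel_measurable_inner borel_measurable_scaleR borel_measurable_indicator) auto
      show "(\<lambda>z. E z \<bullet> (c n z *\<^sub>R b)) \<in> borel_measurable lborel" for n
        using Em borel_measurable_continuous_onI[OF cc[of n]] by (intro borel_measurable_inner borel_measurable_scaleR) auto
      show "AE z in lborel. (\<lambda>n. E z \<bullet> (c n z *\<^sub>R b)) \<longlonglongrightarrow> E z \<bullet> (indicator (cball y r) z *\<^sub>R b)"
      proof (rule AE_I2)
        fix z
        have "(\<lambda>n. c n z) \<longlonglongrightarrow> indicator (cball y r) z"
        proof (cases "dist y z \<le> r")
          case True
          then have "c n z = 1" for n by (simp add: c_def)
          then show ?thesis using True by simp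
        next
          case False
          then obtain N where N: "1 / (dist y z - r) < real N" using reals_Archimedean2 by blast
          have "c n z = 0" if "n \<ge> N" for n
          proof -
            have "1 / (dist y z - r) \<le> real (Suc n)" using N that by simp
            then have "1 \<le> real (Suc n) * (dist y z - r)" using False by (simp add: pos_divide_le_eq)
            then have "1 + real (Suc n) * (r - dist y z) \<le> 0" by (simp add: algebra_simps)
            then show ?thesis by (simp add: c_def)
          qed
          then have "\<forall>\<^sub>F n in sequentially. c n z = 0" by (auto simp: eventually_sequentially)
          then show ?thesis using False by (simp add: tendsto_eventually)
        qed
        then show "(\<lambda>n. E z \<bullet> (c n z *\<^sub>R b)) \<longlonglongrightarrow> E z \<bullet> (indicator (cball y r) z *\<^sub>R b)" by (intro tendsto_intros)
      qed
      show "AE z in lborel. norm (E z \<bullet> (c n z *\<^sub>R b)) \<le> norm (indicator (cball y (r + 1)) z *\<^sub>R E z)" for n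
      proof (rule AE_I2)
        fix z
        show "norm (E z \<bullet> (c n z *\<^sub>R b)) \<le> norm (indicator (cball y (r + 1)) z *\<^sub>R E z)"
        proof (cases "dist y z > r + 1")
          case True
          then show ?thesis by (simp add: cz)
        next
          case False
          have "\<bar>E z \<bullet> (c n z *\<^sub>R b)\<bar> \<le> norm (E z) * norm (c n z *\<^sub>R b)" by (rule Cauchy_Schwarz_ineq2)
          also have "\<dots> \<le> norm (E z) * 1" using c0[of n z] nb by (intro mult_left_mono) auto
          finally show ?thesis using False by simp
        qed
      qed
    qed
  qed
  then have "(\<lambda>E. (\<integral>z. E z \<bullet> (indicator (cball y r) z *\<^sub>R b) \<partial>lborel) / measure lborel (cball y r)) \<in> borel_measurable field_algebra"
    by simp
  moreover have "avg r y E \<bullet> b = (\<integral>z. E z \<bullet> (indicator (cball y r) z *\<^sub>R b) \<partial>lborel) / measure lborel (cball y r)"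
    if "E \<in> space field_algebra" for E
  proof -
    have E: "Lp_loc 1 E" using that by (simp add: space_field_algebra electric_Lp)
    have "(\<integral>z. (indicator (cball y r) z *\<^sub>R E z) \<bullet> b \<partial>lborel) = (LINT z:cball y r|lborel. E z) \<bullet> b"
      unfolding set_lebesgue_integral_def
      by (rule integral_inner_left) (use Lp_loc_cball(3)[OF E] in \<open>simp add: set_integrable_def\<close>)
    then show ?thesis by (simp add: avg_def divide_inverse mult.commute)
  qed
  ultimately show "(\<lambda>E. avg r y E \<bullet> b) \<in> borel_measurable field_algebra"
    by (simp cong: measurable_cong)
qed

lemma AE_not_sphere: "r > 0 \<Longrightarrow> AE z in lborel. dist (y::plane) z \<noteq> r"
proof -
  assume r: "r > 0"
  have "emeasure lborel (cball y r - ball y r) = emeasure lborel (cball y r) - emeasure lborel (ball y r)"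
    using r by (intro emeasure_Diff) (auto simp: emeasure_ball_plane)
  then have "emeasure lborel (cball y r - ball y r) = 0" using r by (simp add: emeasure_ball_plane emeasure_cball_plane)
  then have "cball y r - ball y r \<in> null_sets lborel" by (intro null_setsI) auto
  then have "AE z in lborel. z \<notin> cball y r - ball y r" by (rule AE_not_in)
  then show ?thesis by eventually_elim auto
qed

text \<open>Dominated convergence: off the limiting circle, which is a null set, the indicators of
  the moving disks are eventually constant.\<close>

lemma avg_tendsto:
  assumes F: "Lp_loc 1 F" and y: "ys \<longlonglongrightarrow> y" and r: "rs \<longlonglongrightarrow> r" "r > 0"
  shows "(\<lambda>n. avg (rs n) (ys n) F) \<longlonglongrightarrow> avg r y F"
proof -
  note Fm = Lp_loc_cball(1)[OF F]
  obtain B1 where B1: "\<And>n. norm (ys n) \<le> B1" using convergent_imp_Bseq[OF convergentI[OF y]] by (auto simp: Bseq_def)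
  obtain B2 where B2: "\<And>n. norm (rs n) \<le> B2" using convergent_imp_Bseq[OF convergentI[OF r(1)]] by (auto simp: Bseq_def)
  have "(\<lambda>n. LINT z:cball (ys n) (rs n)|lborel. F z) \<longlonglongrightarrow> (LINT z:cball y r|lborel. F z)"
    unfolding set_lebesgue_integral_def
  proof (rule integral_dominated_convergence[where w="\<lambda>z. norm (indicator (cball 0 (B1 + B2)) z *\<^sub>R F z)"])
    show "integrable lborel (\<lambda>z. norm (indicator (cball 0 (B1 + B2)) z *\<^sub>R F z))"
      using Lp_loc_cball(3)[OF F, of 0 "B1 + B2"] unfolding set_integrable_def by (rule integrable_norm)
    show "(\<lambda>z. indicator (cball y r) z *\<^sub>R F z) \<in> borel_measurable lborel"
      using Fm by (intro borel_measurable_scaleR borel_measurable_indicator) auto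
    show "(\<lambda>z. indicator (cball (ys n) (rs n)) z *\<^sub>R F z) \<in> borel_measurable lborel" for n
      using Fm by (intro borel_measurable_scaleR borel_measurable_indicator) auto
    show "AE z in lborel. (\<lambda>n. indicator (cball (ys n) (rs n)) z *\<^sub>R F z) \<longlonglongrightarrow> indicator (cball y r) z *\<^sub>R F z"
      using AE_not_sphere[OF r(2), of y]
    proof eventually_elim
      case (elim z)
      have l: "(\<lambda>n. dist (ys n) z - rs n) \<longlonglongrightarrow> dist y z - r" by (intro tendsto_intros y r)
      have "\<forall>\<^sub>F n in sequentially. indicator (cball (ys n) (rs n)) z = (indicator (cball y r) z :: real)"
      proof (cases "dist y z < r")
        case True
        then have "\<forall>\<^sub>F n in sequentially. dist (ys n) z - rs n < 0" by (intro order_tendstoD(2)[OF l]) simp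
        then show ?thesis by eventually_elim (use True in simp)
      next
        case False
        then have "\<forall>\<^sub>F n in sequentially. dist (ys n) z - rs n > 0" using elim by (intro order_tendstoD(1)[OF l]) simp
        then show ?thesis by eventually_elim (use False elim in simp)
      qed
      then have "(\<lambda>n. indicator (cball (ys n) (rs n)) z :: real) \<longlonglongrightarrow> indicator (cball y r) z" by (rule tendsto_eventually)
      then show ?case by (intro tendsto_intros)
    qed
    show "AE z in lborel. norm (indicator (cball (ys n) (rs n)) z *\<^sub>R F z) \<le> norm (indicator (cball 0 (B1 + B2)) z *\<^sub>R F z)" for n
    proof (rule AE_I2)
      fix z
      have "z \<in> cball (ys n) (rs n) \<Longrightarrow> z \<in> cball 0 (B1 + B2)"
        using norm_triangle_sub[of z "ys n"] B1[of n] B2[of n] by (auto simp: dist_norm norm_minus_commute)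
      then show "norm (indicator (cball (ys n) (rs n)) z *\<^sub>R F z) \<le> norm (indicator (cball 0 (B1 + B2)) z *\<^sub>R F z)"
        by (auto simp: indicator_def)
    qed
  qed
  moreover have "(\<lambda>n. measure lborel (cball (ys n) (rs n))) \<longlonglongrightarrow> measure lborel (cball y r)"
  proof -
    have ms: "measure lborel (cball x s) = pi * s\<^sup>2" if "s > 0" for x :: plane and s
      using emeasure_cball_plane[of s x] that by (simp add: measure_def)
    have "\<forall>\<^sub>F n in sequentially. rs n > 0" using order_tendstoD(1)[OF r] .
    then have "\<forall>\<^sub>F n in sequentially. pi * (rs n)\<^sup>2 = measure lborel (cball (ys n) (rs n))"
      by eventually_elim (simp add: ms)
    moreover have "(\<lambda>n. pi * (rs n)\<^sup>2) \<longlonglongrightarrow> pi * r\<^sup>2" by (intro tendsto_intros r)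
    ultimately show ?thesis unfolding ms[OF r(2)] by (rule Lim_transform_eventually[rotated])
  qed
  moreover have "measure lborel (cball y r) \<noteq> 0" using emeasure_cball_plane[of r y] r(2) by (simp add: measure_def)
  ultimately show ?thesis unfolding avg_def by (intro tendsto_intros)
qed

text \<open>The average is measurable in the field and continuous in the centre. Rounding the centre
  to a grid of mesh \<open>1 / Suc n\<close> leaves countably many centres, and joint measurability
  passes to the limit.\<close>

lemma avg_joint:
  assumes Q: "sets Q = sets field_algebra" and r: "r > 0"
  shows "(\<lambda>p. avg r (snd p) (fst p)) \<in> borel_measurable (Q \<Otimes>\<^sub>M lborel)"
proof (rule borel_measurable_LIMSEQ_metric)
  fix n :: nat
  show "(\<lambda>p. avg r (flr (real (Suc n) *\<^sub>R snd p) /\<^sub>R real (Suc n)) (fst p)) \<in> borel_measurable (Q \<Otimes>\<^sub>M lborel)"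
  proof (rule measurable_compose_countable'[where I=ZZ and f="\<lambda>i p. avg r (i /\<^sub>R real (Suc n)) (fst p)" and g="\<lambda>p. flr (real (Suc n) *\<^sub>R snd p)"])
    fix i
    have "(\<lambda>E. avg r (i /\<^sub>R real (Suc n)) E) \<in> borel_measurable Q"
      using avg_measurable measurable_cong_sets[OF Q refl, of "borel :: plane measure"] by blast
    then show "(\<lambda>p. avg r (i /\<^sub>R real (Suc n)) (fst p)) \<in> borel_measurable (Q \<Otimes>\<^sub>M lborel)"
      by (rule measurable_compose[OF measurable_fst])
    have "(\<lambda>p. real (Suc n) *\<^sub>R snd p) \<in> borel_measurable (Q \<Otimes>\<^sub>M (lborel :: plane measure))"
      by (intro borel_measurable_scaleR) auto
    then show "(\<lambda>p. flr (real (Suc n) *\<^sub>R snd p)) \<in> measurable (Q \<Otimes>\<^sub>M lborel) (count_space ZZ)"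
      by (rule measurable_compose[OF _ flr_measurable])
  qed (rule countable_ZZ)
next
  fix p assume "p \<in> space (Q \<Otimes>\<^sub>M (lborel :: plane measure))"
  then have "fst p \<in> space Q" by (simp only: space_pair_measure mem_Times_iff)
  then have "fst p \<in> electric_fields" by (simp only: sets_eq_imp_space_eq[OF Q] space_field_algebra)
  then have E: "Lp_loc 1 (fst p)" by (rule electric_Lp)
  have "(\<lambda>n. flr (real (Suc n) *\<^sub>R snd p) /\<^sub>R real (Suc n)) \<longlonglongrightarrow> snd p"
  proof (rule LIM_zero_cancel, rule Lim_null_comparison)
    show "\<forall>\<^sub>F n in sequentially. norm (flr (real (Suc n) *\<^sub>R snd p) /\<^sub>R real (Suc n) - snd p) \<le> 2 * inverse (real (Suc n))"
    proof (rule always_eventually, rule allI)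
      fix n
      define x where "x = real (Suc n) *\<^sub>R snd p"
      have "snd p = x /\<^sub>R real (Suc n)" by (simp add: x_def del: of_nat_Suc)
      then have "flr x /\<^sub>R real (Suc n) - snd p = - inverse (real (Suc n)) *\<^sub>R (x - flr x)" by (simp only: scaleR_diff_right scaleR_minus_left) (simp del: of_nat_Suc)
      then have "norm (flr x /\<^sub>R real (Suc n) - snd p) = inverse (real (Suc n)) * norm (x - flr x)" by (simp del: of_nat_Suc)
      also have "\<dots> \<le> inverse (real (Suc n)) * 2" by (rule mult_left_mono[OF norm_Cell[OF sub_flr_in_Cell[of x]]]) simp
      finally show "norm (flr (real (Suc n) *\<^sub>R snd p) /\<^sub>R real (Suc n) - snd p) \<le> 2 * inverse (real (Suc n))"
        unfolding x_def by (simp only: mult.commute)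
    qed
    show "(\<lambda>n. 2 * inverse (real (Suc n))) \<longlonglongrightarrow> 0" by (rule tendsto_mult_right_zero[OF LIMSEQ_inverse_real_of_nat])
  qed
  then show "(\<lambda>n. avg r (flr (real (Suc n) *\<^sub>R snd p) /\<^sub>R real (Suc n)) (fst p)) \<longlonglongrightarrow> avg r (snd p) (fst p)"
    by (rule avg_tendsto[OF E _ tendsto_const r])
qed

section \<open>The Lebesgue value through rational radii\<close>

definition rr :: "nat \<Rightarrow> nat \<Rightarrow> real" where "rr a b = real (Suc a) / real (Suc b)"

lemma rr_pos: "rr a b > 0" by (simp add: rr_def)

lemma rr0_tendsto: "filterlim (rr 0) (at_right 0) sequentially"
  unfolding filterlim_at
proof
  show "rr 0 \<longlonglongrightarrow> 0" using LIMSEQ_inverse_real_of_nat by (simp add: rr_def[abs_def] inverse_eq_divide)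
qed (simp add: rr_pos less_imp_neq[OF rr_pos, symmetric])

lemma rr_small:
  assumes "e > 0" obtains k where "rr 0 k < e"
proof -
  obtain k where "1 / real (Suc k) < e" using nat_approx_posE[OF assms] by blast
  then show ?thesis by (intro that[of k]) (simp add: rr_def)
qed

lemma rr_approx:
  assumes "r > 0"
  obtains a where "(\<lambda>j. rr (a j) j) \<longlonglongrightarrow> r"
proof
  \<comment> \<open>\<open>rr\<close> adds 1 to the numerator, so the floor yields an approximation
    of \<open>r\<close> from above.\<close>
  define a where "a j = nat \<lfloor>r * real (Suc j)\<rfloor>" for j
  have b: "r \<le> rr (a j) j" "rr (a j) j \<le> r + inverse (real (Suc j))" for j
  proof -
    have "real (a j) = of_int \<lfloor>r * real (Suc j)\<rfloor>" using assms by (simp add: a_def)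
    then have "real (a j) \<le> r * real (Suc j)" "r * real (Suc j) \<le> real (Suc (a j))" by linarith+
    then show "r \<le> rr (a j) j" "rr (a j) j \<le> r + inverse (real (Suc j))"
      unfolding rr_def by (simp_all add: pos_le_divide_eq pos_divide_le_eq distrib_right del: of_nat_Suc)
  qed
  show "(\<lambda>j. rr (nat \<lfloor>r * real (Suc j)\<rfloor>) j) \<longlonglongrightarrow> r"
    unfolding a_def[symmetric]
  proof (rule tendsto_sandwich[OF _ _ tendsto_const])
    show "(\<lambda>j. r + inverse (real (Suc j))) \<longlonglongrightarrow> r" using tendsto_add[OF tendsto_const[of r] LIMSEQ_inverse_real_of_nat] by simp
  qed (use b in auto)
qed

text \<open>A Cauchy criterion for the averages that involves rational radii only, hence is measurable.\<close>

definition conv_at :: "(plane \<Rightarrow> plane) \<Rightarrow> plane \<Rightarrow> bool" where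
  "conv_at E y \<longleftrightarrow> (\<forall>k::nat. \<exists>m::nat. \<forall>a b. rr a b < rr 0 m \<longrightarrow>
     dist (avg (rr a b) y E) (avg (rr 0 (Suc m)) y E) \<le> rr 0 k)"

text \<open>Averages depend continuously on the radius, so the estimate extends from rational to all
  radii, where it is a Cauchy criterion at 0.\<close>

lemma conv_at_limit:
  assumes E: "Lp_loc 1 E" and c: "conv_at E y"
  obtains l where "((\<lambda>r. avg r y E) \<longlongrightarrow> l) (at_right 0)"
proof -
  have ex: "\<exists>m v. \<forall>r. 0 < r \<and> r < rr 0 m \<longrightarrow> dist (avg r y E) v \<le> rr 0 k" for k
  proof -
    obtain m where m: "\<And>a b. rr a b < rr 0 m \<Longrightarrow> dist (avg (rr a b) y E) (avg (rr 0 (Suc m)) y E) \<le> rr 0 k"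
      using c unfolding conv_at_def by blast
    have "dist (avg r y E) (avg (rr 0 (Suc m)) y E) \<le> rr 0 k" if r: "0 < r" "r < rr 0 m" for r
    proof -
      obtain a where a: "(\<lambda>j. rr (a j) j) \<longlonglongrightarrow> r" using rr_approx[OF r(1)] .
      have lim: "(\<lambda>j. dist (avg (rr (a j) j) y E) (avg (rr 0 (Suc m)) y E)) \<longlonglongrightarrow> dist (avg r y E) (avg (rr 0 (Suc m)) y E)"
        by (intro tendsto_intros avg_tendsto[OF E tendsto_const a r(1)])
      have "\<forall>\<^sub>F j in sequentially. rr (a j) j < rr 0 m" using order_tendstoD(2)[OF a r(2)] .
      then have "\<forall>\<^sub>F j in sequentially. dist (avg (rr (a j) j) y E) (avg (rr 0 (Suc m)) y E) \<le> rr 0 k"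
        by eventually_elim (rule m)
      then show ?thesis by (rule tendsto_upperbound[OF lim]) simp
    qed
    then show ?thesis by blast
  qed
  have "\<exists>b>0. \<forall>r r'. 0 < r \<and> r < b \<and> 0 < r' \<and> r' < b \<longrightarrow> dist (avg r y E) (avg r' y E) < e" if e: "e > 0" for e
  proof -
    obtain k where k: "rr 0 k < e / 2" using rr_small[of "e / 2"] e by (meson half_gt_zero)
    obtain m v where mv: "\<And>r. 0 < r \<and> r < rr 0 m \<Longrightarrow> dist (avg r y E) v \<le> rr 0 k" using ex[of k] by blast
    have "dist (avg r y E) (avg r' y E) < e" if "0 < r \<and> r < rr 0 m \<and> 0 < r' \<and> r' < rr 0 m" for r r'
      using mv[of r] mv[of r'] that k dist_triangle2[of "avg r y E" "avg r' y E" v] by linarith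
    then show ?thesis using rr_pos[of 0 m] by blast
  qed
  note cau = this
  have ev: "\<forall>\<^sub>F n in sequentially. rr 0 n < b" if "b > 0" for b
  proof -
    have "rr 0 \<longlonglongrightarrow> 0" using rr0_tendsto by (simp add: filterlim_at)
    then show ?thesis using that by (rule order_tendstoD(2))
  qed
  have "Cauchy (\<lambda>n. avg (rr 0 n) y E)"
  proof (rule metric_CauchyI)
    fix e :: real assume e: "e > 0"
    obtain b where b: "b > 0" "\<And>r r'. 0 < r \<and> r < b \<and> 0 < r' \<and> r' < b \<Longrightarrow> dist (avg r y E) (avg r' y E) < e" using cau[OF e] by blast
    obtain N where "\<And>n. n \<ge> N \<Longrightarrow> rr 0 n < b" using ev[OF b(1)] unfolding eventually_sequentially by blast
    then show "\<exists>M. \<forall>m\<ge>M. \<forall>n\<ge>M. dist (avg (rr 0 m) y E) (avg (rr 0 n) y E) < e" using b(2) rr_pos by blast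
  qed
  then obtain l where l: "(\<lambda>n. avg (rr 0 n) y E) \<longlonglongrightarrow> l" using Cauchy_convergent_iff convergent_def by blast
  show ?thesis
  proof (rule that[of l], rule tendstoI)
    fix e :: real assume e: "e > 0"
    then have e2: "e / 2 > 0" by simp
    obtain b where b: "b > 0" "\<And>r r'. 0 < r \<and> r < b \<and> 0 < r' \<and> r' < b \<Longrightarrow> dist (avg r y E) (avg r' y E) < e / 2" using cau[OF e2] by blast
    have "dist (avg r y E) l < e" if r: "0 < r" "r < b" for r
    proof -
      have "\<forall>\<^sub>F n in sequentially. rr 0 n < b \<and> dist (avg (rr 0 n) y E) l < e / 2"
        using ev[OF b(1)] tendstoD[OF l e2] by (rule eventually_conj)
      then obtain n where n: "rr 0 n < b" "dist (avg (rr 0 n) y E) l < e / 2" unfolding eventually_sequentially by blast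
      show ?thesis using b(2)[of r "rr 0 n"] r n rr_pos[of 0 n] dist_triangle[of "avg r y E" l "avg (rr 0 n) y E"] by simp
    qed
    then show "\<forall>\<^sub>F r in at_right 0. dist (avg r y E) l < e" unfolding eventually_at_right_field using b(1) by blast
  qed
qed

text \<open>The liminf along the radii \<open>rr 0 n\<close> is a measurable way to write the
  squared norm of the limit.\<close>

lemma limit_conv_at:
  assumes l: "((\<lambda>r. avg r y E) \<longlongrightarrow> l) (at_right 0)"
  shows "conv_at E y" "liminf (\<lambda>n. ennreal ((norm (avg (rr 0 n) y E))\<^sup>2)) = ennreal ((norm l)\<^sup>2)"
proof -
  show "conv_at E y" unfolding conv_at_def
  proof
    fix k
    have "\<forall>\<^sub>F r in at_right 0. dist (avg r y E) l < rr 0 k / 2" by (rule tendstoD[OF l]) (simp add: rr_pos)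
    then obtain b where b: "b > 0" "\<And>r. 0 < r \<Longrightarrow> r < b \<Longrightarrow> dist (avg r y E) l < rr 0 k / 2"
      unfolding eventually_at_right_field by blast
    obtain m where m: "rr 0 m < b" using rr_small[OF b(1)] .
    have m': "rr 0 (Suc m) < b"
    proof -
      have "rr 0 (Suc m) \<le> rr 0 m" unfolding rr_def by (rule divide_left_mono) auto
      then show ?thesis using m by linarith
    qed
    have "dist (avg (rr a c) y E) (avg (rr 0 (Suc m)) y E) \<le> rr 0 k" if "rr a c < rr 0 m" for a c
      using b(2)[OF rr_pos[of a c]] b(2)[OF rr_pos m'] that m dist_triangle2[of "avg (rr a c) y E" "avg (rr 0 (Suc m)) y E" l] by linarith
    then show "\<exists>m. \<forall>a b. rr a b < rr 0 m \<longrightarrow> dist (avg (rr a b) y E) (avg (rr 0 (Suc m)) y E) \<le> rr 0 k" by blast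
  qed
  have "(\<lambda>n. avg (rr 0 n) y E) \<longlonglongrightarrow> l" by (rule filterlim_compose[OF l rr0_tendsto])
  then have "(\<lambda>n. ennreal ((norm (avg (rr 0 n) y E))\<^sup>2)) \<longlonglongrightarrow> ennreal ((norm l)\<^sup>2)" by (intro tendsto_intros tendsto_ennrealI)
  then show "liminf (\<lambda>n. ennreal ((norm (avg (rr 0 n) y E))\<^sup>2)) = ennreal ((norm l)\<^sup>2)" by (intro lim_imp_Liminf) simp
qed

section \<open>Reading the cluster structure off a configuration\<close>

lemma hbox_subset_cball:
  assumes s: "s > 0" and x: "x \<in> hbox p s" and y: "y \<in> hbox p s"
  shows "dist x y \<le> 2 * s"
proof -
  have "\<bar>(x - y) $ i\<bar> \<le> s" for i using x y unfolding hbox_iff[OF s] by (auto simp: abs_le_iff) (smt (verit))+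
  then have "\<bar>(x - y) $ 1\<bar> + \<bar>(x - y) $ 2\<bar> \<le> s + s" by (intro add_mono)
  then show ?thesis using norm_plane_le[of "x - y"] by (simp add: dist_norm)
qed

lemma bounded_hbox: "s > 0 \<Longrightarrow> bounded (hbox p s)"
proof -
  assume s: "s > 0"
  then have "p \<in> hbox p s" by (simp add: hbox_iff)
  then have "hbox p s \<subseteq> cball p (2 * s)" using hbox_subset_cball[OF s] by auto
  then show ?thesis using bounded_cball by (rule bounded_subset[rotated])
qed

text \<open>In each coordinate the corner has to lie between the larger value minus \<open>s\<close>
  and the smaller value, an interval with rational points.\<close>

lemma rational_box:
  assumes s: "s > 0" and d: "\<And>i. \<bar>x $ i - z $ i\<bar> < s"
  obtains p where "p \<in> qpts" "x \<in> hbox p s" "z \<in> hbox p s"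
proof -
  have "\<exists>q\<in>\<rat>. max (x $ i) (z $ i) - s < q \<and> q < min (x $ i) (z $ i)" for i
  proof -
    have "max (x $ i) (z $ i) - s < min (x $ i) (z $ i)" using d[of i] s by (auto simp: max_def min_def abs_less_iff)
    from Rats_dense_in_real[OF this] show ?thesis by blast
  qed
  then obtain f where f: "\<And>i. f i \<in> \<rat>" "\<And>i. max (x $ i) (z $ i) - s < f i" "\<And>i. f i < min (x $ i) (z $ i)" by metis
  have g: "f i \<le> x $ i \<and> x $ i < f i + s \<and> f i \<le> z $ i \<and> z $ i < f i + s" for i
    using f(2)[of i] f(3)[of i] by auto
  show ?thesis
    by (rule that[of "\<chi> i. f i"]) (use f(1) g in \<open>simp_all add: qpts_def hbox_iff[OF s]\<close>)
qed

text \<open>A box of side \<open>ll k\<close> is not empty, which gives a point \<open>x\<close>. A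
  small rational box isolates \<open>x\<close>, so its count, 0 or \<open>Mk k\<close>, is the
  multiplicity of \<open>x\<close>. A second point closer than \<open>ll k\<close> would share a
  rational box of side \<open>ll k\<close> with \<open>x\<close>, although \<open>x\<close> already
  exhausts the count of that box. The small box is kept in the conclusion because
  \<open>GG_disjoint\<close> reads the scale from it.\<close>

lemma GG_structure:
  assumes X: "X \<in> GG k"
  obtains x q n where "norm x \<le> 2 * ll k" "of_nat (Mk k) \<le> emeasure X {x}" "emeasure X (ball x (ll k) - {x}) = 0"
    "q \<in> qpts" "emeasure X (hbox q (1 / real (n + 1))) = of_nat (Mk k)"
proof -
  have XC: "X \<in> configs" and G1: "\<And>p. p \<in> qpts \<Longrightarrow> emeasure X (hbox p (ll k)) = of_nat (Mk k)"
    and G2: "\<And>p n. p \<in> qpts \<Longrightarrow> emeasure X (hbox p (1 / real (n + 1))) \<in> {0, of_nat (Mk k)}"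
    using X unfolding GG_def by blast+
  obtain I :: "(plane \<times> nat) set" where I: "loc_fin I fst" "X = conf I fst" using configs_conf[OF XC] .
  have em: "emeasure X A = of_nat (card {i\<in>I. fst i \<in> A})" "finite {i\<in>I. fst i \<in> A}" if "bounded A" "A \<in> sets borel" for A
    unfolding I(2) using emeasure_conf_bounded[OF I(1) that] loc_fin_bounded[OF I(1) that(1)] by auto
  have z: "0 \<in> qpts" by (simp add: qpts_def)
  have "emeasure X (hbox 0 (ll k)) \<noteq> 0" using G1[OF z] Mk_pos[of k] by simp
  then have "card {i\<in>I. fst i \<in> hbox 0 (ll k)} \<noteq> 0" using em(1)[OF bounded_hbox[OF ll_pos(1)] hbox_borel, of 0 k] by auto
  then obtain i0 where i0: "i0 \<in> I" "fst i0 \<in> hbox 0 (ll k)" by (metis (mono_tags, lifting) card.empty Collect_empty_eq)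
  define x where "x = fst i0"
  have "0 \<in> hbox 0 (ll k)" using ll_pos(1)[of k] by (simp add: hbox_iff)
  from hbox_subset_cball[OF ll_pos(1) i0(2) this] have nx: "norm x \<le> 2 * ll k" by (simp add: x_def)
  obtain d where d: "d > 0" "\<And>i. i \<in> I \<Longrightarrow> fst i \<noteq> x \<Longrightarrow> d \<le> dist x (fst i)" using isolate_point[OF I(1)] by metis
  obtain n where n: "1 / real (n + 1) < d / 2" using nat_approx_posE[of "d / 2"] d(1) by (auto simp: add.commute)
  have sp: "0 < 1 / real (n + 1)" by simp
  obtain q where q: "q \<in> qpts" "x \<in> hbox q (1 / real (n + 1))"
    using rational_box[OF sp, of x x] sp by (metis abs_zero diff_self)
  have "{i\<in>I. fst i \<in> hbox q (1 / real (n + 1))} = {i\<in>I. fst i \<in> {x}}"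
  proof (intro Collect_cong conj_cong refl iffI)
    fix i assume i: "i \<in> I" "fst i \<in> hbox q (1 / real (n + 1))"
    have le: "dist x (fst i) \<le> 2 * (1 / real (n + 1))" by (rule hbox_subset_cball[OF sp q(2) i(2)])
    show "fst i \<in> {x}"
    proof (rule ccontr)
      assume "fst i \<notin> {x}"
      then have "d \<le> dist x (fst i)" by (intro d(2)[OF i(1)]) simp
      then show False using le n by linarith
    qed
  next
    fix i assume "fst i \<in> {x}"
    then have "fst i = x" by (rule singletonD)
    then show "fst i \<in> hbox q (1 / real (n + 1))" using q(2) by (simp only:)
  qed
  then have eq: "emeasure X (hbox q (1 / real (n + 1))) = emeasure X {x}"
    using em(1)[OF bounded_hbox[OF sp] hbox_borel, of q] em(1)[of "{x}"] by (simp only: bounded_insert bounded_empty borel_singleton sets.empty_sets)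
  have point: "1 \<le> emeasure X {fst i}" if "i \<in> I" for i
  proof -
    have "{j\<in>I. fst j \<in> {fst i}} \<noteq> {}" using that by blast
    moreover have "finite {j\<in>I. fst j \<in> {fst i}}" by (rule em(2)) simp_all
    ultimately have c: "1 \<le> card {j\<in>I. fst j \<in> {fst i}}" by (simp only: card_gt_0_iff Suc_le_eq One_nat_def not_False_eq_True simp_thms)
    have e: "emeasure X {fst i} = of_nat (card {j\<in>I. fst j \<in> {fst i}})" by (rule em(1)) simp_all
    show ?thesis using of_nat_mono[OF c, where 'a=ennreal] unfolding e of_nat_1 .
  qed
  have "emeasure X {x} \<noteq> 0" using point[OF i0(1)] by (auto simp: x_def)
  then have M: "emeasure X {x} = of_nat (Mk k)" using G2[OF q(1), of n] unfolding eq by blast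
  have far: "fst i \<notin> ball x (ll k)" if i: "i \<in> I" "fst i \<noteq> x" for i
  proof
    assume b: "fst i \<in> ball x (ll k)"
    have "\<bar>x $ j - fst i $ j\<bar> < ll k" for j
      using b component_le_norm_cart[of "x - fst i" j] by (simp add: dist_norm)
    then obtain p where p: "p \<in> qpts" "x \<in> hbox p (ll k)" "fst i \<in> hbox p (ll k)" using rational_box[OF ll_pos(1)] by blast
    have "of_nat (Mk k) + 1 \<le> emeasure X {x} + emeasure X {fst i}" using M point[OF i(1)] by (intro add_mono) auto
    also have "\<dots> = emeasure X ({x} \<union> {fst i})"
      using i(2) sets_configs[OF XC] by (intro plus_emeasure) auto
    also have "\<dots> \<le> emeasure X (hbox p (ll k))"
      using p(2,3) sets_configs[OF XC] by (intro emeasure_mono) auto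
    also have "\<dots> = of_nat (Mk k)" by (rule G1[OF p(1)])
    finally have "(of_nat (Suc (Mk k)) :: ennreal) \<le> of_nat (Mk k)" by (simp add: add.commute)
    then show False by (simp only: of_nat_le_iff)
  qed
  have "\<not> (i \<in> I \<and> fst i \<in> ball x (ll k) - {x})" for i using far[of i] by blast
  then have none: "{i\<in>I. fst i \<in> ball x (ll k) - {x}} = {}" by blast
  have "emeasure X (ball x (ll k) - {x}) = of_nat (card {i\<in>I. fst i \<in> ball x (ll k) - {x}})"
    by (rule em(1)) (auto intro: bounded_subset[OF bounded_ball[of x "ll k"] Diff_subset])
  then have "emeasure X (ball x (ll k) - {x}) = 0" by (simp only: none card.empty of_nat_0)
  then show ?thesis using that[OF nx _ _ q(1)] M eq by simp
qed

lemma GG_disjoint: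
  assumes "X \<in> GG i" "X \<in> GG k" shows "i = k"
proof -
  obtain q n where q: "q \<in> qpts" "emeasure X (hbox q (1 / real (n + 1))) = of_nat (Mk i)" using GG_structure[OF assms(1)] by metis
  have "emeasure X (hbox q (1 / real (n + 1))) \<in> {0, of_nat (Mk k)}" using assms(2) q(1) unfolding GG_def by blast
  then have "(of_nat (Mk i) :: ennreal) = of_nat (Mk k)" using q(2) Mk_pos[of i] by auto
  then show ?thesis using Mk_inj by (simp only: of_nat_eq_iff)
qed

section \<open>From the energy at the origin to the energy in a large disk\<close>

definition qn :: "nat \<Rightarrow> plane" where "qn = from_nat_into qpts"

lemma qn_dense: "e > 0 \<Longrightarrow> \<exists>n. dist (qn n) y < e"
proof -
  assume "e > 0"
  then obtain t where t: "t \<in> qpts" "dist t y < e" using qpts_dense by metis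
  obtain n where "qn n = t" using from_nat_into_surj[OF countable_qpts t(1)] unfolding qn_def by blast
  then show ?thesis using t(2) by blast
qed

text \<open>
  Measurable versions of the squared norm of a field, at \<open>y\<close> and at the origin, set to \<open>0\<close> unless there is
  no point nearby, so that truncation has no effect. In \<open>hdens\<close> the disk has its centre in a
  countable set to make the condition jointly measurable.
\<close>

definition hdens :: "(plane \<Rightarrow> plane) \<Rightarrow> plane \<Rightarrow> ennreal" where
  "hdens E y = (if conv_at E y \<and> (\<exists>n. dist (qn n) y < 1/10 \<and> emeasure (field_config E) (cball (qn n) (8/5)) = 0)
     then liminf (\<lambda>n. ennreal ((norm (avg (rr 0 n) y E))\<^sup>2)) else 0)"

definition h0 :: "(plane \<Rightarrow> plane) \<Rightarrow> ennreal" where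
  "h0 E = (if conv_at E 0 \<and> emeasure (field_config E) (cball 0 (3/2)) = 0
     then liminf (\<lambda>n. ennreal ((norm (avg (rr 0 n) 0 E))\<^sup>2)) else 0)"

lemma avg_translate:
  assumes E: "E \<in> borel_measurable borel" and r: "r > 0"
  shows "avg r y (\<lambda>z. E (z - t)) = avg r (y - t) E"
proof -
  have "(LINT z:cball y r|lborel. E (z - t)) = (\<integral>z. indicator (cball (y - t) r) (z + (- t)) *\<^sub>R E (z + (- t)) \<partial>lborel)"
    unfolding set_lebesgue_integral_def
    by (rule Bochner_Integration.integral_cong) (auto simp: indicator_def dist_norm algebra_simps)
  also have "\<dots> = (LINT z:cball (y - t) r|lborel. E z)"
    unfolding set_lebesgue_integral_def
    by (rule lborel_integral_shift[of "\<lambda>z. indicator (cball (y - t) r) z *\<^sub>R E z"])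
      (use E in \<open>intro borel_measurable_scaleR borel_measurable_indicator, auto\<close>)
  finally show ?thesis unfolding avg_def using emeasure_cball_plane[of r y] emeasure_cball_plane[of r "y - t"] r
    by (simp add: measure_def)
qed

lemma conv_at_translate:
  assumes "E \<in> borel_measurable borel"
  shows "conv_at (\<lambda>z. E (z - t)) y \<longleftrightarrow> conv_at E (y - t)"
  unfolding conv_at_def avg_translate[OF assms rr_pos] ..

text \<open>The disk of radius \<open>3/2\<close> about \<open>y\<close> lies in the disk of radius
  \<open>8/5 = 3/2 + 1/10\<close> about \<open>qn n\<close>, so after moving \<open>y\<close> to the
  origin the condition of \<open>hdens\<close> implies that of \<open>h0\<close>.\<close>

lemma hdens_le_h0:
  assumes E: "E \<in> borel_measurable borel" and X: "field_config E \<in> configs"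
    and t: "field_config (\<lambda>z. E (z + y)) = translate_config (- y) (field_config E)"
  shows "hdens E y \<le> h0 (\<lambda>z. E (z + y))"
proof (cases "conv_at E y \<and> (\<exists>n. dist (qn n) y < 1/10 \<and> emeasure (field_config E) (cball (qn n) (8/5)) = 0)")
  case True
  then obtain n where n: "conv_at E y" "dist (qn n) y < 1/10" "emeasure (field_config E) (cball (qn n) (8/5)) = 0" by blast
  have "(\<lambda>x. x + - y) -` cball 0 (3/2) \<subseteq> cball (qn n) (8/5)"
  proof
    fix x assume "x \<in> (\<lambda>x. x + - y) -` cball 0 (3/2)"
    then have "dist y x \<le> 3/2" by (simp add: dist_norm norm_minus_commute)
    then show "x \<in> cball (qn n) (8/5)" using n(2) dist_triangle[of "qn n" x y] by simp
  qed
  then have "emeasure (field_config E) ((\<lambda>x. x + - y) -` cball 0 (3/2)) \<le> emeasure (field_config E) (cball (qn n) (8/5))"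
    using sets_configs[OF X] by (intro emeasure_mono) auto
  then have "emeasure (field_config (\<lambda>z. E (z + y))) (cball 0 (3/2)) = 0"
    unfolding t emeasure_translate_config[OF X cball_borel] using n(3) by simp
  then show ?thesis
    using n(1) conv_at_translate[OF E, of "- y" 0] avg_translate[OF E rr_pos, of 0 _ 0 "- y"] by (simp add: h0_def hdens_def)
qed (auto simp: hdens_def)

lemma compatible_translate:
  assumes E: "E \<in> borel_measurable borel" and X: "X \<in> configs" and c: "compatible E X"
  shows "compatible (\<lambda>z. E (z + y)) (translate_config (- y) X)"
  unfolding compatible_def
proof (intro allI impI)
  fix \<phi> assume \<phi>: "test_function \<phi>"
  then have sm: "smooth \<phi>" and bd: "bounded {x. \<phi> x \<noteq> 0}" by (auto simp: test_function_def)
  define \<psi> where "\<psi> = (\<lambda>x. \<phi> (x - y))"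
  have sm': "smooth \<psi>"
    using Ck_affine[where c=1 and t=1 and b="- y" and f=\<phi>] sm by (simp add: smooth_def \<psi>_def)
  have g: "gradient \<psi> x = gradient \<phi> (x - y)" for x
  proof (rule gradient_eq)
    have "GDERIV \<phi> (1 *\<^sub>R x + - y) :> gradient \<phi> (x - y)" using smooth_GDERIV[OF sm, of "x - y"] by simp
    from GDERIV_affine[where c=1, OF this] show "GDERIV \<psi> x :> gradient \<phi> (x - y)" by (simp add: \<psi>_def)
  qed
  have "{x. \<psi> x \<noteq> 0} = (\<lambda>x. x + y) ` {x. \<phi> x \<noteq> 0}"
  proof (intro set_eqI iffI)
    fix x assume "x \<in> {x. \<psi> x \<noteq> 0}"
    then show "x \<in> (\<lambda>x. x + y) ` {x. \<phi> x \<noteq> 0}" by (intro image_eqI[of _ _ "x - y"]) (auto simp: \<psi>_def)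
  qed (auto simp: \<psi>_def)
  then have "bounded {x. \<psi> x \<noteq> 0}" using bounded_translation[OF bd, of y] by (simp add: add.commute)
  then have t\<psi>: "test_function \<psi>" using sm' by (simp add: test_function_def)
  have gm: "gradient \<phi> \<in> borel_measurable borel" by (rule borel_measurable_continuous_onI[OF gradient_continuous[OF sm]])
  have gm': "gradient \<psi> \<in> borel_measurable borel" by (rule borel_measurable_continuous_onI[OF gradient_continuous[OF sm']])
  have "(\<integral>z. E (z + y) \<bullet> gradient \<phi> z \<partial>lborel) = (\<integral>z. E (z + y) \<bullet> gradient \<psi> (z + y) \<partial>lborel)"
    by (simp add: g)
  also have "\<dots> = (\<integral>z. E z \<bullet> gradient \<psi> z \<partial>lborel)"
    by (rule lborel_integral_shift[of "\<lambda>z. E z \<bullet> gradient \<psi> z"]) (use E gm' in \<open>intro borel_measurable_inner\<close>)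
  also have "\<dots> = 2 * pi * ((\<integral>x. \<psi> x \<partial>X) - (\<integral>x. \<psi> x \<partial>lborel))" using c t\<psi> by (simp add: compatible_def)
  also have "(\<integral>x. \<psi> x \<partial>X) = (\<integral>x. \<phi> x \<partial>translate_config (- y) X)"
  proof -
    have "(\<lambda>x. x + - y) \<in> measurable X borel" using measurable_cong_sets[OF sets_configs[OF X] refl, of "borel :: plane measure"] by simp
    then have "(\<integral>x. \<phi> x \<partial>distr X borel (\<lambda>x. x + - y)) = (\<integral>x. \<phi> (x + - y) \<partial>X)" by (rule integral_distr) (rule smooth_borel[OF sm])
    then show ?thesis by (simp add: translate_config_def \<psi>_def)
  qed
  also have "(\<integral>x. \<psi> x \<partial>lborel) = (\<integral>x. \<phi> x \<partial>lborel)"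
    using lborel_integral_shift[OF smooth_borel[OF sm], of "- y"] by (simp add: \<psi>_def)
  finally show "(\<integral>z. E (z + y) \<bullet> gradient \<phi> z \<partial>lborel) = 2 * pi * ((\<integral>x. \<phi> x \<partial>translate_config (- y) X) - (\<integral>x. \<phi> x \<partial>lborel))" .
qed

text \<open>If the disk of radius \<open>3/2\<close> is free of points and
  \<open>\<eta> \<le> 1\<close>, truncation leaves the field unchanged within \<open>1/2\<close> of
  the origin. The averages over small disks agree, and hence so do the Lebesgue values.\<close>

lemma h0_le_value:
  assumes moll: "mollifier \<rho>" and eta: "0 < \<eta>" "\<eta> \<le> 1" and E: "Lp_loc 1 E" and X: "field_config E \<in> configs"
  shows "h0 E \<le> ennreal ((norm (value_at (truncated_field \<rho> \<eta> E) 0))\<^sup>2)"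
proof (cases "conv_at E 0 \<and> emeasure (field_config E) (cball 0 (3/2)) = 0")
  case True
  obtain l where l: "((\<lambda>r. avg r 0 E) \<longlongrightarrow> l) (at_right 0)" using conv_at_limit[OF E] True by blast
  have tf: "truncated_field \<rho> \<eta> E y = E y" if "norm y < 1/2" for y
  proof -
    have "cball 0 (3/2) \<in> null_sets (field_config E)" using True sets_configs[OF X] by (intro null_setsI) auto
    then have "AE x in field_config E. x \<notin> cball 0 (3/2)" by (rule AE_not_in)
    then have "AE x in field_config E. gradient (f_trunc \<rho> \<eta>) (y - x) = 0"
    proof eventually_elim
      case (elim x)
      have "norm x \<le> norm (y - x) + norm y" using norm_triangle_sub[of x y] by (simp add: norm_minus_commute)
      then show ?case using elim that eta by (intro f_trunc_gradient_zero[OF moll eta(1)]) simp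
    qed
    then have "(\<integral>x. gradient (f_trunc \<rho> \<eta>) (y - x) \<partial>field_config E) = 0" by (rule integral_eq_zero_AE)
    then show ?thesis by (simp add: truncated_field_def)
  qed
  have "avg r 0 (truncated_field \<rho> \<eta> E) = avg r 0 E" if "r < 1/2" for r
  proof -
    have "(LINT z:cball 0 r|lborel. truncated_field \<rho> \<eta> E z) = (LINT z:cball 0 r|lborel. E z)"
      unfolding set_lebesgue_integral_def by (rule Bochner_Integration.integral_cong) (use that tf in \<open>auto simp: indicator_def\<close>)
    then show ?thesis by (simp add: avg_def)
  qed
  then have "\<forall>\<^sub>F r in at_right 0. avg r 0 E = avg r 0 (truncated_field \<rho> \<eta> E)"
    unfolding eventually_at_right_field by (intro exI[of _ "1/2"]) simp
  then have "((\<lambda>r. avg r 0 (truncated_field \<rho> \<eta> E)) \<longlongrightarrow> l) (at_right 0)" using l by (rule Lim_transform_eventually[rotated])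
  then have "value_at (truncated_field \<rho> \<eta> E) 0 = l" unfolding value_at_def avg_def[symmetric]
    by (intro tendsto_Lim) (simp_all add: trivial_limit_at_right_real)
  then show ?thesis using limit_conv_at(2)[OF l] True by (simp add: h0_def)
qed (auto simp: h0_def)

text \<open>The annuli with inner radii \<open>4 ^ Suc i\<close>, \<open>i < k\<close>, about a
  cluster are disjoint and stay within \<open>ll k / 4\<close> of it, hence inside the disk of
  radius \<open>3 * ll k\<close> about the origin. They begin at radius 4 and are far from all other
  points, so that the condition in \<open>hdens\<close> on empty disks holds throughout
  them.\<close>

lemma GG_energy:
  assumes moll: "mollifier \<rho>" and E: "Lp_loc 1 E" and X: "X \<in> GG k" and c: "compatible E X"
  shows "ennreal (real k * (pi * real (Mk k))\<^sup>2) \<le> (\<integral>\<^sup>+y\<in>cball 0 (3 * ll k). hdens E y \<partial>lborel) * D0 \<rho>"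
proof -
  have XC: "X \<in> configs" using X by (simp add: GG_def)
  have fc: "field_config E = X" by (rule field_config_eq[OF moll XC c])
  note Em = Lp_loc_cball(1)[OF E]
  obtain x where x: "norm x \<le> 2 * ll k" "of_nat (Mk k) \<le> emeasure X {x}" "emeasure X (ball x (ll k) - {x}) = 0"
    using GG_structure[OF X] by metis
  define A where "A i = annulus x (4 ^ Suc i)" for i :: nat
  have A: "A i \<in> sets borel" for i unfolding A_def by (rule annulus_borel[OF moll])
  have Ai: "y \<in> A i \<longleftrightarrow> 4 ^ Suc i \<le> dist x y \<and> dist x y < 4 * 4 ^ Suc i" for y i by (simp add: A_def annulus_def[OF moll])
  have lk: "4 * 4 ^ Suc i \<le> ll k / 4" if "i < k" for i
  proof -
    have "(4::real) ^ Suc i \<le> 4 ^ k" using that by (intro power_increasing) auto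
    then show ?thesis by (simp add: ll_def)
  qed
  have disj: "y \<notin> A j" if "y \<in> A i" "i \<noteq> j" for i j y
  proof
    assume "y \<in> A j"
    then have "(4::real) ^ Suc i < 4 * 4 ^ Suc j" "(4::real) ^ Suc j < 4 * 4 ^ Suc i" using that(1) unfolding Ai by linarith+
    then have "(4::real) ^ Suc i < 4 ^ Suc (Suc j)" "(4::real) ^ Suc j < 4 ^ Suc (Suc i)" by simp_all
    then have "Suc i < Suc (Suc j)" "Suc j < Suc (Suc i)" by (meson one_less_numeral_iff power_less_imp_less_exp semiring_norm(76))+
    then show False using that(2) by simp
  qed
  have hole: "\<exists>n. dist (qn n) y < 1/10 \<and> emeasure X (cball (qn n) (8/5)) = 0" if y: "y \<in> A i" "i < k" for y i
  proof -
    obtain n where n: "dist (qn n) y < 1/10" using qn_dense[of "1/10"] by auto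
    have "(4::real) \<le> 4 ^ Suc i" by simp
    then have d: "4 \<le> dist x y" "dist x y < ll k / 4" "16 \<le> ll k" using y(1) lk[OF y(2)] unfolding Ai by linarith+
    have "cball (qn n) (8/5) \<subseteq> ball x (ll k) - {x}"
    proof
      fix z assume "z \<in> cball (qn n) (8/5)"
      then have "dist y z < 2" using n dist_triangle3[of y z "qn n"] by simp
      then have "dist x z < ll k" "0 < dist x z"
        using d dist_triangle[of x z y] dist_triangle[of x y z] by (auto simp: dist_commute)
      then show "z \<in> ball x (ll k) - {x}" by auto
    qed
    then have "emeasure X (cball (qn n) (8/5)) \<le> emeasure X (ball x (ll k) - {x})"
      using sets_configs[OF XC] by (intro emeasure_mono) auto
    then show ?thesis using n x(3) by auto
  qed
  have "ennreal (real k * (pi * real (Mk k))\<^sup>2) = (\<Sum>i<k. ennreal ((pi * real (Mk k))\<^sup>2))"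
    by (simp add: ennreal_mult ennreal_of_nat_eq_real_of_nat)
  also have "\<dots> \<le> (\<Sum>i<k. (\<integral>\<^sup>+z\<in>A i. ennreal ((norm (E z))\<^sup>2) \<partial>lborel) * D0 \<rho>)"
  proof (rule sum_mono)
    fix i assume i: "i \<in> {..<k}"
    have "128 * (4 ^ Suc i)\<^sup>2 \<le> real (Mk k)"
    proof -
      have "(16::real) ^ Suc i \<le> 16 ^ k" using i by (intro power_increasing) auto
      moreover have "((4::real) ^ Suc i)\<^sup>2 = 16 ^ Suc i" by (simp add: power2_eq_square power_mult_distrib[symmetric])
      moreover have "(0::real) \<le> 16 ^ k" by simp
      ultimately have "128 * ((4::real) ^ Suc i)\<^sup>2 \<le> 256 * 16 ^ k" by linarith
      then show ?thesis by (simp add: Mk_eq)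
    qed
    then show "ennreal ((pi * real (Mk k))\<^sup>2) \<le> (\<integral>\<^sup>+z\<in>A i. ennreal ((norm (E z))\<^sup>2) \<partial>lborel) * D0 \<rho>"
      unfolding A_def by (intro annulus_energy[OF moll Em XC c _ x(2)]) simp_all
  qed
  also have "\<dots> = (\<Sum>i<k. (\<integral>\<^sup>+z\<in>A i. ennreal ((norm (E z))\<^sup>2) \<partial>lborel)) * D0 \<rho>" by (rule sum_distrib_right[symmetric])
  also have "(\<Sum>i<k. (\<integral>\<^sup>+z\<in>A i. ennreal ((norm (E z))\<^sup>2) \<partial>lborel)) = (\<integral>\<^sup>+z. (\<Sum>i<k. ennreal ((norm (E z))\<^sup>2) * indicator (A i) z) \<partial>lborel)"
  proof (rule nn_integral_sum[symmetric])
    fix i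
    have "(\<lambda>z. ennreal ((norm (E z))\<^sup>2)) \<in> borel_measurable lborel"
      using Em by (intro measurable_compose[OF _ measurable_ennreal] borel_measurable_power measurable_compose[OF _ borel_measurable_norm]) simp
    then show "(\<lambda>z. ennreal ((norm (E z))\<^sup>2) * indicator (A i) z) \<in> borel_measurable lborel"
      using A[of i] by (intro borel_measurable_times_ennreal borel_measurable_indicator) auto
  qed
  also have "\<dots> \<le> (\<integral>\<^sup>+y\<in>cball 0 (3 * ll k). hdens E y \<partial>lborel)"
  proof (rule nn_integral_mono_AE)
    \<comment> \<open>At almost every point the averages converge to the field, and on the annuli
      \<open>hdens\<close> is then its squared norm.\<close>
    show "AE y in lborel. (\<Sum>i<k. ennreal ((norm (E y))\<^sup>2) * indicator (A i) y) \<le> hdens E y * indicator (cball 0 (3 * ll k)) y"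
      using lebesgue_differentiation[OF E]
    proof eventually_elim
      case (elim y)
      show ?case
      proof (cases "\<exists>i<k. y \<in> A i")
        case False
        then have "(\<Sum>i<k. ennreal ((norm (E y))\<^sup>2) * indicator (A i) y) = 0" by (intro sum.neutral) auto
        then show ?thesis by (simp only: zero_le)
      next
        case True
        then obtain i where i: "i < k" "y \<in> A i" by blast
        have "(\<Sum>j<k. ennreal ((norm (E y))\<^sup>2) * indicator (A j) y) = ennreal ((norm (E y))\<^sup>2) * indicator (A i) y + (\<Sum>j\<in>{..<k} - {i}. ennreal ((norm (E y))\<^sup>2) * indicator (A j) y)"
          by (rule sum.remove) (use i in auto)
        also have "(\<Sum>j\<in>{..<k} - {i}. ennreal ((norm (E y))\<^sup>2) * indicator (A j) y) = 0"
          by (rule sum.neutral) (use disj[OF i(2)] in auto)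
        finally have 1: "(\<Sum>j<k. ennreal ((norm (E y))\<^sup>2) * indicator (A j) y) = ennreal ((norm (E y))\<^sup>2)" using i(2) by simp
        have "dist x y < ll k / 4" using i(2) lk[OF i(1)] unfolding Ai by linarith
        then have "y \<in> cball 0 (3 * ll k)" using x(1) norm_triangle_sub[of y x] ll_pos(1)[of k] by (simp add: dist_norm norm_minus_commute)
        moreover have "hdens E y = ennreal ((norm (E y))\<^sup>2)"
          using limit_conv_at[OF elim] hole[OF i(2,1)] by (simp add: hdens_def fc)
        ultimately show ?thesis unfolding 1 by simp
      qed
    qed
  qed
  finally show ?thesis by (simp add: mult_right_mono)
qed

text \<open>Argued through the representation of \<open>P1\<close>: a shifted lattice of scale
  \<open>j\<close> lies in \<open>GG k\<close> exactly when \<open>j = k\<close>, and its translates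
  are shifted lattices of the same scale.\<close>

lemma AE_GG_translate: "AE X in P1. translate_config t X \<in> GG k \<longleftrightarrow> X \<in> GG k"
  unfolding P1_def
proof (rule AE_mix[OF gl_G1 gl_H0])
  have m: "{X\<in>space config_algebra. translate_config t X \<in> GG k} \<in> sets config_algebra"
  proof -
    have "{X\<in>space config_algebra. translate_config t X \<in> GG k} = translate_config t -` GG k \<inter> space config_algebra" by blast
    then show ?thesis by (simp only: measurable_sets[OF translate_config_measurable GG_sets])
  qed
  have sub: "GG k \<subseteq> configs" unfolding GG_def by blast
  have "{X \<in> configs. (translate_config t X \<in> GG k) = (X \<in> GG k)}
    = ({X\<in>space config_algebra. translate_config t X \<in> GG k} \<inter> GG k) \<union>
      (space config_algebra - ({X\<in>space config_algebra. translate_config t X \<in> GG k} \<union> GG k))"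
    unfolding space_config_algebra using sub by blast
  also have "\<dots> \<in> sets config_algebra" by (intro sets.Un sets.Int sets.Diff sets.top m GG_sets)
  finally show "{X \<in> configs. (translate_config t X \<in> GG k) = (X \<in> GG k)} \<in> sets config_algebra" .
next
  fix j w assume w: "w \<in> space Om2"
  have w': "T2 (G1 j) H0 t w \<in> space Om2" using measurable_space[OF T2_measurable w] .
  show "(translate_config t (X1 j w) \<in> GG k) = (X1 j w \<in> GG k)"
    unfolding translate_sconf[OF gl_G1 gl_H0]
    using X1_GG[OF w, of k] X1_GG[OF w', of k] X1_not_GG[OF w, of j k] X1_not_GG[OF w', of j k] by (cases "j = k") auto
qed

lemma P1_GG: "ennreal (pmf J1 k) \<le> emeasure P1 (GG k)"
proof -
  have "ennreal (pmf J1 k) = (\<Sum>j. ennreal (pmf J1 j) * indicator {k} j)"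
    by (subst suminf_finite[of "{k}"]) auto
  also have "\<dots> \<le> (\<Sum>j. ennreal (pmf J1 j) * (\<integral>\<^sup>+w. indicator (GG k) (X1 j w) \<partial>Om2))"
  proof (rule suminf_le)
    fix j
    have "(\<integral>\<^sup>+w. indicator (GG k) (X1 k w) \<partial>Om2) = (\<integral>\<^sup>+w. 1 \<partial>Om2)" by (rule nn_integral_cong) (simp add: X1_GG)
    also have "\<dots> = 1" by (simp add: prob_space.emeasure_space_1[OF prob_space_Om2])
    finally show "ennreal (pmf J1 j) * indicator {k} j \<le> ennreal (pmf J1 j) * (\<integral>\<^sup>+w. indicator (GG k) (X1 j w) \<partial>Om2)"
      by (cases "j = k") auto
  qed auto
  also have "\<dots> = (\<integral>\<^sup>+X. indicator (GG k) X \<partial>P1)"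
    unfolding P1_def by (subst nn_integral_mix[OF gl_G1 gl_H0]) (rule borel_measurable_indicator[OF GG_sets], simp only: nn_integral_nat_pmf)
  also have "\<dots> = emeasure P1 (GG k)" by (rule nn_integral_indicator) (simp add: P1_def sets_mix[OF gl_G1 gl_H0] GG_sets)
  finally show ?thesis .
qed

lemma hdens_joint:
  assumes Q: "sets Q = sets field_algebra" and fm: "field_config \<in> measurable Q config_algebra"
  shows "(\<lambda>p. hdens (fst p) (snd p)) \<in> borel_measurable (Q \<Otimes>\<^sub>M lborel)"
proof -
  let ?M = "Q \<Otimes>\<^sub>M (lborel :: plane measure)"
  note am = avg_joint[OF Q rr_pos]
  have dm: "{p \<in> space ?M. dist (avg (rr a b) (snd p) (fst p)) (avg (rr 0 m) (snd p) (fst p)) \<le> rr 0 k} \<in> sets ?M" for a b m k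
    by (intro borel_measurable_le borel_measurable_dist am borel_measurable_const)
  have c: "{p \<in> space ?M. conv_at (fst p) (snd p)} \<in> sets ?M"
    unfolding conv_at_def
    by (intro sets.sets_Collect_countable_All sets.sets_Collect_countable_Ex sets.sets_Collect_imp sets.sets_Collect_const dm)
  have em: "(\<lambda>p. emeasure (field_config (fst p)) (cball (qn n) (8/5))) \<in> borel_measurable ?M" for n
    by (rule measurable_compose[OF measurable_compose[OF measurable_fst fm] emeasure_config_measurable[OF cball_borel]])
  have h: "{p \<in> space ?M. \<exists>n. dist (qn n) (snd p) < 1/10 \<and> emeasure (field_config (fst p)) (cball (qn n) (8/5)) = 0} \<in> sets ?M"
  proof (intro sets.sets_Collect_countable_Ex sets.sets_Collect_conj)
    fix n
    have s: "snd \<in> borel_measurable ?M" using measurable_snd[of Q "lborel :: plane measure"] by simp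
    show "{p \<in> space ?M. dist (qn n) (snd p) < 1/10} \<in> sets ?M"
      by (intro borel_measurable_less borel_measurable_dist borel_measurable_const s)
    show "{p \<in> space ?M. emeasure (field_config (fst p)) (cball (qn n) (8/5)) = 0} \<in> sets ?M"
      by (rule borel_measurable_eq[OF em borel_measurable_const])
  qed
  have l: "(\<lambda>p. liminf (\<lambda>n. ennreal ((norm (avg (rr 0 n) (snd p) (fst p)))\<^sup>2))) \<in> borel_measurable ?M"
    by (intro borel_measurable_liminf measurable_compose[OF _ measurable_ennreal] borel_measurable_power measurable_compose[OF _ borel_measurable_norm] am)
  show ?thesis unfolding hdens_def
    by (rule measurable_If[OF l borel_measurable_const sets.sets_Collect_conj[OF h c]])
qed

lemma h0_measurable:
  assumes Q: "sets Q = sets field_algebra" and fm: "field_config \<in> measurable Q config_algebra"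
  shows "h0 \<in> borel_measurable Q"
proof -
  have am: "(\<lambda>E. avg r y E) \<in> borel_measurable Q" for r y
    using avg_measurable measurable_cong_sets[OF Q refl, of "borel :: plane measure"] by blast
  have dm: "{E \<in> space Q. dist (avg (rr a b) 0 E) (avg (rr 0 m) 0 E) \<le> rr 0 k} \<in> sets Q" for a b m k
    by (intro borel_measurable_le borel_measurable_dist am borel_measurable_const)
  have c: "{E \<in> space Q. conv_at E 0} \<in> sets Q"
    unfolding conv_at_def by (intro sets.sets_Collect_countable_All sets.sets_Collect_countable_Ex sets.sets_Collect_imp sets.sets_Collect_const dm)
  have em: "(\<lambda>E. emeasure (field_config E) (cball 0 (3/2))) \<in> borel_measurable Q"
    by (rule measurable_compose[OF fm emeasure_config_measurable[OF cball_borel]])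
  have h: "{E \<in> space Q. emeasure (field_config E) (cball 0 (3/2)) = 0} \<in> sets Q"
    by (rule borel_measurable_eq[OF em borel_measurable_const])
  have l: "(\<lambda>E. liminf (\<lambda>n. ennreal ((norm (avg (rr 0 n) 0 E))\<^sup>2))) \<in> borel_measurable Q"
    by (intro borel_measurable_liminf measurable_compose[OF _ measurable_ennreal] borel_measurable_power measurable_compose[OF _ borel_measurable_norm] am)
  show ?thesis unfolding h0_def[abs_def]
    by (rule measurable_If[OF l borel_measurable_const sets.sets_Collect_conj[OF h c]])
qed

lemma field_translate_space: "E \<in> electric_fields \<Longrightarrow> (\<lambda>z. E (z - t)) \<in> electric_fields"
  unfolding electric_fields_def
proof (intro CollectI allI impI)
  fix p assume E: "E \<in> {E. \<forall>p. 1 \<le> p \<and> p < 2 \<longrightarrow> Lp_loc p E}" and p: "1 \<le> p \<and> p < (2::real)"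
  then have L: "Lp_loc p E" by blast
  then have Em: "E \<in> borel_measurable borel" by (simp add: Lp_loc_def)
  have tm: "(\<lambda>z :: plane. z - t) \<in> measurable borel borel" by simp
  show "Lp_loc p (\<lambda>z. E (z - t))" unfolding Lp_loc_def
  proof (intro conjI allI impI)
    show "(\<lambda>z. E (z - t)) \<in> borel_measurable borel" by (rule measurable_compose[OF tm Em])
    fix K :: "plane set" assume K: "compact K"
    then have Kt: "compact ((\<lambda>z. - t + z) ` K)" by (rule compact_translation)
    have Kb: "(\<lambda>z. - t + z) ` K \<in> sets borel" using compact_imp_closed[OF Kt] by simp
    have nm: "(\<lambda>x. ennreal (norm (E x) powr p) * indicator ((\<lambda>z. - t + z) ` K) x) \<in> borel_measurable borel"
      using Kb measurable_compose[OF Em borel_measurable_norm]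
      by (intro borel_measurable_times_ennreal borel_measurable_indicator measurable_compose[OF _ measurable_ennreal] powr_real_measurable borel_measurable_const) auto
    have "(\<integral>\<^sup>+x\<in>K. ennreal (norm (E (x - t)) powr p) \<partial>lborel)
      = (\<integral>\<^sup>+x. ennreal (norm (E (- t + x)) powr p) * indicator ((\<lambda>z. - t + z) ` K) (- t + x) \<partial>lborel)"
    proof (rule nn_integral_cong)
      fix x
      have "- t + x \<in> (\<lambda>z. - t + z) ` K \<longleftrightarrow> x \<in> K" by auto
      then show "ennreal (norm (E (x - t)) powr p) * indicator K x = ennreal (norm (E (- t + x)) powr p) * indicator ((\<lambda>z. - t + z) ` K) (- t + x)"
        by (simp add: indicator_def)
    qed
    also have "\<dots> = (\<integral>\<^sup>+x. ennreal (norm (E x) powr p) * indicator ((\<lambda>z. - t + z) ` K) x \<partial>distr lborel borel ((+) (- t)))"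
      by (rule nn_integral_distr[symmetric]) (use nm in auto)
    also have "\<dots> = (\<integral>\<^sup>+x\<in>(\<lambda>z. - t + z) ` K. ennreal (norm (E x) powr p) \<partial>lborel)" by (simp add: lborel_distr_plus)
    also have "\<dots> < \<infinity>" using L Kt by (simp add: Lp_loc_def)
    finally show "(\<integral>\<^sup>+x\<in>K. ennreal (norm (E (x - t)) powr p) \<partial>lborel) < \<infinity>" .
  qed
qed

text \<open>The default value of \<open>field_config\<close> is the empty configuration, so
  membership holds for every field and not only almost surely.\<close>

lemma field_config_in_configs:
  assumes moll: "mollifier \<rho>"
  shows "field_config E \<in> configs"
proof (cases "\<exists>X\<in>configs. compatible E X")
  case True
  then show ?thesis using field_config_eq[OF moll] by metis
next
  case False
  have "null_measure borel = (conf {} (\<lambda>x. x) :: plane measure)"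
  proof (rule measure_eqI)
    fix A :: "plane set" assume "A \<in> sets (null_measure borel)"
    then show "emeasure (null_measure borel) A = emeasure (conf {} (\<lambda>x. x)) A" by (simp add: emeasure_conf nn_integral_empty)
  qed simp
  moreover have "conf {} (\<lambda>x :: plane. x) \<in> configs" by (rule conf_in_configs) (simp add: loc_fin_def)
  ultimately show ?thesis using False by (simp add: field_config_def)
qed

text \<open>For a competitor \<open>Q\<close>, restrict to scale \<open>k\<close> and integrate
  \<open>hdens\<close> over the disk of radius \<open>3 * ll k\<close>. By \<open>GG_energy\<close>
  the mean of this integral times \<open>D0 \<rho>\<close> is at least
  \<open>pmf J1 k * k * (pi * Mk k)\<^sup>2\<close>; by stationarity the mean is at most the area,
  which is at most \<open>36 * Mk k\<close>, times the mean of \<open>g k\<close>. Dividing by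
  \<open>Mk k\<close> and summing over \<open>k\<close> bounds a divergent series by a finite
  multiple of the energy at the origin.\<close>

lemma Coul_P1:
  assumes moll: "mollifier \<rho>" and eta: "0 < \<eta>" "\<eta> \<le> 1"
  shows "Coul \<rho> \<eta> P1 = \<infinity>"
proof -
  have "(\<integral>\<^sup>+E. ennreal ((norm (value_at (truncated_field \<rho> \<eta> E) 0))\<^sup>2) \<partial>Q) = \<infinity>"
    if st: "stationary_field Q" and co: "compatible_process Q P1" for Q
  proof -
    have Qs: "sets Q = sets field_algebra" and tr: "\<And>t. distr Q field_algebra (\<lambda>E y. E (y - t)) = Q"
      and Qp: "prob_space Q"
      using st by (simp_all add: stationary_field_def random_field_def)
    interpret Q: prob_space Q by (rule Qp)
    interpret QL: pair_sigma_finite Q "lborel :: plane measure" ..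
    have Qsp: "space Q = electric_fields" using sets_eq_imp_space_eq[OF Qs] by (simp only: space_field_algebra)
    have P1p: "prob_space P1" unfolding P1_def by (rule prob_space_mix[OF gl_G1 gl_H0])
    have dc: "distr Q config_algebra field_config = P1" and cAE: "AE E in Q. \<exists>X\<in>configs. compatible E X"
      using co by (simp_all add: compatible_process_def)
    note fcC = field_config_in_configs[OF moll]
    have fm: "field_config \<in> measurable Q config_algebra"
      by (rule measurable_of_distr_prob[OF P1p dc]) (simp add: space_config_algebra Pi_iff fcC)
    define \<tau> where "\<tau> y E = (\<lambda>z. E (z + y))" for y and E :: "plane \<Rightarrow> plane"
    have tr': "distr Q field_algebra (\<tau> y) = Q" for y using tr[of "- y"] by (simp add: \<tau>_def[abs_def])
    have \<tau>m: "\<tau> y \<in> measurable Q field_algebra" for y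
    proof (rule measurable_of_distr_prob[OF Qp tr'])
      show "\<tau> y \<in> space Q \<rightarrow> space field_algebra"
        unfolding Qsp space_field_algebra \<tau>_def using field_translate_space[of _ "- y"] by simp
    qed
    define g where "g k E = indicator (GG k) (field_config E) * h0 E" for k E
    have h0m: "h0 \<in> borel_measurable Q" by (rule h0_measurable[OF Qs fm])
    have gi: "(\<lambda>E. indicator (GG k) (field_config E) :: ennreal) \<in> borel_measurable Q" for k
      by (rule measurable_compose[OF fm borel_measurable_indicator[OF GG_sets]])
    have gm: "g k \<in> borel_measurable Q" for k unfolding g_def[abs_def] by (intro borel_measurable_times_ennreal gi h0m)
    define V where "V = (\<integral>\<^sup>+E. ennreal ((norm (value_at (truncated_field \<rho> \<eta> E) 0))\<^sup>2) \<partial>Q)"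
    \<comment> \<open>The events \<open>GG k\<close> are disjoint, so the functions
      \<open>g k\<close> add up to at most \<open>h0\<close>.\<close>
    have Vge: "(\<Sum>k. \<integral>\<^sup>+E. g k E \<partial>Q) \<le> V"
    proof -
      have "(\<Sum>k. \<integral>\<^sup>+E. g k E \<partial>Q) = (\<integral>\<^sup>+E. (\<Sum>k. g k E) \<partial>Q)" by (rule nn_integral_suminf[symmetric]) (rule gm)
      also have "\<dots> \<le> V" unfolding V_def
      proof (rule nn_integral_mono)
        fix E assume "E \<in> space Q"
        then have E: "Lp_loc 1 E" unfolding Qsp by (rule electric_Lp)
        have "(\<Sum>k. g k E) \<le> h0 E"
        proof (cases "\<exists>k. field_config E \<in> GG k")
          case True
          then obtain k where k: "field_config E \<in> GG k" by blast
          have "g j E = 0" if "j \<notin> {k}" for j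
            using GG_disjoint[OF k, of j] that by (auto simp: g_def indicator_def)
          then have "(\<Sum>j. g j E) = (\<Sum>j\<in>{k}. g j E)" by (intro suminf_finite) auto
          then show ?thesis using k by (simp add: g_def)
        next
          case False
          then show ?thesis by (simp add: g_def)
        qed
        also have "\<dots> \<le> ennreal ((norm (value_at (truncated_field \<rho> \<eta> E) 0))\<^sup>2)" by (rule h0_le_value[OF moll eta E fcC])
        finally show "(\<Sum>k. g k E) \<le> ennreal ((norm (value_at (truncated_field \<rho> \<eta> E) 0))\<^sup>2)" .
      qed
      finally show ?thesis .
    qed
    \<comment> \<open>Stationarity of \<open>Q\<close> moves \<open>y\<close> to the origin, and the
      scale is almost surely the same after the translation.\<close>
    have Jle: "(\<integral>\<^sup>+E. indicator (GG k) (field_config E) * hdens E y \<partial>Q) \<le> (\<integral>\<^sup>+E. g k E \<partial>Q)" for k y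
    proof -
      have gmf: "g k \<in> borel_measurable field_algebra"
        using gm[of k] measurable_cong_sets[OF Qs refl, of "borel :: ennreal measure"] by blast
      have "AE X in distr Q config_algebra field_config. translate_config (- y) X \<in> GG k \<longleftrightarrow> X \<in> GG k"
        unfolding dc by (rule AE_GG_translate)
      then have inv: "AE E in Q. translate_config (- y) (field_config E) \<in> GG k \<longleftrightarrow> field_config E \<in> GG k"
        by (rule AE_distrD[OF fm])
      have "(\<integral>\<^sup>+E. indicator (GG k) (field_config E) * hdens E y \<partial>Q) \<le> (\<integral>\<^sup>+E. g k (\<tau> y E) \<partial>Q)"
      proof (rule nn_integral_mono_AE)
        show "AE E in Q. indicator (GG k) (field_config E) * hdens E y \<le> g k (\<tau> y E)"
          using cAE inv AE_space
        proof eventually_elim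
          case (elim E)
          have Em: "E \<in> borel_measurable borel" using elim(3) Lp_loc_cball(1)[OF electric_Lp] by (simp add: Qsp)
          obtain X where X: "X \<in> configs" "compatible E X" using elim(1) by blast
          have fE: "field_config E = X" by (rule field_config_eq[OF moll X])
          have t: "field_config (\<tau> y E) = translate_config (- y) (field_config E)"
            unfolding fE \<tau>_def by (rule field_config_eq[OF moll translate_in_configs[OF X(1)] compatible_translate[OF Em X]])
          have "hdens E y \<le> h0 (\<tau> y E)" using hdens_le_h0[OF Em fcC t[unfolded \<tau>_def]] by (simp add: \<tau>_def)
          moreover have "(indicator (GG k) (field_config (\<tau> y E)) :: ennreal) = indicator (GG k) (field_config E)"
            unfolding t using elim(2) by (simp add: indicator_def)
          ultimately show ?case unfolding g_def by (simp add: mult_left_mono)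
        qed
      qed
      also have "\<dots> = (\<integral>\<^sup>+E. g k E \<partial>distr Q field_algebra (\<tau> y))" by (rule nn_integral_distr[OF \<tau>m, symmetric]) (simp add: gmf)
      also have "\<dots> = (\<integral>\<^sup>+E. g k E \<partial>Q)" unfolding tr' ..
      finally show ?thesis .
    qed
    have main: "ennreal (pmf J1 k * (real k * real (Mk k))) \<le> (\<integral>\<^sup>+E. g k E \<partial>Q) * (ennreal 36 * D0 \<rho>)" for k
    proof -
      let ?W = "cball (0::plane) (3 * ll k)"
      have area: "emeasure lborel ?W \<le> ennreal (36 * real (Mk k))"
      proof -
        have "emeasure lborel ?W = ennreal (pi * (3 * ll k)\<^sup>2)" using ll_pos(1)[of k] by (intro emeasure_cball_plane) simp
        also have "\<dots> \<le> ennreal (36 * real (Mk k))"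
        proof (rule ennreal_leI)
          have "pi * (9 * (ll k)\<^sup>2) \<le> 4 * (9 * (ll k)\<^sup>2)" using pi_less_4 by (intro mult_right_mono) auto
          then show "pi * (3 * ll k)\<^sup>2 \<le> 36 * real (Mk k)" by (simp add: Mk_ll power_mult_distrib)
        qed
        finally show ?thesis .
      qed
      have jm: "(\<lambda>p. indicator (GG k) (field_config (fst p)) * hdens (fst p) (snd p) * indicator ?W (snd p)) \<in> borel_measurable (Q \<Otimes>\<^sub>M lborel)"
        by (intro borel_measurable_times_ennreal hdens_joint[OF Qs fm] measurable_compose[OF measurable_fst gi]
            measurable_compose[OF measurable_snd borel_measurable_indicator]) simp
      have "ennreal (pmf J1 k) * ennreal (real k * (pi * real (Mk k))\<^sup>2)
        \<le> emeasure P1 (GG k) * ennreal (real k * (pi * real (Mk k))\<^sup>2)" by (rule mult_right_mono[OF P1_GG]) simp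
      also have "emeasure P1 (GG k) = (\<integral>\<^sup>+E. indicator (GG k) (field_config E) \<partial>Q)"
      proof -
        have "emeasure P1 (GG k) = (\<integral>\<^sup>+X. indicator (GG k) X \<partial>distr Q config_algebra field_config)"
          unfolding dc by (rule nn_integral_indicator[symmetric]) (simp add: P1_def sets_mix[OF gl_G1 gl_H0] GG_sets)
        also have "\<dots> = (\<integral>\<^sup>+E. indicator (GG k) (field_config E) \<partial>Q)"
          by (rule nn_integral_distr[OF fm]) (simp only: measurable_distr_eq1 borel_measurable_indicator[OF GG_sets])
        finally show ?thesis .
      qed
      also have "\<dots> * ennreal (real k * (pi * real (Mk k))\<^sup>2) = (\<integral>\<^sup>+E. indicator (GG k) (field_config E) * ennreal (real k * (pi * real (Mk k))\<^sup>2) \<partial>Q)"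
        by (rule nn_integral_multc[symmetric, OF gi])
      also have "\<dots> \<le> (\<integral>\<^sup>+E. (\<integral>\<^sup>+y. indicator (GG k) (field_config E) * hdens E y * indicator ?W y \<partial>lborel) * D0 \<rho> \<partial>Q)"
      proof (rule nn_integral_mono_AE)
        show "AE E in Q. indicator (GG k) (field_config E) * ennreal (real k * (pi * real (Mk k))\<^sup>2)
            \<le> (\<integral>\<^sup>+y. indicator (GG k) (field_config E) * hdens E y * indicator ?W y \<partial>lborel) * D0 \<rho>"
          using cAE AE_space
        proof eventually_elim
          case (elim E)
          obtain X where X: "X \<in> configs" "compatible E X" using elim(1) by blast
          have fE: "field_config E = X" by (rule field_config_eq[OF moll X])
          have E: "Lp_loc 1 E" using elim(2) electric_Lp by (simp add: Qsp)
          show ?case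
          proof (cases "X \<in> GG k")
            case True
            then show ?thesis using GG_energy[OF moll E True X(2)] by (simp add: fE)
          qed (simp add: fE)
        qed
      qed
      also have "\<dots> = (\<integral>\<^sup>+E. (\<integral>\<^sup>+y. indicator (GG k) (field_config E) * hdens E y * indicator ?W y \<partial>lborel) \<partial>Q) * D0 \<rho>"
        by (rule nn_integral_multc) (rule lborel.borel_measurable_nn_integral_fst[OF jm, simplified])
      also have "(\<integral>\<^sup>+E. (\<integral>\<^sup>+y. indicator (GG k) (field_config E) * hdens E y * indicator ?W y \<partial>lborel) \<partial>Q)
         = (\<integral>\<^sup>+y. (\<integral>\<^sup>+E. indicator (GG k) (field_config E) * hdens E y * indicator ?W y \<partial>Q) \<partial>lborel)"
        by (rule QL.Fubini'[symmetric]) (use jm in \<open>simp add: split_beta'\<close>)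
      also have "\<dots> \<le> (\<integral>\<^sup>+y. (\<integral>\<^sup>+E. g k E \<partial>Q) * indicator ?W y \<partial>lborel)"
      proof (rule nn_integral_mono)
        fix y :: plane
        show "(\<integral>\<^sup>+E. indicator (GG k) (field_config E) * hdens E y * indicator ?W y \<partial>Q) \<le> (\<integral>\<^sup>+E. g k E \<partial>Q) * indicator ?W y"
          using Jle[of k y] by (cases "y \<in> ?W") simp_all
      qed
      also have "\<dots> = (\<integral>\<^sup>+E. g k E \<partial>Q) * emeasure lborel ?W" by (rule nn_integral_cmult_indicator) simp
      also have "\<dots> \<le> (\<integral>\<^sup>+E. g k E \<partial>Q) * ennreal (36 * real (Mk k))" by (rule mult_left_mono[OF area]) simp
      finally have "ennreal (pmf J1 k) * ennreal (real k * (pi * real (Mk k))\<^sup>2)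
        \<le> (\<integral>\<^sup>+E. g k E \<partial>Q) * ennreal (36 * real (Mk k)) * D0 \<rho>" by (simp add: mult_right_mono)
      moreover have "ennreal (real (Mk k)) * ennreal (pmf J1 k * (real k * real (Mk k))) \<le> ennreal (pmf J1 k) * ennreal (real k * (pi * real (Mk k))\<^sup>2)"
      proof -
        have "1 \<le> pi * pi" using pi_ge_two mult_mono[of 1 pi 1 pi] by simp
        then have "(real k * (real (Mk k))\<^sup>2) * 1 \<le> (real k * (real (Mk k))\<^sup>2) * (pi * pi)" by (intro mult_left_mono) auto
        then have "pmf J1 k * (real k * (real (Mk k))\<^sup>2) \<le> pmf J1 k * (real k * (pi * real (Mk k))\<^sup>2)"
          by (intro mult_left_mono[OF _ pmf_nonneg]) (simp add: power2_eq_square mult_ac)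
        then show ?thesis by (subst (1 2) ennreal_mult[symmetric]) (auto intro!: ennreal_leI simp: power2_eq_square mult_ac)
      qed
      ultimately have "ennreal (real (Mk k)) * ennreal (pmf J1 k * (real k * real (Mk k)))
         \<le> (\<integral>\<^sup>+E. g k E \<partial>Q) * ennreal (36 * real (Mk k)) * D0 \<rho>" by (rule order_trans[rotated])
      also have "\<dots> = ennreal (real (Mk k)) * ((\<integral>\<^sup>+E. g k E \<partial>Q) * (ennreal 36 * D0 \<rho>))"
      proof -
        have e: "ennreal (36 * real (Mk k)) = ennreal 36 * ennreal (real (Mk k))" by (rule ennreal_mult) simp_all
        show ?thesis unfolding e by (simp only: mult_ac)
      qed
      finally show ?thesis
        by (subst (asm) ennreal_mult_le_mult_iff) (use Mk_pos[of k] in simp_all)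
    qed
    have "\<infinity> = (\<integral>\<^sup>+k. ennreal (real k * real (Mk k)) \<partial>measure_pmf J1)" using nn_integral_J1_Mk by (rule sym)
    also have "\<dots> = (\<Sum>k. ennreal (pmf J1 k * (real k * real (Mk k))))"
      unfolding nn_integral_nat_pmf by (simp add: ennreal_mult)
    also have "\<dots> \<le> (\<Sum>k. (\<integral>\<^sup>+E. g k E \<partial>Q) * (ennreal 36 * D0 \<rho>))" by (rule suminf_le[OF main]) auto
    also have "\<dots> = (\<Sum>k. \<integral>\<^sup>+E. g k E \<partial>Q) * (ennreal 36 * D0 \<rho>)" by (rule ennreal_suminf_multc)
    also have "\<dots> \<le> V * (ennreal 36 * D0 \<rho>)" by (rule mult_right_mono[OF Vge]) simp
    finally have inf: "V * (ennreal 36 * D0 \<rho>) = \<infinity>" by (simp add: top_unique)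
    have "ennreal 36 * D0 \<rho> < \<infinity>" using D0_finite[OF moll] by (simp add: ennreal_mult_less_top)
    then have "V = \<infinity>" using inf by (auto simp: ennreal_mult_eq_top_iff)
    then show ?thesis unfolding V_def .
  qed
  then show ?thesis unfolding Coul_def by (intro INF_eqI[THEN sym, THEN sym] antisym) (auto intro!: INF_greatest simp: top_unique)
qed

theorem theorem2:
  fixes \<rho> :: "plane \<Rightarrow> real"
  assumes "mollifier \<rho>"
  shows "(\<exists>P. stationary_process P \<and> Wass 2 P < \<infinity> \<and> (\<forall>\<eta>\<in>{0<..1}. Coul \<rho> \<eta> P = \<infinity>)) \<and>
         (\<exists>P. stationary_process P \<and> has_intensity P 1 \<and> hyperuniform P \<and>
              Wass 1 P = \<infinity> \<and> Wass 2 P = \<infinity>)"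
proof
  show "\<exists>P. stationary_process P \<and> Wass 2 P < \<infinity> \<and> (\<forall>\<eta>\<in>{0<..1}. Coul \<rho> \<eta> P = \<infinity>)"
    using stationary_P1 Wass_P1 Coul_P1[OF assms] by (intro exI[of _ P1] conjI ballI) auto
  show "\<exists>P. stationary_process P \<and> has_intensity P 1 \<and> hyperuniform P \<and> Wass 1 P = \<infinity> \<and> Wass 2 P = \<infinity>"
    using stationary_P2 intensity_P2 hyperuniform_P2 Wass_P2[of 1] Wass_P2[of 2] by (intro exI[of _ P2] conjI) auto
qed

end
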